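(* $\mathbf{M^j}$ is a definitional extension of $\mathbf{WKV}$.
   Context: All systems are based on two-sorted intuitionistic predicate logic with number variables and function variables (one-place number-theoretic functions); number equality primitive, $u=v:\equiv\forall x\,u(x)=v(x)$. $\mathbf{WKV}$ (Weak Kleene–Vesley, I. Loeb): constants $0,S,+,\cdot,=$, a pairing function $j$ onto $\mathbb{N}$ with projections $j_1,j_2$, function application and $\lambda$-abstraction; its axioms include the basic arithmetical axioms for these constants, induction, $\lambda$-conversion, the primitive recursion schema $\exists\beta[\beta(0)=t\,\&\,\forall y\,\beta(S(y))=r(j(y,\beta(y)))]$ ($t$ a term, $r$ a functor), and $\mathrm{AC_{00}!}$. $\mathbf{IA_1}$: $0,',+,\cdot$ and finitely many further primitive recursive function(al) constants (exponentiation, factorial, predecessor, cut-off subtraction, min, max, $\mathrm{sg}$, $\overline{\mathrm{sg}}$, $|a-b|$, remainder, quotient, bounded sums/products/min/max of function values, prime enumeration, exponent, length, concatenation, $\overline{\alpha}(x)$, $\widetilde{\alpha}(x)$, $a\circ b$, Kleene's $\mathrm{ccp}$), application and $\lambda$-abstraction; axioms: Peano axioms, equality axioms, defining equations, $x=y\to\alpha(x)=\alpha(y)$, $\lambda$-conversion, induction for all formulas. $\mathbf{M}=\mathbf{IA_1}+\mathrm{AC_{00}!}$. $\mathbf{M^j}$ is the extension of $\mathbf{M}$ by the pairing and projection constants of $\mathbf{WKV}$ (interpreted by a primitive recursive pairing onto $\mathbb{N}$ and its primitive recursive inverses) with their axioms. $\mathrm{AC_{00}!}$: $\forall x\exists!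 y\,A(x,y)\to\exists\alpha\forall x\,A(x,\alpha(x))$, $\exists!y\,B(y)\equiv\exists y[B(y)\,\&\,\forall z(B(z)\to y=z)]$. $S_2$ is a definitional extension of $S_1$ if there is an effective translation $E\mapsto E'$ from formulas of $S_2$ to formulas of $S_1$ with $E'\equiv E$ for $E$ in the language of $S_1$, $S_2\vdash E'\leftrightarrow E$, $\Gamma\vdash_{S_2}E\Rightarrow\Gamma'\vdash_{S_1}E'$, and $'$ commuting with the logical operations. *)

theory Defs
  imports Main "HOL-Library.Nat_Bijection"
begin

section \<open>Two-sorted syntax\<close>

text \<open>One syntax serves both systems; the language of WKV is carved out of it below. Bound
  variables are de Bruijn indices, with separate index spaces for the two sorts, so formulas are
  identified up to renaming of bound variables. As in Kleene and Vesley, a constant for a one-place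
  number-theoretic function is itself a functor.\<close>

datatype const1 =
    Succ | Proj1 | Proj2
  | Factorial | Pred | SgBar | Sg
  | Prime    \<comment> \<open>the enumeration \<open>p\<^sub>0 = 2, p\<^sub>1 = 3, \<dots>\<close>\<close>
  | Lh

datatype const2 =
    Add | Mult | PairJ
  | Power | Monus | MinC | MaxC | Dist
  | Rem      \<comment> \<open>\<open>Rem a b\<close> is the remainder of \<open>a\<close> divided by \<open>b\<close>; likewise \<open>Quot\<close>\<close>
  | Quot
  | Expo     \<comment> \<open>\<open>Expo a i\<close> is \<open>(a)\<^sub>i\<close>, the exponent of \<open>p\<^sub>i\<close> in \<open>a\<close>\<close>
  | Concat   \<comment> \<open>\<open>a * b\<close>\<close>
  | Circ     \<comment> \<open>\<open>a \<circ> b\<close>\<close>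

text \<open>Constants with one number argument \<open>b\<close> and one function argument \<open>\<alpha>\<close>, in this order: the sum
  and product of \<open>\<alpha>(y)\<close> over \<open>y < b\<close>, its minimum and maximum over \<open>y \<le> b\<close>, the two
  course-of-values functions, and Kleene's \<open>ccp\<close>.\<close>

datatype constF = BSum | BProd | BMin | BMax | CourseBar | CourseTilde | Ccp

datatype trm =
    NVar nat
  | Zero
  | Fn2 const2 trm trm
  | FnF constF trm ftr
  | App ftr trm
and ftr =
    FVar nat
  | FConst const1
  | Lam trm     \<comment> \<open>binds number variable 0\<close>

datatype fm =
    Eq trm trm
  | And fm fm
  | Or fm fm
  | Imp fm fm
  | Neg fm
  | AllN fm
  | ExN fm
  | AllF fm
  | ExF fm

definition Iff :: "fm \<Rightarrow> fm \<Rightarrow> fm" where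
  "Iff A B = And (Imp A B) (Imp B A)"

section \<open>Renaming and substitution\<close>

fun up_ren :: "(nat \<Rightarrow> nat) \<Rightarrow> nat \<Rightarrow> nat" where
  "up_ren \<rho> 0 = 0"
| "up_ren \<rho> (Suc n) = Suc (\<rho> n)"

primrec ren_trm :: "(nat \<Rightarrow> nat) \<Rightarrow> (nat \<Rightarrow> nat) \<Rightarrow> trm \<Rightarrow> trm"
  and ren_ftr :: "(nat \<Rightarrow> nat) \<Rightarrow> (nat \<Rightarrow> nat) \<Rightarrow> ftr \<Rightarrow> ftr" where
  "ren_trm \<rho> \<phi> (NVar n) = NVar (\<rho> n)"
| "ren_trm \<rho> \<phi> Zero = Zero"
| "ren_trm \<rho> \<phi> (Fn2 c s t) = Fn2 c (ren_trm \<rho> \<phi> s) (ren_trm \<rho> \<phi> t)"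
| "ren_trm \<rho> \<phi> (FnF c s u) = FnF c (ren_trm \<rho> \<phi> s) (ren_ftr \<rho> \<phi> u)"
| "ren_trm \<rho> \<phi> (App u s) = App (ren_ftr \<rho> \<phi> u) (ren_trm \<rho> \<phi> s)"
| "ren_ftr \<rho> \<phi> (FVar n) = FVar (\<phi> n)"
| "ren_ftr \<rho> \<phi> (FConst c) = FConst c"
| "ren_ftr \<rho> \<phi> (Lam t) = Lam (ren_trm (up_ren \<rho>) \<phi> t)"

primrec ren_fm :: "(nat \<Rightarrow> nat) \<Rightarrow> (nat \<Rightarrow> nat) \<Rightarrow> fm \<Rightarrow> fm" where
  "ren_fm \<rho> \<phi> (Eq s t) = Eq (ren_trm \<rho> \<phi> s) (ren_trm \<rho> \<phi> t)"
| "ren_fm \<rho> \<phi> (And A B) = And (ren_fm \<rho> \<phi> A) (ren_fm \<rho> \<phi> B)"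
| "ren_fm \<rho> \<phi> (Or A B) = Or (ren_fm \<rho> \<phi> A) (ren_fm \<rho> \<phi> B)"
| "ren_fm \<rho> \<phi> (Imp A B) = Imp (ren_fm \<rho> \<phi> A) (ren_fm \<rho> \<phi> B)"
| "ren_fm \<rho> \<phi> (Neg A) = Neg (ren_fm \<rho> \<phi> A)"
| "ren_fm \<rho> \<phi> (AllN A) = AllN (ren_fm (up_ren \<rho>) \<phi> A)"
| "ren_fm \<rho> \<phi> (ExN A) = ExN (ren_fm (up_ren \<rho>) \<phi> A)"
| "ren_fm \<rho> \<phi> (AllF A) = AllF (ren_fm \<rho> (up_ren \<phi>) A)"
| "ren_fm \<rho> \<phi> (ExF A) = ExF (ren_fm \<rho> (up_ren \<phi>) A)"

fun scons :: "'a \<Rightarrow> (nat \<Rightarrow> 'a) \<Rightarrow> nat \<Rightarrow> 'a" where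
  "scons x \<sigma> 0 = x"
| "scons x \<sigma> (Suc n) = \<sigma> n"

abbreviation upN_trm :: "(nat \<Rightarrow> trm) \<Rightarrow> nat \<Rightarrow> trm" where
  "upN_trm \<sigma> \<equiv> scons (NVar 0) (\<lambda>n. ren_trm Suc id (\<sigma> n))"

abbreviation upN_ftr :: "(nat \<Rightarrow> ftr) \<Rightarrow> nat \<Rightarrow> ftr" where
  "upN_ftr \<tau> \<equiv> (\<lambda>n. ren_ftr Suc id (\<tau> n))"

abbreviation upF_trm :: "(nat \<Rightarrow> trm) \<Rightarrow> nat \<Rightarrow> trm" where
  "upF_trm \<sigma> \<equiv> (\<lambda>n. ren_trm id Suc (\<sigma> n))"

abbreviation upF_ftr :: "(nat \<Rightarrow> ftr) \<Rightarrow> nat \<Rightarrow> ftr" where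
  "upF_ftr \<tau> \<equiv> scons (FVar 0) (\<lambda>n. ren_ftr id Suc (\<tau> n))"

primrec sub_trm :: "(nat \<Rightarrow> trm) \<Rightarrow> (nat \<Rightarrow> ftr) \<Rightarrow> trm \<Rightarrow> trm"
  and sub_ftr :: "(nat \<Rightarrow> trm) \<Rightarrow> (nat \<Rightarrow> ftr) \<Rightarrow> ftr \<Rightarrow> ftr" where
  "sub_trm \<sigma> \<tau> (NVar n) = \<sigma> n"
| "sub_trm \<sigma> \<tau> Zero = Zero"
| "sub_trm \<sigma> \<tau> (Fn2 c s t) = Fn2 c (sub_trm \<sigma> \<tau> s) (sub_trm \<sigma> \<tau> t)"
| "sub_trm \<sigma> \<tau> (FnF c s u) = FnF c (sub_trm \<sigma> \<tau> s) (sub_ftr \<sigma> \<tau> u)"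
| "sub_trm \<sigma> \<tau> (App u s) = App (sub_ftr \<sigma> \<tau> u) (sub_trm \<sigma> \<tau> s)"
| "sub_ftr \<sigma> \<tau> (FVar n) = \<tau> n"
| "sub_ftr \<sigma> \<tau> (FConst c) = FConst c"
| "sub_ftr \<sigma> \<tau> (Lam t) = Lam (sub_trm (upN_trm \<sigma>) (upN_ftr \<tau>) t)"

primrec sub_fm :: "(nat \<Rightarrow> trm) \<Rightarrow> (nat \<Rightarrow> ftr) \<Rightarrow> fm \<Rightarrow> fm" where
  "sub_fm \<sigma> \<tau> (Eq s t) = Eq (sub_trm \<sigma> \<tau> s) (sub_trm \<sigma> \<tau> t)"
| "sub_fm \<sigma> \<tau> (And A B) = And (sub_fm \<sigma> \<tau> A) (sub_fm \<sigma> \<tau> B)"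
| "sub_fm \<sigma> \<tau> (Or A B) = Or (sub_fm \<sigma> \<tau> A) (sub_fm \<sigma> \<tau> B)"
| "sub_fm \<sigma> \<tau> (Imp A B) = Imp (sub_fm \<sigma> \<tau> A) (sub_fm \<sigma> \<tau> B)"
| "sub_fm \<sigma> \<tau> (Neg A) = Neg (sub_fm \<sigma> \<tau> A)"
| "sub_fm \<sigma> \<tau> (AllN A) = AllN (sub_fm (upN_trm \<sigma>) (upN_ftr \<tau>) A)"
| "sub_fm \<sigma> \<tau> (ExN A) = ExN (sub_fm (upN_trm \<sigma>) (upN_ftr \<tau>) A)"
| "sub_fm \<sigma> \<tau> (AllF A) = AllF (sub_fm (upF_trm \<sigma>) (upF_ftr \<tau>) A)"
| "sub_fm \<sigma> \<tau> (ExF A) = ExF (sub_fm (upF_trm \<sigma>) (upF_ftr \<tau>) A)"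

definition liftN :: "fm \<Rightarrow> fm" where
  "liftN = ren_fm Suc id"

definition liftF :: "fm \<Rightarrow> fm" where
  "liftF = ren_fm id Suc"

definition instN :: "trm \<Rightarrow> fm \<Rightarrow> fm" where
  "instN t = sub_fm (scons t NVar) FVar"

definition instF :: "ftr \<Rightarrow> fm \<Rightarrow> fm" where
  "instF u = sub_fm NVar (scons u FVar)"

section \<open>Formal systems and intuitionistic derivability\<close>

record formal_system =
  lang :: "fm set"
  axioms :: "fm set"

text \<open>Natural deduction in which the free variables of the open assumptions are held constant. The
  conditions \<open>\<in> L\<close> ensure that every formula occurring in a derivation belongs to the language.\<close>

inductive nd :: "fm set \<Rightarrow> fm set \<Rightarrow> fm set \<Rightarrow> fm \<Rightarrow> bool" for L Ax where
  assm: "A \<in> \<Gamma> \<Longrightarrow> A \<in> L \<Longrightarrow> nd L Ax \<Gamma> A"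
| axm: "A \<in> Ax \<Longrightarrow> A \<in> L \<Longrightarrow> nd L Ax \<Gamma> A"
| AndI: "nd L Ax \<Gamma> A \<Longrightarrow> nd L Ax \<Gamma> B \<Longrightarrow> nd L Ax \<Gamma> (And A B)"
| AndE1: "nd L Ax \<Gamma> (And A B) \<Longrightarrow> nd L Ax \<Gamma> A"
| AndE2: "nd L Ax \<Gamma> (And A B) \<Longrightarrow> nd L Ax \<Gamma> B"
| OrI1: "nd L Ax \<Gamma> A \<Longrightarrow> B \<in> L \<Longrightarrow> nd L Ax \<Gamma> (Or A B)"
| OrI2: "nd L Ax \<Gamma> B \<Longrightarrow> A \<in> L \<Longrightarrow> nd L Ax \<Gamma> (Or A B)"
| OrE: "nd L Ax \<Gamma> (Or A B) \<Longrightarrow> nd L Ax (insert A \<Gamma>) C \<Longrightarrow> nd L Ax (insert B \<Gamma>) C \<Longrightarrow> nd L Ax \<Gamma> C"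
| ImpI: "nd L Ax (insert A \<Gamma>) B \<Longrightarrow> A \<in> L \<Longrightarrow> nd L Ax \<Gamma> (Imp A B)"
| ImpE: "nd L Ax \<Gamma> (Imp A B) \<Longrightarrow> nd L Ax \<Gamma> A \<Longrightarrow> nd L Ax \<Gamma> B"
| NegI: "nd L Ax (insert A \<Gamma>) B \<Longrightarrow> nd L Ax (insert A \<Gamma>) (Neg B) \<Longrightarrow> A \<in> L \<Longrightarrow> nd L Ax \<Gamma> (Neg A)"
| NegE: "nd L Ax \<Gamma> A \<Longrightarrow> nd L Ax \<Gamma> (Neg A) \<Longrightarrow> B \<in> L \<Longrightarrow> nd L Ax \<Gamma> B"
| AllNI: "nd L Ax (liftN ` \<Gamma>) A \<Longrightarrow> nd L Ax \<Gamma> (AllN A)"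
| AllNE: "nd L Ax \<Gamma> (AllN A) \<Longrightarrow> instN t A \<in> L \<Longrightarrow> nd L Ax \<Gamma> (instN t A)"
| ExNI: "nd L Ax \<Gamma> (instN t A) \<Longrightarrow> ExN A \<in> L \<Longrightarrow> nd L Ax \<Gamma> (ExN A)"
| ExNE: "nd L Ax \<Gamma> (ExN A) \<Longrightarrow> nd L Ax (insert A (liftN ` \<Gamma>)) (liftN C) \<Longrightarrow> nd L Ax \<Gamma> C"
| AllFI: "nd L Ax (liftF ` \<Gamma>) A \<Longrightarrow> nd L Ax \<Gamma> (AllF A)"
| AllFE: "nd L Ax \<Gamma> (AllF A) \<Longrightarrow> instF u A \<in> L \<Longrightarrow> nd L Ax \<Gamma> (instF u A)"
| ExFI: "nd L Ax \<Gamma> (instF u A) \<Longrightarrow> ExF A \<in> L \<Longrightarrow> nd L Ax \<Gamma> (ExF A)"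
| ExFE: "nd L Ax \<Gamma> (ExF A) \<Longrightarrow> nd L Ax (insert A (liftF ` \<Gamma>)) (liftF C) \<Longrightarrow> nd L Ax \<Gamma> C"

text \<open>The finite subset matters for infinite \<open>\<Gamma>\<close>, which may leave no variable fresh for a
  derivation.\<close>

definition derivable :: "formal_system \<Rightarrow> fm set \<Rightarrow> fm \<Rightarrow> bool" where
  "derivable S \<Gamma> E \<longleftrightarrow> (\<exists>\<Gamma>\<^sub>0. finite \<Gamma>\<^sub>0 \<and> \<Gamma>\<^sub>0 \<subseteq> \<Gamma> \<and> nd (lang S) (axioms S) \<Gamma>\<^sub>0 E)"

section \<open>Axioms common to both systems\<close>

abbreviation S' :: "trm \<Rightarrow> trm" where "S' t \<equiv> App (FConst Succ) t"

definition eq_axioms :: "fm set" where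
  "eq_axioms =
    {Eq (NVar 0) (NVar 0),
     Imp (Eq (NVar 0) (NVar 1)) (Imp (Eq (NVar 0) (NVar 2)) (Eq (NVar 1) (NVar 2))),
     Imp (Eq (NVar 0) (NVar 1)) (Eq (App (FVar 0) (NVar 0)) (App (FVar 0) (NVar 1)))}"

definition arith_axioms :: "fm set" where
  "arith_axioms =
    {Imp (Eq (NVar 0) (NVar 1)) (Eq (S' (NVar 0)) (S' (NVar 1))),
     Imp (Eq (S' (NVar 0)) (S' (NVar 1))) (Eq (NVar 0) (NVar 1)),
     Neg (Eq (S' (NVar 0)) Zero),
     Eq (Fn2 Add (NVar 0) Zero) (NVar 0),
     Eq (Fn2 Add (NVar 0) (S' (NVar 1))) (S' (Fn2 Add (NVar 0) (NVar 1))),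
     Eq (Fn2 Mult (NVar 0) Zero) Zero,
     Eq (Fn2 Mult (NVar 0) (S' (NVar 1))) (Fn2 Add (Fn2 Mult (NVar 0) (NVar 1)) (NVar 0))}"

definition pairing_axioms :: "fm set" where
  "pairing_axioms =
    {Eq (App (FConst Proj1) (Fn2 PairJ (NVar 0) (NVar 1))) (NVar 0),
     Eq (App (FConst Proj2) (Fn2 PairJ (NVar 0) (NVar 1))) (NVar 1),
     Eq (Fn2 PairJ (App (FConst Proj1) (NVar 0)) (App (FConst Proj2) (NVar 0))) (NVar 0)}"

definition lambda_conversion :: "fm set" where
  "lambda_conversion = {Eq (App (Lam t) s) (sub_trm (scons s NVar) FVar t) | t s. True}"

definition induction_schema :: "fm set" where
  "induction_schema =
    {Imp (And (instN Zero A)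
              (AllN (Imp A (sub_fm (scons (S' (NVar 0)) (\<lambda>n. NVar (Suc n))) FVar A))))
         (AllN A) | A. True}"

definition ExUniqueN :: "fm \<Rightarrow> fm" where
  "ExUniqueN B = ExN (And B (AllN (Imp (ren_fm (up_ren Suc) id B) (Eq (NVar 1) (NVar 0)))))"

text \<open>In \<open>A\<close>, index 0 is \<open>y\<close> and index 1 is \<open>x\<close>. In the conclusion, \<open>x\<close> becomes index 0 and \<open>y\<close> is
  replaced by \<open>\<alpha>(x)\<close>, where \<open>\<alpha>\<close> is function index 0.\<close>

definition AC00_unique :: "fm set" where
  "AC00_unique =
    {Imp (AllN (ExUniqueN A))
         (ExF (AllN (sub_fm (scons (App (FVar 0) (NVar 0)) NVar) (\<lambda>n. FVar (Suc n)) A))) | A. True}"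

definition common_axioms :: "fm set" where
  "common_axioms = eq_axioms \<union> arith_axioms \<union> pairing_axioms \<union> lambda_conversion
     \<union> induction_schema \<union> AC00_unique"

section \<open>The system WKV\<close>

fun wkv_const1 :: "const1 \<Rightarrow> bool" where
  "wkv_const1 c \<longleftrightarrow> c \<in> {Succ, Proj1, Proj2}"

fun wkv_const2 :: "const2 \<Rightarrow> bool" where
  "wkv_const2 c \<longleftrightarrow> c \<in> {Add, Mult, PairJ}"

primrec wkv_trm :: "trm \<Rightarrow> bool" and wkv_ftr :: "ftr \<Rightarrow> bool" where
  "wkv_trm (NVar n) \<longleftrightarrow> True"
| "wkv_trm Zero \<longleftrightarrow> True"
| "wkv_trm (Fn2 c s t) \<longleftrightarrow> wkv_const2 c \<and> wkv_trm s \<and> wkv_trm t"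
| "wkv_trm (FnF c s u) \<longleftrightarrow> False"
| "wkv_trm (App u s) \<longleftrightarrow> wkv_ftr u \<and> wkv_trm s"
| "wkv_ftr (FVar n) \<longleftrightarrow> True"
| "wkv_ftr (FConst c) \<longleftrightarrow> wkv_const1 c"
| "wkv_ftr (Lam t) \<longleftrightarrow> wkv_trm t"

primrec wkv_fm :: "fm \<Rightarrow> bool" where
  "wkv_fm (Eq s t) \<longleftrightarrow> wkv_trm s \<and> wkv_trm t"
| "wkv_fm (And A B) \<longleftrightarrow> wkv_fm A \<and> wkv_fm B"
| "wkv_fm (Or A B) \<longleftrightarrow> wkv_fm A \<and> wkv_fm B"
| "wkv_fm (Imp A B) \<longleftrightarrow> wkv_fm A \<and> wkv_fm B"
| "wkv_fm (Neg A) \<longleftrightarrow> wkv_fm A"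
| "wkv_fm (AllN A) \<longleftrightarrow> wkv_fm A"
| "wkv_fm (ExN A) \<longleftrightarrow> wkv_fm A"
| "wkv_fm (AllF A) \<longleftrightarrow> wkv_fm A"
| "wkv_fm (ExF A) \<longleftrightarrow> wkv_fm A"

text \<open>\<open>\<exists>\<beta> [\<beta>(0) = t \<and> (\<forall>y. \<beta>(S y) = r(j(y, \<beta>(y))))]\<close>; renaming keeps \<open>\<beta>\<close> out of \<open>t\<close>, and \<open>\<beta>\<close> and
  \<open>y\<close> out of \<open>r\<close>.\<close>

definition prim_rec_schema :: "fm set" where
  "prim_rec_schema =
    {ExF (And (Eq (App (FVar 0) Zero) (ren_trm id Suc t))
              (AllN (Eq (App (FVar 0) (S' (NVar 0)))
                        (App (ren_ftr Suc Suc r)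
                             (Fn2 PairJ (NVar 0) (App (FVar 0) (NVar 0))))))) | t r. True}"

definition WKV :: formal_system where
  "WKV = \<lparr>lang = {A. wkv_fm A},
          axioms = (common_axioms \<union> prim_rec_schema) \<inter> {A. wkv_fm A}\<rparr>"

section \<open>The system M with pairing\<close>

abbreviation one :: trm where "one \<equiv> S' Zero"

text \<open>Kleene's representation of the least \<open>y < n\<close> with \<open>r(y) = 0\<close> (and \<open>n\<close> if there is none) as
  \<open>\<Sum>\<^sub>y\<^sub><\<^sub>n \<Prod>\<^sub>z\<^sub>\<le>\<^sub>y r(z)\<close>, for \<open>r\<close> with values in \<open>{0, 1}\<close>. The argument of \<open>r\<close> is number index 0.\<close>

definition bmu :: "trm \<Rightarrow> trm \<Rightarrow> trm" where
  "bmu n r = FnF BSum n (Lam (FnF BProd (S' (NVar 0)) (Lam (ren_trm (up_ren Suc) id r))))"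

text \<open>In the following defining equations \<open>a, b, i\<close> and \<open>x\<close> are free number variables among the
  indices 0 and 1, and \<open>\<alpha>\<close> is \<open>FVar 0\<close>. Below a \<open>Lam\<close> or in the second argument of \<open>bmu\<close> these
  number indices are shifted by one.\<close>

definition arith_defining_axioms :: "fm set" where
  "arith_defining_axioms =
    {Eq (Fn2 Power (NVar 0) Zero) one,
     Eq (Fn2 Power (NVar 0) (S' (NVar 1))) (Fn2 Mult (Fn2 Power (NVar 0) (NVar 1)) (NVar 0)),
     Eq (App (FConst Factorial) Zero) one,
     Eq (App (FConst Factorial) (S' (NVar 0)))
        (Fn2 Mult (App (FConst Factorial) (NVar 0)) (S' (NVar 0))),
     Eq (App (FConst Pred) Zero) Zero,
     Eq (App (FConst Pred) (S' (NVar 0))) (NVar 0),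
     Eq (Fn2 Monus (NVar 0) Zero) (NVar 0),
     Eq (Fn2 Monus (NVar 0) (S' (NVar 1))) (App (FConst Pred) (Fn2 Monus (NVar 0) (NVar 1))),
     Eq (Fn2 MinC (NVar 0) (NVar 1)) (Fn2 Monus (NVar 1) (Fn2 Monus (NVar 1) (NVar 0))),
     Eq (Fn2 MaxC (NVar 0) (NVar 1)) (Fn2 Add (Fn2 Monus (NVar 0) (NVar 1)) (NVar 1)),
     Eq (App (FConst SgBar) Zero) one,
     Eq (App (FConst SgBar) (S' (NVar 0))) Zero,
     Eq (App (FConst Sg) Zero) Zero,
     Eq (App (FConst Sg) (S' (NVar 0))) one,
     Eq (Fn2 Dist (NVar 0) (NVar 1))
        (Fn2 Add (Fn2 Monus (NVar 0) (NVar 1)) (Fn2 Monus (NVar 1) (NVar 0))),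
     Eq (Fn2 Rem Zero (NVar 1)) Zero,
     Eq (Fn2 Rem (S' (NVar 0)) (NVar 1))
        (Fn2 Mult (S' (Fn2 Rem (NVar 0) (NVar 1)))
           (App (FConst Sg) (Fn2 Dist (NVar 1) (S' (Fn2 Rem (NVar 0) (NVar 1)))))),
     Eq (Fn2 Quot Zero (NVar 1)) Zero,
     Eq (Fn2 Quot (S' (NVar 0)) (NVar 1))
        (Fn2 Add (Fn2 Quot (NVar 0) (NVar 1))
           (App (FConst SgBar) (Fn2 Dist (NVar 1) (S' (Fn2 Rem (NVar 0) (NVar 1))))))}"

definition bounded_defining_axioms :: "fm set" where
  "bounded_defining_axioms =
    {Eq (FnF BSum Zero (FVar 0)) Zero,
     Eq (FnF BSum (S' (NVar 0)) (FVar 0))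
        (Fn2 Add (FnF BSum (NVar 0) (FVar 0)) (App (FVar 0) (NVar 0))),
     Eq (FnF BProd Zero (FVar 0)) one,
     Eq (FnF BProd (S' (NVar 0)) (FVar 0))
        (Fn2 Mult (FnF BProd (NVar 0) (FVar 0)) (App (FVar 0) (NVar 0))),
     Eq (FnF BMin Zero (FVar 0)) (App (FVar 0) Zero),
     Eq (FnF BMin (S' (NVar 0)) (FVar 0))
        (Fn2 MinC (FnF BMin (NVar 0) (FVar 0)) (App (FVar 0) (S' (NVar 0)))),
     Eq (FnF BMax Zero (FVar 0)) (App (FVar 0) Zero),
     Eq (FnF BMax (S' (NVar 0)) (FVar 0))
        (Fn2 MaxC (FnF BMax (NVar 0) (FVar 0)) (App (FVar 0) (S' (NVar 0))))}"

text \<open>For \<open>p\<^sub>i\<^sub>+\<^sub>1 = \<mu>c\<^sub>c\<^sub><\<^sub>p\<^sub>!\<^sub>+\<^sub>2 [p < c \<and> c is prime]\<close> with \<open>p = p\<^sub>i\<close>: a term with values in \<open>{0, 1}\<close>, in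
  \<open>c\<close> (index 0) and \<open>i\<close> (index 1), that is zero iff \<open>p < c\<close> and no \<open>d < c\<close> with \<open>d > 1\<close> divides \<open>c\<close>.\<close>

definition prime_test :: trm where
  "prime_test =
     App (FConst Sg)
       (Fn2 Add (Fn2 Monus (S' (App (FConst Prime) (NVar 1))) (NVar 0))
          (FnF BSum (NVar 0)
             (Lam (Fn2 Mult (App (FConst Sg) (App (FConst Pred) (NVar 0)))
                            (App (FConst SgBar) (Fn2 Rem (NVar 1) (NVar 0)))))))"

text \<open>For \<open>(a)\<^sub>i = \<mu>x\<^sub>x\<^sub><\<^sub>a [p\<^sub>i\<^sup>x divides a \<and> p\<^sub>i\<^sup>x\<^sup>+\<^sup>1 does not divide a]\<close>: a term with values in \<open>{0, 1}\<close>,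
  in \<open>x\<close> (index 0), \<open>a\<close> (index 1) and \<open>i\<close> (index 2), that is zero iff the bracket holds.\<close>

definition expo_test :: trm where
  "expo_test =
     App (FConst Sg)
       (Fn2 Add (Fn2 Rem (NVar 1) (Fn2 Power (App (FConst Prime) (NVar 2)) (NVar 0)))
          (App (FConst SgBar)
             (Fn2 Rem (NVar 1) (Fn2 Power (App (FConst Prime) (NVar 2)) (S' (NVar 0))))))"

text \<open>In mathematical notation, the last seven equations below are
  \<open>lh(a) = \<Sum>\<^sub>i\<^sub><\<^sub>a sg((a)\<^sub>i)\<close>,
  \<open>a * b = a \<cdot> \<Prod>\<^sub>i\<^sub><\<^sub>l\<^sub>h\<^sub>(\<^sub>b\<^sub>) (p\<^sub>l\<^sub>h\<^sub>(\<^sub>a\<^sub>)\<^sub>+\<^sub>i)^(b)\<^sub>i\<close>,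
  the codes \<open>\<Prod>\<^sub>i\<^sub><\<^sub>x p\<^sub>i^(\<alpha>(i)+1)\<close> and \<open>\<Prod>\<^sub>i\<^sub><\<^sub>x p\<^sub>i^\<alpha>(i)\<close> of the course of values of \<open>\<alpha>\<close>,
  \<open>a \<circ> b = \<Prod>\<^sub>i\<^sub><\<^sub>m\<^sub>a\<^sub>x\<^sub>(\<^sub>a\<^sub>,\<^sub>b\<^sub>) p\<^sub>i^max((a)\<^sub>i,(b)\<^sub>i)\<close>,
  and the continued product with respect to \<open>\<circ>\<close>,
  \<open>ccp\<^sub>y\<^sub><\<^sub>0 \<alpha>(y) = 1\<close> and \<open>ccp\<^sub>y\<^sub><\<^sub>b\<^sub>+\<^sub>1 \<alpha>(y) = (ccp\<^sub>y\<^sub><\<^sub>b \<alpha>(y)) \<circ> \<alpha>(b)\<close>.\<close>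

definition coding_defining_axioms :: "fm set" where
  "coding_defining_axioms =
    {Eq (App (FConst Prime) Zero) (S' one),
     Eq (App (FConst Prime) (S' (NVar 0)))
        (bmu (S' (S' (App (FConst Factorial) (App (FConst Prime) (NVar 0))))) prime_test),
     Eq (Fn2 Expo (NVar 0) (NVar 1)) (bmu (NVar 0) expo_test),
     Eq (App (FConst Lh) (NVar 0))
        (FnF BSum (NVar 0) (Lam (App (FConst Sg) (Fn2 Expo (NVar 1) (NVar 0))))),
     Eq (Fn2 Concat (NVar 0) (NVar 1))
        (Fn2 Mult (NVar 0)
           (FnF BProd (App (FConst Lh) (NVar 1))
              (Lam (Fn2 Power
                      (App (FConst Prime) (Fn2 Add (App (FConst Lh) (NVar 1)) (NVar 0)))
                      (Fn2 Expo (NVar 2) (NVar 0)))))),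
     Eq (FnF CourseBar (NVar 0) (FVar 0))
        (FnF BProd (NVar 0)
           (Lam (Fn2 Power (App (FConst Prime) (NVar 0)) (S' (App (FVar 0) (NVar 0)))))),
     Eq (FnF CourseTilde (NVar 0) (FVar 0))
        (FnF BProd (NVar 0)
           (Lam (Fn2 Power (App (FConst Prime) (NVar 0)) (App (FVar 0) (NVar 0))))),
     Eq (Fn2 Circ (NVar 0) (NVar 1))
        (FnF BProd (Fn2 MaxC (NVar 0) (NVar 1))
           (Lam (Fn2 Power (App (FConst Prime) (NVar 0))
                   (Fn2 MaxC (Fn2 Expo (NVar 1) (NVar 0)) (Fn2 Expo (NVar 2) (NVar 0)))))),
     Eq (FnF Ccp Zero (FVar 0)) one,
     Eq (FnF Ccp (S' (NVar 0)) (FVar 0))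
        (Fn2 Circ (FnF Ccp (NVar 0) (FVar 0)) (App (FVar 0) (NVar 0)))}"

definition Mj :: formal_system where
  "Mj = \<lparr>lang = UNIV,
         axioms = common_axioms \<union> arith_defining_axioms \<union> bounded_defining_axioms
           \<union> coding_defining_axioms\<rparr>"

section \<open>Effective translations\<close>

text \<open>\<open>recursive n f\<close>: on argument lists of length \<open>n\<close>, \<open>f\<close> is a total recursive function.\<close>

inductive recursive :: "nat \<Rightarrow> (nat list \<Rightarrow> nat) \<Rightarrow> bool" where
  rec_zero: "recursive n (\<lambda>_. 0)"
| rec_succ: "recursive 1 (\<lambda>xs. Suc (xs ! 0))"
| rec_proj: "i < n \<Longrightarrow> recursive n (\<lambda>xs. xs ! i)"
| rec_comp: "recursive (length gs) f \<Longrightarrow> \<forall>g \<in> set gs. recursive n g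
    \<Longrightarrow> recursive n (\<lambda>xs. f (map (\<lambda>g. g xs) gs))"
| rec_prim: "recursive n f \<Longrightarrow> recursive (Suc (Suc n)) g
    \<Longrightarrow> recursive (Suc n) (\<lambda>xs. rec_nat (f (tl xs)) (\<lambda>k v. g (k # v # tl xs)) (hd xs))"
| rec_mu: "recursive (Suc n) f \<Longrightarrow> \<forall>xs. length xs = n \<longrightarrow> (\<exists>y. f (y # xs) = 0)
    \<Longrightarrow> recursive n (\<lambda>xs. LEAST y. f (y # xs) = 0)"

primrec code_const1 :: "const1 \<Rightarrow> nat" where
  "code_const1 Succ = 0"
| "code_const1 Proj1 = 1"
| "code_const1 Proj2 = 2"
| "code_const1 Factorial = 3"
| "code_const1 Pred = 4"
| "code_const1 SgBar = 5"
| "code_const1 Sg = 6"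
| "code_const1 Prime = 7"
| "code_const1 Lh = 8"

primrec code_const2 :: "const2 \<Rightarrow> nat" where
  "code_const2 Add = 0"
| "code_const2 Mult = 1"
| "code_const2 PairJ = 2"
| "code_const2 Power = 3"
| "code_const2 Monus = 4"
| "code_const2 MinC = 5"
| "code_const2 MaxC = 6"
| "code_const2 Dist = 7"
| "code_const2 Rem = 8"
| "code_const2 Quot = 9"
| "code_const2 Expo = 10"
| "code_const2 Concat = 11"
| "code_const2 Circ = 12"

primrec code_constF :: "constF \<Rightarrow> nat" where
  "code_constF BSum = 0"
| "code_constF BProd = 1"
| "code_constF BMin = 2"
| "code_constF BMax = 3"
| "code_constF CourseBar = 4"
| "code_constF CourseTilde = 5"
| "code_constF Ccp = 6"

primrec code_trm :: "trm \<Rightarrow> nat" and code_ftr :: "ftr \<Rightarrow> nat" where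
  "code_trm (NVar n) = prod_encode (0, n)"
| "code_trm Zero = prod_encode (1, 0)"
| "code_trm (Fn2 c s t) =
     prod_encode (2, prod_encode (code_const2 c, prod_encode (code_trm s, code_trm t)))"
| "code_trm (FnF c s u) =
     prod_encode (3, prod_encode (code_constF c, prod_encode (code_trm s, code_ftr u)))"
| "code_trm (App u s) = prod_encode (4, prod_encode (code_ftr u, code_trm s))"
| "code_ftr (FVar n) = prod_encode (0, n)"
| "code_ftr (FConst c) = prod_encode (1, code_const1 c)"
| "code_ftr (Lam t) = prod_encode (2, code_trm t)"

primrec code_fm :: "fm \<Rightarrow> nat" where
  "code_fm (Eq s t) = prod_encode (0, prod_encode (code_trm s, code_trm t))"
| "code_fm (And A B) = prod_encode (1, prod_encode (code_fm A, code_fm B))"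
| "code_fm (Or A B) = prod_encode (2, prod_encode (code_fm A, code_fm B))"
| "code_fm (Imp A B) = prod_encode (3, prod_encode (code_fm A, code_fm B))"
| "code_fm (Neg A) = prod_encode (4, code_fm A)"
| "code_fm (AllN A) = prod_encode (5, code_fm A)"
| "code_fm (ExN A) = prod_encode (6, code_fm A)"
| "code_fm (AllF A) = prod_encode (7, code_fm A)"
| "code_fm (ExF A) = prod_encode (8, code_fm A)"

definition effective_on :: "fm set \<Rightarrow> (fm \<Rightarrow> fm) \<Rightarrow> bool" where
  "effective_on L tr \<longleftrightarrow> (\<exists>f. recursive 1 f \<and> (\<forall>E\<in>L. f [code_fm E] = code_fm (tr E)))"

section \<open>Definitional extensions\<close>

definition commutes_with_logic :: "fm set \<Rightarrow> (fm \<Rightarrow> fm) \<Rightarrow> bool" where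
  "commutes_with_logic L tr \<longleftrightarrow>
     (\<forall>A\<in>L. \<forall>B\<in>L.
        tr (And A B) = And (tr A) (tr B) \<and>
        tr (Or A B) = Or (tr A) (tr B) \<and>
        tr (Imp A B) = Imp (tr A) (tr B)) \<and>
     (\<forall>A\<in>L.
        tr (Neg A) = Neg (tr A) \<and>
        tr (AllN A) = AllN (tr A) \<and>
        tr (ExN A) = ExN (tr A) \<and>
        tr (AllF A) = AllF (tr A) \<and>
        tr (ExF A) = ExF (tr A))"

definition extension :: "formal_system \<Rightarrow> formal_system \<Rightarrow> bool" where
  "extension S\<^sub>2 S\<^sub>1 \<longleftrightarrow> lang S\<^sub>1 \<subseteq> lang S\<^sub>2 \<and>
     (\<forall>\<Gamma> E. \<Gamma> \<subseteq> lang S\<^sub>1 \<longrightarrow> E \<in> lang S\<^sub>1 \<longrightarrow> derivable S\<^sub>1 \<Gamma> E \<longrightarrow> derivable S\<^sub>2 \<Gamma> E)"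

definition definitional_extension :: "formal_system \<Rightarrow> formal_system \<Rightarrow> bool" where
  "definitional_extension S\<^sub>2 S\<^sub>1 \<longleftrightarrow> extension S\<^sub>2 S\<^sub>1 \<and>
     (\<exists>tr.
        effective_on (lang S\<^sub>2) tr \<and>
        (\<forall>E\<in>lang S\<^sub>2. tr E \<in> lang S\<^sub>1) \<and>
        (\<forall>E\<in>lang S\<^sub>1. tr E = E) \<and>
        (\<forall>E\<in>lang S\<^sub>2. derivable S\<^sub>2 {} (Iff (tr E) E)) \<and>
        (\<forall>\<Gamma> E. \<Gamma> \<subseteq> lang S\<^sub>2 \<longrightarrow> E \<in> lang S\<^sub>2 \<longrightarrow> derivable S\<^sub>2 \<Gamma> E
             \<longrightarrow> derivable S\<^sub>1 (tr ` \<Gamma>) (tr E)) \<and>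
        commutes_with_logic (lang S\<^sub>2) tr)"

end

(*
  Derivability from finite contexts is treated as a forcing relation: implication and the universal
  quantifiers are forced as in a Kripke model whose worlds are the contexts, disjunction and the
  existential quantifiers locally. With AC00! a primitive recursion is obtained from the traces of its
  values, since on each argument the existence of a unique value is proved by induction; this works
  with any formula for the graph of the recursion. Hence the recursion schema of WKV holds in M^j, and
  in WKV the additional constants of M^j can be replaced by formulas defining their graphs, which are
  provably total and single-valued. A translated equation says that both sides have the same value;
  reading every formula in this way, the axioms and rules of M^j hold in WKV. In M^j itself the graphs
  agree with the constants, so every formula is equivalent to its translation. The translation is a
  recursion on codes, carried out by a machine with a stack.
*)
theory Submission imports Defs begin

text \<open>The difficulty lies with functors rather than numbers. A constant such as the bounded
  sum takes a functor that may itself contain constants missing in WKV; its graph must then speak of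
  some function of WKV with the same values, and AC00! has to provide it. Moreover, a term of M^j
  put for a variable is no term of WKV, so \<open>tr\<close> cannot simply be pushed through a
  substitution; the quantifier rules are treated with environments of WKV terms, in which such a
  term is represented by a value. A context need not decide a disjunction or name a witness, which
  is why these are forced only locally; uniqueness makes local witnesses interchangeable.

  The recursion theorem is derived from the axioms common to both systems, because its steps are
  given by formulas and not by functors as in the schema of WKV. Sequence numbers would presuppose
  exponentiation or some number theory; infinite sequences, prolonged at the front by a definition
  by cases, avoid both.\<close>

lemma up_ren_comp: "up_ren f (up_ren g n) = up_ren (f \<circ> g) n"
  by (cases n) auto

lemma up_ren_comp': "up_ren f \<circ> up_ren g = up_ren (f \<circ> g)"
  by (rule ext) (simp add: up_ren_comp)

lemma up_ren_id [simp]: "up_ren id = id" "up_ren (\<lambda>n. n) = (\<lambda>n. n)"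
proof -
  show "up_ren id = id" by (rule ext, case_tac x) auto
  then show "up_ren (\<lambda>n. n) = (\<lambda>n. n)" by (simp add: id_def)
qed

lemma scons_up_ren: "scons x f \<circ> up_ren g = scons x (f \<circ> g)"
  by (rule ext, case_tac xa) auto

lemma comp_scons: "(\<lambda>n. f (scons x g n)) = scons (f x) (\<lambda>n. f (g n))"
  by (rule ext, case_tac n) auto

lemma scons_comp_Suc [simp]: "scons x f \<circ> Suc = f"
  by (rule ext) auto

section \<open>Laws of renaming and substitution, and finite dependence on variables\<close>

lemma ren_ren:
  "ren_trm \<rho>' \<phi>' (ren_trm \<rho> \<phi> t) = ren_trm (\<rho>' \<circ> \<rho>) (\<phi>' \<circ> \<phi>) t"
  "ren_ftr \<rho>' \<phi>' (ren_ftr \<rho> \<phi> u) = ren_ftr (\<rho>' \<circ> \<rho>) (\<phi>' \<circ> \<phi>) u"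
  by (induction t and u arbitrary: \<rho> \<rho>' and \<rho> \<rho>') (auto simp: up_ren_comp')

lemma sub_ren:
  "sub_trm \<sigma> \<tau> (ren_trm \<rho> \<phi> t) = sub_trm (\<sigma> \<circ> \<rho>) (\<tau> \<circ> \<phi>) t"
  "sub_ftr \<sigma> \<tau> (ren_ftr \<rho> \<phi> u) = sub_ftr (\<sigma> \<circ> \<rho>) (\<tau> \<circ> \<phi>) u"
  by (induction t and u arbitrary: \<sigma> \<tau> \<rho> and \<sigma> \<tau> \<rho>) (auto simp: scons_up_ren, simp_all add: comp_def)

lemma ren_sub:
  "ren_trm \<rho> \<phi> (sub_trm \<sigma> \<tau> t) = sub_trm (\<lambda>n. ren_trm \<rho> \<phi> (\<sigma> n)) (\<lambda>n. ren_ftr \<rho> \<phi> (\<tau> n)) t"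
  "ren_ftr \<rho> \<phi> (sub_ftr \<sigma> \<tau> u) = sub_ftr (\<lambda>n. ren_trm \<rho> \<phi> (\<sigma> n)) (\<lambda>n. ren_ftr \<rho> \<phi> (\<tau> n)) u"
proof (induction t and u arbitrary: \<sigma> \<tau> \<rho> and \<sigma> \<tau> \<rho>)
  case (Lam t)
  show ?case by (simp add: Lam.IH comp_scons ren_ren comp_def)
qed auto

text \<open>Below a binder the substitution is composed with a renaming, so the mixed laws
  \<open>sub_ren\<close> and \<open>ren_sub\<close> have to come first.\<close>

lemma sub_sub:
  "sub_trm \<sigma>' \<tau>' (sub_trm \<sigma> \<tau> t) = sub_trm (\<lambda>n. sub_trm \<sigma>' \<tau>' (\<sigma> n)) (\<lambda>n. sub_ftr \<sigma>' \<tau>' (\<tau> n)) t"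
  "sub_ftr \<sigma>' \<tau>' (sub_ftr \<sigma> \<tau> u) = sub_ftr (\<lambda>n. sub_trm \<sigma>' \<tau>' (\<sigma> n)) (\<lambda>n. sub_ftr \<sigma>' \<tau>' (\<tau> n)) u"
proof (induction t and u arbitrary: \<sigma> \<tau> \<sigma>' \<tau>' and \<sigma> \<tau> \<sigma>' \<tau>')
  case (Lam t)
  show ?case by (simp add: Lam.IH comp_scons ren_sub sub_ren comp_def)
qed auto

lemma scons_NVar [simp]: "scons (NVar 0) (\<lambda>n. NVar (Suc n)) = NVar"
  by (rule ext, case_tac x) auto

lemma scons_FVar [simp]: "scons (FVar 0) (\<lambda>n. FVar (Suc n)) = FVar"
  by (rule ext, case_tac x) auto

lemma sub_id [simp]:
  "sub_trm NVar FVar t = t" "sub_ftr NVar FVar u = u"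
  by (induction t and u) auto

lemma ren_eq_sub:
  "ren_trm \<rho> \<phi> t = sub_trm (\<lambda>n. NVar (\<rho> n)) (\<lambda>n. FVar (\<phi> n)) t"
  "ren_ftr \<rho> \<phi> u = sub_ftr (\<lambda>n. NVar (\<rho> n)) (\<lambda>n. FVar (\<phi> n)) u"
  using ren_sub[of \<rho> \<phi> NVar FVar] by auto

lemma ren_fm_sub_fm:
  "ren_fm \<rho> \<phi> A = sub_fm (\<lambda>n. NVar (\<rho> n)) (\<lambda>n. FVar (\<phi> n)) A"
proof -
  have 1: "(\<lambda>n. NVar (up_ren \<rho> n)) = scons (NVar 0) (\<lambda>n. NVar (Suc (\<rho> n)))" for \<rho>
    by (rule ext, case_tac n) auto
  have 2: "(\<lambda>n. FVar (up_ren \<rho> n)) = scons (FVar 0) (\<lambda>n. FVar (Suc (\<rho> n)))" for \<rho>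
    by (rule ext, case_tac n) auto
  show ?thesis by (induction A arbitrary: \<rho> \<phi>) (auto simp: ren_eq_sub 1 2)
qed

lemma sub_fm_sub_fm:
  "sub_fm \<sigma>' \<tau>' (sub_fm \<sigma> \<tau> A) = sub_fm (\<lambda>n. sub_trm \<sigma>' \<tau>' (\<sigma> n)) (\<lambda>n. sub_ftr \<sigma>' \<tau>' (\<tau> n)) A"
proof (induction A arbitrary: \<sigma> \<tau> \<sigma>' \<tau>')
  case (AllN A)
  show ?case by (simp add: AllN.IH comp_scons ren_sub sub_ren comp_def)
next
  case (ExN A)
  show ?case by (simp add: ExN.IH comp_scons ren_sub sub_ren comp_def)
next
  case (AllF A)
  show ?case by (simp add: AllF.IH comp_scons ren_sub sub_ren comp_def)
next
  case (ExF A)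
  show ?case by (simp add: ExF.IH comp_scons ren_sub sub_ren comp_def)
qed (auto simp: sub_sub)

lemma sub_fm_id [simp]: "sub_fm NVar FVar A = A"
  by (induction A) auto

lemma sub_ren_fm:
  "sub_fm \<sigma> \<tau> (ren_fm \<rho> \<phi> A) = sub_fm (\<lambda>n. \<sigma> (\<rho> n)) (\<lambda>n. \<tau> (\<phi> n)) A"
  by (simp add: ren_fm_sub_fm sub_fm_sub_fm)

lemma sub_ren_Suc [simp]:
  "sub_trm (scons x \<sigma>) \<tau> (ren_trm Suc id t) = sub_trm \<sigma> \<tau> t"
  "sub_ftr (scons x \<sigma>) \<tau> (ren_ftr Suc id u) = sub_ftr \<sigma> \<tau> u"
  "sub_trm \<sigma> (scons v \<tau>) (ren_trm id Suc t) = sub_trm \<sigma> \<tau> t"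
  "sub_ftr \<sigma> (scons v \<tau>) (ren_ftr id Suc u) = sub_ftr \<sigma> \<tau> u"
  by (simp_all add: sub_ren)

lemma instN_sub: "instN t (sub_fm (upN_trm \<sigma>) (upN_ftr \<tau>) A) = sub_fm (scons t \<sigma>) \<tau> A"
  by (simp add: instN_def sub_fm_sub_fm comp_scons)

lemma instF_sub: "instF u (sub_fm (upF_trm \<sigma>) (upF_ftr \<tau>) A) = sub_fm \<sigma> (scons u \<tau>) A"
  by (simp add: instF_def sub_fm_sub_fm comp_scons)

lemma sub_instN: "sub_fm \<sigma> \<tau> (instN t A) = sub_fm (scons (sub_trm \<sigma> \<tau> t) \<sigma>) \<tau> A"
  by (simp add: instN_def sub_fm_sub_fm comp_scons)

lemma sub_instF: "sub_fm \<sigma> \<tau> (instF u A) = sub_fm \<sigma> (scons (sub_ftr \<sigma> \<tau> u) \<tau>) A"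
  by (simp add: instF_def sub_fm_sub_fm comp_scons)

lemma sub_liftN [simp]: "sub_fm (scons t \<sigma>) \<tau> (liftN A) = sub_fm \<sigma> \<tau> A"
  by (simp add: liftN_def sub_ren_fm)

lemma sub_liftF [simp]: "sub_fm \<sigma> (scons u \<tau>) (liftF A) = sub_fm \<sigma> \<tau> A"
  by (simp add: liftF_def sub_ren_fm)

text \<open>A term mentions finitely many variables. This supplies fresh indices later; one bound
  serves both sorts.\<close>

lemma finite_dependence_trm:
  "\<exists>N. \<forall>\<sigma> \<sigma>' \<tau> \<tau>'. (\<forall>n<N. \<sigma> n = \<sigma>' n \<and> \<tau> n = \<tau>' n) \<longrightarrow> sub_trm \<sigma> \<tau> t = sub_trm \<sigma>' \<tau>' t"
  "\<exists>N. \<forall>\<sigma> \<sigma>' \<tau> \<tau>'. (\<forall>n<N. \<sigma> n = \<sigma>' n \<and> \<tau> n = \<tau>' n) \<longrightarrow> sub_ftr \<sigma> \<tau> u = sub_ftr \<sigma>' \<tau>' u"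
proof (induction t and u)
  case (NVar n)
  show ?case by (rule exI[of _ "Suc n"]) auto
next
  case (FVar n)
  show ?case by (rule exI[of _ "Suc n"]) auto
next
  case (Fn2 c s t)
  then obtain N N' where
    "\<forall>\<sigma> \<sigma>' \<tau> \<tau>'. (\<forall>n<N. \<sigma> n = \<sigma>' n \<and> \<tau> n = \<tau>' n) \<longrightarrow> sub_trm \<sigma> \<tau> s = sub_trm \<sigma>' \<tau>' s"
    "\<forall>\<sigma> \<sigma>' \<tau> \<tau>'. (\<forall>n<N'. \<sigma> n = \<sigma>' n \<and> \<tau> n = \<tau>' n) \<longrightarrow> sub_trm \<sigma> \<tau> t = sub_trm \<sigma>' \<tau>' t" by blast
  then show ?case by (intro exI[of _ "max N N'"]) (auto simp: less_max_iff_disj)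
next
  case (FnF c s u)
  then obtain N N' where
    "\<forall>\<sigma> \<sigma>' \<tau> \<tau>'. (\<forall>n<N. \<sigma> n = \<sigma>' n \<and> \<tau> n = \<tau>' n) \<longrightarrow> sub_trm \<sigma> \<tau> s = sub_trm \<sigma>' \<tau>' s"
    "\<forall>\<sigma> \<sigma>' \<tau> \<tau>'. (\<forall>n<N'. \<sigma> n = \<sigma>' n \<and> \<tau> n = \<tau>' n) \<longrightarrow> sub_ftr \<sigma> \<tau> u = sub_ftr \<sigma>' \<tau>' u" by blast
  then show ?case by (intro exI[of _ "max N N'"]) (auto simp: less_max_iff_disj)
next
  case (App u s)
  then obtain N N' where
    "\<forall>\<sigma> \<sigma>' \<tau> \<tau>'. (\<forall>n<N. \<sigma> n = \<sigma>' n \<and> \<tau> n = \<tau>' n) \<longrightarrow> sub_trm \<sigma> \<tau> s = sub_trm \<sigma>' \<tau>' s"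
    "\<forall>\<sigma> \<sigma>' \<tau> \<tau>'. (\<forall>n<N'. \<sigma> n = \<sigma>' n \<and> \<tau> n = \<tau>' n) \<longrightarrow> sub_ftr \<sigma> \<tau> u = sub_ftr \<sigma>' \<tau>' u" by blast
  then show ?case by (intro exI[of _ "max N N'"]) (auto simp: less_max_iff_disj)
next
  case (Lam t)
  then obtain N where N:
    "\<And>\<sigma> \<sigma>' \<tau> \<tau>'. (\<forall>n<N. \<sigma> n = \<sigma>' n \<and> \<tau> n = \<tau>' n) \<Longrightarrow> sub_trm \<sigma> \<tau> t = sub_trm \<sigma>' \<tau>' t" by blast
  show ?case
  proof (intro exI[of _ N] allI impI)
    fix \<sigma> \<sigma>' :: "nat \<Rightarrow> trm" and \<tau> \<tau>' :: "nat \<Rightarrow> ftr" assume *: "\<forall>n<N. \<sigma> n = \<sigma>' n \<and> \<tau> n = \<tau>' n"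
    \<comment> \<open>Index \<open>Suc n\<close> of a lifted environment consults index
      \<open>n\<close> of the original one, so the bound of the body is good enough.\<close>
    show "sub_ftr \<sigma> \<tau> (Lam t) = sub_ftr \<sigma>' \<tau>' (Lam t)"
      using * by (auto intro!: N simp: less_Suc_eq_0_disj) (case_tac n; simp)
  qed
qed auto

text \<open>Freshness of all indices from \<open>N\<close> on, expressed by substitution because it
  is only ever used to change a substitution there.\<close>

definition depends_below :: "nat \<Rightarrow> fm \<Rightarrow> bool" where
  "depends_below N A \<longleftrightarrow> (\<forall>\<sigma> \<sigma>' \<tau> \<tau>'. (\<forall>n<N. \<sigma> n = \<sigma>' n \<and> \<tau> n = \<tau>' n) \<longrightarrow> sub_fm \<sigma> \<tau> A = sub_fm \<sigma>' \<tau>' A)"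

lemma depends_below_mono: "depends_below N A \<Longrightarrow> N \<le> M \<Longrightarrow> depends_below M A"
  unfolding depends_below_def by (meson le_trans less_le_trans)

lemma depends_belowD:
  "depends_below N A \<Longrightarrow> (\<And>n. n < N \<Longrightarrow> \<sigma> n = \<sigma>' n) \<Longrightarrow> (\<And>n. n < N \<Longrightarrow> \<tau> n = \<tau>' n)
    \<Longrightarrow> sub_fm \<sigma> \<tau> A = sub_fm \<sigma>' \<tau>' A"
  unfolding depends_below_def by blast

lemma depends_below_both:
  "depends_below N A \<Longrightarrow> depends_below N' B \<Longrightarrow> \<exists>M. depends_below M A \<and> depends_below M B"
  by (meson depends_below_mono max.cobounded1 max.cobounded2)

lemma finite_dependence: "\<exists>N. depends_below N A"
proof (induction A)
  case (Eq s t)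
  obtain N N' where
    "\<forall>\<sigma> \<sigma>' \<tau> \<tau>'. (\<forall>n<N. \<sigma> n = \<sigma>' n \<and> \<tau> n = \<tau>' n) \<longrightarrow> sub_trm \<sigma> \<tau> s = sub_trm \<sigma>' \<tau>' s"
    "\<forall>\<sigma> \<sigma>' \<tau> \<tau>'. (\<forall>n<N'. \<sigma> n = \<sigma>' n \<and> \<tau> n = \<tau>' n) \<longrightarrow> sub_trm \<sigma> \<tau> t = sub_trm \<sigma>' \<tau>' t"
    using finite_dependence_trm(1) by metis
  then show ?case unfolding depends_below_def by (intro exI[of _ "max N N'"]) (auto simp: less_max_iff_disj)
next
  case (And A B)
  then obtain M where "depends_below M A" "depends_below M B" using depends_below_both by blast
  then show ?case unfolding depends_below_def by (intro exI[of _ M]) auto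
next
  case (Or A B)
  then obtain M where "depends_below M A" "depends_below M B" using depends_below_both by blast
  then show ?case unfolding depends_below_def by (intro exI[of _ M]) auto
next
  case (Imp A B)
  then obtain M where "depends_below M A" "depends_below M B" using depends_below_both by blast
  then show ?case unfolding depends_below_def by (intro exI[of _ M]) auto
next
  case (Neg A)
  then obtain N where "depends_below N A" by blast
  then show ?case unfolding depends_below_def by (intro exI[of _ N]) auto
next
  case (AllN A)
  then obtain N where N: "depends_below N A" by blast
  show ?case unfolding depends_below_def
    by (intro exI[of _ N]) (auto intro!: depends_belowD[OF N], case_tac n, auto)
next
  case (ExN A)
  then obtain N where N: "depends_below N A" by blast
  show ?case unfolding depends_below_def
    by (intro exI[of _ N]) (auto intro!: depends_belowD[OF N], case_tac n, auto)
next
  case (AllF A)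
  then obtain N where N: "depends_below N A" by blast
  show ?case unfolding depends_below_def
    by (intro exI[of _ N]) (auto intro!: depends_belowD[OF N], case_tac n, auto)
next
  case (ExF A)
  then obtain N where N: "depends_below N A" by blast
  show ?case unfolding depends_below_def
    by (intro exI[of _ N]) (auto intro!: depends_belowD[OF N], case_tac n, auto)
qed

lemma finite_dependence_list: "\<exists>N. \<forall>A\<in>set As. depends_below N A"
proof (induction As)
  case (Cons A As)
  then obtain N where N: "\<forall>A\<in>set As. depends_below N A" by blast
  obtain M where M: "depends_below M A" using finite_dependence by blast
  show ?case by (rule exI[of _ "max N M"]) (use N M in \<open>auto intro: depends_below_mono[OF _ max.cobounded1] depends_below_mono[OF _ max.cobounded2]\<close>)
qed simp

lemma wkv_ren [simp]:
  "wkv_trm (ren_trm \<rho> \<phi> t) = wkv_trm t" "wkv_ftr (ren_ftr \<rho> \<phi> u) = wkv_ftr u"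
  by (induction t and u arbitrary: \<rho> and \<rho>) auto

lemma wkv_sub:
  "(\<And>n. wkv_trm (\<sigma> n)) \<Longrightarrow> (\<And>n. wkv_ftr (\<tau> n)) \<Longrightarrow> wkv_trm (sub_trm \<sigma> \<tau> t) = wkv_trm t"
  "(\<And>n. wkv_trm (\<sigma> n)) \<Longrightarrow> (\<And>n. wkv_ftr (\<tau> n)) \<Longrightarrow> wkv_ftr (sub_ftr \<sigma> \<tau> u) = wkv_ftr u"
proof (induction t and u arbitrary: \<sigma> \<tau> and \<sigma> \<tau>)
  case (Lam t)
  show ?case by (auto intro!: Lam.IH simp: Lam.prems) (case_tac n; simp add: Lam.prems)
qed auto

lemma wkv_sub_fm:
  "(\<And>n. wkv_trm (\<sigma> n)) \<Longrightarrow> (\<And>n. wkv_ftr (\<tau> n)) \<Longrightarrow> wkv_fm (sub_fm \<sigma> \<tau> A) = wkv_fm A"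
proof (induction A arbitrary: \<sigma> \<tau>)
  case (AllN A)
  show ?case by (auto intro!: AllN.IH simp: AllN.prems) (case_tac n; simp add: AllN.prems)
next
  case (ExN A)
  show ?case by (auto intro!: ExN.IH simp: ExN.prems) (case_tac n; simp add: ExN.prems)
next
  case (AllF A)
  show ?case by (auto intro!: AllF.IH simp: AllF.prems) (case_tac n; simp add: AllF.prems)
next
  case (ExF A)
  show ?case by (auto intro!: ExF.IH simp: ExF.prems) (case_tac n; simp add: ExF.prems)
qed (auto simp: wkv_sub)

lemma wkv_ren_fm [simp]: "wkv_fm (ren_fm \<rho> \<phi> A) = wkv_fm A"
  by (simp add: ren_fm_sub_fm wkv_sub_fm)

section \<open>Derivations as a forcing relation\<close>

text \<open>The eigenvariable condition is built into \<open>liftN\<close> and \<open>liftF\<close>,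
  so weakening needs no renaming.\<close>

lemma nd_weaken: "nd L Ax \<Gamma> A \<Longrightarrow> \<Gamma> \<subseteq> \<Delta> \<Longrightarrow> nd L Ax \<Delta> A"
proof (induction arbitrary: \<Delta> rule: nd.induct)
  case (OrE \<Gamma> A B C)
  then show ?case by (meson nd.OrE insert_mono)
next
  case (ExNE \<Gamma> A C)
  then show ?case by (meson nd.ExNE insert_mono image_mono)
next
  case (ExFE \<Gamma> A C)
  then show ?case by (meson nd.ExFE insert_mono image_mono)
next
  case (AllNI \<Gamma> A)
  then show ?case by (meson nd.AllNI image_mono)
next
  case (AllFI \<Gamma> A)
  then show ?case by (meson nd.AllFI image_mono)
next
  case (ImpI A \<Gamma> B)
  then show ?case by (meson nd.ImpI insert_mono)
next
  case (NegI A \<Gamma> B)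
  then show ?case by (meson nd.NegI insert_mono)
qed (blast intro: nd.intros)+

text \<open>\<open>b\<close> chooses the language: all formulas if it is true, the formulas of WKV
  otherwise. Both systems are thus treated at once.\<close>

locale calculus =
  fixes b :: bool and Ax :: "fm set"
begin

definition Lg :: "fm \<Rightarrow> bool" where "Lg A \<longleftrightarrow> b \<or> wkv_fm A"
definition T :: "trm \<Rightarrow> bool" where "T t \<longleftrightarrow> b \<or> wkv_trm t"
definition U :: "ftr \<Rightarrow> bool" where "U u \<longleftrightarrow> b \<or> wkv_ftr u"

lemma Lg_simps [simp]:
  "Lg (Eq s t) \<longleftrightarrow> T s \<and> T t" "Lg (And A B) \<longleftrightarrow> Lg A \<and> Lg B" "Lg (Or A B) \<longleftrightarrow> Lg A \<and> Lg B"
  "Lg (Imp A B) \<longleftrightarrow> Lg A \<and> Lg B" "Lg (Neg A) \<longleftrightarrow> Lg A" "Lg (AllN A) \<longleftrightarrow> Lg A"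
  "Lg (ExN A) \<longleftrightarrow> Lg A" "Lg (AllF A) \<longleftrightarrow> Lg A" "Lg (ExF A) \<longleftrightarrow> Lg A"
  "Lg (ren_fm \<rho> \<phi> A) \<longleftrightarrow> Lg A" "Lg (liftN A) \<longleftrightarrow> Lg A" "Lg (liftF A) \<longleftrightarrow> Lg A"
  by (auto simp: Lg_def T_def liftN_def liftF_def)

lemma T_simps [simp]:
  "T (NVar n)" "T Zero" "T (App u s) \<longleftrightarrow> U u \<and> T s" "T s \<Longrightarrow> T t \<Longrightarrow> wkv_const2 c \<Longrightarrow> T (Fn2 c s t)"
  "U (FVar n)" "U (Lam t) \<longleftrightarrow> T t" "wkv_const1 k \<Longrightarrow> U (FConst k)"
  "T (ren_trm \<rho> \<phi> t) \<longleftrightarrow> T t" "U (ren_ftr \<rho> \<phi> u) \<longleftrightarrow> U u"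
  by (auto simp: T_def U_def)

definition ok :: "(nat \<Rightarrow> trm) \<Rightarrow> (nat \<Rightarrow> ftr) \<Rightarrow> bool" where
  "ok \<sigma> \<tau> \<longleftrightarrow> (\<forall>n. T (\<sigma> n)) \<and> (\<forall>n. U (\<tau> n))"

lemma ok_sub [simp]:
  "ok \<sigma> \<tau> \<Longrightarrow> T (sub_trm \<sigma> \<tau> t) \<longleftrightarrow> T t" "ok \<sigma> \<tau> \<Longrightarrow> U (sub_ftr \<sigma> \<tau> u) \<longleftrightarrow> U u"
  "ok \<sigma> \<tau> \<Longrightarrow> Lg (sub_fm \<sigma> \<tau> A) \<longleftrightarrow> Lg A"
  by (auto simp: ok_def T_def U_def Lg_def wkv_sub wkv_sub_fm)

lemma ok_scons [simp]:
  "ok (scons t \<sigma>) \<tau> \<longleftrightarrow> T t \<and> ok \<sigma> \<tau>" "ok \<sigma> (scons u \<tau>) \<longleftrightarrow> U u \<and> ok \<sigma> \<tau>"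
  by (auto simp: ok_def, metis scons.simps(1), metis scons.simps(2), metis scons.elims,
    metis scons.simps(1), metis scons.simps(2), metis scons.elims)

lemma ok_id [simp]: "ok NVar FVar"
  by (auto simp: ok_def)

lemma okD: "ok \<sigma> \<tau> \<Longrightarrow> T (\<sigma> n)" "ok \<sigma> \<tau> \<Longrightarrow> U (\<tau> n)"
  by (auto simp: ok_def)

lemma ok_inst [simp]: "T t \<Longrightarrow> Lg (instN t A) = Lg A" "U u \<Longrightarrow> Lg (instF u A) = Lg A"
  by (simp_all add: instN_def instF_def)

text \<open>Contexts are lists, hence finite, and can be moved into a formula by
  \<open>foldr Imp\<close>.\<close>

definition pv :: "fm list \<Rightarrow> fm \<Rightarrow> bool" where
  "pv \<Gamma> A \<longleftrightarrow> nd {A. Lg A} Ax (set \<Gamma>) A"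

lemma nd_Lg: "nd {A. Lg A} Ax \<Gamma> A \<Longrightarrow> Lg A"
  by (induction rule: nd.induct) auto

lemma pv_Lg: "pv \<Gamma> A \<Longrightarrow> Lg A"
  unfolding pv_def by (rule nd_Lg)

lemma pv_mono: "pv \<Gamma> A \<Longrightarrow> set \<Gamma> \<subseteq> set \<Delta> \<Longrightarrow> pv \<Delta> A"
  unfolding pv_def by (rule nd_weaken)

lemma pv_hyp: "A \<in> set \<Gamma> \<Longrightarrow> Lg A \<Longrightarrow> pv \<Gamma> A"
  unfolding pv_def by (rule nd.assm) auto

lemma pv_ImpI: "pv (A # \<Gamma>) B \<Longrightarrow> Lg A \<Longrightarrow> pv \<Gamma> (Imp A B)"
  unfolding pv_def by (rule nd.ImpI) auto

lemma pv_ImpE: "pv \<Gamma> (Imp A B) \<Longrightarrow> pv \<Gamma> A \<Longrightarrow> pv \<Gamma> B"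
  unfolding pv_def by (rule nd.ImpE)

lemma pv_Imps: "pv (\<Gamma> @ \<Delta>) A \<Longrightarrow> \<forall>B\<in>set \<Gamma>. Lg B \<Longrightarrow> pv \<Delta> (foldr Imp \<Gamma> A)"
proof (induction \<Gamma> arbitrary: \<Delta>)
  case (Cons B \<Gamma>)
  have "pv (\<Gamma> @ B # \<Delta>) A" by (rule pv_mono[OF Cons.prems(1)]) auto
  then have "pv (B # \<Delta>) (foldr Imp \<Gamma> A)" using Cons by auto
  then show ?case using Cons.prems by (auto intro: pv_ImpI)
qed simp

lemma pv_ImpsE: "pv \<Delta> (foldr Imp \<Gamma> A) \<Longrightarrow> \<forall>B\<in>set \<Gamma>. Lg B \<Longrightarrow> pv (\<Gamma> @ \<Delta>) A"
proof (induction \<Gamma> arbitrary: \<Delta>)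
  case (Cons B \<Gamma>)
  have "pv (B # \<Delta>) (Imp B (foldr Imp \<Gamma> A))" by (rule pv_mono) (use Cons.prems in auto)
  then have "pv (B # \<Delta>) (foldr Imp \<Gamma> A)" by (rule pv_ImpE) (use Cons.prems in \<open>auto intro: pv_hyp\<close>)
  then have "pv (\<Gamma> @ B # \<Delta>) A" using Cons by auto
  then show ?case by (rule pv_mono) auto
qed simp

text \<open>The rule \<open>assm\<close> refuses assumptions outside the language. They must be
  dropped before a context is discharged, since \<open>ImpI\<close> refuses them too.\<close>

lemma pv_Lg_context: "pv \<Gamma> A \<Longrightarrow> pv (filter Lg \<Gamma>) A"
proof -
  have "nd {A. Lg A} Ax \<Gamma> A \<Longrightarrow> nd {A. Lg A} Ax {B \<in> \<Gamma>. Lg B} A" for \<Gamma> A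
  proof (induction rule: nd.induct)
    case (OrE \<Gamma> A B C)
    show ?case by (rule nd.OrE[OF OrE.IH(1)])
        (rule nd_weaken[OF OrE.IH(2)], blast, rule nd_weaken[OF OrE.IH(3)], blast)
  next
    case (ExNE \<Gamma> A C)
    show ?case by (rule nd.ExNE[OF ExNE.IH(1)]) (rule nd_weaken[OF ExNE.IH(2)], auto)
  next
    case (ExFE \<Gamma> A C)
    show ?case by (rule nd.ExFE[OF ExFE.IH(1)]) (rule nd_weaken[OF ExFE.IH(2)], auto)
  next
    case (AllNI \<Gamma> A)
    show ?case by (rule nd.AllNI) (rule nd_weaken[OF AllNI.IH(1)], auto)
  next
    case (AllFI \<Gamma> A)
    show ?case by (rule nd.AllFI) (rule nd_weaken[OF AllFI.IH(1)], auto)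
  next
    case (ImpI A \<Gamma> B)
    show ?case by (rule nd.ImpI) (rule nd_weaken[OF ImpI.IH(1)], use ImpI in auto)
  next
    case (NegI A \<Gamma> B)
    show ?case by (rule nd.NegI[where B=B])
      (rule nd_weaken[OF NegI.IH(1)], blast, rule nd_weaken[OF NegI.IH(2)], blast, use NegI in auto)
  qed (blast intro: nd.assm nd.axm nd.AndI nd.AndE1 nd.AndE2 nd.OrI1 nd.OrI2 nd.ImpE nd.NegE
      nd.AllNE nd.ExNI nd.AllFE nd.ExFI)+
  then show "pv \<Gamma> A \<Longrightarrow> pv (filter Lg \<Gamma>) A" unfolding pv_def by auto
qed

lemma pv_AllN_closed: "pv [] A \<Longrightarrow> pv [] ((AllN ^^ N) A)"
  by (induction N) (auto simp: pv_def intro: nd.AllNI)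

lemma pv_AllF_closed: "pv [] A \<Longrightarrow> pv [] ((AllF ^^ N) A)"
  by (induction N) (auto simp: pv_def intro: nd.AllFI)

lemma pv_AllN_inst: "pv \<Gamma> (sub_fm \<sigma> \<tau> (AllN A)) \<Longrightarrow> T t \<Longrightarrow> pv \<Gamma> (sub_fm (scons t \<sigma>) \<tau> A)"
proof -
  assume 1: "pv \<Gamma> (sub_fm \<sigma> \<tau> (AllN A))" and 2: "T t"
  have "pv \<Gamma> (instN t (sub_fm (upN_trm \<sigma>) (upN_ftr \<tau>) A))"
    using 2 pv_Lg[OF 1] nd.AllNE[OF 1[unfolded pv_def sub_fm.simps]] unfolding pv_def by auto
  then show ?thesis by (simp add: instN_sub)
qed

lemma pv_AllF_inst: "pv \<Gamma> (sub_fm \<sigma> \<tau> (AllF A)) \<Longrightarrow> U u \<Longrightarrow> pv \<Gamma> (sub_fm \<sigma> (scons u \<tau>) A)"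
proof -
  assume 1: "pv \<Gamma> (sub_fm \<sigma> \<tau> (AllF A))" and 2: "U u"
  have "pv \<Gamma> (instF u (sub_fm (upF_trm \<sigma>) (upF_ftr \<tau>) A))"
    using 2 pv_Lg[OF 1] nd.AllFE[OF 1[unfolded pv_def sub_fm.simps]] unfolding pv_def by auto
  then show ?thesis by (simp add: instF_sub)
qed

lemma scons_diff:
  "(\<And>n. n \<ge> Suc N \<Longrightarrow> f n = g (n - Suc N)) \<Longrightarrow> n \<ge> N \<Longrightarrow> f n = scons (f N) g (n - N)"
proof (cases "n = N")
  case False
  assume *: "\<And>n. n \<ge> Suc N \<Longrightarrow> f n = g (n - Suc N)" "n \<ge> N"
  with False obtain k where "n = Suc (N + k)" using less_iff_Suc_add[of N n] by auto
  with *(1)[of n] show ?thesis by (simp add: Suc_diff_le)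
qed simp

text \<open>The outermost of the \<open>N\<close> quantifiers binds index \<open>N - 1\<close>, so
  the terms are supplied from the highest index downwards.\<close>

lemma pv_AllN_insts:
  "pv \<Gamma> (sub_fm \<sigma> \<tau> ((AllN ^^ N) A)) \<Longrightarrow> ok \<sigma>' \<tau> \<Longrightarrow> (\<And>n. n \<ge> N \<Longrightarrow> \<sigma>' n = \<sigma> (n - N))
    \<Longrightarrow> pv \<Gamma> (sub_fm \<sigma>' \<tau> A)"
proof (induction N arbitrary: \<sigma>)
  case 0
  then have "\<sigma>' = \<sigma>" by auto
  with 0 show ?case by simp
next
  case (Suc N)
  have "pv \<Gamma> (sub_fm (scons (\<sigma>' N) \<sigma>) \<tau> ((AllN ^^ N) A))"
    by (rule pv_AllN_inst) (use Suc.prems in \<open>auto intro: okD\<close>)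
  then show ?case
    by (rule Suc.IH[OF _ Suc.prems(2) scons_diff[of N \<sigma>' \<sigma>, OF Suc.prems(3)]])
qed

lemma pv_AllF_insts:
  "pv \<Gamma> (sub_fm \<sigma> \<tau> ((AllF ^^ N) A)) \<Longrightarrow> ok \<sigma> \<tau>' \<Longrightarrow> (\<And>n. n \<ge> N \<Longrightarrow> \<tau>' n = \<tau> (n - N))
    \<Longrightarrow> pv \<Gamma> (sub_fm \<sigma> \<tau>' A)"
proof (induction N arbitrary: \<tau>)
  case 0
  then have "\<tau>' = \<tau>" by auto
  with 0 show ?case by simp
next
  case (Suc N)
  have "pv \<Gamma> (sub_fm \<sigma> (scons (\<tau>' N) \<tau>) ((AllF ^^ N) A))"
    by (rule pv_AllF_inst) (use Suc.prems in \<open>auto intro: okD\<close>)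
  then show ?case
    by (rule Suc.IH[OF _ Suc.prems(2) scons_diff[of N \<tau>' \<tau>, OF Suc.prems(3)]])
qed

text \<open>The axioms need not be closed under substitution: a closed derivation is universally closed
  and instantiated again.\<close>

lemma pv_sub_closed:
  assumes "pv [] A" "ok \<sigma> \<tau>"
  shows "pv [] (sub_fm \<sigma> \<tau> A)"
proof -
  obtain N where N: "depends_below N A" using finite_dependence by blast
  have "pv [] (sub_fm NVar FVar ((AllN ^^ N) ((AllF ^^ N) A)))"
    using assms(1) by (simp add: pv_AllN_closed pv_AllF_closed)
  \<comment> \<open>Indices from \<open>N\<close> on do not matter to \<open>A\<close>; they receive
    the values forced on them by removing \<open>N\<close> quantifiers.\<close>
  then have "pv [] (sub_fm (\<lambda>n. if n < N then \<sigma> n else NVar (n - N)) FVar ((AllF ^^ N) A))"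
    by (rule pv_AllN_insts) (use assms(2) in \<open>auto simp: ok_def\<close>)
  then have "pv [] (sub_fm (\<lambda>n. if n < N then \<sigma> n else NVar (n - N)) (\<lambda>n. if n < N then \<tau> n else FVar (n - N)) A)"
    by (rule pv_AllF_insts) (use assms(2) in \<open>auto simp: ok_def\<close>)
  moreover have "sub_fm (\<lambda>n. if n < N then \<sigma> n else NVar (n - N)) (\<lambda>n. if n < N then \<tau> n else FVar (n - N)) A
    = sub_fm \<sigma> \<tau> A"
    by (rule depends_belowD[OF N]) auto
  ultimately show ?thesis by simp
qed

text \<open>Once the context is discharged by implications, this is the closed case.\<close>

lemma pv_sub:
  assumes "pv \<Gamma> A" "ok \<sigma> \<tau>"
  shows "pv (map (sub_fm \<sigma> \<tau>) \<Gamma>) (sub_fm \<sigma> \<tau> A)"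
proof -
  have F: "sub_fm \<sigma> \<tau> (foldr Imp \<Gamma> A) = foldr Imp (map (sub_fm \<sigma> \<tau>) \<Gamma>) (sub_fm \<sigma> \<tau> A)" for \<Gamma>
    by (induction \<Gamma>) auto
  have "pv [] (foldr Imp (filter Lg \<Gamma>) A)"
    by (rule pv_Imps) (use pv_Lg_context[OF assms(1)] in auto)
  from pv_sub_closed[OF this assms(2)]
  have "pv (map (sub_fm \<sigma> \<tau>) (filter Lg \<Gamma>) @ []) (sub_fm \<sigma> \<tau> A)"
    unfolding F by (rule pv_ImpsE) (use assms in auto)
  then show ?thesis by (rule pv_mono) auto
qed

text \<open>Turns an ordinary fresh variable into the eigenvariable 0 that \<open>AllNI\<close> and
  \<open>ExNE\<close> expect: a renaming moves \<open>N\<close> to 0 and shifts every other index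
  up.\<close>

lemma pv_fresh_numvar:
  assumes "pv \<Gamma> (instN (NVar N) A)" "\<forall>B\<in>set \<Gamma>. depends_below N B" "depends_below N A"
  shows "pv (map liftN \<Gamma>) A"
proof -
  define \<sigma> where "\<sigma> = (\<lambda>n. if n = N then NVar 0 else NVar (Suc n))"
  have "pv (map (sub_fm \<sigma> FVar) \<Gamma>) (sub_fm \<sigma> FVar (instN (NVar N) A))"
    by (rule pv_sub[OF assms(1)]) (auto simp: ok_def \<sigma>_def)
  moreover have "sub_fm \<sigma> FVar (instN (NVar N) A) = sub_fm NVar FVar A"
    unfolding sub_instN
    by (rule depends_belowD[OF assms(3)]) (auto simp: \<sigma>_def, case_tac n, auto)
  moreover have "sub_fm \<sigma> FVar B = liftN B" if "B \<in> set \<Gamma>" for B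
    unfolding liftN_def ren_fm_sub_fm using assms(2) that
    by (intro depends_belowD[of N]) (auto simp: \<sigma>_def)
  ultimately show ?thesis by (simp cong: map_cong)
qed

lemma pv_fresh_funvar:
  assumes "pv \<Gamma> (instF (FVar N) A)" "\<forall>B\<in>set \<Gamma>. depends_below N B" "depends_below N A"
  shows "pv (map liftF \<Gamma>) A"
proof -
  define \<tau> where "\<tau> = (\<lambda>n. if n = N then FVar 0 else FVar (Suc n))"
  have "pv (map (sub_fm NVar \<tau>) \<Gamma>) (sub_fm NVar \<tau> (instF (FVar N) A))"
    by (rule pv_sub[OF assms(1)]) (auto simp: ok_def \<tau>_def)
  moreover have "sub_fm NVar \<tau> (instF (FVar N) A) = sub_fm NVar FVar A"
    unfolding sub_instF
    by (rule depends_belowD[OF assms(3)]) (auto simp: \<tau>_def, case_tac n, auto)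
  moreover have "sub_fm NVar \<tau> B = liftF B" if "B \<in> set \<Gamma>" for B
    unfolding liftF_def ren_fm_sub_fm using assms(2) that
    by (intro depends_belowD[of N]) (auto simp: \<tau>_def)
  ultimately show ?thesis by (simp cong: map_cong)
qed

abbreviation ext :: "fm list \<Rightarrow> fm list \<Rightarrow> bool" (infix "\<sqsubseteq>" 50) where
  "\<Gamma> \<sqsubseteq> \<Delta> \<equiv> set \<Gamma> \<subseteq> set \<Delta>"

text \<open>\<open>P\<close> holds locally at \<open>\<Gamma>\<close>: it may be assumed in order to derive a formula from \<open>\<Gamma>\<close>. Disjunctions
  and existential quantifiers are forced locally.\<close>

definition loc :: "fm list \<Rightarrow> (fm list \<Rightarrow> bool) \<Rightarrow> bool" where
  "loc \<Gamma> P \<longleftrightarrow> (\<forall>C. Lg C \<longrightarrow> (\<forall>\<Delta>. \<Gamma> \<sqsubseteq> \<Delta> \<longrightarrow> P \<Delta> \<longrightarrow> pv \<Delta> C) \<longrightarrow> pv \<Gamma> C)"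

lemma locI: "P \<Gamma> \<Longrightarrow> loc \<Gamma> P"
  unfolding loc_def by blast

lemma loc_pvE: "loc \<Gamma> P \<Longrightarrow> Lg C \<Longrightarrow> (\<And>\<Delta>. \<Gamma> \<sqsubseteq> \<Delta> \<Longrightarrow> P \<Delta> \<Longrightarrow> pv \<Delta> C) \<Longrightarrow> pv \<Gamma> C"
  unfolding loc_def by blast

text \<open>Together with \<open>locI\<close> this makes \<open>loc\<close> a monad: witnesses may
  be drawn one after another from nested existence claims.\<close>

lemma loc_bind: "loc \<Gamma> P \<Longrightarrow> (\<And>\<Delta>. \<Gamma> \<sqsubseteq> \<Delta> \<Longrightarrow> P \<Delta> \<Longrightarrow> loc \<Delta> Q) \<Longrightarrow> loc \<Gamma> Q"
  unfolding loc_def by (meson order_trans)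

lemma loc_map: "loc \<Gamma> P \<Longrightarrow> (\<And>\<Delta>. \<Gamma> \<sqsubseteq> \<Delta> \<Longrightarrow> P \<Delta> \<Longrightarrow> Q \<Delta>) \<Longrightarrow> loc \<Gamma> Q"
  unfolding loc_def by blast

text \<open>\<open>loc\<close> at \<open>\<Gamma>\<close> lets one derive any formula of the
  language from \<open>\<Gamma>\<close>; so the additional assumptions of \<open>\<Delta>\<close>
  are moved into that formula as premises of an implication and afterwards taken out again.\<close>

lemma loc_mono:
  assumes "loc \<Gamma> P" "\<Gamma> \<sqsubseteq> \<Delta>" and mono: "\<And>\<Delta> \<Delta>'. P \<Delta> \<Longrightarrow> \<Delta> \<sqsubseteq> \<Delta>' \<Longrightarrow> P \<Delta>'"
  shows "loc \<Delta> P"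
  unfolding loc_def
proof (intro allI impI)
  fix C assume C: "Lg C" "\<forall>\<Delta>'. \<Delta> \<sqsubseteq> \<Delta>' \<longrightarrow> P \<Delta>' \<longrightarrow> pv \<Delta>' C"
  let ?\<Delta> = "filter Lg \<Delta>"
  have "pv \<Gamma> (foldr Imp ?\<Delta> C)"
  proof (rule loc_pvE[OF assms(1)])
    show "Lg (foldr Imp (filter Lg \<Delta>) C)" using C(1) by (induction \<Delta>) auto
    fix \<Delta>' assume \<Delta>': "\<Gamma> \<sqsubseteq> \<Delta>'" "P \<Delta>'"
    have "P (\<Delta> @ \<Delta>')" by (rule mono[OF \<Delta>'(2)]) auto
    then have "pv (\<Delta> @ \<Delta>') C" using C(2) by auto
    then have "pv (?\<Delta> @ \<Delta>') C" by (rule pv_mono[OF pv_Lg_context]) auto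
    then show "pv \<Delta>' (foldr Imp ?\<Delta> C)" by (rule pv_Imps) auto
  qed
  then have "pv (?\<Delta> @ \<Gamma>) C" by (rule pv_ImpsE) auto
  then show "pv \<Delta> C" by (rule pv_mono) (use assms(2) in auto)
qed

lemma fresh_index: "\<exists>N. depends_below N A \<and> depends_below N B \<and> (\<forall>C\<in>set \<Gamma>. depends_below N C)"
  using finite_dependence_list[of "A # B # \<Gamma>"] by auto

lemma depends_below_Imp: "depends_below N A \<Longrightarrow> depends_below N B \<Longrightarrow> depends_below N (Imp A B)"
  unfolding depends_below_def sub_fm.simps fm.inject by blast

lemma depends_below_lift:
  assumes "depends_below N A"
  shows "depends_below (Suc N) (liftN A)" "depends_below (Suc N) (liftF A)"
  unfolding depends_below_def[of "Suc N"] liftN_def liftF_def sub_ren_fm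
  by (auto intro!: depends_belowD[OF assms])

lemma pv_And: "pv \<Gamma> (And A B) \<longleftrightarrow> pv \<Gamma> A \<and> pv \<Gamma> B"
  unfolding pv_def using nd.AndI[of _ _ _ A B] nd.AndE1[of _ _ _ A B] nd.AndE2[of _ _ _ A B] by blast

text \<open>For the converse the single world \<open>A # \<Gamma>\<close> decides.\<close>

lemma pv_Imp:
  assumes "Lg A"
  shows "pv \<Gamma> (Imp A B) \<longleftrightarrow> (\<forall>\<Delta>. \<Gamma> \<sqsubseteq> \<Delta> \<longrightarrow> pv \<Delta> A \<longrightarrow> pv \<Delta> B)"
proof
  assume "pv \<Gamma> (Imp A B)" then show "\<forall>\<Delta>. \<Gamma> \<sqsubseteq> \<Delta> \<longrightarrow> pv \<Delta> A \<longrightarrow> pv \<Delta> B"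
    using pv_ImpE[of _ A B] pv_mono[of \<Gamma> "Imp A B"] by blast
next
  assume "\<forall>\<Delta>. \<Gamma> \<sqsubseteq> \<Delta> \<longrightarrow> pv \<Delta> A \<longrightarrow> pv \<Delta> B"
  then have "pv (A # \<Gamma>) B" using pv_hyp[of A "A # \<Gamma>"] assms by (metis list.set_intros(1) set_subset_Cons)
  then show "pv \<Gamma> (Imp A B)" using assms by (rule pv_ImpI)
qed

text \<open>The syntax has no falsum; absurdity of a context means that every formula of the
  language is derivable in it.\<close>

lemma pv_Neg:
  assumes "Lg A"
  shows "pv \<Gamma> (Neg A) \<longleftrightarrow> (\<forall>\<Delta>. \<Gamma> \<sqsubseteq> \<Delta> \<longrightarrow> pv \<Delta> A \<longrightarrow> (\<forall>C. Lg C \<longrightarrow> pv \<Delta> C))"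
proof
  assume 1: "pv \<Gamma> (Neg A)"
  show "\<forall>\<Delta>. \<Gamma> \<sqsubseteq> \<Delta> \<longrightarrow> pv \<Delta> A \<longrightarrow> (\<forall>C. Lg C \<longrightarrow> pv \<Delta> C)"
  proof (intro allI impI)
    fix \<Delta> C assume "\<Gamma> \<sqsubseteq> \<Delta>" "pv \<Delta> A" "Lg C"
    then show "pv \<Delta> C" using pv_mono[OF 1] unfolding pv_def by (rule_tac nd.NegE[of _ _ _ A]) auto
  qed
next
  assume *: "\<forall>\<Delta>. \<Gamma> \<sqsubseteq> \<Delta> \<longrightarrow> pv \<Delta> A \<longrightarrow> (\<forall>C. Lg C \<longrightarrow> pv \<Delta> C)"
  have "pv (A # \<Gamma>) C" if "Lg C" for C using * pv_hyp[of A "A # \<Gamma>"] assms that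
    by (metis list.set_intros(1) set_subset_Cons)
  then show "pv \<Gamma> (Neg A)" unfolding pv_def using assms by (rule_tac nd.NegI[where B=A]) auto
qed

lemma pv_Or:
  assumes "Lg A" "Lg B"
  shows "pv \<Gamma> (Or A B) \<longleftrightarrow> loc \<Gamma> (\<lambda>\<Delta>. pv \<Delta> A \<or> pv \<Delta> B)"
proof
  assume 1: "pv \<Gamma> (Or A B)"
  show "loc \<Gamma> (\<lambda>\<Delta>. pv \<Delta> A \<or> pv \<Delta> B)"
    unfolding loc_def
  proof (intro allI impI)
    fix C assume C: "Lg C" "\<forall>\<Delta>. \<Gamma> \<sqsubseteq> \<Delta> \<longrightarrow> pv \<Delta> A \<or> pv \<Delta> B \<longrightarrow> pv \<Delta> C"
    have "pv (A # \<Gamma>) C" "pv (B # \<Gamma>) C"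
      using C(2) pv_hyp[of A "A # \<Gamma>"] pv_hyp[of B "B # \<Gamma>"] assms
      by (metis list.set_intros(1) set_subset_Cons)+
    then show "pv \<Gamma> C" using 1 nd.OrE[of _ _ _ A B C] unfolding pv_def by auto
  qed
next
  assume "loc \<Gamma> (\<lambda>\<Delta>. pv \<Delta> A \<or> pv \<Delta> B)"
  then show "pv \<Gamma> (Or A B)"
    by (rule loc_pvE) (use assms nd.OrI1[of _ _ _ A B] nd.OrI2[of _ _ _ B A] in \<open>auto simp: pv_def\<close>)
qed

text \<open>A fresh variable is one of the terms, so the instances derivable in
  \<open>\<Gamma>\<close> itself decide: the domain is constant, and larger contexts do not enter as
  they do for implication.\<close>

lemma pv_AllN: "pv \<Gamma> (AllN A) \<longleftrightarrow> (\<forall>t. T t \<longrightarrow> pv \<Gamma> (instN t A))"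
proof (intro iffI allI impI)
  fix t assume "pv \<Gamma> (AllN A)" "T t"
  then show "pv \<Gamma> (instN t A)" using pv_AllN_inst[of \<Gamma> NVar FVar A t] by (simp add: instN_def)
next
  assume *: "\<forall>t. T t \<longrightarrow> pv \<Gamma> (instN t A)"
  obtain N where N: "depends_below N A" "\<forall>B\<in>set \<Gamma>. depends_below N B"
    using fresh_index[of A A \<Gamma>] by auto
  have "pv (map liftN \<Gamma>) A" by (rule pv_fresh_numvar[of _ N]) (use * N in auto)
  then show "pv \<Gamma> (AllN A)" unfolding pv_def by (auto intro: nd.AllNI)
qed

lemma pv_AllF: "pv \<Gamma> (AllF A) \<longleftrightarrow> (\<forall>t. U t \<longrightarrow> pv \<Gamma> (instF t A))"
proof (intro iffI allI impI)
  fix t assume "pv \<Gamma> (AllF A)" "U t"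
  then show "pv \<Gamma> (instF t A)" using pv_AllF_inst[of \<Gamma> NVar FVar A t] by (simp add: instF_def)
next
  assume *: "\<forall>t. U t \<longrightarrow> pv \<Gamma> (instF t A)"
  obtain N where N: "depends_below N A" "\<forall>B\<in>set \<Gamma>. depends_below N B"
    using fresh_index[of A A \<Gamma>] by auto
  have "pv (map liftF \<Gamma>) A" by (rule pv_fresh_funvar[of _ N]) (use * N in auto)
  then show "pv \<Gamma> (AllF A)" unfolding pv_def by (auto intro: nd.AllFI)
qed

lemma pv_ExN:
  assumes "Lg A"
  shows "pv \<Gamma> (ExN A) \<longleftrightarrow> loc \<Gamma> (\<lambda>\<Delta>. \<exists>t. T t \<and> pv \<Delta> (instN t A))"
proof
  assume 1: "pv \<Gamma> (ExN A)"
  show "loc \<Gamma> (\<lambda>\<Delta>. \<exists>t. T t \<and> pv \<Delta> (instN t A))"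
    unfolding loc_def
  proof (intro allI impI)
    fix C assume C: "Lg C" "\<forall>\<Delta>. \<Gamma> \<sqsubseteq> \<Delta> \<longrightarrow> (\<exists>t. T t \<and> pv \<Delta> (instN t A)) \<longrightarrow> pv \<Delta> C"
    obtain N' where N': "depends_below N' A" "depends_below N' C" "\<forall>B\<in>set \<Gamma>. depends_below N' B"
      using fresh_index[of A C \<Gamma>] by auto
    \<comment> \<open>The lifted conclusion has its variables one higher, hence the
      successor.\<close>
    define N where "N = Suc N'"
    have N: "depends_below N A" "depends_below N (liftN C)" "depends_below N (liftF C)"
        "B \<in> set \<Gamma> \<Longrightarrow> depends_below N B" for B
      unfolding N_def using N' by (auto intro: depends_below_lift depends_below_mono[of N'])
    have "pv (instN (NVar N) A # \<Gamma>) (instN (NVar N) A)" by (rule pv_hyp) (use assms in auto)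
    then have "\<exists>t. T t \<and> pv (instN (NVar N) A # \<Gamma>) (instN t A)"
      by (intro exI[of _ "NVar N"]) simp
    then have "pv (instN (NVar N) A # \<Gamma>) C" using C(2)[rule_format, of "instN (NVar N) A # \<Gamma>"] by auto
    then have "pv \<Gamma> (instN (NVar N) (Imp A (liftN C)))"
      using assms by (simp add: instN_def pv_ImpI)
    then have "pv (map liftN \<Gamma>) (Imp A (liftN C))"
      by (rule pv_fresh_numvar[of _ N]) (use N(4) depends_below_Imp[OF N(1) N(2)] in auto)
    then have "pv (A # map liftN \<Gamma>) (liftN C)"
      by (rule_tac pv_ImpE[OF pv_mono pv_hyp]) (use assms in auto)
    then show "pv \<Gamma> C" using 1 unfolding pv_def by (rule_tac nd.ExNE[of _ _ _ A C]) auto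
  qed
next
  assume "loc \<Gamma> (\<lambda>\<Delta>. \<exists>t. T t \<and> pv \<Delta> (instN t A))"
  then show "pv \<Gamma> (ExN A)"
  proof (rule loc_pvE)
    fix \<Delta> assume "\<exists>t. T t \<and> pv \<Delta> (instN t A)"
    then obtain t where "pv \<Delta> (instN t A)" by blast
    then show "pv \<Delta> (ExN A)" unfolding pv_def by (rule nd.ExNI) (use assms in simp)
  qed (use assms in simp)
qed

lemma pv_ExF:
  assumes "Lg A"
  shows "pv \<Gamma> (ExF A) \<longleftrightarrow> loc \<Gamma> (\<lambda>\<Delta>. \<exists>t. U t \<and> pv \<Delta> (instF t A))"
proof
  assume 1: "pv \<Gamma> (ExF A)"
  show "loc \<Gamma> (\<lambda>\<Delta>. \<exists>t. U t \<and> pv \<Delta> (instF t A))"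
    unfolding loc_def
  proof (intro allI impI)
    fix C assume C: "Lg C" "\<forall>\<Delta>. \<Gamma> \<sqsubseteq> \<Delta> \<longrightarrow> (\<exists>t. U t \<and> pv \<Delta> (instF t A)) \<longrightarrow> pv \<Delta> C"
    obtain N' where N': "depends_below N' A" "depends_below N' C" "\<forall>B\<in>set \<Gamma>. depends_below N' B"
      using fresh_index[of A C \<Gamma>] by auto
    define N where "N = Suc N'"
    have N: "depends_below N A" "depends_below N (liftN C)" "depends_below N (liftF C)"
        "B \<in> set \<Gamma> \<Longrightarrow> depends_below N B" for B
      unfolding N_def using N' by (auto intro: depends_below_lift depends_below_mono[of N'])
    have "pv (instF (FVar N) A # \<Gamma>) (instF (FVar N) A)" by (rule pv_hyp) (use assms in auto)
    then have "\<exists>t. U t \<and> pv (instF (FVar N) A # \<Gamma>) (instF t A)"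
      by (intro exI[of _ "FVar N"]) simp
    then have "pv (instF (FVar N) A # \<Gamma>) C" using C(2)[rule_format, of "instF (FVar N) A # \<Gamma>"] by auto
    then have "pv \<Gamma> (instF (FVar N) (Imp A (liftF C)))"
      using assms by (simp add: instF_def pv_ImpI)
    then have "pv (map liftF \<Gamma>) (Imp A (liftF C))"
      by (rule pv_fresh_funvar[of _ N]) (use N(4) depends_below_Imp[OF N(1) N(3)] in auto)
    then have "pv (A # map liftF \<Gamma>) (liftF C)"
      by (rule_tac pv_ImpE[OF pv_mono pv_hyp]) (use assms in auto)
    then show "pv \<Gamma> C" using 1 unfolding pv_def by (rule_tac nd.ExFE[of _ _ _ A C]) auto
  qed
next
  assume "loc \<Gamma> (\<lambda>\<Delta>. \<exists>t. U t \<and> pv \<Delta> (instF t A))"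
  then show "pv \<Gamma> (ExF A)"
  proof (rule loc_pvE)
    fix \<Delta> assume "\<exists>t. U t \<and> pv \<Delta> (instF t A)"
    then obtain t where "pv \<Delta> (instF t A)" by blast
    then show "pv \<Delta> (ExF A)" unfolding pv_def by (rule nd.ExFI) (use assms in simp)
  qed (use assms in simp)
qed

text \<open>Forcing under an environment: the formula stays fixed and the environment absorbs all
  instances, so the quantifier clauses merely extend environments.\<close>

definition fc :: "fm list \<Rightarrow> (nat \<Rightarrow> trm) \<Rightarrow> (nat \<Rightarrow> ftr) \<Rightarrow> fm \<Rightarrow> bool" where
  "fc \<Gamma> \<sigma> \<tau> A \<longleftrightarrow> pv \<Gamma> (sub_fm \<sigma> \<tau> A)"

definition eq :: "fm list \<Rightarrow> trm \<Rightarrow> trm \<Rightarrow> bool" where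
  "eq \<Gamma> s t \<longleftrightarrow> pv \<Gamma> (Eq s t)"

lemma ok_ren [simp]: "ok \<sigma> \<tau> \<Longrightarrow> ok (\<lambda>n. ren_trm \<rho> \<phi> (\<sigma> n)) (\<lambda>n. ren_ftr \<rho>' \<phi>' (\<tau> n))"
  by (simp add: ok_def)

lemma fc_simps:
  "fc \<Gamma> \<sigma> \<tau> (Eq s t) \<longleftrightarrow> eq \<Gamma> (sub_trm \<sigma> \<tau> s) (sub_trm \<sigma> \<tau> t)"
  "fc \<Gamma> \<sigma> \<tau> (And A B) \<longleftrightarrow> fc \<Gamma> \<sigma> \<tau> A \<and> fc \<Gamma> \<sigma> \<tau> B"
  "ok \<sigma> \<tau> \<Longrightarrow> Lg A \<Longrightarrow> Lg B \<Longrightarrow> fc \<Gamma> \<sigma> \<tau> (Or A B) \<longleftrightarrow> loc \<Gamma> (\<lambda>\<Delta>. fc \<Delta> \<sigma> \<tau> A \<or> fc \<Delta> \<sigma> \<tau> B)"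
  "ok \<sigma> \<tau> \<Longrightarrow> Lg A \<Longrightarrow> fc \<Gamma> \<sigma> \<tau> (Imp A B) \<longleftrightarrow> (\<forall>\<Delta>. \<Gamma> \<sqsubseteq> \<Delta> \<longrightarrow> fc \<Delta> \<sigma> \<tau> A \<longrightarrow> fc \<Delta> \<sigma> \<tau> B)"
  "ok \<sigma> \<tau> \<Longrightarrow> Lg A \<Longrightarrow> fc \<Gamma> \<sigma> \<tau> (Neg A) \<longleftrightarrow>
     (\<forall>\<Delta>. \<Gamma> \<sqsubseteq> \<Delta> \<longrightarrow> fc \<Delta> \<sigma> \<tau> A \<longrightarrow> (\<forall>C. Lg C \<longrightarrow> pv \<Delta> C))"
  "fc \<Gamma> \<sigma> \<tau> (AllN A) \<longleftrightarrow> (\<forall>t. T t \<longrightarrow> fc \<Gamma> (scons t \<sigma>) \<tau> A)"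
  "fc \<Gamma> \<sigma> \<tau> (AllF A) \<longleftrightarrow> (\<forall>u. U u \<longrightarrow> fc \<Gamma> \<sigma> (scons u \<tau>) A)"
  "ok \<sigma> \<tau> \<Longrightarrow> Lg A \<Longrightarrow> fc \<Gamma> \<sigma> \<tau> (ExN A) \<longleftrightarrow> loc \<Gamma> (\<lambda>\<Delta>. \<exists>t. T t \<and> fc \<Delta> (scons t \<sigma>) \<tau> A)"
  "ok \<sigma> \<tau> \<Longrightarrow> Lg A \<Longrightarrow> fc \<Gamma> \<sigma> \<tau> (ExF A) \<longleftrightarrow> loc \<Gamma> (\<lambda>\<Delta>. \<exists>u. U u \<and> fc \<Delta> \<sigma> (scons u \<tau>) A)"
  by (simp_all add: fc_def eq_def pv_And pv_Imp pv_Neg pv_Or pv_AllN pv_AllF pv_ExN pv_ExF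
      instN_sub instF_sub)

lemma fc_sub: "fc \<Gamma> \<sigma> \<tau> (sub_fm \<sigma>' \<tau>' A) \<longleftrightarrow> fc \<Gamma> (\<lambda>n. sub_trm \<sigma> \<tau> (\<sigma>' n)) (\<lambda>n. sub_ftr \<sigma> \<tau> (\<tau>' n)) A"
  by (simp add: fc_def sub_fm_sub_fm)

lemma fc_ren: "fc \<Gamma> \<sigma> \<tau> (ren_fm \<rho> \<phi> A) \<longleftrightarrow> fc \<Gamma> (\<lambda>n. \<sigma> (\<rho> n)) (\<lambda>n. \<tau> (\<phi> n)) A"
  by (simp add: fc_def sub_ren_fm)

lemma fc_mono: "fc \<Gamma> \<sigma> \<tau> A \<Longrightarrow> \<Gamma> \<sqsubseteq> \<Delta> \<Longrightarrow> fc \<Delta> \<sigma> \<tau> A"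
  unfolding fc_def by (rule pv_mono)

lemma eq_mono: "eq \<Gamma> s t \<Longrightarrow> \<Gamma> \<sqsubseteq> \<Delta> \<Longrightarrow> eq \<Delta> s t"
  unfolding eq_def by (rule pv_mono)

lemma fc_locE: "loc \<Gamma> P \<Longrightarrow> ok \<sigma> \<tau> \<Longrightarrow> Lg A \<Longrightarrow> (\<And>\<Delta>. \<Gamma> \<sqsubseteq> \<Delta> \<Longrightarrow> P \<Delta> \<Longrightarrow> fc \<Delta> \<sigma> \<tau> A) \<Longrightarrow> fc \<Gamma> \<sigma> \<tau> A"
  unfolding fc_def by (erule loc_pvE) auto

lemma eq_locE: "loc \<Gamma> P \<Longrightarrow> T s \<Longrightarrow> T t \<Longrightarrow> (\<And>\<Delta>. \<Gamma> \<sqsubseteq> \<Delta> \<Longrightarrow> P \<Delta> \<Longrightarrow> eq \<Delta> s t) \<Longrightarrow> eq \<Gamma> s t"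
  unfolding eq_def by (erule loc_pvE) auto

text \<open>Axioms are stated for particular variables; closure of derivability under substitution
  carries them to arbitrary terms.\<close>

lemma fc_axiom: "A \<in> Ax \<Longrightarrow> Lg A \<Longrightarrow> ok \<sigma> \<tau> \<Longrightarrow> fc \<Gamma> \<sigma> \<tau> A"
proof -
  assume A: "A \<in> Ax" "Lg A" and *: "ok \<sigma> \<tau>"
  then have "pv [] A" by (auto simp: pv_def intro: nd.axm)
  from pv_sub[OF this *] show "fc \<Gamma> \<sigma> \<tau> A" unfolding fc_def by (rule pv_mono) auto
qed

end

lemma scons_up_ren': "(\<lambda>n. scons x f (up_ren g n)) = scons x (\<lambda>n. f (g n))"
  by (rule ext, case_tac n) auto

lemma sub_scons:
  "(\<lambda>n. sub_trm \<sigma> \<tau> (scons x f n)) = scons (sub_trm \<sigma> \<tau> x) (\<lambda>n. sub_trm \<sigma> \<tau> (f n))"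
  "(\<lambda>n. sub_ftr \<sigma> \<tau> (scons u g n)) = scons (sub_ftr \<sigma> \<tau> u) (\<lambda>n. sub_ftr \<sigma> \<tau> (g n))"
  by (simp_all only: comp_scons)

lemma scons_numeral [simp]: "scons x f (numeral k) = f (pred_numeral k)"
  by (simp add: numeral_eq_Suc)

lemma induction_common:
  "Imp (And (instN Zero A) (AllN (Imp A (sub_fm (scons (S' (NVar 0)) (\<lambda>n. NVar (Suc n))) FVar A))))
     (AllN A) \<in> common_axioms"
  unfolding common_axioms_def Un_iff
  by (rule disjI1, rule disjI2, unfold induction_schema_def, rule CollectI, rule exI[of _ A], rule conjI, rule refl, rule TrueI)

lemma AC00_common:
  "Imp (AllN (ExUniqueN A))
     (ExF (AllN (sub_fm (scons (App (FVar 0) (NVar 0)) NVar) (\<lambda>n. FVar (Suc n)) A))) \<in> common_axioms"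
  unfolding common_axioms_def Un_iff
  by (rule disjI2, unfold AC00_unique_def, rule CollectI, rule exI[of _ A], rule conjI, rule refl, rule TrueI)

section \<open>Equality, induction and unique choice from the common axioms\<close>

locale system = calculus +
  assumes common: "common_axioms \<inter> {A. Lg A} \<subseteq> Ax"
begin

lemma fc_common: "A \<in> common_axioms \<Longrightarrow> Lg A \<Longrightarrow> ok \<sigma> \<tau> \<Longrightarrow> fc \<Gamma> \<sigma> \<tau> A"
  using common by (blast intro: fc_axiom)

lemma wkv_T: "wkv_trm t \<Longrightarrow> T t" "wkv_ftr u \<Longrightarrow> U u" "wkv_fm A \<Longrightarrow> Lg A"
  by (auto simp: T_def U_def Lg_def)

lemma eq_T: "eq \<Gamma> s t \<Longrightarrow> T s" "eq \<Gamma> s t \<Longrightarrow> T t"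
  using pv_Lg[of \<Gamma> "Eq s t"] by (auto simp: eq_def)

lemma eq_refl [simp]: "T t \<Longrightarrow> eq \<Gamma> t t"
  using fc_common[of "Eq (NVar 0) (NVar 0)" "scons t NVar" FVar \<Gamma>]
  by (simp add: common_axioms_def eq_axioms_def fc_simps)

lemma eq_euclid: "eq \<Gamma> r s \<Longrightarrow> eq \<Gamma> r t \<Longrightarrow> eq \<Gamma> s t"
  using fc_common[of "Imp (Eq (NVar 0) (NVar 1)) (Imp (Eq (NVar 0) (NVar 2)) (Eq (NVar 1) (NVar 2)))"
      "scons r (scons s (scons t NVar))" FVar \<Gamma>] eq_T[of \<Gamma> r s] eq_T[of \<Gamma> r t]
  by (simp add: common_axioms_def eq_axioms_def fc_simps) blast

lemma eq_sym: "eq \<Gamma> s t \<Longrightarrow> eq \<Gamma> t s"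
  by (rule eq_euclid[of _ s]) (simp_all add: eq_T)

lemma eq_trans: "eq \<Gamma> r s \<Longrightarrow> eq \<Gamma> s t \<Longrightarrow> eq \<Gamma> r t"
  by (rule eq_euclid[OF eq_sym])

lemma eq_right: "eq \<Gamma> t t' \<Longrightarrow> eq \<Gamma> s t \<longleftrightarrow> eq \<Gamma> s t'"
  by (metis eq_sym eq_trans)

lemma eq_App: "eq \<Gamma> s t \<Longrightarrow> U u \<Longrightarrow> eq \<Gamma> (App u s) (App u t)"
  using fc_common[of "Imp (Eq (NVar 0) (NVar 1)) (Eq (App (FVar 0) (NVar 0)) (App (FVar 0) (NVar 1)))"
      "scons s (scons t NVar)" "scons u FVar" \<Gamma>] eq_T[of \<Gamma> s t]
  by (simp add: common_axioms_def eq_axioms_def fc_simps)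

text \<open>This is the form in which an abstraction appears after an environment has been applied
  to it.\<close>

lemma beta:
  assumes "ok \<sigma> \<tau>" "T t" "T a"
  shows "eq \<Gamma> (App (Lam (sub_trm (upN_trm \<sigma>) (upN_ftr \<tau>) t)) a) (sub_trm (scons a \<sigma>) \<tau> t)"
proof -
  let ?t = "sub_trm (upN_trm \<sigma>) (upN_ftr \<tau>) t"
  have "Eq (App (Lam ?t) a) (sub_trm (scons a NVar) FVar ?t) \<in> common_axioms"
    by (auto simp: common_axioms_def lambda_conversion_def simp del: sub_trm.simps sub_ftr.simps)
  from fc_common[OF this, of NVar FVar \<Gamma>] show ?thesis using assms
    by (simp add: fc_simps sub_sub sub_scons)
qed

lemma beta': "T t \<Longrightarrow> T a \<Longrightarrow> eq \<Gamma> (App (Lam t) a) (sub_trm (scons a NVar) FVar t)"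
  using beta[of NVar FVar t a \<Gamma>] by simp

text \<open>The equality axioms give congruence for the argument of a functor. Abstracting the
  replaced position and lambda-conversion extend it to every term, including positions below a
  \<open>Lam\<close>.\<close>

lemma eq_sub_head:
  assumes "eq \<Gamma> a a'" "ok \<sigma> \<tau>" "T t"
  shows "eq \<Gamma> (sub_trm (scons a \<sigma>) \<tau> t) (sub_trm (scons a' \<sigma>) \<tau> t)"
proof -
  note T = eq_T[OF assms(1)]
  have "eq \<Gamma> (App (Lam (sub_trm (upN_trm \<sigma>) (upN_ftr \<tau>) t)) a) (App (Lam (sub_trm (upN_trm \<sigma>) (upN_ftr \<tau>) t)) a')"
    by (rule eq_App) (use assms in auto)
  with beta[OF assms(2,3) T(1)] beta[OF assms(2,3) T(2)] show ?thesis
    by (blast intro: eq_trans eq_sym)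
qed

lemma eq_Fn2:
  assumes "eq \<Gamma> s s'" "eq \<Gamma> t t'" "T (Fn2 c (NVar 0) (NVar 1))"
  shows "eq \<Gamma> (Fn2 c s t) (Fn2 c s' t')"
proof -
  have T: "T s" "T t" "T s'" "T t'" using assms by (auto intro: eq_T)
  have c: "T (Fn2 c (NVar (Suc 0)) (NVar 0))" using assms(3) by (auto simp: T_def)
  have "eq \<Gamma> (Fn2 c s t) (Fn2 c s' t)"
    using eq_sub_head[OF assms(1), of "scons t NVar" FVar "Fn2 c (NVar 0) (NVar 1)"] assms T by simp
  moreover have "eq \<Gamma> (Fn2 c s' t) (Fn2 c s' t')"
    using eq_sub_head[OF assms(2), of "scons s' NVar" FVar "Fn2 c (NVar (Suc 0)) (NVar 0)"] c T by simp
  ultimately show ?thesis by (rule eq_trans)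
qed

lemma eq_pair: "eq \<Gamma> s s' \<Longrightarrow> eq \<Gamma> t t' \<Longrightarrow> eq \<Gamma> (Fn2 PairJ s t) (Fn2 PairJ s' t')"
  by (rule eq_Fn2) auto

lemma ok_vars [simp]: "ok (\<lambda>n. NVar (f n)) (\<lambda>n. FVar (g n))" "ok NVar (\<lambda>n. FVar (g n))"
    "ok (\<lambda>n. NVar (f n)) FVar"
  by (simp_all add: ok_def)

definition eqf :: "fm list \<Rightarrow> ftr \<Rightarrow> ftr \<Rightarrow> bool" where
  "eqf \<Gamma> u v \<longleftrightarrow> (\<forall>x. T x \<longrightarrow> eq \<Gamma> (App u x) (App v x))"

lemma eqf_refl [simp]: "U u \<Longrightarrow> eqf \<Gamma> u u" by (simp add: eqf_def)
lemma eqf_sym: "eqf \<Gamma> u v \<Longrightarrow> eqf \<Gamma> v u" by (simp add: eqf_def eq_sym)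
lemma eqf_mono: "eqf \<Gamma> u v \<Longrightarrow> \<Gamma> \<sqsubseteq> \<Delta> \<Longrightarrow> eqf \<Delta> u v" by (auto simp: eqf_def intro: eq_mono)

definition eqenv where
  "eqenv \<Gamma> \<sigma> \<tau> \<sigma>' \<tau>' \<longleftrightarrow> (\<forall>n. eq \<Gamma> (\<sigma> n) (\<sigma>' n)) \<and> (\<forall>n. eqf \<Gamma> (\<tau> n) (\<tau>' n))"

lemma eqenv_mono: "eqenv \<Gamma> \<sigma> \<tau> \<sigma>' \<tau>' \<Longrightarrow> \<Gamma> \<sqsubseteq> \<Delta> \<Longrightarrow> eqenv \<Delta> \<sigma> \<tau> \<sigma>' \<tau>'"
  by (auto simp: eqenv_def intro: eq_mono eqf_mono)

lemma eqenv_sym: "eqenv \<Gamma> \<sigma> \<tau> \<sigma>' \<tau>' \<Longrightarrow> eqenv \<Gamma> \<sigma>' \<tau>' \<sigma> \<tau>"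
  by (auto simp: eqenv_def intro: eq_sym eqf_sym)

lemma eqenv_scons:
  "eq \<Gamma> a a' \<Longrightarrow> eqenv \<Gamma> \<sigma> \<tau> \<sigma>' \<tau>' \<Longrightarrow> eqenv \<Gamma> (scons a \<sigma>) \<tau> (scons a' \<sigma>') \<tau>'"
  "eqf \<Gamma> u u' \<Longrightarrow> eqenv \<Gamma> \<sigma> \<tau> \<sigma>' \<tau>' \<Longrightarrow> eqenv \<Gamma> \<sigma> (scons u \<tau>) \<sigma>' (scons u' \<tau>')"
  unfolding eqenv_def by (auto, (case_tac n, auto)+)

lemma eqenv_refl [simp]: "ok \<sigma> \<tau> \<Longrightarrow> eqenv \<Gamma> \<sigma> \<tau> \<sigma> \<tau>"
  by (simp add: eqenv_def okD)

text \<open>In a WKV term every functor occurs applied to an argument, so pointwise equal functors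
  are interchangeable. For a functor that is an argument of a \<open>constF\<close> the equality
  axioms do not state this.\<close>

lemma wkv_cong:
  "wkv_trm t \<Longrightarrow> ok \<sigma> \<tau> \<Longrightarrow> ok \<sigma>' \<tau>' \<Longrightarrow> eqenv \<Gamma> \<sigma> \<tau> \<sigma>' \<tau>' \<Longrightarrow> eq \<Gamma> (sub_trm \<sigma> \<tau> t) (sub_trm \<sigma>' \<tau>' t)"
  "wkv_ftr u \<Longrightarrow> ok \<sigma> \<tau> \<Longrightarrow> ok \<sigma>' \<tau>' \<Longrightarrow> eqenv \<Gamma> \<sigma> \<tau> \<sigma>' \<tau>' \<Longrightarrow> eqf \<Gamma> (sub_ftr \<sigma> \<tau> u) (sub_ftr \<sigma>' \<tau>' u)"
proof (induction t and u arbitrary: \<sigma> \<tau> \<sigma>' \<tau>' and \<sigma> \<tau> \<sigma>' \<tau>')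
  case (Fn2 c s t)
  have "T (Fn2 c (NVar 0) (NVar 1))" using Fn2.prems(1) by (intro wkv_T) auto
  with Fn2 show ?case by (simp add: eq_Fn2)
next
  case (App u s)
  then have "eqf \<Gamma> (sub_ftr \<sigma> \<tau> u) (sub_ftr \<sigma>' \<tau>' u)" "eq \<Gamma> (sub_trm \<sigma> \<tau> s) (sub_trm \<sigma>' \<tau>' s)" by auto
  moreover have "U u" "T s" using App.prems by (auto intro: wkv_T)
  ultimately show ?case using App.prems
    unfolding sub_trm.simps eqf_def by (metis eq_App eq_trans ok_sub(1,2))
next
  case (Lam t)
  have t: "T t" using Lam.prems by (auto intro: wkv_T)
  show ?case unfolding eqf_def sub_ftr.simps
  proof (intro allI impI)
    fix x assume x: "T x"
    have "eq \<Gamma> (sub_trm (scons x \<sigma>) \<tau> t) (sub_trm (scons x \<sigma>') \<tau>' t)"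
      using Lam x by (rule_tac Lam.IH) (auto intro: eqenv_scons)
    with beta[OF Lam.prems(2) t x] beta[OF Lam.prems(3) t x]
    show "eq \<Gamma> (App (Lam (sub_trm (upN_trm \<sigma>) (upN_ftr \<tau>) t)) x)
      (App (Lam (sub_trm (upN_trm \<sigma>') (upN_ftr \<tau>') t)) x)"
      by (blast intro: eq_trans eq_sym)
  qed
qed (auto simp: eqenv_def)

text \<open>Implication and negation use the induction hypothesis for their premise in the opposite
  direction; this is where symmetry of \<open>eqenv\<close> enters.\<close>

lemma fc_cong:
  "wkv_fm A \<Longrightarrow> ok \<sigma> \<tau> \<Longrightarrow> ok \<sigma>' \<tau>' \<Longrightarrow> eqenv \<Gamma> \<sigma> \<tau> \<sigma>' \<tau>' \<Longrightarrow> fc \<Gamma> \<sigma> \<tau> A \<Longrightarrow> fc \<Gamma> \<sigma>' \<tau>' A"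
proof (induction A arbitrary: \<Gamma> \<sigma> \<tau> \<sigma>' \<tau>')
  case (Eq s t)
  then have "eq \<Gamma> (sub_trm \<sigma> \<tau> s) (sub_trm \<sigma>' \<tau>' s)" "eq \<Gamma> (sub_trm \<sigma> \<tau> t) (sub_trm \<sigma>' \<tau>' t)"
    by (auto intro: wkv_cong)
  with Eq.prems(5) show ?case unfolding fc_simps by (blast intro: eq_trans eq_sym)
next
  case (And A B)
  show ?case unfolding fc_simps
    using And.prems(1,5) And.IH(1)[OF _ And.prems(2-4)] And.IH(2)[OF _ And.prems(2-4)]
    by (simp add: fc_simps)
next
  case (Or A B)
  have L: "Lg A" "Lg B" using Or.prems by (auto intro: wkv_T)
  have "loc \<Gamma> (\<lambda>\<Delta>. fc \<Delta> \<sigma> \<tau> A \<or> fc \<Delta> \<sigma> \<tau> B)" using Or.prems L by (simp add: fc_simps)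
  then have "loc \<Gamma> (\<lambda>\<Delta>. fc \<Delta> \<sigma>' \<tau>' A \<or> fc \<Delta> \<sigma>' \<tau>' B)"
  proof (rule loc_map)
    fix \<Delta> assume D: "\<Gamma> \<sqsubseteq> \<Delta>" "fc \<Delta> \<sigma> \<tau> A \<or> fc \<Delta> \<sigma> \<tau> B"
    note E = eqenv_mono[OF Or.prems(4) D(1)]
    show "fc \<Delta> \<sigma>' \<tau>' A \<or> fc \<Delta> \<sigma>' \<tau>' B"
      using D(2) Or.IH(1)[OF _ Or.prems(2,3) E] Or.IH(2)[OF _ Or.prems(2,3) E] Or.prems(1) by auto
  qed
  then show ?case using Or.prems L by (simp add: fc_simps)
next
  case (Imp A B)
  have L: "Lg A" "Lg B" using Imp.prems by (auto intro: wkv_T)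
  show ?case unfolding fc_simps(4)[OF Imp.prems(3) L(1)]
  proof (intro allI impI)
    fix \<Delta> assume D: "\<Gamma> \<sqsubseteq> \<Delta>" "fc \<Delta> \<sigma>' \<tau>' A"
    have E: "eqenv \<Delta> \<sigma> \<tau> \<sigma>' \<tau>'" using Imp.prems(4) D(1) by (rule eqenv_mono)
    have "fc \<Delta> \<sigma> \<tau> A" using Imp.IH(1)[OF _ Imp.prems(3,2) eqenv_sym[OF E] D(2)] Imp.prems(1) by simp
    then have "fc \<Delta> \<sigma> \<tau> B" using Imp.prems L D(1) by (simp add: fc_simps)
    then show "fc \<Delta> \<sigma>' \<tau>' B" using Imp.IH(2)[OF _ Imp.prems(2,3) E] Imp.prems(1) by simp
  qed
next
  case (Neg A)
  have L: "Lg A" using Neg.prems by (auto intro: wkv_T)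
  show ?case unfolding fc_simps(5)[OF Neg.prems(3) L(1)]
  proof (intro allI impI)
    fix \<Delta> C assume D: "\<Gamma> \<sqsubseteq> \<Delta>" "fc \<Delta> \<sigma>' \<tau>' A" and C: "Lg C"
    have E: "eqenv \<Delta> \<sigma> \<tau> \<sigma>' \<tau>'" using Neg.prems(4) D(1) by (rule eqenv_mono)
    have "fc \<Delta> \<sigma> \<tau> A" using Neg.IH(1)[OF _ Neg.prems(3,2) eqenv_sym[OF E] D(2)] Neg.prems(1) by simp
    then show "pv \<Delta> C" using Neg.prems L D(1) C by (simp add: fc_simps)
  qed
next
  case (AllN A)
  have "fc \<Gamma> (scons t \<sigma>') \<tau>' A" if "T t" for t
    using AllN.IH[of "scons t \<sigma>" \<tau> "scons t \<sigma>'" \<tau>' \<Gamma>] AllN.prems that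
    by (simp add: fc_simps eqenv_scons)
  then show ?case by (simp add: fc_simps)
next
  case (AllF A)
  have "fc \<Gamma> \<sigma>' (scons t \<tau>') A" if "U t" for t
    using AllF.IH[of \<sigma> "scons t \<tau>" \<sigma>' "scons t \<tau>'" \<Gamma>] AllF.prems that
    by (simp add: fc_simps eqenv_scons)
  then show ?case by (simp add: fc_simps)
next
  case (ExN A)
  have L: "Lg A" using ExN.prems by (auto intro: wkv_T)
  have "loc \<Gamma> (\<lambda>\<Delta>. \<exists>t. T t \<and> fc \<Delta> (scons t \<sigma>) \<tau> A)" using ExN.prems L by (simp add: fc_simps)
  then have "loc \<Gamma> (\<lambda>\<Delta>. \<exists>t. T t \<and> fc \<Delta> (scons t \<sigma>') \<tau>' A)"
  proof (rule loc_map)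
    fix \<Delta> assume D: "\<Gamma> \<sqsubseteq> \<Delta>" "\<exists>t. T t \<and> fc \<Delta> (scons t \<sigma>) \<tau> A"
    then obtain t where t: "T t" "fc \<Delta> (scons t \<sigma>) \<tau> A" by blast
    have "fc \<Delta> (scons t \<sigma>') \<tau>' A"
      using ExN.IH[OF _ _ _ _ t(2), of "scons t \<sigma>'" \<tau>'] ExN.prems t eqenv_mono[OF ExN.prems(4) D(1)]
      by (simp add: eqenv_scons)
    with t show "\<exists>t. T t \<and> fc \<Delta> (scons t \<sigma>') \<tau>' A" by blast
  qed
  then show ?case using ExN.prems L by (simp add: fc_simps)
next
  case (ExF A)
  have L: "Lg A" using ExF.prems by (auto intro: wkv_T)
  have "loc \<Gamma> (\<lambda>\<Delta>. \<exists>t. U t \<and> fc \<Delta> \<sigma> (scons t \<tau>) A)" using ExF.prems L by (simp add: fc_simps)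
  then have "loc \<Gamma> (\<lambda>\<Delta>. \<exists>t. U t \<and> fc \<Delta> \<sigma>' (scons t \<tau>') A)"
  proof (rule loc_map)
    fix \<Delta> assume D: "\<Gamma> \<sqsubseteq> \<Delta>" "\<exists>t. U t \<and> fc \<Delta> \<sigma> (scons t \<tau>) A"
    then obtain t where t: "U t" "fc \<Delta> \<sigma> (scons t \<tau>) A" by blast
    have "fc \<Delta> \<sigma>' (scons t \<tau>') A"
      using ExF.IH[OF _ _ _ _ t(2), of \<sigma>' "scons t \<tau>'"] ExF.prems t eqenv_mono[OF ExF.prems(4) D(1)]
      by (simp add: eqenv_scons)
    with t show "\<exists>t. U t \<and> fc \<Delta> \<sigma>' (scons t \<tau>') A" by blast
  qed
  then show ?case using ExF.prems L by (simp add: fc_simps)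
qed

text \<open>The step is demanded in all larger contexts because the induction axiom contains it as
  an implication.\<close>

lemma fc_induct:
  assumes "Lg A" "ok \<sigma> \<tau>" "fc \<Gamma> (scons Zero \<sigma>) \<tau> A" "T t"
    and step: "\<And>\<Delta> t. \<Gamma> \<sqsubseteq> \<Delta> \<Longrightarrow> T t \<Longrightarrow> fc \<Delta> (scons t \<sigma>) \<tau> A \<Longrightarrow> fc \<Delta> (scons (S' t) \<sigma>) \<tau> A"
  shows "fc \<Gamma> (scons t \<sigma>) \<tau> A"
proof -
  let ?B = "sub_fm (scons (S' (NVar 0)) (\<lambda>n. NVar (Suc n))) FVar A"
  have "Lg ?B" "Lg (instN Zero A)" using assms(1) by simp_all
  have "fc \<Gamma> \<sigma> \<tau> (Imp (And (instN Zero A) (AllN (Imp A ?B))) (AllN A))"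
    by (rule fc_common[OF induction_common])
      (use assms(1,2) \<open>Lg ?B\<close> \<open>Lg (instN Zero A)\<close> in simp_all)
  moreover have "fc \<Gamma> \<sigma> \<tau> (instN Zero A)"
    using assms(3) by (simp add: fc_sub instN_def sub_scons)
  moreover have "fc \<Gamma> \<sigma> \<tau> (AllN (Imp A ?B))"
    unfolding fc_simps(6)
  proof (intro allI impI)
    fix t assume t: "T t"
    have B: "fc \<Delta> (scons t \<sigma>) \<tau> ?B \<longleftrightarrow> fc \<Delta> (scons (S' t) \<sigma>) \<tau> A" for \<Delta>
      by (simp add: fc_sub sub_scons)
    have "ok (scons t \<sigma>) \<tau>" using assms(2) t by simp
    show "fc \<Gamma> (scons t \<sigma>) \<tau> (Imp A ?B)"
      unfolding fc_simps(4)[OF \<open>ok (scons t \<sigma>) \<tau>\<close> assms(1)] B by (intro allI impI step t)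
  qed
  ultimately have "fc \<Gamma> \<sigma> \<tau> (AllN A)"
    using fc_simps(4)[OF assms(2), of "And (instN Zero A) (AllN (Imp A ?B))" \<Gamma> "AllN A"] assms(1)
      \<open>Lg ?B\<close> \<open>Lg (instN Zero A)\<close> by (simp add: fc_simps(2))
  then show ?thesis using assms(4) by (simp add: fc_simps)
qed

lemma fc_AC:
  assumes A: "Lg A" "ok \<sigma> \<tau>" and ex: "fc \<Gamma> \<sigma> \<tau> (AllN (ExUniqueN A))"
  shows "loc \<Gamma> (\<lambda>\<Delta>. \<exists>\<gamma>. U \<gamma> \<and> (\<forall>x. T x \<longrightarrow> fc \<Delta> (scons (App \<gamma> x) (scons x \<sigma>)) \<tau> A))"
proof -
  let ?B = "sub_fm (scons (App (FVar 0) (NVar 0)) NVar) (\<lambda>n. FVar (Suc n)) A"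
  have L: "Lg ?B" "Lg (ExUniqueN A)" using A(1) by (simp_all add: ExUniqueN_def)
  have "fc \<Gamma> \<sigma> \<tau> (Imp (AllN (ExUniqueN A)) (ExF (AllN ?B)))"
    by (rule fc_common[OF AC00_common]) (use A L in simp_all)
  then have "fc \<Gamma> \<sigma> \<tau> (ExF (AllN ?B))" using ex A L by (simp add: fc_simps)
  then show ?thesis using A L by (simp add: fc_simps fc_sub sub_scons)
qed

text \<open>\<open>ExUniqueN\<close> ties uniqueness to its own witness. Here it is separated from
  existence and asked for in all larger contexts, which makes unique existence easy to
  compose.\<close>

definition uex :: "fm list \<Rightarrow> (fm list \<Rightarrow> trm \<Rightarrow> bool) \<Rightarrow> bool" where
  "uex \<Gamma> P \<longleftrightarrow> loc \<Gamma> (\<lambda>\<Delta>. \<exists>z. T z \<and> P \<Delta> z) \<and>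
     (\<forall>\<Delta> z z'. \<Gamma> \<sqsubseteq> \<Delta> \<longrightarrow> T z \<longrightarrow> T z' \<longrightarrow> P \<Delta> z \<longrightarrow> P \<Delta> z' \<longrightarrow> eq \<Delta> z z')"

text \<open>Two values in a larger context both equal the witness that exists there locally; their
  equation is a formula, so it may be derived under a local assumption.\<close>

lemma fc_ExUniqueN:
  assumes "Lg A" "ok \<sigma> \<tau>"
  shows "fc \<Gamma> \<sigma> \<tau> (ExUniqueN A) \<longleftrightarrow> uex \<Gamma> (\<lambda>\<Delta> z. fc \<Delta> (scons z \<sigma>) \<tau> A)"
proof
  assume "fc \<Gamma> \<sigma> \<tau> (ExUniqueN A)"
  then have *: "loc \<Gamma> (\<lambda>\<Delta>. \<exists>z. T z \<and> fc \<Delta> (scons z \<sigma>) \<tau> A \<and>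
      (\<forall>z'. T z' \<longrightarrow> (\<forall>\<Delta>'. \<Delta> \<sqsubseteq> \<Delta>' \<longrightarrow> fc \<Delta>' (scons z' \<sigma>) \<tau> A \<longrightarrow> eq \<Delta>' z z')))"
    using assms by (simp add: ExUniqueN_def fc_simps fc_ren scons_up_ren' cong: conj_cong imp_cong)
  show "uex \<Gamma> (\<lambda>\<Delta> z. fc \<Delta> (scons z \<sigma>) \<tau> A)"
    unfolding uex_def
  proof (intro conjI allI impI)
    show "loc \<Gamma> (\<lambda>\<Delta>. \<exists>z. T z \<and> fc \<Delta> (scons z \<sigma>) \<tau> A)" by (rule loc_map[OF *]) blast
    fix \<Delta> z z' assume D: "\<Gamma> \<sqsubseteq> \<Delta>" "T z" "T z'" "fc \<Delta> (scons z \<sigma>) \<tau> A" "fc \<Delta> (scons z' \<sigma>) \<tau> A"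
    have "loc \<Delta> (\<lambda>\<Delta>. \<exists>z. T z \<and> fc \<Delta> (scons z \<sigma>) \<tau> A \<and>
      (\<forall>z'. T z' \<longrightarrow> (\<forall>\<Delta>'. \<Delta> \<sqsubseteq> \<Delta>' \<longrightarrow> fc \<Delta>' (scons z' \<sigma>) \<tau> A \<longrightarrow> eq \<Delta>' z z')))"
      by (rule loc_mono[OF * D(1)]) (meson fc_mono order_trans)
    then show "eq \<Delta> z z'"
    proof (rule eq_locE[OF _ D(2,3)])
      fix \<Delta>' assume D': "\<Delta> \<sqsubseteq> \<Delta>'" "\<exists>z. T z \<and> fc \<Delta>' (scons z \<sigma>) \<tau> A \<and>
        (\<forall>z'. T z' \<longrightarrow> (\<forall>\<Delta>''. \<Delta>' \<sqsubseteq> \<Delta>'' \<longrightarrow> fc \<Delta>'' (scons z' \<sigma>) \<tau> A \<longrightarrow> eq \<Delta>'' z z'))"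
      then show "eq \<Delta>' z z'"
        using fc_mono[OF D(4) D'(1)] fc_mono[OF D(5) D'(1)] D(2,3) eq_euclid by blast
    qed
  qed
next
  assume *: "uex \<Gamma> (\<lambda>\<Delta> z. fc \<Delta> (scons z \<sigma>) \<tau> A)"
  then have "loc \<Gamma> (\<lambda>\<Delta>. \<exists>z. T z \<and> fc \<Delta> (scons z \<sigma>) \<tau> A \<and>
      (\<forall>z'. T z' \<longrightarrow> (\<forall>\<Delta>'. \<Delta> \<sqsubseteq> \<Delta>' \<longrightarrow> fc \<Delta>' (scons z' \<sigma>) \<tau> A \<longrightarrow> eq \<Delta>' z z')))"
    unfolding uex_def by (elim conjE loc_map) (meson fc_mono order_trans)
  then show "fc \<Gamma> \<sigma> \<tau> (ExUniqueN A)"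
    using assms by (simp add: ExUniqueN_def fc_simps fc_ren scons_up_ren' cong: conj_cong imp_cong)
qed

lemma choice:
  assumes "Lg A" "ok \<sigma> \<tau>" "\<And>x. T x \<Longrightarrow> uex \<Gamma> (\<lambda>\<Delta> z. fc \<Delta> (scons z (scons x \<sigma>)) \<tau> A)"
  shows "loc \<Gamma> (\<lambda>\<Delta>. \<exists>\<gamma>. U \<gamma> \<and> (\<forall>x. T x \<longrightarrow> fc \<Delta> (scons (App \<gamma> x) (scons x \<sigma>)) \<tau> A))"
  by (rule fc_AC) (use assms in \<open>auto simp: fc_simps fc_ExUniqueN\<close>)

section \<open>Pairs, prolonging a sequence, and primitive recursion from traces\<close>

abbreviation J :: "trm \<Rightarrow> trm \<Rightarrow> trm" where "J \<equiv> Fn2 PairJ"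

lemma T_Fn2D: "T (Fn2 c s t) \<Longrightarrow> T s \<and> T t"
  by (auto simp: T_def)

lemma Suc_inj: "eq \<Gamma> (S' s) (S' t) \<Longrightarrow> eq \<Gamma> s t"
  using fc_common[of "Imp (Eq (S' (NVar 0)) (S' (NVar 1))) (Eq (NVar 0) (NVar 1))"
      "scons s (scons t NVar)" FVar \<Gamma>] eq_T[of \<Gamma> "S' s" "S' t"]
  by (simp add: common_axioms_def arith_axioms_def fc_simps)

lemma Suc_not_Zero: "eq \<Gamma> (S' s) Zero \<Longrightarrow> Lg C \<Longrightarrow> pv \<Gamma> C"
  using fc_common[of "Neg (Eq (S' (NVar 0)) Zero)" "scons s NVar" FVar \<Gamma>] eq_T[of \<Gamma> "S' s" Zero]
  by (simp add: common_axioms_def arith_axioms_def fc_simps)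

lemma Suc_not_Zero_loc: "eq \<Gamma> (S' s) Zero \<Longrightarrow> loc \<Gamma> P"
  unfolding loc_def by (simp add: Suc_not_Zero)

lemma proj_pair:
  assumes "T s" "T t"
  shows "eq \<Gamma> (App (FConst Proj1) (J s t)) s" "eq \<Gamma> (App (FConst Proj2) (J s t)) t"
  using fc_common[of "Eq (App (FConst Proj1) (Fn2 PairJ (NVar 0) (NVar 1))) (NVar 0)"
      "scons s (scons t NVar)" FVar \<Gamma>]
    fc_common[of "Eq (App (FConst Proj2) (Fn2 PairJ (NVar 0) (NVar 1))) (NVar 1)"
      "scons s (scons t NVar)" FVar \<Gamma>] assms
  by (simp_all add: common_axioms_def pairing_axioms_def fc_simps)

lemma pair_inj:
  assumes "eq \<Gamma> (J a c) (J a' c')"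
  shows "eq \<Gamma> a a'" "eq \<Gamma> c c'"
proof -
  have T: "T a" "T c" "T a'" "T c'" using eq_T[OF assms] T_Fn2D by blast+
  have "eq \<Gamma> (App (FConst Proj1) (J a c)) (App (FConst Proj1) (J a' c'))"
    "eq \<Gamma> (App (FConst Proj2) (J a c)) (App (FConst Proj2) (J a' c'))"
    by (rule eq_App[OF assms]; simp)+
  then show "eq \<Gamma> a a'" "eq \<Gamma> c c'"
    using proj_pair[OF T(1,2), of \<Gamma>] proj_pair[OF T(3,4), of \<Gamma>] by (metis eq_trans eq_sym)+
qed

text \<open>An induction whose step exhibits the predecessor directly.\<close>

lemma num_cases:
  assumes "T x"
  shows "loc \<Gamma> (\<lambda>\<Delta>. eq \<Delta> x Zero \<or> (\<exists>y. T y \<and> eq \<Delta> x (S' y)))"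
proof -
  let ?A = "Or (Eq (NVar 0) Zero) (ExN (Eq (NVar 1) (S' (NVar 0))))"
  have A: "fc \<Delta> (scons t NVar) FVar ?A \<longleftrightarrow>
      loc \<Delta> (\<lambda>\<Delta>. eq \<Delta> t Zero \<or> loc \<Delta> (\<lambda>\<Delta>. \<exists>y. T y \<and> eq \<Delta> t (S' y)))" if "T t" for \<Delta> t
    using that by (simp add: fc_simps)
  have "fc \<Gamma> (scons x NVar) FVar ?A"
  proof (rule fc_induct)
    show "fc \<Gamma> (scons Zero NVar) FVar ?A" unfolding A[OF T_simps(2)] by (rule locI) simp
    fix \<Delta> t assume "T t"
    then have "T (S' t)" by simp
    show "fc \<Delta> (scons (S' t) NVar) FVar ?A" unfolding A[OF \<open>T (S' t)\<close>]
      by (intro locI disjI2 exI[of _ t]) (use \<open>T t\<close> in simp)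
  qed (use assms in simp_all)
  then show ?thesis unfolding A[OF assms]
    by (rule loc_bind) (elim disjE, rule locI, blast, elim loc_map, blast)
qed

text \<open>A definition by cases: \<open>num_cases\<close> yields a unique value at each argument,
  and AC00! a function. It prolongs a trace at the front.\<close>

lemma cons_exists:
  assumes a: "T a" and \<beta>: "U \<beta>"
  shows "loc \<Gamma> (\<lambda>\<Delta>. \<exists>\<gamma>. U \<gamma> \<and> eq \<Delta> (App \<gamma> Zero) a \<and> (\<forall>x. T x \<longrightarrow> eq \<Delta> (App \<gamma> (S' x)) (App \<beta> x)))"
proof -
  \<comment> \<open>Index 0 is the value, 1 the argument and 2 the head \<open>a\<close>; below
    \<open>AllN\<close> they are one higher.\<close>
  let ?A = "And (Imp (Eq (NVar 1) Zero) (Eq (NVar 0) (NVar 2)))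
    (AllN (Imp (Eq (NVar 2) (S' (NVar 0))) (Eq (NVar 1) (App (FVar 0) (NVar 0)))))"
  let ?\<sigma> = "scons a NVar" and ?\<tau> = "scons \<beta> FVar"
  have A: "fc \<Delta> (scons z (scons x ?\<sigma>)) ?\<tau> ?A \<longleftrightarrow> (\<forall>\<Delta>'. \<Delta> \<sqsubseteq> \<Delta>' \<longrightarrow> eq \<Delta>' x Zero \<longrightarrow> eq \<Delta>' z a) \<and>
      (\<forall>i. T i \<longrightarrow> (\<forall>\<Delta>'. \<Delta> \<sqsubseteq> \<Delta>' \<longrightarrow> eq \<Delta>' x (S' i) \<longrightarrow> eq \<Delta>' z (App \<beta> i)))"
    if "T x" "T z" for \<Delta> x z
    using that assms by (simp add: fc_simps cong: imp_cong)
  have "loc \<Gamma> (\<lambda>\<Delta>. \<exists>\<gamma>. U \<gamma> \<and> (\<forall>x. T x \<longrightarrow> fc \<Delta> (scons (App \<gamma> x) (scons x ?\<sigma>)) ?\<tau> ?A))"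
  proof (rule choice)
    fix x assume x: "T x"
    show "uex \<Gamma> (\<lambda>\<Delta> z. fc \<Delta> (scons z (scons x ?\<sigma>)) ?\<tau> ?A)"
      unfolding uex_def
    proof (intro conjI allI impI)
      show "loc \<Gamma> (\<lambda>\<Delta>. \<exists>z. T z \<and> fc \<Delta> (scons z (scons x ?\<sigma>)) ?\<tau> ?A)"
        using num_cases[OF x]
      proof (rule loc_map)
        fix \<Delta> assume "eq \<Delta> x Zero \<or> (\<exists>y. T y \<and> eq \<Delta> x (S' y))"
        then show "\<exists>z. T z \<and> fc \<Delta> (scons z (scons x ?\<sigma>)) ?\<tau> ?A"
        proof (elim disjE exE conjE)
          assume e: "eq \<Delta> x Zero"
          have "eq \<Delta>' a (App \<beta> i)" if "T i" "\<Delta> \<sqsubseteq> \<Delta>'" "eq \<Delta>' x (S' i)" for i \<Delta>'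
            using Suc_not_Zero[OF eq_euclid[OF that(3) eq_mono[OF e that(2)]], of "Eq a (App \<beta> i)"]
              that assms by (simp add: eq_def)
          then have "fc \<Delta> (scons a (scons x ?\<sigma>)) ?\<tau> ?A" unfolding A[OF x a] using a by simp
          with a show ?thesis by blast
        next
          fix y assume y: "T y" and e: "eq \<Delta> x (S' y)"
          have "T (App \<beta> y)" using y \<beta> by simp
          have "eq \<Delta>' (App \<beta> y) a" if "\<Delta> \<sqsubseteq> \<Delta>'" "eq \<Delta>' x Zero" for \<Delta>'
            using Suc_not_Zero[OF eq_euclid[OF eq_mono[OF e that(1)] that(2)], of "Eq (App \<beta> y) a"]
              y assms by (simp add: eq_def)
          moreover have "eq \<Delta>' (App \<beta> y) (App \<beta> i)" if "\<Delta> \<sqsubseteq> \<Delta>'" "eq \<Delta>' x (S' i)" for i \<Delta>'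
            by (rule eq_App[OF Suc_inj[OF eq_euclid[OF eq_mono[OF e that(1)] that(2)]] \<beta>])
          ultimately have "fc \<Delta> (scons (App \<beta> y) (scons x ?\<sigma>)) ?\<tau> ?A"
            unfolding A[OF x \<open>T (App \<beta> y)\<close>] by simp
          with \<open>T (App \<beta> y)\<close> show ?thesis by blast
        qed
      qed
      fix \<Delta> z z' assume z: "T z" "T z'"
        and D: "fc \<Delta> (scons z (scons x ?\<sigma>)) ?\<tau> ?A" "fc \<Delta> (scons z' (scons x ?\<sigma>)) ?\<tau> ?A"
      show "eq \<Delta> z z'"
      proof (rule eq_locE[OF num_cases[OF x] z])
        fix \<Delta>' assume D': "\<Delta> \<sqsubseteq> \<Delta>'" "eq \<Delta>' x Zero \<or> (\<exists>y. T y \<and> eq \<Delta>' x (S' y))"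
        show "eq \<Delta>' z z'"
          using D'(2) D[unfolded A[OF x z(1)] A[OF x z(2)]] D'(1) by (metis eq_trans eq_sym)
      qed
    qed
  qed (use assms in simp_all)
  then show ?thesis
  proof (rule loc_map)
    fix \<Delta> assume "\<exists>\<gamma>. U \<gamma> \<and> (\<forall>x. T x \<longrightarrow> fc \<Delta> (scons (App \<gamma> x) (scons x ?\<sigma>)) ?\<tau> ?A)"
    then obtain \<gamma> where \<gamma>: "U \<gamma>" and *: "\<And>x. T x \<Longrightarrow> fc \<Delta> (scons (App \<gamma> x) (scons x ?\<sigma>)) ?\<tau> ?A" by blast
    have T: "T x \<Longrightarrow> T (App \<gamma> x)" for x using \<gamma> by simp
    have "eq \<Delta> (App \<gamma> Zero) a"
      using *[OF T_simps(2)] unfolding A[OF T_simps(2) T[OF T_simps(2)]] by simp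
    moreover have "eq \<Delta> (App \<gamma> (S' x)) (App \<beta> x)" if x: "T x" for x
    proof -
      have S: "T (S' x)" using x by simp
      show ?thesis using *[OF S] x unfolding A[OF S T[OF S]] by (meson S eq_refl order_refl)
    qed
    ultimately show "\<exists>\<gamma>. U \<gamma> \<and> eq \<Delta> (App \<gamma> Zero) a \<and> (\<forall>x. T x \<longrightarrow> eq \<Delta> (App \<gamma> (S' x)) (App \<beta> x))"
      using \<gamma> by blast
  qed
qed

text \<open>\<open>A\<^sub>0\<close> and \<open>A\<^sub>1\<close> are the graphs of the initial
  value and of the step. In both, index 0 is the new value; in \<open>A\<^sub>1\<close> the previous
  value and the argument follow as indices 1 and 2. The remaining indices are parameters.\<close>

context
  fixes \<sigma> \<tau> and A\<^sub>0 A\<^sub>1 :: fm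
  assumes wf: "wkv_fm A\<^sub>0" "wkv_fm A\<^sub>1" "ok \<sigma> \<tau>"
begin

text \<open>A trace of a recursion is a sequence of pairs (argument, value) with descending arguments; once
  the argument zero is reached it is constrained no further.\<close>

definition trace :: "fm list \<Rightarrow> ftr \<Rightarrow> bool" where
  "trace \<Gamma> \<beta> \<longleftrightarrow>
    (\<forall>i. T i \<longrightarrow> (\<forall>v. T v \<longrightarrow> (\<forall>\<Delta>. \<Gamma> \<sqsubseteq> \<Delta> \<longrightarrow> eq \<Delta> (App \<beta> i) (J Zero v) \<longrightarrow> fc \<Delta> (scons v \<sigma>) \<tau> A\<^sub>0))) \<and>
    (\<forall>i. T i \<longrightarrow> (\<forall>k. T k \<longrightarrow> (\<forall>w. T w \<longrightarrow> (\<forall>\<Delta>. \<Gamma> \<sqsubseteq> \<Delta> \<longrightarrow> eq \<Delta> (App \<beta> i) (J (S' k) w) \<longrightarrow>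
      loc \<Delta> (\<lambda>\<Delta>. \<exists>v. T v \<and> eq \<Delta> (App \<beta> (S' i)) (J k v) \<and> fc \<Delta> (scons w (scons v (scons k \<sigma>))) \<tau> A\<^sub>1)))))"

text \<open>The value of the recursion at \<open>y\<close> is \<open>z\<close>. The trace begins
  with the pair in question and runs downwards, so its length need not be recorded.\<close>

definition reach :: "fm list \<Rightarrow> trm \<Rightarrow> trm \<Rightarrow> bool" where
  "reach \<Gamma> y z \<longleftrightarrow> loc \<Gamma> (\<lambda>\<Delta>. \<exists>\<beta>. U \<beta> \<and> eq \<Delta> (App \<beta> Zero) (J y z) \<and> trace \<Delta> \<beta>)"

text \<open>The same relation as a formula, as induction and AC00! require. The shifts by four and
  six step over the bound variables and over \<open>y\<close> and \<open>z\<close> to the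
  parameters.\<close>

definition reach_fm :: fm where
  "reach_fm = ExF (And (Eq (App (FVar 0) Zero) (J (NVar 1) (NVar 0)))
    (And (AllN (AllN (Imp (Eq (App (FVar 0) (NVar 1)) (J Zero (NVar 0)))
            (sub_fm (scons (NVar 0) (\<lambda>n. NVar (Suc (Suc (Suc (Suc n)))))) (\<lambda>n. FVar (Suc n)) A\<^sub>0))))
         (AllN (AllN (AllN (Imp (Eq (App (FVar 0) (NVar 2)) (J (S' (NVar 1)) (NVar 0)))
            (ExN (And (Eq (App (FVar 0) (S' (NVar 3))) (J (NVar 2) (NVar 0)))
                      (sub_fm (scons (NVar 1) (scons (NVar 0) (scons (NVar 2)
                          (\<lambda>n. NVar (Suc (Suc (Suc (Suc (Suc (Suc n))))))))))
                        (\<lambda>n. FVar (Suc n)) A\<^sub>1)))))))))"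

lemma Lg_reach [simp]: "Lg reach_fm"
  using wf by (simp add: reach_fm_def wkv_T)

lemma fc_reach: "T y \<Longrightarrow> T z \<Longrightarrow> fc \<Gamma> (scons z (scons y \<sigma>)) \<tau> reach_fm \<longleftrightarrow> reach \<Gamma> y z"
  using wf by (simp add: reach_fm_def reach_def trace_def fc_simps fc_sub sub_scons wkv_T
      cong: conj_cong imp_cong)

lemma traceD:
  "trace \<Gamma> \<beta> \<Longrightarrow> \<Gamma> \<sqsubseteq> \<Delta> \<Longrightarrow> T i \<Longrightarrow> T v \<Longrightarrow> eq \<Delta> (App \<beta> i) (J Zero v) \<Longrightarrow> fc \<Delta> (scons v \<sigma>) \<tau> A\<^sub>0"
  "trace \<Gamma> \<beta> \<Longrightarrow> \<Gamma> \<sqsubseteq> \<Delta> \<Longrightarrow> T i \<Longrightarrow> T k \<Longrightarrow> T w \<Longrightarrow> eq \<Delta> (App \<beta> i) (J (S' k) w) \<Longrightarrow>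
    loc \<Delta> (\<lambda>\<Delta>. \<exists>v. T v \<and> eq \<Delta> (App \<beta> (S' i)) (J k v) \<and> fc \<Delta> (scons w (scons v (scons k \<sigma>))) \<tau> A\<^sub>1)"
  unfolding trace_def by simp_all

lemma trace_mono: "trace \<Gamma> \<beta> \<Longrightarrow> \<Gamma> \<sqsubseteq> \<Delta> \<Longrightarrow> trace \<Delta> \<beta>"
  unfolding trace_def by (meson order_trans)

lemma reach_mono: "reach \<Gamma> y z \<Longrightarrow> \<Gamma> \<sqsubseteq> \<Delta> \<Longrightarrow> reach \<Delta> y z"
  unfolding reach_def by (erule loc_mono) (auto intro: trace_mono eq_mono)

text \<open>The constant sequence of pairs \<open>(0, z)\<close> is a trace: no argument in it is a
  successor, so the second clause is vacuous.\<close>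

lemma reach_Zero:
  assumes z: "T z"
  shows "reach \<Gamma> Zero z \<longleftrightarrow> fc \<Gamma> (scons z \<sigma>) \<tau> A\<^sub>0"
proof
  assume "reach \<Gamma> Zero z"
  then show "fc \<Gamma> (scons z \<sigma>) \<tau> A\<^sub>0" unfolding reach_def
    by (rule fc_locE) (use wf z traceD(1)[OF _ order_refl T_simps(2) z] in \<open>auto simp: wkv_T\<close>)
next
  assume A: "fc \<Gamma> (scons z \<sigma>) \<tau> A\<^sub>0"
  let ?\<beta> = "Lam (ren_trm Suc id (J Zero z))"
  have \<beta>: "eq \<Delta> (App ?\<beta> i) (J Zero z)" if "T i" for i \<Delta>
    using beta'[of "ren_trm Suc id (J Zero z)" i] that z by simp
  have "trace \<Gamma> ?\<beta>"
    unfolding trace_def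
  proof (intro conjI allI impI)
    fix i v \<Delta> assume *: "T i" "T v" "\<Gamma> \<sqsubseteq> \<Delta>" "eq \<Delta> (App ?\<beta> i) (J Zero v)"
    have "eq \<Delta> z v" using pair_inj(2)[OF eq_euclid[OF \<beta>[OF *(1)] *(4)]] .
    then show "fc \<Delta> (scons v \<sigma>) \<tau> A\<^sub>0"
      by (intro fc_cong[OF wf(1) _ _ _ fc_mono[OF A *(3)]]) (use wf z * in \<open>simp_all add: eqenv_scons\<close>)
  next
    fix i k w \<Delta> assume *: "T i" "T k" "T w" "\<Gamma> \<sqsubseteq> \<Delta>" "eq \<Delta> (App ?\<beta> i) (J (S' k) w)"
    have "eq \<Delta> (S' k) Zero" using pair_inj(1)[OF eq_euclid[OF *(5) \<beta>[OF *(1)]]] .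
    then show "loc \<Delta> (\<lambda>\<Delta>. \<exists>v. T v \<and> eq \<Delta> (App ?\<beta> (S' i)) (J k v) \<and> fc \<Delta> (scons w (scons v (scons k \<sigma>))) \<tau> A\<^sub>1)"
      by (rule Suc_not_Zero_loc)
  qed
  moreover have "U ?\<beta>" using z by simp
  ultimately show "reach \<Gamma> Zero z" unfolding reach_def using \<beta>[OF T_simps(2)] by (intro locI exI[of _ ?\<beta>]) blast
qed

text \<open>Removing the first pair of a trace leaves a trace for \<open>k\<close>; conversely the
  pair \<open>(k + 1, z)\<close> is put in front of one.\<close>

lemma reach_Suc:
  assumes k: "T k" and z: "T z"
  shows "reach \<Gamma> (S' k) z \<longleftrightarrow>
    loc \<Gamma> (\<lambda>\<Delta>. \<exists>v. T v \<and> reach \<Delta> k v \<and> fc \<Delta> (scons z (scons v (scons k \<sigma>))) \<tau> A\<^sub>1)"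
proof
  assume "reach \<Gamma> (S' k) z"
  then show "loc \<Gamma> (\<lambda>\<Delta>. \<exists>v. T v \<and> reach \<Delta> k v \<and> fc \<Delta> (scons z (scons v (scons k \<sigma>))) \<tau> A\<^sub>1)"
    unfolding reach_def[of \<Gamma>]
  proof (rule loc_bind)
    fix \<Delta> assume "\<exists>\<beta>. U \<beta> \<and> eq \<Delta> (App \<beta> Zero) (J (S' k) z) \<and> trace \<Delta> \<beta>"
    then obtain \<beta> where \<beta>: "U \<beta>" "eq \<Delta> (App \<beta> Zero) (J (S' k) z)" and tr: "trace \<Delta> \<beta>" by blast
    have "loc \<Delta> (\<lambda>\<Delta>. \<exists>v. T v \<and> eq \<Delta> (App \<beta> (S' Zero)) (J k v) \<and> fc \<Delta> (scons z (scons v (scons k \<sigma>))) \<tau> A\<^sub>1)"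
      using tr \<beta>(2) k z unfolding trace_def by simp
    then show "loc \<Delta> (\<lambda>\<Delta>. \<exists>v. T v \<and> reach \<Delta> k v \<and> fc \<Delta> (scons z (scons v (scons k \<sigma>))) \<tau> A\<^sub>1)"
    proof (rule loc_map, elim exE conjE)
      fix \<Delta>' v assume D: "\<Delta> \<sqsubseteq> \<Delta>'" "T v" "eq \<Delta>' (App \<beta> (S' Zero)) (J k v)"
        "fc \<Delta>' (scons z (scons v (scons k \<sigma>))) \<tau> A\<^sub>1"
      \<comment> \<open>The tail of the sequence \<open>\<beta>\<close>.\<close>
      let ?g = "App (ren_ftr Suc id \<beta>) (S' (NVar 0))"
      have g: "eq \<Delta> (App (Lam ?g) i) (App \<beta> (S' i))" if "T i" for i \<Delta>
        using beta'[of ?g i \<Delta>] that \<beta>(1) by simp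
      have tr': "trace \<Delta>' \<beta>" using tr D(1) by (rule trace_mono)
      have "trace \<Delta>' (Lam ?g)"
        unfolding trace_def
      proof (intro conjI allI impI)
        fix i v \<Delta> assume *: "T i" "T v" "\<Delta>' \<sqsubseteq> \<Delta>" "eq \<Delta> (App (Lam ?g) i) (J Zero v)"
        have "eq \<Delta> (App \<beta> (S' i)) (J Zero v)" using g[OF *(1)] *(4) by (rule eq_euclid)
        then show "fc \<Delta> (scons v \<sigma>) \<tau> A\<^sub>0" using traceD(1)[OF tr' *(3) _ *(2), of "S' i"] *(1) by simp
      next
        fix i k w \<Delta> assume *: "T i" "T k" "T w" "\<Delta>' \<sqsubseteq> \<Delta>" "eq \<Delta> (App (Lam ?g) i) (J (S' k) w)"
        have "eq \<Delta> (App \<beta> (S' i)) (J (S' k) w)" using g[OF *(1)] *(5) by (rule eq_euclid)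
        then have "loc \<Delta> (\<lambda>\<Delta>. \<exists>v. T v \<and> eq \<Delta> (App \<beta> (S' (S' i))) (J k v) \<and> fc \<Delta> (scons w (scons v (scons k \<sigma>))) \<tau> A\<^sub>1)"
          using traceD(2)[OF tr' *(4) _ *(2,3), of "S' i"] *(1) by simp
        then show "loc \<Delta> (\<lambda>\<Delta>. \<exists>v. T v \<and> eq \<Delta> (App (Lam ?g) (S' i)) (J k v) \<and> fc \<Delta> (scons w (scons v (scons k \<sigma>))) \<tau> A\<^sub>1)"
        proof (rule loc_map, elim exE conjE)
          fix D v assume "T v" "eq D (App \<beta> (S' (S' i))) (J k v)" "fc D (scons w (scons v (scons k \<sigma>))) \<tau> A\<^sub>1"
          moreover have "eq D (App (Lam ?g) (S' i)) (App \<beta> (S' (S' i)))" by (rule g) (use * in simp)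
          ultimately show "\<exists>v. T v \<and> eq D (App (Lam ?g) (S' i)) (J k v) \<and> fc D (scons w (scons v (scons k \<sigma>))) \<tau> A\<^sub>1"
            by (metis eq_trans)
        qed
      qed
      moreover have "eq \<Delta>' (App (Lam ?g) Zero) (J k v)" using g[OF T_simps(2)] D(3) by (rule eq_trans)
      moreover have "U (Lam ?g)" using \<beta>(1) by simp
      ultimately have "reach \<Delta>' k v" unfolding reach_def by (intro locI exI[of _ "Lam ?g"]) blast
      with D show "\<exists>v. T v \<and> reach \<Delta>' k v \<and> fc \<Delta>' (scons z (scons v (scons k \<sigma>))) \<tau> A\<^sub>1" by blast
    qed
  qed
next
  assume "loc \<Gamma> (\<lambda>\<Delta>. \<exists>v. T v \<and> reach \<Delta> k v \<and> fc \<Delta> (scons z (scons v (scons k \<sigma>))) \<tau> A\<^sub>1)"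
  then show "reach \<Gamma> (S' k) z"
    unfolding reach_def[of \<Gamma>]
  proof (rule loc_bind, elim exE conjE)
    fix \<Delta> v assume v: "T v" "reach \<Delta> k v" and R: "fc \<Delta> (scons z (scons v (scons k \<sigma>))) \<tau> A\<^sub>1"
    show "loc \<Delta> (\<lambda>\<Delta>. \<exists>\<beta>. U \<beta> \<and> eq \<Delta> (App \<beta> Zero) (J (S' k) z) \<and> trace \<Delta> \<beta>)"
      using v(2)[unfolded reach_def]
    proof (rule loc_bind, elim exE conjE)
      fix \<Delta>\<^sub>1 \<beta> assume D1: "\<Delta> \<sqsubseteq> \<Delta>\<^sub>1" and \<beta>: "U \<beta>" "eq \<Delta>\<^sub>1 (App \<beta> Zero) (J k v)" and tr: "trace \<Delta>\<^sub>1 \<beta>"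
      have "T (J (S' k) z)" using k z by simp
      from cons_exists[OF this \<beta>(1), of \<Delta>\<^sub>1]
      show "loc \<Delta>\<^sub>1 (\<lambda>\<Delta>. \<exists>\<beta>. U \<beta> \<and> eq \<Delta> (App \<beta> Zero) (J (S' k) z) \<and> trace \<Delta> \<beta>)"
      proof (rule loc_map, elim exE conjE)
        fix \<Delta>\<^sub>2 \<gamma> assume D2: "\<Delta>\<^sub>1 \<sqsubseteq> \<Delta>\<^sub>2" and \<gamma>: "U \<gamma>" "eq \<Delta>\<^sub>2 (App \<gamma> Zero) (J (S' k) z)"
          "\<forall>x. T x \<longrightarrow> eq \<Delta>\<^sub>2 (App \<gamma> (S' x)) (App \<beta> x)"
        have tr2: "trace \<Delta>\<^sub>2 \<beta>" using tr D2 by (rule trace_mono)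
        have \<beta>2: "eq \<Delta>\<^sub>2 (App \<beta> Zero) (J k v)" using \<beta>(2) D2 by (rule eq_mono)
        have R2: "fc \<Delta>\<^sub>2 (scons z (scons v (scons k \<sigma>))) \<tau> A\<^sub>1"
          by (rule fc_mono[OF R]) (use D1 D2 in blast)
        have g0: "eq D (App \<gamma> i) (J (S' k) z)" if "\<Delta>\<^sub>2 \<sqsubseteq> D" "eq D i Zero" for D i
          using eq_App[OF that(2) \<gamma>(1)] eq_mono[OF \<gamma>(2) that(1)] by (rule eq_trans)
        have gS: "eq D (App \<gamma> i) (App \<beta> y)" if "\<Delta>\<^sub>2 \<sqsubseteq> D" "T y" "eq D i (S' y)" for D i y
          using eq_App[OF that(3) \<gamma>(1)] eq_mono[OF \<gamma>(3)[rule_format, OF that(2)] that(1)] by (rule eq_trans)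
        have "trace \<Delta>\<^sub>2 \<gamma>"
          unfolding trace_def
        proof (intro conjI allI impI)
          fix i v \<Delta> assume *: "T i" "T v" "\<Delta>\<^sub>2 \<sqsubseteq> \<Delta>" "eq \<Delta> (App \<gamma> i) (J Zero v)"
          show "fc \<Delta> (scons v \<sigma>) \<tau> A\<^sub>0"
          \<comment> \<open>Position zero holds the new pair, whose argument is a successor; a
            position \<open>S' y\<close> belongs to the old trace at \<open>y\<close>.\<close>
          proof (rule fc_locE[OF num_cases[OF *(1), of \<Delta>]])
            fix D assume D: "\<Delta> \<sqsubseteq> D" "eq D i Zero \<or> (\<exists>y. T y \<and> eq D i (S' y))"
            have sub: "\<Delta>\<^sub>2 \<sqsubseteq> D" using *(3) D(1) by blast
            have e: "eq D (App \<gamma> i) (J Zero v)" using *(4) D(1) by (rule eq_mono)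
            from D(2) show "fc D (scons v \<sigma>) \<tau> A\<^sub>0"
            proof (elim disjE exE conjE)
              assume "eq D i Zero"
              then have "eq D (S' k) Zero" using pair_inj(1)[OF eq_euclid[OF g0[OF sub] e]] by simp
              then show ?thesis unfolding fc_def by (rule Suc_not_Zero) (use wf * in \<open>simp add: wkv_T\<close>)
            next
              fix y assume y: "T y" "eq D i (S' y)"
              have "eq D (App \<beta> y) (J Zero v)" using gS[OF sub y] e by (rule eq_euclid)
              then show ?thesis using tr2 y(1) *(2) sub unfolding trace_def by simp
            qed
          qed (use wf * in \<open>simp_all add: wkv_T\<close>)
        next
          fix i k' w \<Delta> assume *: "T i" "T k'" "T w" "\<Delta>\<^sub>2 \<sqsubseteq> \<Delta>" "eq \<Delta> (App \<gamma> i) (J (S' k') w)"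
          let ?goal = "\<lambda>\<Delta>. \<exists>v. T v \<and> eq \<Delta> (App \<gamma> (S' i)) (J k' v) \<and> fc \<Delta> (scons w (scons v (scons k' \<sigma>))) \<tau> A\<^sub>1"
          show "loc \<Delta> ?goal"
          proof (rule loc_bind[OF num_cases[OF *(1), of \<Delta>]])
            fix D assume D: "\<Delta> \<sqsubseteq> D" "eq D i Zero \<or> (\<exists>y. T y \<and> eq D i (S' y))"
            have sub: "\<Delta>\<^sub>2 \<sqsubseteq> D" using *(4) D(1) by blast
            have e: "eq D (App \<gamma> i) (J (S' k') w)" using *(5) D(1) by (rule eq_mono)
            have g: "eq E (App \<gamma> (S' i)) (App \<beta> i)" if "\<Delta>\<^sub>2 \<sqsubseteq> E" for E
              using eq_mono[OF \<gamma>(3)[rule_format, OF *(1)] that] .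
            from D(2) show "loc D ?goal"
            proof (elim disjE exE conjE)
              assume i: "eq D i Zero"
              note p = eq_euclid[OF g0[OF sub i] e]
              have kk: "eq D k k'" using Suc_inj[OF pair_inj(1)[OF p]] .
              have "eq D (App \<beta> i) (J k v)"
                using eq_App[OF i \<beta>(1)] eq_mono[OF \<beta>2 sub] by (rule eq_trans)
              then have "eq D (App \<beta> i) (J k' v)"
                using eq_pair[OF kk eq_refl[OF v(1)]] by (rule eq_trans)
              with g[OF sub] have "eq D (App \<gamma> (S' i)) (J k' v)" by (rule eq_trans)
              moreover have "fc D (scons w (scons v (scons k' \<sigma>))) \<tau> A\<^sub>1"
                by (rule fc_cong[OF wf(2) _ _ _ fc_mono[OF R2 sub]])
                  (use wf z v k * pair_inj(2)[OF p] kk in \<open>simp_all add: eqenv_scons\<close>)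
              ultimately show ?thesis using v(1) by (intro locI) blast
            next
              fix y assume y: "T y" "eq D i (S' y)"
              have "eq D (App \<beta> y) (J (S' k') w)" using gS[OF sub y] e by (rule eq_euclid)
              then have "loc D (\<lambda>\<Delta>. \<exists>v. T v \<and> eq \<Delta> (App \<beta> (S' y)) (J k' v) \<and> fc \<Delta> (scons w (scons v (scons k' \<sigma>))) \<tau> A\<^sub>1)"
                using tr2 y(1) *(2,3) sub unfolding trace_def by simp
              then show ?thesis
              proof (rule loc_map, elim exE conjE)
                fix E u assume E: "D \<sqsubseteq> E" and u: "T u" "eq E (App \<beta> (S' y)) (J k' u)"
                  "fc E (scons w (scons u (scons k' \<sigma>))) \<tau> A\<^sub>1"
                have "eq E (App \<gamma> (S' i)) (App \<beta> i)" by (rule g) (use sub E in blast)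
                then have "eq E (App \<gamma> (S' i)) (App \<beta> (S' y))"
                  using eq_App[OF eq_mono[OF y(2) E] \<beta>(1)] by (rule eq_trans)
                then have "eq E (App \<gamma> (S' i)) (J k' u)" using u(2) by (rule eq_trans)
                with u show "?goal E" by blast
              qed
            qed
          qed
        qed
        with \<gamma> show "\<exists>\<beta>. U \<beta> \<and> eq \<Delta>\<^sub>2 (App \<beta> Zero) (J (S' k) z) \<and> trace \<Delta>\<^sub>2 \<beta>" by blast
      qed
    qed
  qed
qed

theorem primitive_recursion:
  assumes zero: "uex \<Gamma> (\<lambda>\<Delta> v. fc \<Delta> (scons v \<sigma>) \<tau> A\<^sub>0)"
    and step: "\<And>\<Delta> v y. \<Gamma> \<sqsubseteq> \<Delta> \<Longrightarrow> T v \<Longrightarrow> T y \<Longrightarrow> uex \<Delta> (\<lambda>\<Delta> w. fc \<Delta> (scons w (scons v (scons y \<sigma>))) \<tau> A\<^sub>1)"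
  shows "loc \<Gamma> (\<lambda>\<Delta>. \<exists>\<beta>. U \<beta> \<and> fc \<Delta> (scons (App \<beta> Zero) \<sigma>) \<tau> A\<^sub>0 \<and>
    (\<forall>y. T y \<longrightarrow> fc \<Delta> (scons (App \<beta> (S' y)) (scons (App \<beta> y) (scons y \<sigma>))) \<tau> A\<^sub>1))"
proof -
  \<comment> \<open>The induction axiom applies only to formulas, so unique existence of the value
    is passed through \<open>ExUniqueN\<close>.\<close>
  have R: "fc \<Delta> (scons y \<sigma>) \<tau> (ExUniqueN reach_fm) \<longleftrightarrow> uex \<Delta> (\<lambda>\<Delta>. reach \<Delta> y)" if "T y" for \<Delta> y
    using wf that fc_reach[OF that] by (subst fc_ExUniqueN) (auto simp: uex_def cong: conj_cong)
  have uex: "uex \<Gamma> (\<lambda>\<Delta>. reach \<Delta> y)" if y: "T y" for y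
    unfolding R[OF y, symmetric]
  proof (rule fc_induct[OF _ wf(3) _ y])
    show "fc \<Gamma> (scons Zero \<sigma>) \<tau> (ExUniqueN reach_fm)"
      unfolding R[OF T_simps(2)] using zero by (simp add: uex_def reach_Zero cong: conj_cong)
  next
    fix \<Delta> k assume D: "\<Gamma> \<sqsubseteq> \<Delta>" and k: "T k" and "fc \<Delta> (scons k \<sigma>) \<tau> (ExUniqueN reach_fm)"
    then have IH: "uex \<Delta> (\<lambda>\<Delta>. reach \<Delta> k)" using R by blast
    have S: "T (S' k)" using k by simp
    show "fc \<Delta> (scons (S' k) \<sigma>) \<tau> (ExUniqueN reach_fm)"
      unfolding R[OF S] uex_def
    proof (intro conjI allI impI)
      show "loc \<Delta> (\<lambda>\<Delta>. \<exists>z. T z \<and> reach \<Delta> (S' k) z)"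
        using IH[unfolded uex_def, THEN conjunct1]
      proof (rule loc_bind, elim exE conjE)
        fix \<Delta>' v assume D': "\<Delta> \<sqsubseteq> \<Delta>'" and v: "T v" "reach \<Delta>' k v"
        have "uex \<Delta>' (\<lambda>\<Delta> w. fc \<Delta> (scons w (scons v (scons k \<sigma>))) \<tau> A\<^sub>1)"
          by (rule step[OF _ v(1) k]) (use D D' in blast)
        then have "loc \<Delta>' (\<lambda>\<Delta>. \<exists>w. T w \<and> fc \<Delta> (scons w (scons v (scons k \<sigma>))) \<tau> A\<^sub>1)"
          unfolding uex_def by blast
        then show "loc \<Delta>' (\<lambda>\<Delta>. \<exists>z. T z \<and> reach \<Delta> (S' k) z)"
        proof (rule loc_map, elim exE conjE)
          fix D w assume "\<Delta>' \<sqsubseteq> D" "T w" "fc D (scons w (scons v (scons k \<sigma>))) \<tau> A\<^sub>1"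
          moreover then have "reach D k v" using reach_mono[OF v(2)] by blast
          ultimately have "reach D (S' k) w" unfolding reach_Suc[OF k \<open>T w\<close>] using v(1) by (intro locI) blast
          with \<open>T w\<close> show "\<exists>z. T z \<and> reach D (S' k) z" by blast
        qed
      qed
      fix D z z' assume D': "\<Delta> \<sqsubseteq> D" and z: "T z" "T z'" and r: "reach D (S' k) z" "reach D (S' k) z'"
      show "eq D z z'"
        using r(1)[unfolded reach_Suc[OF k z(1)]]
      proof (rule eq_locE[OF _ z], elim exE conjE)
        fix E v assume E: "D \<sqsubseteq> E" and v: "T v" "reach E k v" "fc E (scons z (scons v (scons k \<sigma>))) \<tau> A\<^sub>1"
        show "eq E z z'"
          using reach_mono[OF r(2) E, unfolded reach_Suc[OF k z(2)]]
        proof (rule eq_locE[OF _ z], elim exE conjE)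
          fix F v' assume F: "E \<sqsubseteq> F" and v': "T v'" "reach F k v'" "fc F (scons z' (scons v' (scons k \<sigma>))) \<tau> A\<^sub>1"
          have sub: "\<Delta> \<sqsubseteq> F" "\<Gamma> \<sqsubseteq> F" using D D' E F by blast+
          have "eq F v v'" using IH sub(1) v(1) v'(1,2) reach_mono[OF v(2) F] unfolding uex_def by blast
          then have "fc F (scons z' (scons v (scons k \<sigma>))) \<tau> A\<^sub>1"
            by (intro fc_cong[OF wf(2) _ _ _ v'(3)]) (use wf z v v' k in \<open>simp_all add: eqenv_scons eq_sym\<close>)
          then show "eq F z z'"
            using step[OF sub(2) v(1) k] fc_mono[OF v(3) F] z unfolding uex_def by blast
        qed
      qed
    qed
  qed (use wf in \<open>simp add: ExUniqueN_def\<close>)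
  have "loc \<Gamma> (\<lambda>\<Delta>. \<exists>\<gamma>. U \<gamma> \<and> (\<forall>x. T x \<longrightarrow> fc \<Delta> (scons (App \<gamma> x) (scons x \<sigma>)) \<tau> reach_fm))"
    by (rule fc_AC) (use wf uex R in \<open>simp_all add: fc_simps(6)\<close>)
  then show ?thesis
  proof (rule loc_map, elim exE conjE)
    fix \<Delta> \<gamma> assume D: "\<Gamma> \<sqsubseteq> \<Delta>" and \<gamma>: "U \<gamma>" and *: "\<forall>x. T x \<longrightarrow> fc \<Delta> (scons (App \<gamma> x) (scons x \<sigma>)) \<tau> reach_fm"
    have T: "T (App \<gamma> x)" if "T x" for x using that \<gamma> by simp
    have r: "reach \<Delta> x (App \<gamma> x)" if "T x" for x
      using * fc_reach[OF that T[OF that]] that by blast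
    have "fc \<Delta> (scons (App \<gamma> Zero) \<sigma>) \<tau> A\<^sub>0"
      using r[OF T_simps(2)] reach_Zero[OF T[OF T_simps(2)]] by blast
    moreover have "fc \<Delta> (scons (App \<gamma> (S' y)) (scons (App \<gamma> y) (scons y \<sigma>))) \<tau> A\<^sub>1" if y: "T y" for y
    proof -
      have S: "T (S' y)" using y by simp
      show ?thesis
        using r[OF S, unfolded reach_Suc[OF y T[OF S]]]
      proof (rule fc_locE, goal_cases)
        case (3 E)
        then obtain v where v: "T v" "reach E y v" "fc E (scons (App \<gamma> (S' y)) (scons v (scons y \<sigma>))) \<tau> A\<^sub>1"
          and E: "\<Delta> \<sqsubseteq> E" by blast
        \<comment> \<open>The successor clause yields only some previous value \<open>v\<close>;
          uniqueness identifies it with the chosen one.\<close>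
        have "eq E v (App \<gamma> y)"
          using uex[OF y] D E v(1,2) T[OF y] reach_mono[OF r[OF y] E] unfolding uex_def by (meson order_trans)
        then show ?case
          by (intro fc_cong[OF wf(2) _ _ _ v(3)]) (use wf v y S \<gamma> in \<open>simp_all add: eqenv_scons\<close>)
      qed (use wf y \<gamma> in \<open>simp_all add: wkv_T\<close>)
    qed
    ultimately show "\<exists>\<beta>. U \<beta> \<and> fc \<Delta> (scons (App \<beta> Zero) \<sigma>) \<tau> A\<^sub>0 \<and>
      (\<forall>y. T y \<longrightarrow> fc \<Delta> (scons (App \<beta> (S' y)) (scons (App \<beta> y) (scons y \<sigma>))) \<tau> A\<^sub>1)"
      using \<gamma> by blast
  qed
qed

end
end

section \<open>Eliminating the constants\<close>

datatype cst = C1 const1 | C2 const2 | CF constF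

text \<open>\<open>Base t\<close> and \<open>Expl t\<close> define a constant by the term \<open>t\<close>, which for \<open>Base\<close> belongs to WKV. The
  arguments are number indices 0, 1 and function index 0. \<open>Rec r t\<^sub>0 t\<^sub>1\<close> defines it by recursion on number
  argument \<open>r\<close>; in \<open>t\<^sub>1\<close> index 0 is the previous value, and the arguments are shifted by one.\<close>

datatype body = Base trm | Expl trm | Rec nat trm trm

text \<open>Bound variables of the original term are found through their levels, which stay valid as
  \<open>d\<close> grows; free variables lie beyond all \<open>d\<close> binders. For a whole term
  \<open>d\<close> starts at 1, index 0 being the value.\<close>

definition idx :: "nat list \<Rightarrow> nat \<Rightarrow> nat \<Rightarrow> nat" where
  "idx e d n = (if n < length e then d - 1 - e ! n else n - length e + d)"

text \<open>\<open>graph D e d m t\<close> says that index 0 is the value of \<open>t\<close>, where \<open>D c\<close> says that index 0 is the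
  value of the constant \<open>c\<close> at the following indices. It is built below \<open>d\<close> number binders and \<open>m\<close>
  function binders. The list \<open>e\<close> locates the variables bound within the original term, as levels (the
  number of binders further out), which do not change on descending. For functors the argument is
  index 1. Indices of \<open>D c\<close> beyond the arguments of \<open>c\<close> are filled arbitrarily, function indices by
  \<open>Succ\<close>.\<close>

primrec graph :: "(cst \<Rightarrow> fm) \<Rightarrow> nat list \<Rightarrow> nat \<Rightarrow> nat \<Rightarrow> trm \<Rightarrow> fm"
  and graphf :: "(cst \<Rightarrow> fm) \<Rightarrow> nat list \<Rightarrow> nat \<Rightarrow> nat \<Rightarrow> ftr \<Rightarrow> fm" where
  "graph D e d m (NVar n) = Eq (NVar 0) (NVar (idx e d n))"
| "graph D e d m Zero = Eq (NVar 0) Zero"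
| "graph D e d m (Fn2 c s t) = ExN (And (graph D e (Suc d) m s) (ExN (And (graph D e (Suc (Suc d)) m t)
     (sub_fm (\<lambda>n. NVar (2 - n)) (\<lambda>_. FConst Succ) (D (C2 c))))))"
| "graph D e d m (FnF c s u) = ExN (And (graph D e (Suc d) m s) (ExF (And
     (AllN (ExN (And (Eq (NVar 0) (App (FVar 0) (NVar 1))) (graphf D e (Suc (Suc (Suc d))) (Suc m) u))))
     (sub_fm (\<lambda>n. NVar (1 - n)) (\<lambda>_. FVar 0) (D (CF c))))))"
| "graph D e d m (App u s) = ExN (And (graph D e (Suc d) m s)
     (ExN (And (Eq (NVar 0) (NVar 2)) (graphf D e (Suc (Suc d)) m u))))"
| "graphf D e d m (FVar n) = Eq (NVar 0) (App (FVar (n + m)) (NVar 1))"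
| "graphf D e d m (FConst c) = sub_fm (\<lambda>n. NVar (min n 1)) (\<lambda>_. FConst Succ) (D (C1 c))"
| "graphf D e d m (Lam t) = graph D ((d - 2) # e) d m t"

text \<open>For a recursion, a function \<open>\<beta>\<close> solves the two equations and the
  value is read off at argument \<open>r\<close>. That argument keeps its place among the
  parameters, but the equations overwrite it by zero and by the running argument.\<close>

primrec graph_body :: "(cst \<Rightarrow> fm) \<Rightarrow> body \<Rightarrow> fm" where
  "graph_body D (Base t) = Eq (NVar 0) (ren_trm Suc id t)"
| "graph_body D (Expl t) = graph D [] 1 0 t"
| "graph_body D (Rec r t\<^sub>0 t\<^sub>1) = ExF (And
     (sub_fm (scons (App (FVar 0) Zero) (\<lambda>n. if n = r then Zero else NVar (Suc n))) (\<lambda>n. FVar (Suc n))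
        (graph D [] 1 0 t\<^sub>0)) (And
     (AllN (sub_fm (scons (App (FVar 0) (S' (NVar 0))) (scons (App (FVar 0) (NVar 0))
           (\<lambda>n. if n = r then NVar 0 else NVar (Suc (Suc n))))) (\<lambda>n. FVar (Suc n)) (graph D [] 1 0 t\<^sub>1)))
     (Eq (NVar 0) (App (FVar 0) (NVar (Suc r))))))"

primrec csts :: "trm \<Rightarrow> cst set" and cstsf :: "ftr \<Rightarrow> cst set" where
  "csts (NVar n) = {}"
| "csts Zero = {}"
| "csts (Fn2 c s t) = insert (C2 c) (csts s \<union> csts t)"
| "csts (FnF c s u) = insert (CF c) (csts s \<union> cstsf u)"
| "csts (App u s) = cstsf u \<union> csts s"
| "cstsf (FVar n) = {}"
| "cstsf (FConst c) = {C1 c}"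
| "cstsf (Lam t) = csts t"

lemma graph_cong:
  "(\<And>c. c \<in> csts t \<Longrightarrow> D c = D' c) \<Longrightarrow> graph D e d m t = graph D' e d m t"
  "(\<And>c. c \<in> cstsf u \<Longrightarrow> D c = D' c) \<Longrightarrow> graphf D e d m u = graphf D' e d m u"
  by (induction t and u arbitrary: e d m and e d m) auto

lemma wkv_graph:
  assumes "\<And>c. wkv_fm (D c)"
  shows "wkv_fm (graph D e d m t)" "wkv_fm (graphf D e d m u)"
  by (induction t and u arbitrary: e d m and e d m) (auto simp: assms wkv_sub_fm)

lemma wkv_scons: "wkv_trm x \<Longrightarrow> (\<And>n. wkv_trm (f n)) \<Longrightarrow> wkv_trm (scons x f n)"
  by (cases n) auto

context calculus
begin

abbreviation argsem :: "(cst \<Rightarrow> fm) \<Rightarrow> fm list \<Rightarrow> (nat \<Rightarrow> trm) \<Rightarrow> (nat \<Rightarrow> ftr) \<Rightarrow> cst \<Rightarrow> trm \<Rightarrow> bool" where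
  "argsem D \<Gamma> \<sigma> \<tau> c z \<equiv> fc \<Gamma> (scons z \<sigma>) \<tau> (D c)"

text \<open>The reading of \<open>graph\<close> under an environment, free of depths and levels. A
  functor passed to a \<open>constF\<close> may contain constants outside the language, so it is
  represented by a \<open>\<gamma>\<close> of the language with the same values.\<close>

primrec val :: "(cst \<Rightarrow> fm) \<Rightarrow> fm list \<Rightarrow> (nat \<Rightarrow> trm) \<Rightarrow> (nat \<Rightarrow> ftr) \<Rightarrow> trm \<Rightarrow> trm \<Rightarrow> bool"
  and valf :: "(cst \<Rightarrow> fm) \<Rightarrow> fm list \<Rightarrow> (nat \<Rightarrow> trm) \<Rightarrow> (nat \<Rightarrow> ftr) \<Rightarrow> ftr \<Rightarrow> trm \<Rightarrow> trm \<Rightarrow> bool" where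
  "val D \<Gamma> \<sigma> \<tau> (NVar n) = (\<lambda>z. eq \<Gamma> z (\<sigma> n))"
| "val D \<Gamma> \<sigma> \<tau> Zero = (\<lambda>z. eq \<Gamma> z Zero)"
| "val D \<Gamma> \<sigma> \<tau> (Fn2 c s t) = (\<lambda>z. loc \<Gamma> (\<lambda>\<Delta>. \<exists>a. T a \<and> val D \<Delta> \<sigma> \<tau> s a \<and> loc \<Delta> (\<lambda>\<Delta>. \<exists>b. T b \<and>
     val D \<Delta> \<sigma> \<tau> t b \<and> argsem D \<Delta> (scons a (\<lambda>_. b)) (\<lambda>_. FConst Succ) (C2 c) z)))"
| "val D \<Gamma> \<sigma> \<tau> (FnF c s u) = (\<lambda>z. loc \<Gamma> (\<lambda>\<Delta>. \<exists>a. T a \<and> val D \<Delta> \<sigma> \<tau> s a \<and> loc \<Delta> (\<lambda>\<Delta>. \<exists>\<gamma>. U \<gamma> \<and>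
     (\<forall>x. T x \<longrightarrow> valf D \<Delta> \<sigma> \<tau> u x (App \<gamma> x)) \<and> argsem D \<Delta> (\<lambda>_. a) (\<lambda>_. \<gamma>) (CF c) z)))"
| "val D \<Gamma> \<sigma> \<tau> (App u s) = (\<lambda>z. loc \<Gamma> (\<lambda>\<Delta>. \<exists>a. T a \<and> val D \<Delta> \<sigma> \<tau> s a \<and> valf D \<Delta> \<sigma> \<tau> u a z))"
| "valf D \<Gamma> \<sigma> \<tau> (FVar n) = (\<lambda>x z. eq \<Gamma> z (App (\<tau> n) x))"
| "valf D \<Gamma> \<sigma> \<tau> (FConst c) = (\<lambda>x z. argsem D \<Gamma> (\<lambda>_. x) (\<lambda>_. FConst Succ) (C1 c) z)"
| "valf D \<Gamma> \<sigma> \<tau> (Lam t) = (\<lambda>x z. val D \<Gamma> (scons x \<sigma>) \<tau> t z)"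

end

context system
begin

lemma ok_const [simp]:
  "ok (\<lambda>n. NVar (f n)) (\<lambda>_. u) \<longleftrightarrow> U u" "ok (\<lambda>_. a) (\<lambda>_. u) \<longleftrightarrow> T a \<and> U u"
  by (auto simp: ok_def)

lemma val_mono:
  "val D \<Gamma> \<sigma> \<tau> t z \<Longrightarrow> \<Gamma> \<sqsubseteq> \<Delta> \<Longrightarrow> val D \<Delta> \<sigma> \<tau> t z"
  "valf D \<Gamma> \<sigma> \<tau> u x z \<Longrightarrow> \<Gamma> \<sqsubseteq> \<Delta> \<Longrightarrow> valf D \<Delta> \<sigma> \<tau> u x z"
proof (induction t and u arbitrary: \<Gamma> \<Delta> \<sigma> z and \<Gamma> \<Delta> \<sigma> x z)
  case (Fn2 c s t)
  define P where "P = (\<lambda>a \<Delta>. \<exists>b. T b \<and> val D \<Delta> \<sigma> \<tau> t b \<and> argsem D \<Delta> (scons a (\<lambda>_. b)) (\<lambda>_. FConst Succ) (C2 c) z)"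
  have P: "P a \<Delta>'" if "P a \<Delta>" "\<Delta> \<sqsubseteq> \<Delta>'" for a \<Delta> \<Delta>'
    using that(1) Fn2.IH(2)[OF _ that(2)] fc_mono[OF _ that(2)] unfolding P_def by blast
  have i: "loc \<Delta>' (P a)" if "loc \<Delta> (P a)" "\<Delta> \<sqsubseteq> \<Delta>'" for a \<Delta> \<Delta>'
    using that P by (rule loc_mono)
  have Q: "\<exists>a. T a \<and> val D \<Delta>' \<sigma> \<tau> s a \<and> loc \<Delta>' (P a)"
    if "\<exists>a. T a \<and> val D \<Delta> \<sigma> \<tau> s a \<and> loc \<Delta> (P a)" "\<Delta> \<sqsubseteq> \<Delta>'" for \<Delta> \<Delta>'
    using that(1) Fn2.IH(1)[OF _ that(2)] i[OF _ that(2)] by blast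
  have Pa: "(\<lambda>\<Delta>. \<exists>b. T b \<and> val D \<Delta> \<sigma> \<tau> t b \<and> argsem D \<Delta> (scons a (\<lambda>_. b)) (\<lambda>_. FConst Succ) (C2 c) z) = P a" for a
    by (simp add: P_def)
  show ?case using Fn2.prems(1) unfolding val.simps Pa
    by (rule loc_mono[OF _ Fn2.prems(2) Q])
next
  case (FnF c s u)
  define P where "P = (\<lambda>a \<Delta>. \<exists>\<gamma>. U \<gamma> \<and> (\<forall>x. T x \<longrightarrow> valf D \<Delta> \<sigma> \<tau> u x (App \<gamma> x)) \<and> argsem D \<Delta> (\<lambda>_. a) (\<lambda>_. \<gamma>) (CF c) z)"
  have P: "P a \<Delta>'" if "P a \<Delta>" "\<Delta> \<sqsubseteq> \<Delta>'" for a \<Delta> \<Delta>'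
    using that(1) FnF.IH(2)[OF _ that(2)] fc_mono[OF _ that(2)] unfolding P_def by blast
  have i: "loc \<Delta>' (P a)" if "loc \<Delta> (P a)" "\<Delta> \<sqsubseteq> \<Delta>'" for a \<Delta> \<Delta>'
    using that P by (rule loc_mono)
  have Q: "\<exists>a. T a \<and> val D \<Delta>' \<sigma> \<tau> s a \<and> loc \<Delta>' (P a)"
    if "\<exists>a. T a \<and> val D \<Delta> \<sigma> \<tau> s a \<and> loc \<Delta> (P a)" "\<Delta> \<sqsubseteq> \<Delta>'" for \<Delta> \<Delta>'
    using that(1) FnF.IH(1)[OF _ that(2)] i[OF _ that(2)] by blast
  have Pa: "(\<lambda>\<Delta>. \<exists>\<gamma>. U \<gamma> \<and> (\<forall>x. T x \<longrightarrow> valf D \<Delta> \<sigma> \<tau> u x (App \<gamma> x)) \<and> argsem D \<Delta> (\<lambda>_. a) (\<lambda>_. \<gamma>) (CF c) z) = P a" for a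
    by (simp add: P_def)
  show ?case using FnF.prems(1) unfolding val.simps Pa
    by (rule loc_mono[OF _ FnF.prems(2) Q])
next
  case (App u s)
  have Q: "\<exists>a. T a \<and> val D \<Delta>' \<sigma> \<tau> s a \<and> valf D \<Delta>' \<sigma> \<tau> u a z"
    if "\<exists>a. T a \<and> val D \<Delta> \<sigma> \<tau> s a \<and> valf D \<Delta> \<sigma> \<tau> u a z" "\<Delta> \<sqsubseteq> \<Delta>'" for \<Delta> \<Delta>'
    using that(1) App.IH(1)[OF _ that(2)] App.IH(2)[OF _ that(2)] by blast
  show ?case using App.prems(1) unfolding val.simps
    by (rule loc_mono[OF _ App.prems(2) Q])
next
  case (Lam t)
  show ?case using Lam.prems unfolding valf.simps by (rule Lam.IH)
qed (auto intro: eq_mono fc_mono)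

lemma val_ren:
  "val D \<Gamma> \<sigma> \<tau> (ren_trm \<rho> \<phi> t) z \<longleftrightarrow> val D \<Gamma> (\<lambda>n. \<sigma> (\<rho> n)) (\<lambda>n. \<tau> (\<phi> n)) t z"
  "valf D \<Gamma> \<sigma> \<tau> (ren_ftr \<rho> \<phi> u) x z \<longleftrightarrow> valf D \<Gamma> (\<lambda>n. \<sigma> (\<rho> n)) (\<lambda>n. \<tau> (\<phi> n)) u x z"
  by (induction t and u arbitrary: \<Gamma> \<sigma> \<rho> z and \<Gamma> \<sigma> \<rho> x z) (simp_all add: scons_up_ren')

lemma idx_Suc: "\<forall>l\<in>set e. l < d \<Longrightarrow> idx e (Suc d) n = Suc (idx e d n)"
  by (auto simp: idx_def Suc_diff_Suc)

lemma loc_cong: "(\<And>\<Delta>. \<Gamma> \<sqsubseteq> \<Delta> \<Longrightarrow> P \<Delta> \<longleftrightarrow> Q \<Delta>) \<Longrightarrow> loc \<Gamma> P \<longleftrightarrow> loc \<Gamma> Q"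
  by (rule iffI; erule loc_map; simp)

context
  fixes D :: "cst \<Rightarrow> fm"
  assumes wkvD: "\<And>c. wkv_fm (D c)"
begin

lemma Lg_graph [simp]: "Lg (graph D e d m t)" "Lg (graphf D e d m u)" "Lg (D c)"
  by (rule wkv_T(3) wkv_graph wkvD)+

text \<open>Levels are invariant, so every subterm sees the same environment however many binders
  the formula has put around it.\<close>

lemma fc_graph:
  "ok \<sigma> \<tau> \<Longrightarrow> \<forall>l\<in>set e. l < d \<Longrightarrow>
    fc \<Gamma> \<sigma> \<tau> (graph D e d m t) \<longleftrightarrow> val D \<Gamma> (\<lambda>n. \<sigma> (idx e d n)) (\<lambda>n. \<tau> (n + m)) t (\<sigma> 0)"
  "ok \<sigma> \<tau> \<Longrightarrow> \<forall>l\<in>set e. l < d \<Longrightarrow> 2 \<le> d \<Longrightarrow>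
    fc \<Gamma> \<sigma> \<tau> (graphf D e d m u) \<longleftrightarrow> valf D \<Gamma> (\<lambda>n. \<sigma> (idx e d n)) (\<lambda>n. \<tau> (n + m)) u (\<sigma> 1) (\<sigma> 0)"
proof (induction t and u arbitrary: \<sigma> \<tau> e d m \<Gamma> and \<sigma> \<tau> e d m \<Gamma>)
  case (Fn2 c s t)
  have [simp]: "idx e (Suc d) n = Suc (idx e d n)" "idx e (Suc (Suc d)) n = Suc (Suc (idx e d n))" for n
    using Fn2.prems(2) by (simp_all add: idx_Suc less_Suc_eq)
  have [simp]: "(\<lambda>n. scons b (scons a \<sigma>) (2 - n)) = scons (\<sigma> 0) (scons a (\<lambda>_. b))" for a b
    by (rule ext, case_tac n rule: nat.exhaust, simp, case_tac x2, simp_all)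
  show ?case using Fn2.prems
    by (simp add: fc_simps fc_sub Fn2.IH less_Suc_eq cong: conj_cong)
next
  case (FnF c s u)
  have [simp]: "idx e (Suc d) n = Suc (idx e d n)" "idx e (Suc (Suc d)) n = Suc (Suc (idx e d n))"
     "idx e (Suc (Suc (Suc d))) n = Suc (Suc (Suc (idx e d n)))" for n
    using FnF.prems(2) by (simp_all add: idx_Suc less_Suc_eq)
  have [simp]: "(\<lambda>n. scons a \<sigma> (Suc 0 - n)) = scons (\<sigma> 0) (\<lambda>_. a)" for a
    by (rule ext, case_tac n, simp_all)
  \<comment> \<open>\<open>graphf\<close> has fixed places for argument and value, so the formula
    introduces a new variable equal to \<open>App \<gamma> x\<close>; congruence for WKV formulas
    removes it.\<close>
  have u: "loc \<Delta> (\<lambda>\<Delta>. \<exists>z. T z \<and> eq \<Delta> z (App \<gamma> x) \<and>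
      valf D \<Delta> (\<lambda>n. \<sigma> (idx e d n)) (\<lambda>n. \<tau> (n + m)) u x z) \<longleftrightarrow>
      valf D \<Delta> (\<lambda>n. \<sigma> (idx e d n)) (\<lambda>n. \<tau> (n + m)) u x (App \<gamma> x)"
    if x: "T x" and a: "T a" and g: "U \<gamma>" for \<Delta> \<gamma> x a
  proof -
    have V: "valf D \<Delta> (\<lambda>n. \<sigma> (idx e d n)) (\<lambda>n. \<tau> (n + m)) u x z \<longleftrightarrow>
        fc \<Delta> (scons z (scons x (scons a \<sigma>))) (scons \<gamma> \<tau>) (graphf D e (Suc (Suc (Suc d))) (Suc m) u)"
      if "T z" for z \<Delta>
      using FnF.IH(2)[of "scons z (scons x (scons a \<sigma>))" "scons \<gamma> \<tau>" e "Suc (Suc (Suc d))"] FnF.prems x a g that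
      by (simp add: less_Suc_eq)
    have T: "T (App \<gamma> x)" using x g by simp
    show ?thesis
    proof
      assume "loc \<Delta> (\<lambda>\<Delta>. \<exists>z. T z \<and> eq \<Delta> z (App \<gamma> x) \<and>
        valf D \<Delta> (\<lambda>n. \<sigma> (idx e d n)) (\<lambda>n. \<tau> (n + m)) u x z)"
      then show "valf D \<Delta> (\<lambda>n. \<sigma> (idx e d n)) (\<lambda>n. \<tau> (n + m)) u x (App \<gamma> x)"
        unfolding V[OF T]
      proof (rule fc_locE, goal_cases)
        case (3 E)
        then obtain z where z: "T z" "eq E z (App \<gamma> x)"
          "fc E (scons z (scons x (scons a \<sigma>))) (scons \<gamma> \<tau>) (graphf D e (Suc (Suc (Suc d))) (Suc m) u)"
          using V by blast
        show ?case
          by (rule fc_cong[OF wkv_graph(2)[OF wkvD] _ _ _ z(3)])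
            (use FnF.prems x a g T z in \<open>simp_all add: eqenv_scons\<close>)
      qed (use FnF.prems x a g T in simp_all)
    next
      assume "valf D \<Delta> (\<lambda>n. \<sigma> (idx e d n)) (\<lambda>n. \<tau> (n + m)) u x (App \<gamma> x)"
      then show "loc \<Delta> (\<lambda>\<Delta>. \<exists>z. T z \<and> eq \<Delta> z (App \<gamma> x) \<and>
        valf D \<Delta> (\<lambda>n. \<sigma> (idx e d n)) (\<lambda>n. \<tau> (n + m)) u x z)"
        by (intro locI exI[of _ "App \<gamma> x"] conjI T eq_refl)
    qed
  qed
  show ?case using FnF.prems
    by (simp add: fc_simps fc_sub FnF.IH less_Suc_eq u cong: conj_cong imp_cong)
next
  case (App u s)
  have [simp]: "idx e (Suc d) n = Suc (idx e d n)" "idx e (Suc (Suc d)) n = Suc (Suc (idx e d n))" for n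
    using App.prems(2) by (simp_all add: idx_Suc less_Suc_eq)
  have T: "T (\<sigma> 0)" using App.prems(1) by (rule okD)
  have d: "2 \<le> Suc (Suc d)" by simp
  have u: "loc \<Delta> (\<lambda>\<Delta>. \<exists>z. T z \<and> eq \<Delta> z (\<sigma> 0) \<and>
      valf D \<Delta> (\<lambda>n. \<sigma> (idx e d n)) (\<lambda>n. \<tau> (n + m)) u a z) \<longleftrightarrow>
      valf D \<Delta> (\<lambda>n. \<sigma> (idx e d n)) (\<lambda>n. \<tau> (n + m)) u a (\<sigma> 0)"
    if a: "T a" for \<Delta> a
  proof -
    have V: "valf D \<Delta> (\<lambda>n. \<sigma> (idx e d n)) (\<lambda>n. \<tau> (n + m)) u a z \<longleftrightarrow>
        fc \<Delta> (scons z (scons a \<sigma>)) \<tau> (graphf D e (Suc (Suc d)) m u)"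
      if "T z" for z \<Delta>
      using App.IH(1)[of "scons z (scons a \<sigma>)" \<tau> e "Suc (Suc d)"] App.prems a that
      by (simp add: less_Suc_eq)
    show ?thesis
    proof
      assume "loc \<Delta> (\<lambda>\<Delta>. \<exists>z. T z \<and> eq \<Delta> z (\<sigma> 0) \<and>
        valf D \<Delta> (\<lambda>n. \<sigma> (idx e d n)) (\<lambda>n. \<tau> (n + m)) u a z)"
      then show "valf D \<Delta> (\<lambda>n. \<sigma> (idx e d n)) (\<lambda>n. \<tau> (n + m)) u a (\<sigma> 0)"
        unfolding V[OF T]
      proof (rule fc_locE, goal_cases)
        case (3 E)
        then obtain z where z: "T z" "eq E z (\<sigma> 0)"
          "fc E (scons z (scons a \<sigma>)) \<tau> (graphf D e (Suc (Suc d)) m u)"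
          using V by blast
        show ?case
          by (rule fc_cong[OF wkv_graph(2)[OF wkvD] _ _ _ z(3)])
            (use App.prems a T z in \<open>simp_all add: eqenv_scons\<close>)
      qed (use App.prems a T in simp_all)
    next
      assume "valf D \<Delta> (\<lambda>n. \<sigma> (idx e d n)) (\<lambda>n. \<tau> (n + m)) u a (\<sigma> 0)"
      then show "loc \<Delta> (\<lambda>\<Delta>. \<exists>z. T z \<and> eq \<Delta> z (\<sigma> 0) \<and>
        valf D \<Delta> (\<lambda>n. \<sigma> (idx e d n)) (\<lambda>n. \<tau> (n + m)) u a z)"
        by (intro locI exI[of _ "\<sigma> 0"] conjI T eq_refl)
    qed
  qed
  show ?case using App.prems
    by (simp add: fc_simps App.IH less_Suc_eq u cong: conj_cong imp_cong)
next
  case (FConst c)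
  have [simp]: "(\<lambda>n. \<sigma> (min n (Suc 0))) = scons (\<sigma> 0) (\<lambda>_. \<sigma> (Suc 0))"
    by (rule ext, case_tac n, simp_all)
  show ?case by (simp add: fc_sub)
next
  case (Lam t)
  \<comment> \<open>Index 1, the argument of the functor, has level \<open>d - 2\<close>; this
    presupposes two binders.\<close>
  have "(\<lambda>n. \<sigma> (idx ((d - 2) # e) d n)) = scons (\<sigma> 1) (\<lambda>n. \<sigma> (idx e d n))"
    using Lam.prems(3) by (intro ext, case_tac n) (auto simp: idx_def numeral_2_eq_2)
  then show ?case using Lam by auto
qed (simp_all add: fc_simps)

end
end

section \<open>Totality, exactness and substitution for the values of terms\<close>

primrec lhs :: "cst \<Rightarrow> trm" where
  "lhs (C1 c) = App (FConst c) (NVar 0)"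
| "lhs (C2 c) = Fn2 c (NVar 0) (NVar 1)"
| "lhs (CF c) = FnF c (NVar 0) (FVar 0)"

context system
begin

lemma uex_eq: "T a \<Longrightarrow> uex \<Gamma> (\<lambda>\<Delta> z. eq \<Delta> z a)"
  unfolding uex_def
  by (intro conjI allI impI locI exI[of _ a] eq_refl) (auto intro: eq_trans eq_sym)

lemma uex_cong: "(\<And>\<Delta> z. \<Gamma> \<sqsubseteq> \<Delta> \<Longrightarrow> T z \<Longrightarrow> P \<Delta> z \<longleftrightarrow> Q \<Delta> z) \<Longrightarrow> uex \<Gamma> P \<longleftrightarrow> uex \<Gamma> Q"
  unfolding uex_def by (intro arg_cong2[of _ _ _ _ "(\<and>)"] loc_cong) (metis, metis)

lemma uexD: "uex \<Gamma> P \<Longrightarrow> \<Gamma> \<sqsubseteq> \<Delta> \<Longrightarrow> T z \<Longrightarrow> T z' \<Longrightarrow> P \<Delta> z \<Longrightarrow> P \<Delta> z' \<Longrightarrow> eq \<Delta> z z'"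
  unfolding uex_def by simp

text \<open>Composition of unique existence: the intermediate object need only be unique up to a
  relation \<open>E\<close> that the final condition respects. For numbers \<open>E\<close> is
  \<open>eq\<close>, for functors \<open>eqf\<close>.\<close>

lemma uex_bind:
  assumes ex: "loc \<Gamma> (\<lambda>\<Delta>. \<exists>a. X a \<and> P \<Delta> a)"
    and un: "\<And>\<Delta> a a'. \<Gamma> \<sqsubseteq> \<Delta> \<Longrightarrow> X a \<Longrightarrow> X a' \<Longrightarrow> P \<Delta> a \<Longrightarrow> P \<Delta> a' \<Longrightarrow> E \<Delta> a a'"
    and Pm: "\<And>\<Delta> \<Delta>' a. P \<Delta> a \<Longrightarrow> \<Delta> \<sqsubseteq> \<Delta>' \<Longrightarrow> P \<Delta>' a"
    and Q: "\<And>\<Delta> a. \<Gamma> \<sqsubseteq> \<Delta> \<Longrightarrow> X a \<Longrightarrow> uex \<Delta> (Q a)"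
    and Qm: "\<And>\<Delta> \<Delta>' a z. Q a \<Delta> z \<Longrightarrow> \<Delta> \<sqsubseteq> \<Delta>' \<Longrightarrow> Q a \<Delta>' z"
    and cong: "\<And>\<Delta> a a' z. \<Gamma> \<sqsubseteq> \<Delta> \<Longrightarrow> X a \<Longrightarrow> X a' \<Longrightarrow> E \<Delta> a a' \<Longrightarrow> T z \<Longrightarrow> Q a \<Delta> z \<Longrightarrow> Q a' \<Delta> z"
  shows "uex \<Gamma> (\<lambda>\<Delta> z. loc \<Delta> (\<lambda>\<Delta>. \<exists>a. X a \<and> P \<Delta> a \<and> Q a \<Delta> z))"
  unfolding uex_def
proof (intro conjI allI impI)
  show "loc \<Gamma> (\<lambda>\<Delta>. \<exists>z. T z \<and> loc \<Delta> (\<lambda>\<Delta>. \<exists>a. X a \<and> P \<Delta> a \<and> Q a \<Delta> z))"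
    using ex
  proof (rule loc_bind, elim exE conjE)
    fix \<Delta> a assume D: "\<Gamma> \<sqsubseteq> \<Delta>" "X a" "P \<Delta> a"
    show "loc \<Delta> (\<lambda>\<Delta>. \<exists>z. T z \<and> loc \<Delta> (\<lambda>\<Delta>. \<exists>a. X a \<and> P \<Delta> a \<and> Q a \<Delta> z))"
      using Q[OF D(1,2), unfolded uex_def, THEN conjunct1]
    proof (rule loc_map, elim exE conjE)
      fix \<Delta>' z assume "\<Delta> \<sqsubseteq> \<Delta>'" "T z" "Q a \<Delta>' z"
      with D Pm[OF D(3)] show "\<exists>z. T z \<and> loc \<Delta>' (\<lambda>\<Delta>. \<exists>a. X a \<and> P \<Delta> a \<and> Q a \<Delta> z)"
        by (intro exI[of _ z] conjI locI exI[of _ a]) auto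
    qed
  qed
  fix \<Delta> z z' assume D: "\<Gamma> \<sqsubseteq> \<Delta>" and z: "T z" "T z'"
    and l: "loc \<Delta> (\<lambda>\<Delta>. \<exists>a. X a \<and> P \<Delta> a \<and> Q a \<Delta> z)" "loc \<Delta> (\<lambda>\<Delta>. \<exists>a. X a \<and> P \<Delta> a \<and> Q a \<Delta> z')"
  have m: "\<exists>a. X a \<and> P \<Delta>' a \<and> Q a \<Delta>' z'" if "\<exists>a. X a \<and> P \<Delta> a \<and> Q a \<Delta> z'" "\<Delta> \<sqsubseteq> \<Delta>'" for \<Delta> \<Delta>'
    using that(1) Pm[OF _ that(2)] Qm[OF _ that(2)] by blast
  show "eq \<Delta> z z'"
    using l(1)
  proof (rule eq_locE[OF _ z], elim exE conjE)
    fix D1 a assume D1: "\<Delta> \<sqsubseteq> D1" "X a" "P D1 a" "Q a D1 z"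
    have "loc D1 (\<lambda>\<Delta>. \<exists>a. X a \<and> P \<Delta> a \<and> Q a \<Delta> z')" using l(2) D1(1) m by (rule loc_mono)
    then show "eq D1 z z'"
    proof (rule eq_locE[OF _ z], elim exE conjE)
      fix D2 a' assume D2: "D1 \<sqsubseteq> D2" "X a'" "P D2 a'" "Q a' D2 z'"
      have sub: "\<Gamma> \<sqsubseteq> D2" using D D1(1) D2(1) by blast
      have "Q a' D2 z"
        by (rule cong[OF sub D1(2) D2(2) un[OF sub D1(2) D2(2) Pm[OF D1(3) D2(1)] D2(3)] z(1) Qm[OF D1(4) D2(1)]])
      then show "eq D2 z z'" by (rule uexD[OF Q[OF sub D2(2)] order_refl z]) (rule D2(4))
    qed
  qed
qed

lemma eqenv_const: "eq \<Gamma> a a' \<Longrightarrow> eqf \<Gamma> u u' \<Longrightarrow> eqenv \<Gamma> (\<lambda>_. a) (\<lambda>_. u) (\<lambda>_. a') (\<lambda>_. u')"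
  by (simp add: eqenv_def)

context
  fixes D :: "cst \<Rightarrow> fm"
  assumes wkvD: "\<And>c. wkv_fm (D c)"
begin

lemma idx_Nil [simp]: "idx [] d n = n + d"
  by (simp add: idx_def)

lemma val_graph: "ok \<sigma> \<tau> \<Longrightarrow> T z \<Longrightarrow> val D \<Gamma> \<sigma> \<tau> t z \<longleftrightarrow> fc \<Gamma> (scons z \<sigma>) \<tau> (graph D [] 1 0 t)"
  by (simp add: fc_graph[OF wkvD])

lemma valf_graph: "ok \<sigma> \<tau> \<Longrightarrow> T z \<Longrightarrow> T x \<Longrightarrow>
    valf D \<Gamma> \<sigma> \<tau> u x z \<longleftrightarrow> fc \<Gamma> (scons z (scons x \<sigma>)) \<tau> (graphf D [] 2 0 u)"
  by (simp add: fc_graph[OF wkvD])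

text \<open>The term may contain arbitrary constants, but its graph is a formula of WKV, where
  congruence is known.\<close>

lemma val_cong:
  assumes "ok \<sigma> \<tau>" "ok \<sigma>' \<tau>'" "T z" "T z'" "eqenv \<Gamma> \<sigma> \<tau> \<sigma>' \<tau>'" "eq \<Gamma> z z'" "val D \<Gamma> \<sigma> \<tau> t z"
  shows "val D \<Gamma> \<sigma>' \<tau>' t z'"
  using assms(7) unfolding val_graph[OF assms(1,3)] val_graph[OF assms(2,4)]
  by (rule fc_cong[OF wkv_graph(1)[OF wkvD], rotated -1]) (use assms in \<open>simp_all add: eqenv_scons\<close>)

lemma valf_cong:
  assumes "ok \<sigma> \<tau>" "ok \<sigma>' \<tau>'" "T z" "T z'" "T x" "T x'" "eqenv \<Gamma> \<sigma> \<tau> \<sigma>' \<tau>'" "eq \<Gamma> z z'" "eq \<Gamma> x x'"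
    "valf D \<Gamma> \<sigma> \<tau> u x z"
  shows "valf D \<Gamma> \<sigma>' \<tau>' u x' z'"
  using assms(10) unfolding valf_graph[OF assms(1,3,5)] valf_graph[OF assms(2,4,6)]
  by (rule fc_cong[OF wkv_graph(2)[OF wkvD], rotated -1]) (use assms in \<open>simp_all add: eqenv_scons\<close>)

lemma val_locE:
  assumes "loc \<Gamma> P" "ok \<sigma> \<tau>" "T z" "\<And>\<Delta>. \<Gamma> \<sqsubseteq> \<Delta> \<Longrightarrow> P \<Delta> \<Longrightarrow> val D \<Delta> \<sigma> \<tau> t z"
  shows "val D \<Gamma> \<sigma> \<tau> t z"
  unfolding val_graph[OF assms(2,3)]
  by (rule fc_locE[OF assms(1)])
    (use assms(2,3) Lg_graph[OF wkvD] assms(4)[unfolded val_graph[OF assms(2,3)]] in simp_all)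

definition total :: "cst \<Rightarrow> bool" where
  "total c \<longleftrightarrow> (\<forall>\<Gamma> \<sigma> \<tau>. ok \<sigma> \<tau> \<longrightarrow> uex \<Gamma> (\<lambda>\<Delta> z. argsem D \<Delta> \<sigma> \<tau> c z))"

lemma totalD: "total c \<Longrightarrow> ok \<sigma> \<tau> \<Longrightarrow> uex \<Gamma> (\<lambda>\<Delta> z. argsem D \<Delta> \<sigma> \<tau> c z)"
  unfolding total_def by simp

lemma argsem_cong:
  assumes "ok \<sigma> \<tau>" "ok \<sigma>' \<tau>'" "T z" "T z'" "eqenv \<Gamma> \<sigma> \<tau> \<sigma>' \<tau>'" "eq \<Gamma> z z'" "argsem D \<Gamma> \<sigma> \<tau> c z"
  shows "argsem D \<Gamma> \<sigma>' \<tau>' c z'"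
  by (rule fc_cong[OF wkvD _ _ _ assms(7)]) (use assms in \<open>simp_all add: eqenv_scons\<close>)

text \<open>In the case of \<open>FnF\<close>, the unique values of the functor at all arguments are
  collected by AC00! into a functor of the language, unique up to pointwise equality.\<close>

lemma val_total:
  "\<forall>c\<in>csts t. total c \<Longrightarrow> ok \<sigma> \<tau> \<Longrightarrow> uex \<Gamma> (\<lambda>\<Delta> z. val D \<Delta> \<sigma> \<tau> t z)"
  "\<forall>c\<in>cstsf u. total c \<Longrightarrow> ok \<sigma> \<tau> \<Longrightarrow> T x \<Longrightarrow> uex \<Gamma> (\<lambda>\<Delta> z. valf D \<Delta> \<sigma> \<tau> u x z)"
proof (induction t and u arbitrary: \<Gamma> \<sigma> and \<Gamma> \<sigma> x)
  case (Fn2 c s t)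
  have tot: "total (C2 c)" "\<forall>c\<in>csts s. total c" "\<forall>c\<in>csts t. total c" using Fn2.prems by auto
  have s: "uex \<Delta> (\<lambda>\<Delta> z. val D \<Delta> \<sigma> \<tau> s z)" and t: "uex \<Delta> (\<lambda>\<Delta> z. val D \<Delta> \<sigma> \<tau> t z)" for \<Delta>
    using Fn2.IH(1)[OF tot(2) Fn2.prems(2)] Fn2.IH(2)[OF tot(3) Fn2.prems(2)] by auto
  define Q where "Q = (\<lambda>a \<Delta> z. loc \<Delta> (\<lambda>\<Delta>. \<exists>b. T b \<and>
     val D \<Delta> \<sigma> \<tau> t b \<and> argsem D \<Delta> (scons a (\<lambda>_. b)) (\<lambda>_. FConst Succ) (C2 c) z))"
  have m: "\<exists>b. T b \<and> val D \<Delta>' \<sigma> \<tau> t b \<and> argsem D \<Delta>' (scons a (\<lambda>_. b)) (\<lambda>_. FConst Succ) (C2 c) z"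
    if "\<exists>b. T b \<and> val D \<Delta> \<sigma> \<tau> t b \<and> argsem D \<Delta> (scons a (\<lambda>_. b)) (\<lambda>_. FConst Succ) (C2 c) z" "\<Delta> \<sqsubseteq> \<Delta>'"
    for \<Delta> \<Delta>' a z using that(1) val_mono(1)[OF _ that(2)] fc_mono[OF _ that(2)] by blast
  have "uex \<Gamma> (\<lambda>\<Delta> z. loc \<Delta> (\<lambda>\<Delta>. \<exists>a. T a \<and> val D \<Delta> \<sigma> \<tau> s a \<and> Q a \<Delta> z))"
  proof (rule uex_bind[where E = eq])
    show "loc \<Gamma> (\<lambda>\<Delta>. \<exists>a. T a \<and> val D \<Delta> \<sigma> \<tau> s a)" using s unfolding uex_def by simp
    show "eq \<Delta> a a'" if "T a" "T a'" "val D \<Delta> \<sigma> \<tau> s a" "val D \<Delta> \<sigma> \<tau> s a'" for \<Delta> a a'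
      by (rule uexD[OF s order_refl that])
    show "val D \<Delta>' \<sigma> \<tau> s a" if "val D \<Delta> \<sigma> \<tau> s a" "\<Delta> \<sqsubseteq> \<Delta>'" for \<Delta> \<Delta>' a
      using that by (rule val_mono)
    show "Q a \<Delta>' z" if "Q a \<Delta> z" "\<Delta> \<sqsubseteq> \<Delta>'" for a \<Delta> \<Delta>' z
      using that m unfolding Q_def by (rule loc_mono)
    show "Q a' \<Delta> z" if "T a" "T a'" "eq \<Delta> a a'" "T z" "Q a \<Delta> z" for a a' \<Delta> z
      using that(5) unfolding Q_def
    proof (rule loc_map, elim exE conjE)
      fix \<Delta>' b assume d: "\<Delta> \<sqsubseteq> \<Delta>'" and b: "T b" "val D \<Delta>' \<sigma> \<tau> t b" "argsem D \<Delta>' (scons a (\<lambda>_. b)) (\<lambda>_. FConst Succ) (C2 c) z"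
      have "argsem D \<Delta>' (scons a' (\<lambda>_. b)) (\<lambda>_. FConst Succ) (C2 c) z"
        by (rule argsem_cong[OF _ _ that(4,4) _ _ b(3)])
          (use that b d in \<open>simp_all add: eqenv_scons eq_mono[OF that(3) d]\<close>)
      with b show "\<exists>b. T b \<and> val D \<Delta>' \<sigma> \<tau> t b \<and> argsem D \<Delta>' (scons a' (\<lambda>_. b)) (\<lambda>_. FConst Succ) (C2 c) z"
        by blast
    qed
    show "uex \<Delta> (Q a)" if a: "T a" for \<Delta> a
      unfolding Q_def
    proof (rule uex_bind[where E = eq])
      show "loc \<Delta> (\<lambda>\<Delta>. \<exists>a. T a \<and> val D \<Delta> \<sigma> \<tau> t a)" using t unfolding uex_def by simp
      show "eq \<Delta> a a'" if "T a" "T a'" "val D \<Delta> \<sigma> \<tau> t a" "val D \<Delta> \<sigma> \<tau> t a'" for \<Delta> a a'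
        by (rule uexD[OF t order_refl that])
      show "val D \<Delta>' \<sigma> \<tau> t a" if "val D \<Delta> \<sigma> \<tau> t a" "\<Delta> \<sqsubseteq> \<Delta>'" for \<Delta> \<Delta>' a
        using that by (rule val_mono)
      show "argsem D \<Delta> (scons a (\<lambda>_. b')) (\<lambda>_. FConst Succ) (C2 c) z"
        if "T b" "T b'" "eq \<Delta> b b'" "T z" "argsem D \<Delta> (scons a (\<lambda>_. b)) (\<lambda>_. FConst Succ) (C2 c) z" for \<Delta> b b' z
        by (rule argsem_cong[OF _ _ that(4,4) _ _ that(5)])
          (use that a in \<open>simp_all add: eqenv_scons eqenv_const\<close>)
      show "uex \<Delta> (\<lambda>\<Delta> z. argsem D \<Delta> (scons a (\<lambda>_. b)) (\<lambda>_. FConst Succ) (C2 c) z)" if "T b" for \<Delta> b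
        by (rule totalD[OF tot(1)]) (use that a in simp)
    qed (rule fc_mono)
  qed
  then show ?case by (simp add: Q_def)
next
  case (FnF c s u)
  have tot: "total (CF c)" "\<forall>c\<in>csts s. total c" "\<forall>c\<in>cstsf u. total c" using FnF.prems by auto
  have s: "uex \<Delta> (\<lambda>\<Delta> z. val D \<Delta> \<sigma> \<tau> s z)" for \<Delta>
    using FnF.IH(1)[OF tot(2) FnF.prems(2)] .
  have u: "uex \<Delta> (\<lambda>\<Delta> z. valf D \<Delta> \<sigma> \<tau> u x z)" if "T x" for \<Delta> x
    using FnF.IH(2)[OF tot(3) FnF.prems(2) that] .
  have uex: "loc \<Delta> (\<lambda>\<Delta>. \<exists>\<gamma>. U \<gamma> \<and> (\<forall>x. T x \<longrightarrow> valf D \<Delta> \<sigma> \<tau> u x (App \<gamma> x)))" for \<Delta>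
  proof -
    have "loc \<Delta> (\<lambda>\<Delta>. \<exists>\<gamma>. U \<gamma> \<and> (\<forall>x. T x \<longrightarrow> fc \<Delta> (scons (App \<gamma> x) (scons x \<sigma>)) \<tau> (graphf D [] 2 0 u)))"
    proof (rule choice)
      fix x assume x: "T x"
      show "uex \<Delta> (\<lambda>\<Delta> z. fc \<Delta> (scons z (scons x \<sigma>)) \<tau> (graphf D [] 2 0 u))"
        using u[OF x] by (subst uex_cong[OF valf_graph[OF FnF.prems(2) _ x, symmetric]])
    qed (use FnF.prems Lg_graph[OF wkvD] in simp_all)
    then show ?thesis
      by (rule loc_map) (use valf_graph[OF FnF.prems(2)] in auto)
  qed
  define Q where "Q = (\<lambda>a \<Delta> z. loc \<Delta> (\<lambda>\<Delta>. \<exists>\<gamma>. U \<gamma> \<and> (\<forall>x. T x \<longrightarrow> valf D \<Delta> \<sigma> \<tau> u x (App \<gamma> x)) \<and>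
     argsem D \<Delta> (\<lambda>_. a) (\<lambda>_. \<gamma>) (CF c) z))"
  have m: "\<exists>\<gamma>. U \<gamma> \<and> (\<forall>x. T x \<longrightarrow> valf D \<Delta>' \<sigma> \<tau> u x (App \<gamma> x)) \<and> argsem D \<Delta>' (\<lambda>_. a) (\<lambda>_. \<gamma>) (CF c) z"
    if "\<exists>\<gamma>. U \<gamma> \<and> (\<forall>x. T x \<longrightarrow> valf D \<Delta> \<sigma> \<tau> u x (App \<gamma> x)) \<and> argsem D \<Delta> (\<lambda>_. a) (\<lambda>_. \<gamma>) (CF c) z" "\<Delta> \<sqsubseteq> \<Delta>'"
    for \<Delta> \<Delta>' a z using that(1) val_mono(2)[OF _ that(2)] fc_mono[OF _ that(2)] by blast
  have "uex \<Gamma> (\<lambda>\<Delta> z. loc \<Delta> (\<lambda>\<Delta>. \<exists>a. T a \<and> val D \<Delta> \<sigma> \<tau> s a \<and> Q a \<Delta> z))"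
  proof (rule uex_bind[where E = eq])
    show "loc \<Gamma> (\<lambda>\<Delta>. \<exists>a. T a \<and> val D \<Delta> \<sigma> \<tau> s a)" using s unfolding uex_def by simp
    show "eq \<Delta> a a'" if "T a" "T a'" "val D \<Delta> \<sigma> \<tau> s a" "val D \<Delta> \<sigma> \<tau> s a'" for \<Delta> a a'
      by (rule uexD[OF s order_refl that])
    show "val D \<Delta>' \<sigma> \<tau> s a" if "val D \<Delta> \<sigma> \<tau> s a" "\<Delta> \<sqsubseteq> \<Delta>'" for \<Delta> \<Delta>' a
      using that by (rule val_mono)
    show "Q a \<Delta>' z" if "Q a \<Delta> z" "\<Delta> \<sqsubseteq> \<Delta>'" for a \<Delta> \<Delta>' z
      using that m unfolding Q_def by (rule loc_mono)
    show "Q a' \<Delta> z" if "T a" "T a'" "eq \<Delta> a a'" "T z" "Q a \<Delta> z" for a a' \<Delta> z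
      using that(5) unfolding Q_def
    proof (rule loc_map, elim exE conjE)
      fix \<Delta>' b assume d: "\<Delta> \<sqsubseteq> \<Delta>'" and b: "U b" "\<forall>x. T x \<longrightarrow> valf D \<Delta>' \<sigma> \<tau> u x (App b x)" "argsem D \<Delta>' (\<lambda>_. a) (\<lambda>_. b) (CF c) z"
      have "argsem D \<Delta>' (\<lambda>_. a') (\<lambda>_. b) (CF c) z"
        by (rule argsem_cong[OF _ _ that(4,4) _ _ b(3)])
          (use that b d in \<open>simp_all add: eqenv_const eq_mono[OF that(3) d]\<close>)
      with b show "\<exists>b. U b \<and> (\<forall>x. T x \<longrightarrow> valf D \<Delta>' \<sigma> \<tau> u x (App b x)) \<and> argsem D \<Delta>' (\<lambda>_. a') (\<lambda>_. b) (CF c) z"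
        by blast
    qed
    show "uex \<Delta> (Q a)" if a: "T a" for \<Delta> a
      unfolding Q_def
    proof (rule uex_bind[where E = eqf])
      show "loc \<Delta> (\<lambda>\<Delta>. \<exists>\<gamma>. U \<gamma> \<and> (\<forall>x. T x \<longrightarrow> valf D \<Delta> \<sigma> \<tau> u x (App \<gamma> x)))" by (rule uex)
      show "eqf \<Delta> \<gamma> \<gamma>'" if "U \<gamma>" "U \<gamma>'" "\<forall>x. T x \<longrightarrow> valf D \<Delta> \<sigma> \<tau> u x (App \<gamma> x)"
        "\<forall>x. T x \<longrightarrow> valf D \<Delta> \<sigma> \<tau> u x (App \<gamma>' x)" for \<Delta> \<gamma> \<gamma>'
        unfolding eqf_def by (intro allI impI uexD[OF u order_refl]) (use that in \<open>(simp; fail | blast)+\<close>)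
      show "\<forall>x. T x \<longrightarrow> valf D \<Delta>' \<sigma> \<tau> u x (App \<gamma> x)" if "\<forall>x. T x \<longrightarrow> valf D \<Delta> \<sigma> \<tau> u x (App \<gamma> x)" "\<Delta> \<sqsubseteq> \<Delta>'" for \<Delta> \<Delta>' \<gamma>
        using that(1) val_mono(2)[OF _ that(2)] by blast
      show "argsem D \<Delta> (\<lambda>_. a) (\<lambda>_. b') (CF c) z"
        if "U b" "U b'" "eqf \<Delta> b b'" "T z" "argsem D \<Delta> (\<lambda>_. a) (\<lambda>_. b) (CF c) z" for \<Delta> b b' z
        by (rule argsem_cong[OF _ _ that(4,4) _ _ that(5)])
          (use that a in \<open>simp_all add: eqenv_const\<close>)
      show "uex \<Delta> (\<lambda>\<Delta> z. argsem D \<Delta> (\<lambda>_. a) (\<lambda>_. b) (CF c) z)" if "U b" for \<Delta> b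
        by (rule totalD[OF tot(1)]) (use that a in simp)
    qed (rule fc_mono)
  qed
  then show ?case by (simp add: Q_def)
next
  case (App u s)
  have tot: "\<forall>c\<in>csts s. total c" "\<forall>c\<in>cstsf u. total c" using App.prems by auto
  have s: "uex \<Delta> (\<lambda>\<Delta> z. val D \<Delta> \<sigma> \<tau> s z)" for \<Delta>
    using App.IH(2)[OF tot(1) App.prems(2)] .
  show ?case unfolding val.simps
  proof (rule uex_bind[where E = eq])
    show "loc \<Gamma> (\<lambda>\<Delta>. \<exists>a. T a \<and> val D \<Delta> \<sigma> \<tau> s a)" using s unfolding uex_def by simp
    show "eq \<Delta> a a'" if "T a" "T a'" "val D \<Delta> \<sigma> \<tau> s a" "val D \<Delta> \<sigma> \<tau> s a'" for \<Delta> a a'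
      by (rule uexD[OF s order_refl that])
    show "val D \<Delta>' \<sigma> \<tau> s a" if "val D \<Delta> \<sigma> \<tau> s a" "\<Delta> \<sqsubseteq> \<Delta>'" for \<Delta> \<Delta>' a
      using that by (rule val_mono)
    show "valf D \<Delta>' \<sigma> \<tau> u a z" if "valf D \<Delta> \<sigma> \<tau> u a z" "\<Delta> \<sqsubseteq> \<Delta>'" for \<Delta> \<Delta>' a z
      using that by (rule val_mono)
    show "uex \<Delta> (\<lambda>\<Delta> z. valf D \<Delta> \<sigma> \<tau> u a z)" if "T a" for \<Delta> a
      using App.IH(1)[OF tot(2) App.prems(2) that] .
    show "valf D \<Delta> \<sigma> \<tau> u a' z" if "T a" "T a'" "eq \<Delta> a a'" "T z" "valf D \<Delta> \<sigma> \<tau> u a z" for \<Delta> a a' z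
      by (rule valf_cong[OF App.prems(2,2) that(4,4) that(1,2) _ _ that(3) that(5)]) (use App.prems that in simp_all)
  qed
next
  case (FConst c)
  then show ?case by (simp add: totalD)
next
  case (Lam t)
  then show ?case by simp
qed (simp_all add: uex_eq okD)

text \<open>\<open>exact c\<close> only makes sense if the constant \<open>c\<close> is in the language.\<close>

definition exact :: "cst \<Rightarrow> bool" where
  "exact c \<longleftrightarrow> (\<forall>\<Gamma> \<sigma> \<tau> z. ok \<sigma> \<tau> \<longrightarrow> T z \<longrightarrow> argsem D \<Gamma> \<sigma> \<tau> c z \<longleftrightarrow> eq \<Gamma> z (sub_trm \<sigma> \<tau> (lhs c)))"

lemma exactD: "exact c \<Longrightarrow> ok \<sigma> \<tau> \<Longrightarrow> T z \<Longrightarrow> argsem D \<Gamma> \<sigma> \<tau> c z \<longleftrightarrow> eq \<Gamma> z (sub_trm \<sigma> \<tau> (lhs c))"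
  unfolding exact_def by simp

lemma exact_total: "exact c \<Longrightarrow> T (lhs c) \<Longrightarrow> total c"
  unfolding total_def
  by (intro allI impI, subst uex_cong[OF exactD], assumption+) (simp add: uex_eq)

text \<open>When the formulas of all constants involved are correct, having a value means being
  equal to the term; lambda-conversion settles abstractions.\<close>

lemma val_exact:
  "\<forall>c\<in>csts t. exact c \<Longrightarrow> T t \<Longrightarrow> ok \<sigma> \<tau> \<Longrightarrow> T z \<Longrightarrow> val D \<Gamma> \<sigma> \<tau> t z \<longleftrightarrow> eq \<Gamma> z (sub_trm \<sigma> \<tau> t)"
  "\<forall>c\<in>cstsf u. exact c \<Longrightarrow> U u \<Longrightarrow> ok \<sigma> \<tau> \<Longrightarrow> T x \<Longrightarrow> T z \<Longrightarrow> valf D \<Gamma> \<sigma> \<tau> u x z \<longleftrightarrow> eq \<Gamma> z (App (sub_ftr \<sigma> \<tau> u) x)"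
proof (induction t and u arbitrary: \<Gamma> \<sigma> z and \<Gamma> \<sigma> x z)
  case (Fn2 c s t)
  have T: "T s" "T t" "T (Fn2 c (NVar 0) (NVar 1))" using Fn2.prems(2) by (auto simp: T_def)
  let ?s = "sub_trm \<sigma> \<tau> s" and ?t = "sub_trm \<sigma> \<tau> t"
  have s: "val D \<Delta> \<sigma> \<tau> s a \<longleftrightarrow> eq \<Delta> a ?s" and t: "val D \<Delta> \<sigma> \<tau> t a \<longleftrightarrow> eq \<Delta> a ?t"
    if "T a" for \<Delta> a using Fn2.IH Fn2.prems T that by simp_all
  have c: "argsem D \<Delta> (scons a (\<lambda>_. b)) (\<lambda>_. FConst Succ) (C2 c) z \<longleftrightarrow> eq \<Delta> z (Fn2 c a b)"
    if "T a" "T b" for a b \<Delta>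
    using exactD[of "C2 c" "scons a (\<lambda>_. b)" "\<lambda>_. FConst Succ" z \<Delta>] Fn2.prems that by simp
  have Ts: "T ?s" "T ?t" using Fn2.prems T by simp_all
  have TF: "T (Fn2 c ?s ?t)" using T Ts by (auto simp: T_def)
  show ?case unfolding val.simps sub_trm.simps
  proof
    assume "loc \<Gamma> (\<lambda>\<Delta>. \<exists>a. T a \<and> val D \<Delta> \<sigma> \<tau> s a \<and> loc \<Delta> (\<lambda>\<Delta>. \<exists>b. T b \<and>
     val D \<Delta> \<sigma> \<tau> t b \<and> argsem D \<Delta> (scons a (\<lambda>_. b)) (\<lambda>_. FConst Succ) (C2 c) z))"
    then show "eq \<Gamma> z (Fn2 c ?s ?t)"
    proof (rule eq_locE[OF _ Fn2.prems(4) TF], elim exE conjE)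
      fix D1 a assume a: "T a" "val D D1 \<sigma> \<tau> s a" and
        "loc D1 (\<lambda>\<Delta>. \<exists>b. T b \<and> val D \<Delta> \<sigma> \<tau> t b \<and> argsem D \<Delta> (scons a (\<lambda>_. b)) (\<lambda>_. FConst Succ) (C2 c) z)"
      from this(3) show "eq D1 z (Fn2 c ?s ?t)"
      proof (rule eq_locE[OF _ Fn2.prems(4) TF], elim exE conjE)
        fix D2 b' assume b: "T b'" "val D D2 \<sigma> \<tau> t b'" "D1 \<sqsubseteq> D2"
          and e: "argsem D D2 (scons a (\<lambda>_. b')) (\<lambda>_. FConst Succ) (C2 c) z"
        have "eq D2 a ?s" using eq_mono[OF _ b(3)] a s by blast
        moreover have "eq D2 b' ?t" using b t by blast
        ultimately have "eq D2 (Fn2 c a b') (Fn2 c ?s ?t)" using T by (intro eq_Fn2)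
        with e[unfolded c[OF a(1) b(1)]] show "eq D2 z (Fn2 c ?s ?t)" by (rule eq_trans)
      qed
    qed
  next
    assume "eq \<Gamma> z (Fn2 c ?s ?t)"
    then show "loc \<Gamma> (\<lambda>\<Delta>. \<exists>a. T a \<and> val D \<Delta> \<sigma> \<tau> s a \<and> loc \<Delta> (\<lambda>\<Delta>. \<exists>b. T b \<and>
     val D \<Delta> \<sigma> \<tau> t b \<and> argsem D \<Delta> (scons a (\<lambda>_. b)) (\<lambda>_. FConst Succ) (C2 c) z))"
      using Ts s[OF Ts(1)] t[OF Ts(2)] c[OF Ts]
      by (intro locI exI[of _ ?s] exI[of _ ?t] conjI) simp_all
  qed
next
  case (FnF c s u)
  \<comment> \<open>A term built with \<open>FnF\<close> is never in WKV, so the language must be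
    the full one.\<close>
  have b using FnF.prems(2) by (simp add: T_def)
  then have T: "T s" "U u" "T (FnF c (NVar 0) (FVar 0))" unfolding T_def U_def by simp_all
  let ?s = "sub_trm \<sigma> \<tau> s" and ?u = "sub_ftr \<sigma> \<tau> u"
  have s: "val D \<Delta> \<sigma> \<tau> s a \<longleftrightarrow> eq \<Delta> a ?s" and u: "valf D \<Delta> \<sigma> \<tau> u x a \<longleftrightarrow> eq \<Delta> a (App ?u x)"
    if "T a" "T x" for \<Delta> a x using FnF.IH FnF.prems T that by simp_all
  have c: "argsem D \<Delta> (\<lambda>_. a) (\<lambda>_. \<gamma>) (CF c) z \<longleftrightarrow> eq \<Delta> z (FnF c a \<gamma>)"
    if "T a" "U \<gamma>" for a \<gamma> \<Delta>
    using exactD[of "CF c" "\<lambda>_. a" "\<lambda>_. \<gamma>" z \<Delta>] FnF.prems that by simp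
  have Ts: "T ?s" "U ?u" using FnF.prems T by simp_all
  have TF: "T (FnF c ?s ?u)" using \<open>b\<close> unfolding T_def by simp
  show ?case unfolding val.simps sub_trm.simps
  proof
    assume "loc \<Gamma> (\<lambda>\<Delta>. \<exists>a. T a \<and> val D \<Delta> \<sigma> \<tau> s a \<and> loc \<Delta> (\<lambda>\<Delta>. \<exists>\<gamma>. U \<gamma> \<and>
     (\<forall>x. T x \<longrightarrow> valf D \<Delta> \<sigma> \<tau> u x (App \<gamma> x)) \<and> argsem D \<Delta> (\<lambda>_. a) (\<lambda>_. \<gamma>) (CF c) z))"
    then show "eq \<Gamma> z (FnF c ?s ?u)"
    proof (rule eq_locE[OF _ FnF.prems(4) TF], elim exE conjE)
      fix D1 a assume a: "T a" "val D D1 \<sigma> \<tau> s a" and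
        "loc D1 (\<lambda>\<Delta>. \<exists>\<gamma>. U \<gamma> \<and> (\<forall>x. T x \<longrightarrow> valf D \<Delta> \<sigma> \<tau> u x (App \<gamma> x)) \<and> argsem D \<Delta> (\<lambda>_. a) (\<lambda>_. \<gamma>) (CF c) z)"
      from this(3) show "eq D1 z (FnF c ?s ?u)"
      proof (rule eq_locE[OF _ FnF.prems(4) TF], elim exE conjE)
        fix D2 \<gamma> assume b: "U \<gamma>" "\<forall>x. T x \<longrightarrow> valf D D2 \<sigma> \<tau> u x (App \<gamma> x)" "D1 \<sqsubseteq> D2"
          and e: "argsem D D2 (\<lambda>_. a) (\<lambda>_. \<gamma>) (CF c) z"
        have "eq D2 a ?s" using eq_mono[OF _ b(3)] a s by blast
        moreover have "eqf D2 \<gamma> ?u" unfolding eqf_def using b(1,2) u by simp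
        \<comment> \<open>\<open>\<gamma>\<close> is only pointwise equal to \<open>?u\<close>. The
          replacement is made inside the WKV formula \<open>D (CF c)\<close>, where congruence
          allows it.\<close>
        ultimately have "argsem D D2 (\<lambda>_. ?s) (\<lambda>_. ?u) (CF c) z"
          by (intro argsem_cong[OF _ _ FnF.prems(4,4) _ _ e]) (use a b Ts FnF.prems in \<open>simp_all add: eqenv_const\<close>)
        then show "eq D2 z (FnF c ?s ?u)" unfolding c[OF Ts] .
      qed
    qed
  next
    assume "eq \<Gamma> z (FnF c ?s ?u)"
    then show "loc \<Gamma> (\<lambda>\<Delta>. \<exists>a. T a \<and> val D \<Delta> \<sigma> \<tau> s a \<and> loc \<Delta> (\<lambda>\<Delta>. \<exists>\<gamma>. U \<gamma> \<and>
     (\<forall>x. T x \<longrightarrow> valf D \<Delta> \<sigma> \<tau> u x (App \<gamma> x)) \<and> argsem D \<Delta> (\<lambda>_. a) (\<lambda>_. \<gamma>) (CF c) z))"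
      using Ts s[OF Ts(1) T_simps(2)] u c[OF Ts]
      by (intro locI exI[of _ ?s] exI[of _ ?u] conjI allI impI) simp_all
  qed
next
  case (App u s)
  have T: "T s" "U u" using App.prems(2) by auto
  let ?s = "sub_trm \<sigma> \<tau> s" and ?u = "sub_ftr \<sigma> \<tau> u"
  have s: "val D \<Delta> \<sigma> \<tau> s a \<longleftrightarrow> eq \<Delta> a ?s" and u: "valf D \<Delta> \<sigma> \<tau> u a z \<longleftrightarrow> eq \<Delta> z (App ?u a)"
    if "T a" for \<Delta> a using App.IH App.prems T that by simp_all
  have Ts: "T ?s" "U ?u" using App.prems T by simp_all
  show ?case unfolding val.simps sub_trm.simps
  proof
    assume "loc \<Gamma> (\<lambda>\<Delta>. \<exists>a. T a \<and> val D \<Delta> \<sigma> \<tau> s a \<and> valf D \<Delta> \<sigma> \<tau> u a z)"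
    then show "eq \<Gamma> z (App ?u ?s)"
    proof (rule eq_locE, goal_cases)
      case (3 E)
      then obtain a where a: "T a" "eq E a ?s" "eq E z (App ?u a)" using s u by blast
      show ?case using a(3) eq_App[OF a(2) Ts(2)] by (rule eq_trans)
    qed (use App.prems Ts in simp_all)
  next
    assume "eq \<Gamma> z (App ?u ?s)"
    then show "loc \<Gamma> (\<lambda>\<Delta>. \<exists>a. T a \<and> val D \<Delta> \<sigma> \<tau> s a \<and> valf D \<Delta> \<sigma> \<tau> u a z)"
      using Ts s[OF Ts(1)] u[OF Ts(1)] by (intro locI exI[of _ ?s] conjI) simp_all
  qed
next
  case (FConst c)
  then show ?case using exactD[of "C1 c" "\<lambda>_. x" "\<lambda>_. FConst Succ" z \<Gamma>] by simp
next
  case (Lam t)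
  have "valf D \<Gamma> \<sigma> \<tau> (Lam t) x z \<longleftrightarrow> eq \<Gamma> z (sub_trm (scons x \<sigma>) \<tau> t)"
    using Lam by simp
  also have "\<dots> \<longleftrightarrow> eq \<Gamma> z (App (Lam (sub_trm (upN_trm \<sigma>) (upN_ftr \<tau>) t)) x)"
    using Lam.prems by (intro eq_right eq_sym[OF beta]) simp_all
  finally show ?case by simp
qed simp_all

end

context
  fixes D :: "cst \<Rightarrow> fm"
  assumes wkvD: "\<And>c. wkv_fm (D c)"
begin

text \<open>A substituted term may lie outside the language, but the environment
  \<open>\<sigma>''\<close>, \<open>\<tau>''\<close> contains its value. Since values are unique up
  to equality, having the value of the term and being equal to the entry are the same.\<close>

lemma val_sub:
  assumes tot: "\<And>c. total D c"
  shows "ok \<sigma>' \<tau>' \<Longrightarrow> ok \<sigma>'' \<tau>'' \<Longrightarrow> T z \<Longrightarrow>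
      (\<And>n. val D \<Gamma> \<sigma>' \<tau>' (\<sigma> n) (\<sigma>'' n)) \<Longrightarrow> (\<And>n x. T x \<Longrightarrow> valf D \<Gamma> \<sigma>' \<tau>' (\<tau> n) x (App (\<tau>'' n) x)) \<Longrightarrow>
      val D \<Gamma> \<sigma>' \<tau>' (sub_trm \<sigma> \<tau> t) z \<longleftrightarrow> val D \<Gamma> \<sigma>'' \<tau>'' t z"
    "ok \<sigma>' \<tau>' \<Longrightarrow> ok \<sigma>'' \<tau>'' \<Longrightarrow> T z \<Longrightarrow> T x \<Longrightarrow>
      (\<And>n. val D \<Gamma> \<sigma>' \<tau>' (\<sigma> n) (\<sigma>'' n)) \<Longrightarrow> (\<And>n x. T x \<Longrightarrow> valf D \<Gamma> \<sigma>' \<tau>' (\<tau> n) x (App (\<tau>'' n) x)) \<Longrightarrow>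
      valf D \<Gamma> \<sigma>' \<tau>' (sub_ftr \<sigma> \<tau> u) x z \<longleftrightarrow> valf D \<Gamma> \<sigma>'' \<tau>'' u x z"
proof (induction t and u arbitrary: \<Gamma> \<sigma> \<sigma>' \<sigma>'' \<tau> z and \<Gamma> \<sigma> \<sigma>' \<sigma>'' \<tau> x z)
  case (NVar n)
  have T: "T (\<sigma>'' n)" using NVar.prems(2) by (rule okD)
  show ?case unfolding sub_trm.simps val.simps
  proof
    assume "val D \<Gamma> \<sigma>' \<tau>' (\<sigma> n) z"
    then show "eq \<Gamma> z (\<sigma>'' n)"
      by (rule_tac uexD[OF val_total(1)[OF wkvD _ NVar.prems(1)] order_refl NVar.prems(3) T _ NVar.prems(4)])
        (simp_all add: tot)
  next
    assume "eq \<Gamma> z (\<sigma>'' n)"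
    then show "val D \<Gamma> \<sigma>' \<tau>' (\<sigma> n) z"
      by (rule val_cong[OF wkvD NVar.prems(1,1) T NVar.prems(3) eqenv_refl[OF NVar.prems(1)] eq_sym NVar.prems(4)])
  qed
next
  case (FVar n)
  have T: "T (App (\<tau>'' n) x)" using FVar.prems(2,4) by (simp add: okD(2)[of \<sigma>'' \<tau>''])
  show ?case unfolding sub_ftr.simps valf.simps
  proof
    assume "valf D \<Gamma> \<sigma>' \<tau>' (\<tau> n) x z"
    then show "eq \<Gamma> z (App (\<tau>'' n) x)"
      by (rule_tac uexD[OF val_total(2)[OF wkvD _ FVar.prems(1,4)] order_refl FVar.prems(3) T _ FVar.prems(6)[OF FVar.prems(4)]])
        (simp_all add: tot)
  next
    assume "eq \<Gamma> z (App (\<tau>'' n) x)"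
    then show "valf D \<Gamma> \<sigma>' \<tau>' (\<tau> n) x z"
      by (rule valf_cong[OF wkvD FVar.prems(1,1) T FVar.prems(3,4,4) eqenv_refl[OF FVar.prems(1)] eq_sym
        eq_refl[OF FVar.prems(4)] FVar.prems(6)[OF FVar.prems(4)]])
  qed
next
  case (Fn2 c s t)
  have s: "val D \<Delta> \<sigma>' \<tau>' (sub_trm \<sigma> \<tau> s) a \<longleftrightarrow> val D \<Delta> \<sigma>'' \<tau>'' s a"
    and t: "val D \<Delta> \<sigma>' \<tau>' (sub_trm \<sigma> \<tau> t) a \<longleftrightarrow> val D \<Delta> \<sigma>'' \<tau>'' t a" if "T a" "\<Gamma> \<sqsubseteq> \<Delta>" for \<Delta> a
    by (rule Fn2.IH[OF Fn2.prems(1,2) that(1) val_mono(1)[OF Fn2.prems(4) that(2)] val_mono(2)[OF Fn2.prems(5) that(2)]], assumption)+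
  show ?case unfolding sub_trm.simps val.simps
  proof (rule loc_cong, rule ex_cong1, rule conj_cong, rule refl, rule conj_cong)
    fix \<Delta> a assume D: "\<Gamma> \<sqsubseteq> \<Delta>" "T a"
    show "val D \<Delta> \<sigma>' \<tau>' (sub_trm \<sigma> \<tau> s) a \<longleftrightarrow> val D \<Delta> \<sigma>'' \<tau>'' s a" using D(2,1) by (rule s)
    show "loc \<Delta> (\<lambda>\<Delta>. \<exists>b. T b \<and> val D \<Delta> \<sigma>' \<tau>' (sub_trm \<sigma> \<tau> t) b \<and> argsem D \<Delta> (scons a (\<lambda>_. b)) (\<lambda>_. FConst Succ) (C2 c) z) \<longleftrightarrow>
      loc \<Delta> (\<lambda>\<Delta>. \<exists>b. T b \<and> val D \<Delta> \<sigma>'' \<tau>'' t b \<and> argsem D \<Delta> (scons a (\<lambda>_. b)) (\<lambda>_. FConst Succ) (C2 c) z)"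
      by (rule loc_cong, rule ex_cong1, rule conj_cong, rule refl, rule conj_cong, rule t)
        (use D(1) in auto)
  qed
next
  case (FnF c s u)
  have s: "val D \<Delta> \<sigma>' \<tau>' (sub_trm \<sigma> \<tau> s) a \<longleftrightarrow> val D \<Delta> \<sigma>'' \<tau>'' s a" if "T a" "\<Gamma> \<sqsubseteq> \<Delta>" for \<Delta> a
    by (rule FnF.IH(1)[OF FnF.prems(1,2) that(1) val_mono(1)[OF FnF.prems(4) that(2)] val_mono(2)[OF FnF.prems(5) that(2)]], assumption)
  have u: "valf D \<Delta> \<sigma>' \<tau>' (sub_ftr \<sigma> \<tau> u) x a \<longleftrightarrow> valf D \<Delta> \<sigma>'' \<tau>'' u x a" if "T a" "T x" "\<Gamma> \<sqsubseteq> \<Delta>" for \<Delta> x a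
    by (rule FnF.IH(2)[OF FnF.prems(1,2) that(1,2) val_mono(1)[OF FnF.prems(4) that(3)] val_mono(2)[OF FnF.prems(5) that(3)]], assumption)
  show ?case unfolding sub_trm.simps val.simps
  proof (rule loc_cong, rule ex_cong1, rule conj_cong, rule refl, rule conj_cong)
    fix \<Delta> a assume D: "\<Gamma> \<sqsubseteq> \<Delta>" "T a"
    show "val D \<Delta> \<sigma>' \<tau>' (sub_trm \<sigma> \<tau> s) a \<longleftrightarrow> val D \<Delta> \<sigma>'' \<tau>'' s a" using D(2,1) by (rule s)
    show "loc \<Delta> (\<lambda>\<Delta>. \<exists>\<gamma>. U \<gamma> \<and> (\<forall>x. T x \<longrightarrow> valf D \<Delta> \<sigma>' \<tau>' (sub_ftr \<sigma> \<tau> u) x (App \<gamma> x)) \<and> argsem D \<Delta> (\<lambda>_. a) (\<lambda>_. \<gamma>) (CF c) z) \<longleftrightarrow>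
      loc \<Delta> (\<lambda>\<Delta>. \<exists>\<gamma>. U \<gamma> \<and> (\<forall>x. T x \<longrightarrow> valf D \<Delta> \<sigma>'' \<tau>'' u x (App \<gamma> x)) \<and> argsem D \<Delta> (\<lambda>_. a) (\<lambda>_. \<gamma>) (CF c) z)"
      by (rule loc_cong, rule ex_cong1, rule conj_cong, rule refl, rule conj_cong,
          rule all_cong1, rule imp_cong, rule refl, rule u) (use D(1) in auto)
  qed
next
  case (App u s)
  have s: "val D \<Delta> \<sigma>' \<tau>' (sub_trm \<sigma> \<tau> s) a \<longleftrightarrow> val D \<Delta> \<sigma>'' \<tau>'' s a" if "T a" "\<Gamma> \<sqsubseteq> \<Delta>" for \<Delta> a
    by (rule App.IH(2)[OF App.prems(1,2) that(1) val_mono(1)[OF App.prems(4) that(2)] val_mono(2)[OF App.prems(5) that(2)]], assumption)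
  have u: "valf D \<Delta> \<sigma>' \<tau>' (sub_ftr \<sigma> \<tau> u) x z \<longleftrightarrow> valf D \<Delta> \<sigma>'' \<tau>'' u x z" if "T x" "\<Gamma> \<sqsubseteq> \<Delta>" for \<Delta> x
    by (rule App.IH(1)[OF App.prems(1,2) App.prems(3) that(1) val_mono(1)[OF App.prems(4) that(2)] val_mono(2)[OF App.prems(5) that(2)]], assumption)
  show ?case unfolding sub_trm.simps val.simps
    by (rule loc_cong, rule ex_cong1, rule conj_cong, rule refl, rule conj_cong, erule (1) s, rule u)
next
  case (Lam t)
  show ?case unfolding sub_ftr.simps valf.simps
  proof (rule Lam.IH)
    show "val D \<Gamma> (scons x \<sigma>') \<tau>' (upN_trm \<sigma> n) (scons x \<sigma>'' n)" for n
      using Lam.prems(4,5) by (cases n) (simp_all add: val_ren)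
    show "valf D \<Gamma> (scons x \<sigma>') \<tau>' (upN_ftr \<tau> n) y (App (\<tau>'' n) y)" if "T y" for n y
      using Lam.prems(6)[OF that] by (simp add: val_ren)
  qed (use Lam.prems in simp_all)
qed simp_all

lemma total_Expl:
  assumes "D c = graph_body D (Expl t)" "\<forall>c\<in>csts t. total D c"
  shows "total D c"
  unfolding total_def[OF wkvD]
proof (intro allI impI)
  fix \<Gamma> \<sigma> \<tau> assume ok: "ok \<sigma> \<tau>"
  have "argsem D \<Delta> \<sigma> \<tau> c z \<longleftrightarrow> val D \<Delta> \<sigma> \<tau> t z" if "T z" for \<Delta> z
    using assms(1) by (simp add: val_graph[OF wkvD ok that])
  then show "uex \<Gamma> (\<lambda>\<Delta> z. argsem D \<Delta> \<sigma> \<tau> c z)"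
    using val_total(1)[OF wkvD assms(2) ok] uex_cong[of \<Gamma> "\<lambda>\<Delta> z. argsem D \<Delta> \<sigma> \<tau> c z" "\<lambda>\<Delta> z. val D \<Delta> \<sigma> \<tau> t z"]
    by blast
qed

context
  fixes c r t\<^sub>0 t\<^sub>1
  assumes Dc: "D c = graph_body D (Rec r t\<^sub>0 t\<^sub>1)"
    and tot0: "\<forall>c\<in>csts t\<^sub>0. total D c" and tot1: "\<forall>c\<in>csts t\<^sub>1. total D c"
begin

definition recf :: "fm list \<Rightarrow> (nat \<Rightarrow> trm) \<Rightarrow> (nat \<Rightarrow> ftr) \<Rightarrow> ftr \<Rightarrow> bool" where
  "recf \<Gamma> \<sigma> \<tau> \<beta> \<longleftrightarrow> val D \<Gamma> (\<sigma>(r := Zero)) \<tau> t\<^sub>0 (App \<beta> Zero) \<and>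
     (\<forall>y. T y \<longrightarrow> val D \<Gamma> (scons (App \<beta> y) (\<sigma>(r := y))) \<tau> t\<^sub>1 (App \<beta> (S' y)))"

lemma ok_upd [simp]: "ok \<sigma> \<tau> \<Longrightarrow> T a \<Longrightarrow> ok (\<sigma>(r := a)) \<tau>"
  by (simp add: ok_def)

text \<open>Both equations overwrite entry \<open>r\<close>, so one solution serves all values of
  the recursion argument.\<close>

lemma recf_upd [simp]: "recf \<Gamma> (\<sigma>(r := a)) \<tau> \<beta> = recf \<Gamma> \<sigma> \<tau> \<beta>"
  by (simp add: recf_def)

lemma recf_mono: "recf \<Gamma> \<sigma> \<tau> \<beta> \<Longrightarrow> \<Gamma> \<sqsubseteq> \<Delta> \<Longrightarrow> recf \<Delta> \<sigma> \<tau> \<beta>"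
  unfolding recf_def using val_mono(1)[of D \<Gamma>] by blast

lemma recf_exists:
  assumes ok: "ok \<sigma> \<tau>"
  shows "loc \<Gamma> (\<lambda>\<Delta>. \<exists>\<beta>. U \<beta> \<and> recf \<Delta> \<sigma> \<tau> \<beta>)"
proof -
  \<comment> \<open>Index 0 is the new value in both formulas; in \<open>?A1\<close> the previous
    value is 1 and the running argument 2. Entry \<open>r\<close> of the parameters is replaced by
    zero or by index 2.\<close>
  let ?A0 = "sub_fm (scons (NVar 0) (\<lambda>n. if n = r then Zero else NVar (Suc n))) FVar (graph D [] 1 0 t\<^sub>0)"
  let ?A1 = "sub_fm (scons (NVar 0) (scons (NVar 1) (\<lambda>n. if n = r then NVar 2 else NVar (Suc (Suc (Suc n))))))
    FVar (graph D [] 1 0 t\<^sub>1)"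
  have e0: "(\<lambda>n. sub_trm (scons v \<sigma>) \<tau> (if n = r then Zero else NVar (Suc n))) = \<sigma>(r := Zero)" for v
    by (rule ext) simp
  have e1: "(\<lambda>n. sub_trm (scons w (scons v (scons y \<sigma>))) \<tau> (if n = r then NVar 2 else NVar (Suc (Suc (Suc n))))) = \<sigma>(r := y)" for w v y
    by (rule ext) simp
  have A0: "fc \<Delta> (scons v \<sigma>) \<tau> ?A0 \<longleftrightarrow> val D \<Delta> (\<sigma>(r := Zero)) \<tau> t\<^sub>0 v" if "T v" for \<Delta> v
    using ok that by (simp add: fc_sub sub_scons e0 val_graph[OF wkvD])
  have A1: "fc \<Delta> (scons w (scons v (scons y \<sigma>))) \<tau> ?A1 \<longleftrightarrow> val D \<Delta> (scons v (\<sigma>(r := y))) \<tau> t\<^sub>1 w"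
    if "T v" "T w" "T y" for \<Delta> w v y
    using ok that by (simp add: fc_sub sub_scons e1 val_graph[OF wkvD])
  have "loc \<Gamma> (\<lambda>\<Delta>. \<exists>\<beta>. U \<beta> \<and> fc \<Delta> (scons (App \<beta> Zero) \<sigma>) \<tau> ?A0 \<and>
    (\<forall>y. T y \<longrightarrow> fc \<Delta> (scons (App \<beta> (S' y)) (scons (App \<beta> y) (scons y \<sigma>))) \<tau> ?A1))"
  proof (rule primitive_recursion)
    show "wkv_fm ?A0" "wkv_fm ?A1"
      by (auto simp: wkv_sub_fm wkv_scons wkv_graph[OF wkvD])
    show "uex \<Gamma> (\<lambda>\<Delta> v. fc \<Delta> (scons v \<sigma>) \<tau> ?A0)"
      by (subst uex_cong[OF A0], assumption) (use ok in \<open>simp add: val_total(1)[OF wkvD tot0]\<close>)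
    show "uex \<Delta> (\<lambda>\<Delta> w. fc \<Delta> (scons w (scons v (scons y \<sigma>))) \<tau> ?A1)" if "T v" "T y" for \<Delta> v y
      by (subst uex_cong[OF A1[OF that(1) _ that(2)]], assumption)
        (use ok that in \<open>simp add: val_total(1)[OF wkvD tot1]\<close>)
  qed (rule ok)
  then show ?thesis
  proof (rule loc_map, elim exE conjE)
    fix \<Delta> \<beta> assume "U \<beta>" "fc \<Delta> (scons (App \<beta> Zero) \<sigma>) \<tau> ?A0"
      "\<forall>y. T y \<longrightarrow> fc \<Delta> (scons (App \<beta> (S' y)) (scons (App \<beta> y) (scons y \<sigma>))) \<tau> ?A1"
    then have "recf \<Delta> \<sigma> \<tau> \<beta>" unfolding recf_def using A0 A1 by simp
    with \<open>U \<beta>\<close> show "\<exists>\<beta>. U \<beta> \<and> recf \<Delta> \<sigma> \<tau> \<beta>" by blast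
  qed
qed

text \<open>Induction on the argument: the step has a unique value and respects equality of the
  previous values.\<close>

lemma recf_unique:
  assumes ok: "ok \<sigma> \<tau>" and \<beta>: "U \<beta>" "recf \<Gamma> \<sigma> \<tau> \<beta>" "U \<beta>'" "recf \<Gamma> \<sigma> \<tau> \<beta>'"
  shows "eqf \<Gamma> \<beta> \<beta>'"
  unfolding eqf_def
proof (intro allI impI)
  fix x assume x: "T x"
  let ?A = "Eq (App (FVar 0) (NVar 0)) (App (FVar 1) (NVar 0))"
  have A: "fc \<Delta> (scons x NVar) (scons \<beta> (scons \<beta>' FVar)) ?A \<longleftrightarrow> eq \<Delta> (App \<beta> x) (App \<beta>' x)" for \<Delta> x
    by (simp add: fc_simps)
  have "fc \<Gamma> (scons x NVar) (scons \<beta> (scons \<beta>' FVar)) ?A"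
  proof (rule fc_induct[OF _ _ _ x])
    show "fc \<Gamma> (scons Zero NVar) (scons \<beta> (scons \<beta>' FVar)) ?A"
      unfolding A by (rule uexD[OF val_total(1)[OF wkvD tot0, of "\<sigma>(r := Zero)" \<tau>] order_refl])
        (use ok \<beta> in \<open>simp_all add: recf_def\<close>)
    fix \<Delta> y assume D: "\<Gamma> \<sqsubseteq> \<Delta>" and y: "T y" and "fc \<Delta> (scons y NVar) (scons \<beta> (scons \<beta>' FVar)) ?A"
    then have IH: "eq \<Delta> (App \<beta> y) (App \<beta>' y)" unfolding A by simp
    have r: "recf \<Delta> \<sigma> \<tau> \<beta>" "recf \<Delta> \<sigma> \<tau> \<beta>'" using \<beta> D by (auto intro: recf_mono)
    have "val D \<Delta> (scons (App \<beta>' y) (\<sigma>(r := y))) \<tau> t\<^sub>1 (App \<beta> (S' y))"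
      by (rule val_cong[OF wkvD, of "scons (App \<beta> y) (\<sigma>(r := y))" \<tau> _ _ "App \<beta> (S' y)"])
        (use ok \<beta> y r IH in \<open>simp_all add: recf_def eqenv_scons\<close>)
    then show "fc \<Delta> (scons (S' y) NVar) (scons \<beta> (scons \<beta>' FVar)) ?A"
      unfolding A by (rule uexD[OF val_total(1)[OF wkvD tot1] order_refl, rotated 3])
        (use ok \<beta> y r in \<open>simp_all add: recf_def\<close>)
  qed (use \<beta> in simp_all)
  then show "eq \<Gamma> (App \<beta> x) (App \<beta>' x)" unfolding A .
qed

lemma argsem_Rec:
  assumes ok: "ok \<sigma> \<tau>" and z: "T z"
  shows "argsem D \<Gamma> \<sigma> \<tau> c z \<longleftrightarrow> loc \<Gamma> (\<lambda>\<Delta>. \<exists>\<beta>. U \<beta> \<and> recf \<Delta> \<sigma> \<tau> \<beta> \<and> eq \<Delta> z (App \<beta> (\<sigma> r)))"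
proof -
  have e0: "(\<lambda>n. sub_trm (scons z \<sigma>) (scons \<beta> \<tau>) (if n = r then Zero else NVar (Suc n))) = \<sigma>(r := Zero)" for \<beta>
    by (rule ext) simp
  have e1: "(\<lambda>n. sub_trm (scons y (scons z \<sigma>)) (scons \<beta> \<tau>) (if n = r then NVar 0 else NVar (Suc (Suc n)))) = \<sigma>(r := y)" for y \<beta>
    by (rule ext) simp
  have o: "ok (\<lambda>n. if n = r then Zero else NVar (Suc n)) (\<lambda>n. FVar (Suc n))"
    "ok (\<lambda>n. if n = r then NVar 0 else NVar (Suc (Suc n))) (\<lambda>n. FVar (Suc n))" by (simp_all add: ok_def)
  show ?thesis using ok z
    by (simp add: Dc fc_simps fc_sub sub_scons e0 e1 o Lg_graph[OF wkvD] val_graph[OF wkvD] recf_def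
        cong: conj_cong imp_cong)
qed

lemma argsem_RecI:
  assumes ok: "ok \<sigma> \<tau>" and "U \<beta>" "recf \<Gamma> \<sigma> \<tau> \<beta>"
  shows "argsem D \<Gamma> \<sigma> \<tau> c (App \<beta> (\<sigma> r))"
proof -
  have "T (App \<beta> (\<sigma> r))" using assms by (simp add: okD(1))
  then show ?thesis unfolding argsem_Rec[OF ok \<open>T (App \<beta> (\<sigma> r))\<close>]
    using assms by (intro locI exI[of _ \<beta>]) simp
qed

lemma argsem_RecD:
  assumes ok: "ok \<sigma> \<tau>" and z: "T z" and \<beta>: "U \<beta>" "recf \<Gamma> \<sigma> \<tau> \<beta>" and "argsem D \<Gamma> \<sigma> \<tau> c z"
  shows "eq \<Gamma> z (App \<beta> (\<sigma> r))"
  using assms(5) unfolding argsem_Rec[OF ok z]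
proof (rule eq_locE, goal_cases)
  case (3 \<Delta>)
  then obtain \<beta>' where b: "U \<beta>'" "recf \<Delta> \<sigma> \<tau> \<beta>'" "eq \<Delta> z (App \<beta>' (\<sigma> r))" by blast
  have "eqf \<Delta> \<beta>' \<beta>" by (rule recf_unique[OF ok b(1,2) \<beta>(1) recf_mono[OF \<beta>(2) 3(1)]])
  then have "eq \<Delta> (App \<beta>' (\<sigma> r)) (App \<beta> (\<sigma> r))" using ok by (simp add: eqf_def okD(1))
  with b(3) show ?case by (rule eq_trans)
qed (use z ok \<beta> in \<open>simp_all add: okD(1)\<close>)

lemma total_Rec: "total D c"
  unfolding total_def[OF wkvD]
proof (intro allI impI)
  fix \<Gamma> \<sigma> \<tau> assume ok: "ok \<sigma> \<tau>"
  show "uex \<Gamma> (\<lambda>\<Delta> z. argsem D \<Delta> \<sigma> \<tau> c z)"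
    unfolding uex_def
  proof (intro conjI allI impI)
    show "loc \<Gamma> (\<lambda>\<Delta>. \<exists>z. T z \<and> argsem D \<Delta> \<sigma> \<tau> c z)"
      using recf_exists[OF ok]
    proof (rule loc_map, elim exE conjE)
      fix \<Delta> \<beta> assume "U \<beta>" "recf \<Delta> \<sigma> \<tau> \<beta>"
      then show "\<exists>z. T z \<and> argsem D \<Delta> \<sigma> \<tau> c z"
        using argsem_RecI[OF ok] ok by (intro exI[of _ "App \<beta> (\<sigma> r)"]) (simp add: okD(1))
    qed
    fix \<Delta> z z' assume z: "T z" "T z'" and a: "argsem D \<Delta> \<sigma> \<tau> c z" "argsem D \<Delta> \<sigma> \<tau> c z'"
    show "eq \<Delta> z z'"
      using recf_exists[OF ok]
    proof (rule eq_locE[OF _ z], elim exE conjE)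
      fix E \<beta> assume E: "\<Delta> \<sqsubseteq> E" "U \<beta>" "recf E \<sigma> \<tau> \<beta>"
      show "eq E z z'"
        using argsem_RecD[OF ok z(1) E(2,3) fc_mono[OF a(1) E(1)]] argsem_RecD[OF ok z(2) E(2,3) fc_mono[OF a(2) E(1)]]
        by (rule eq_trans[OF _ eq_sym])
    qed
  qed
qed

text \<open>A solution \<open>\<beta>\<close> exists locally; relative to it both sides say that
  \<open>z\<close> is \<open>\<beta>(0)\<close>. The successor equation below is proved in the same
  way with \<open>\<beta>(y)\<close> as the previous value.\<close>

lemma argsem_Rec_Zero:
  assumes ok: "ok \<sigma> \<tau>" and z: "T z"
  shows "argsem D \<Gamma> (\<sigma>(r := Zero)) \<tau> c z \<longleftrightarrow> val D \<Gamma> (\<sigma>(r := Zero)) \<tau> t\<^sub>0 z"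
proof -
  have ok': "ok (\<sigma>(r := Zero)) \<tau>" using ok by simp
  have *: "argsem D \<Delta> (\<sigma>(r := Zero)) \<tau> c z \<longleftrightarrow> val D \<Delta> (\<sigma>(r := Zero)) \<tau> t\<^sub>0 z"
    if b: "U \<beta>" "recf \<Delta> \<sigma> \<tau> \<beta>" for \<Delta> \<beta>
  proof -
    have v: "val D \<Delta> (\<sigma>(r := Zero)) \<tau> t\<^sub>0 (App \<beta> Zero)" using b(2) unfolding recf_def by simp
    have a: "argsem D \<Delta> (\<sigma>(r := Zero)) \<tau> c (App \<beta> Zero)"
      using argsem_RecI[OF ok' b(1), of \<Delta>] b(2) by simp
    have T0: "T (App \<beta> Zero)" using b by simp
    show ?thesis
    proof
      assume "argsem D \<Delta> (\<sigma>(r := Zero)) \<tau> c z"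
      then have "eq \<Delta> z (App \<beta> Zero)" using argsem_RecD[OF ok' z b(1), of \<Delta>] b(2) by simp
      then show "val D \<Delta> (\<sigma>(r := Zero)) \<tau> t\<^sub>0 z"
        by (rule val_cong[OF wkvD ok' ok' T0 z eqenv_refl[OF ok'] eq_sym v])
    next
      assume "val D \<Delta> (\<sigma>(r := Zero)) \<tau> t\<^sub>0 z"
      then have "eq \<Delta> (App \<beta> Zero) z" by (rule uexD[OF val_total(1)[OF wkvD tot0 ok'] order_refl T0 z v])
      then show "argsem D \<Delta> (\<sigma>(r := Zero)) \<tau> c z"
        by (rule argsem_cong[where D = D and c = c, OF wkvD ok' ok' T0 z eqenv_refl[OF ok'] _ a])
    qed
  qed
  show ?thesis
  proof
    assume a: "argsem D \<Gamma> (\<sigma>(r := Zero)) \<tau> c z"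
    show "val D \<Gamma> (\<sigma>(r := Zero)) \<tau> t\<^sub>0 z"
      by (rule val_locE[OF wkvD recf_exists[OF ok] ok' z], elim exE conjE) (use * fc_mono[OF a] in blast)
  next
    assume a: "val D \<Gamma> (\<sigma>(r := Zero)) \<tau> t\<^sub>0 z"
    show "argsem D \<Gamma> (\<sigma>(r := Zero)) \<tau> c z"
    proof (rule fc_locE[OF recf_exists[OF ok]], goal_cases)
      case (3 \<Delta>)
      then show ?case using * val_mono(1)[OF a] by blast
    qed (use ok' z Lg_graph(3)[OF wkvD] in simp_all)
  qed
qed

lemma argsem_Rec_Suc:
  assumes ok: "ok \<sigma> \<tau>" and z: "T z" and y: "T y"
  shows "argsem D \<Gamma> (\<sigma>(r := S' y)) \<tau> c z \<longleftrightarrow> loc \<Gamma> (\<lambda>\<Delta>. \<exists>v. T v \<and>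
    argsem D \<Delta> (\<sigma>(r := y)) \<tau> c v \<and> val D \<Delta> (scons v (\<sigma>(r := y))) \<tau> t\<^sub>1 z)"
proof -
  have Sy: "T (S' y)" using y by simp
  have ok': "ok (\<sigma>(r := y)) \<tau>" "ok (\<sigma>(r := S' y)) \<tau>" using ok y by simp_all
  show ?thesis
  proof
    assume a: "argsem D \<Gamma> (\<sigma>(r := S' y)) \<tau> c z"
    show "loc \<Gamma> (\<lambda>\<Delta>. \<exists>v. T v \<and> argsem D \<Delta> (\<sigma>(r := y)) \<tau> c v \<and> val D \<Delta> (scons v (\<sigma>(r := y))) \<tau> t\<^sub>1 z)"
      using recf_exists[OF ok]
    proof (rule loc_map, elim exE conjE)
      fix \<Delta> \<beta> assume D: "\<Gamma> \<sqsubseteq> \<Delta>" and b: "U \<beta>" "recf \<Delta> \<sigma> \<tau> \<beta>"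
      have Tb: "T (App \<beta> y)" "T (App \<beta> (S' y))" using b y by simp_all
      have "argsem D \<Delta> (\<sigma>(r := y)) \<tau> c (App \<beta> y)"
        using argsem_RecI[OF ok'(1) b(1), of \<Delta>] b(2) by simp
      moreover have e: "eq \<Delta> z (App \<beta> (S' y))"
        using argsem_RecD[OF ok'(2) z b(1) _ fc_mono[OF a D]] b(2) by simp
      moreover have "val D \<Delta> (scons (App \<beta> y) (\<sigma>(r := y))) \<tau> t\<^sub>1 z"
        by (rule val_cong[OF wkvD _ _ Tb(2) z _ eq_sym[OF e], of "scons (App \<beta> y) (\<sigma>(r := y))" \<tau>])
          (use b ok' Tb y in \<open>simp_all add: recf_def\<close>)
      ultimately show "\<exists>v. T v \<and> argsem D \<Delta> (\<sigma>(r := y)) \<tau> c v \<and> val D \<Delta> (scons v (\<sigma>(r := y))) \<tau> t\<^sub>1 z"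
        using Tb by blast
    qed
  next
    assume l: "loc \<Gamma> (\<lambda>\<Delta>. \<exists>v. T v \<and> argsem D \<Delta> (\<sigma>(r := y)) \<tau> c v \<and> val D \<Delta> (scons v (\<sigma>(r := y))) \<tau> t\<^sub>1 z)"
    show "argsem D \<Gamma> (\<sigma>(r := S' y)) \<tau> c z"
      using l
    proof (rule fc_locE, goal_cases)
      case (3 \<Delta>)
      then obtain v where v: "T v" "argsem D \<Delta> (\<sigma>(r := y)) \<tau> c v" "val D \<Delta> (scons v (\<sigma>(r := y))) \<tau> t\<^sub>1 z" by blast
      show ?case
        using recf_exists[OF ok]
      proof (rule fc_locE, goal_cases)
        case (3 E)
        then obtain \<beta> where b: "U \<beta>" "recf E \<sigma> \<tau> \<beta>" and E: "\<Delta> \<sqsubseteq> E" by blast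
        have Tb: "T (App \<beta> y)" "T (App \<beta> (S' y))" using b y by simp_all
        have "eq E v (App \<beta> y)"
          using argsem_RecD[OF ok'(1) v(1) b(1) _ fc_mono[OF v(2) E]] b(2) by simp
        then have "val D E (scons (App \<beta> y) (\<sigma>(r := y))) \<tau> t\<^sub>1 z"
          by (intro val_cong[OF wkvD _ _ z z _ _ val_mono(1)[OF v(3) E]])
            (use ok' v z Tb in \<open>simp_all add: eqenv_scons\<close>)
        then have "eq E (App \<beta> (S' y)) z"
          by (rule_tac uexD[OF val_total(1)[OF wkvD tot1] order_refl Tb(2) z])
            (use b ok' Tb y in \<open>simp_all add: recf_def\<close>)
        moreover have "argsem D E (\<sigma>(r := S' y)) \<tau> c (App \<beta> (S' y))"
          using argsem_RecI[OF ok'(2) b(1), of E] b(2) by simp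
        ultimately show ?case
          by (intro argsem_cong[where D = D and c = c, OF wkvD ok'(2) ok'(2) Tb(2) z eqenv_refl[OF ok'(2)]])
      qed (use ok' z Lg_graph(3)[OF wkvD] in simp_all)
    qed (use ok' z Lg_graph(3)[OF wkvD] in simp_all)
  qed
qed

end
end
end

section \<open>The defining formulas\<close>

text \<open>The bodies follow the defining axioms of M^j, with the recursive call replaced by the
  previous value. For \<open>Prime\<close> that value has index 1 in the second argument of
  \<open>bmu\<close>, below one binder.\<close>

primrec defn1 :: "const1 \<Rightarrow> body" where
  "defn1 Succ = Base (S' (NVar 0))"
| "defn1 Proj1 = Base (App (FConst Proj1) (NVar 0))"
| "defn1 Proj2 = Base (App (FConst Proj2) (NVar 0))"
| "defn1 Factorial = Rec 0 one (Fn2 Mult (NVar 0) (S' (NVar 1)))"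
| "defn1 Pred = Rec 0 Zero (NVar 1)"
| "defn1 SgBar = Rec 0 one Zero"
| "defn1 Sg = Rec 0 Zero one"
| "defn1 Prime = Rec 0 (S' one) (bmu (S' (S' (App (FConst Factorial) (NVar 0))))
     (App (FConst Sg)
       (Fn2 Add (Fn2 Monus (S' (NVar 1)) (NVar 0))
          (FnF BSum (NVar 0)
             (Lam (Fn2 Mult (App (FConst Sg) (App (FConst Pred) (NVar 0)))
                            (App (FConst SgBar) (Fn2 Rem (NVar 1) (NVar 0)))))))))"
| "defn1 Lh = Expl (FnF BSum (NVar 0) (Lam (App (FConst Sg) (Fn2 Expo (NVar 1) (NVar 0)))))"

primrec defn2 :: "const2 \<Rightarrow> body" where
  "defn2 Add = Base (Fn2 Add (NVar 0) (NVar 1))"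
| "defn2 Mult = Base (Fn2 Mult (NVar 0) (NVar 1))"
| "defn2 PairJ = Base (Fn2 PairJ (NVar 0) (NVar 1))"
| "defn2 Power = Rec 1 one (Fn2 Mult (NVar 0) (NVar 1))"
| "defn2 Monus = Rec 1 (NVar 0) (App (FConst Pred) (NVar 0))"
| "defn2 MinC = Expl (Fn2 Monus (NVar 1) (Fn2 Monus (NVar 1) (NVar 0)))"
| "defn2 MaxC = Expl (Fn2 Add (Fn2 Monus (NVar 0) (NVar 1)) (NVar 1))"
| "defn2 Dist = Expl (Fn2 Add (Fn2 Monus (NVar 0) (NVar 1)) (Fn2 Monus (NVar 1) (NVar 0)))"
| "defn2 Rem = Rec 0 Zero (Fn2 Mult (S' (NVar 0))
           (App (FConst Sg) (Fn2 Dist (NVar 2) (S' (NVar 0)))))"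
| "defn2 Quot = Rec 0 Zero (Fn2 Add (NVar 0)
           (App (FConst SgBar) (Fn2 Dist (NVar 2) (S' (Fn2 Rem (NVar 1) (NVar 2))))))"
| "defn2 Expo = Expl (bmu (NVar 0) expo_test)"
| "defn2 Concat = Expl (Fn2 Mult (NVar 0)
           (FnF BProd (App (FConst Lh) (NVar 1))
              (Lam (Fn2 Power
                      (App (FConst Prime) (Fn2 Add (App (FConst Lh) (NVar 1)) (NVar 0)))
                      (Fn2 Expo (NVar 2) (NVar 0))))))"
| "defn2 Circ = Expl (FnF BProd (Fn2 MaxC (NVar 0) (NVar 1))
           (Lam (Fn2 Power (App (FConst Prime) (NVar 0))
                   (Fn2 MaxC (Fn2 Expo (NVar 1) (NVar 0)) (Fn2 Expo (NVar 2) (NVar 0))))))"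

primrec defnF :: "constF \<Rightarrow> body" where
  "defnF BSum = Rec 0 Zero (Fn2 Add (NVar 0) (App (FVar 0) (NVar 1)))"
| "defnF BProd = Rec 0 one (Fn2 Mult (NVar 0) (App (FVar 0) (NVar 1)))"
| "defnF BMin = Rec 0 (App (FVar 0) Zero) (Fn2 MinC (NVar 0) (App (FVar 0) (S' (NVar 1))))"
| "defnF BMax = Rec 0 (App (FVar 0) Zero) (Fn2 MaxC (NVar 0) (App (FVar 0) (S' (NVar 1))))"
| "defnF CourseBar = Expl (FnF BProd (NVar 0)
           (Lam (Fn2 Power (App (FConst Prime) (NVar 0)) (S' (App (FVar 0) (NVar 0))))))"
| "defnF CourseTilde = Expl (FnF BProd (NVar 0)
           (Lam (Fn2 Power (App (FConst Prime) (NVar 0)) (App (FVar 0) (NVar 0)))))"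
| "defnF Ccp = Rec 0 one (Fn2 Circ (NVar 0) (App (FVar 0) (NVar 1)))"

primrec defn :: "cst \<Rightarrow> body" where
  "defn (C1 c) = defn1 c" | "defn (C2 c) = defn2 c" | "defn (CF c) = defnF c"

text \<open>Ranks witnessing that the definitions are well-founded: a body mentions only constants
  of smaller rank. The largest rank is 9.\<close>

primrec lev1 :: "const1 \<Rightarrow> nat" where
  "lev1 Succ = 0" | "lev1 Proj1 = 0" | "lev1 Proj2 = 0" | "lev1 Factorial = 1" | "lev1 Pred = 1"
| "lev1 SgBar = 1" | "lev1 Sg = 1" | "lev1 Prime = 6" | "lev1 Lh = 8"

primrec lev2 :: "const2 \<Rightarrow> nat" where
  "lev2 Add = 0" | "lev2 Mult = 0" | "lev2 PairJ = 0" | "lev2 Power = 1" | "lev2 Monus = 2"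
| "lev2 MinC = 3" | "lev2 MaxC = 3" | "lev2 Dist = 3" | "lev2 Rem = 4" | "lev2 Quot = 5"
| "lev2 Expo = 7" | "lev2 Concat = 9" | "lev2 Circ = 8"

primrec levF :: "constF \<Rightarrow> nat" where
  "levF BSum = 1" | "levF BProd = 1" | "levF BMin = 4" | "levF BMax = 4"
| "levF CourseBar = 7" | "levF CourseTilde = 7" | "levF Ccp = 9"

primrec lev :: "cst \<Rightarrow> nat" where
  "lev (C1 c) = lev1 c" | "lev (C2 c) = lev2 c" | "lev (CF c) = levF c"

primrec body_csts :: "body \<Rightarrow> cst set" where
  "body_csts (Base t) = {}"
| "body_csts (Expl t) = csts t"
| "body_csts (Rec r t\<^sub>0 t\<^sub>1) = csts t\<^sub>0 \<union> csts t\<^sub>1"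

lemma lev_less_10: "lev c < 10"
proof (cases c)
  case (C1 k) then show ?thesis by (cases k) auto
next
  case (C2 k) then show ?thesis by (cases k) auto
next
  case (CF k) then show ?thesis by (cases k) auto
qed

lemma lev_defn: "c' \<in> body_csts (defn c) \<Longrightarrow> lev c' < lev c"
proof (cases c)
  case (C1 k) then show "c' \<in> body_csts (defn c) \<Longrightarrow> lev c' < lev c"
    by (cases k) (auto simp: bmu_def)
next
  case (C2 k) then show "c' \<in> body_csts (defn c) \<Longrightarrow> lev c' < lev c"
    by (cases k) (auto simp: bmu_def expo_test_def)
next
  case (CF k) then show "c' \<in> body_csts (defn c) \<Longrightarrow> lev c' < lev c"
    by (cases k) auto
qed

lemma graph_body_cong: "(\<And>c. c \<in> body_csts B \<Longrightarrow> D c = D' c) \<Longrightarrow> graph_body D B = graph_body D' B"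
  by (cases B) (simp_all cong: graph_cong)

text \<open>The definitions are unrolled \<open>k\<close> times. As soon as \<open>k\<close> exceeds
  the rank of a constant its formula no longer changes; the formula at stage 0 is a
  placeholder.\<close>

fun stage :: "nat \<Rightarrow> cst \<Rightarrow> fm" where
  "stage 0 c = Eq Zero Zero"
| "stage (Suc k) c = graph_body (stage k) (defn c)"

lemma stage_stable: "lev c < k \<Longrightarrow> lev c < k' \<Longrightarrow> stage k c = stage k' c"
proof (induction "lev c" arbitrary: c k k' rule: less_induct)
  case less
  obtain m m' where m: "k = Suc m" "k' = Suc m'" using less.prems by (metis not0_implies_Suc not_less0)
  have "stage m c' = stage m' c'" if "c' \<in> body_csts (defn c)" for c'
    by (rule less.hyps[OF lev_defn[OF that]]) (use lev_defn[OF that] less.prems m in simp_all)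
  then show ?case unfolding m stage.simps by (rule graph_body_cong)
qed

definition Df :: "cst \<Rightarrow> fm" where "Df = stage 10"

lemma Df_eq: "Df c = graph_body Df (defn c)"
proof -
  have "stage 10 c = stage (Suc 10) c" by (rule stage_stable) (use lev_less_10[of c] in simp_all)
  then show ?thesis unfolding Df_def stage.simps .
qed

lemma defn_Base: "defn c = Base t \<Longrightarrow> t = lhs c \<and> wkv_trm (lhs c)"
proof (cases c)
  case (C1 k) then show "defn c = Base t \<Longrightarrow> t = lhs c \<and> wkv_trm (lhs c)" by (cases k) auto
next
  case (C2 k) then show "defn c = Base t \<Longrightarrow> t = lhs c \<and> wkv_trm (lhs c)" by (cases k) auto
next
  case (CF k) then show "defn c = Base t \<Longrightarrow> t = lhs c \<and> wkv_trm (lhs c)" by (cases k) auto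
qed

lemma wkv_graph_body:
  assumes "\<And>c. wkv_fm (D c)" "\<And>t. B = Base t \<Longrightarrow> wkv_trm t"
  shows "wkv_fm (graph_body D B)"
  using assms(2) by (cases B) (auto simp: wkv_graph[OF assms(1)] wkv_sub_fm wkv_scons)

lemma wkv_stage: "wkv_fm (stage k c)"
proof (induction k arbitrary: c)
  case (Suc k)
  show ?case unfolding stage.simps by (rule wkv_graph_body[OF Suc]) (use defn_Base in auto)
qed simp

lemma wkv_Df: "wkv_fm (Df c)"
  by (simp add: Df_def wkv_stage)

text \<open>The equations a body stands for, in the syntactic form of the axioms of M^j; in the step
  equation the constant itself takes the place of the previous value.\<close>

primrec body_axioms :: "trm \<Rightarrow> body \<Rightarrow> fm set" where
  "body_axioms l (Base t) = {}"
| "body_axioms l (Expl t) = {Eq l t}"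
| "body_axioms l (Rec r t\<^sub>0 t\<^sub>1) =
    {Eq (sub_trm (NVar(r := Zero)) FVar l) (sub_trm (NVar(r := Zero)) FVar t\<^sub>0),
     Eq (sub_trm (NVar(r := S' (NVar r))) FVar l) (sub_trm (scons l NVar) FVar t\<^sub>1)}"

abbreviation cst_axioms :: "cst \<Rightarrow> fm set" where
  "cst_axioms c \<equiv> body_axioms (lhs c) (defn c)"

lemma up_ren_numeral [simp]: "up_ren f (numeral k) = Suc (f (pred_numeral k))"
  by (simp add: numeral_eq_Suc)

lemma arith_defining:
  "arith_defining_axioms =
    (\<Union>c\<in>{C2 Power, C1 Factorial, C1 Pred, C2 Monus, C2 MinC, C2 MaxC, C1 SgBar, C1 Sg, C2 Dist, C2 Rem, C2 Quot}. cst_axioms c)"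
  unfolding arith_defining_axioms_def by (simp del: Un_insert_right)

lemma bounded_defining:
  "bounded_defining_axioms =
    (\<Union>c\<in>{CF BSum, CF BProd, CF BMin, CF BMax}. cst_axioms c)"
  unfolding bounded_defining_axioms_def by (simp del: Un_insert_right)

lemma coding_defining:
  "coding_defining_axioms =
    (\<Union>c\<in>{C1 Prime, C2 Expo, C1 Lh, C2 Concat, CF CourseBar, CF CourseTilde, C2 Circ, CF Ccp}. cst_axioms c)"
  unfolding coding_defining_axioms_def by (simp add: bmu_def prime_test_def del: Un_insert_right)

text \<open>The generated equations are literally the axioms, so each property of the defining
  axioms can be proved once for all bodies.\<close>

lemma defining_axioms:
  "arith_defining_axioms \<union> bounded_defining_axioms \<union> coding_defining_axioms = (\<Union>c. cst_axioms c)"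
proof -
  have UN: "(\<Union>c\<in>S. cst_axioms c) = (\<Union>c. cst_axioms c)" if S: "\<And>c. c \<in> S \<or> (\<exists>t. defn c = Base t)" for S
  proof (intro equalityI UN_least)
    show "cst_axioms c \<subseteq> (\<Union>c. cst_axioms c)" for c by (rule UN_upper) simp
    show "cst_axioms c \<subseteq> (\<Union>c\<in>S. cst_axioms c)" for c using S[of c] by (elim disjE exE UN_upper) simp
  qed
  show ?thesis
    unfolding arith_defining bounded_defining coding_defining UN_Un[symmetric]
  proof (rule UN)
    fix c
    show "c \<in> {C2 Power, C1 Factorial, C1 Pred, C2 Monus, C2 MinC, C2 MaxC, C1 SgBar, C1 Sg, C2 Dist, C2 Rem, C2 Quot}
      \<union> {CF BSum, CF BProd, CF BMin, CF BMax}
      \<union> {C1 Prime, C2 Expo, C1 Lh, C2 Concat, CF CourseBar, CF CourseTilde, C2 Circ, CF Ccp}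
      \<or> (\<exists>t. defn c = Base t)"
    proof (cases c)
      case (C1 k) then show ?thesis by (cases k) simp_all
    next
      case (C2 k) then show ?thesis by (cases k) simp_all
    next
      case (CF k) then show ?thesis by (cases k) simp_all
    qed
  qed
qed

text \<open>\<open>graph\<close> fills the places beyond the arguments of a constant arbitrarily;
  bounds on the free indices of the bodies show that this is harmless.\<close>

primrec bnd :: "nat \<Rightarrow> nat \<Rightarrow> trm \<Rightarrow> bool" and bndf :: "nat \<Rightarrow> nat \<Rightarrow> ftr \<Rightarrow> bool" where
  "bnd k m (NVar n) \<longleftrightarrow> n < k"
| "bnd k m Zero \<longleftrightarrow> True"
| "bnd k m (Fn2 c s t) \<longleftrightarrow> bnd k m s \<and> bnd k m t"
| "bnd k m (FnF c s u) \<longleftrightarrow> bnd k m s \<and> bndf k m u"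
| "bnd k m (App u s) \<longleftrightarrow> bndf k m u \<and> bnd k m s"
| "bndf k m (FVar n) \<longleftrightarrow> n < m"
| "bndf k m (FConst c) \<longleftrightarrow> True"
| "bndf k m (Lam t) \<longleftrightarrow> bnd (Suc k) m t"

primrec nargs :: "cst \<Rightarrow> nat" where
  "nargs (C1 c) = 1" | "nargs (C2 c) = 2" | "nargs (CF c) = 1"

primrec fargs :: "cst \<Rightarrow> nat" where
  "fargs (C1 c) = 0" | "fargs (C2 c) = 0" | "fargs (CF c) = 1"

primrec bnd_body :: "nat \<Rightarrow> nat \<Rightarrow> body \<Rightarrow> bool" where
  "bnd_body k m (Base t) \<longleftrightarrow> bnd k m t"
| "bnd_body k m (Expl t) \<longleftrightarrow> bnd k m t"
| "bnd_body k m (Rec r t\<^sub>0 t\<^sub>1) \<longleftrightarrow> r < k \<and> bnd k m t\<^sub>0 \<and> bnd (Suc k) m t\<^sub>1"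

lemma bnd_defn: "bnd_body (nargs c) (fargs c) (defn c)"
proof (cases c)
  case (C1 k) then show ?thesis by (cases k) (auto simp: bmu_def)
next
  case (C2 k) then show ?thesis by (cases k) (auto simp: bmu_def expo_test_def)
next
  case (CF k) then show ?thesis by (cases k) auto
qed

context calculus
begin

lemma val_agree:
  "bnd k m t \<Longrightarrow> (\<And>n. n < k \<Longrightarrow> \<sigma> n = \<sigma>' n) \<Longrightarrow> (\<And>n. n < m \<Longrightarrow> \<tau> n = \<tau>' n) \<Longrightarrow>
    val D \<Gamma> \<sigma> \<tau> t = val D \<Gamma> \<sigma>' \<tau>' t"
  "bndf k m u \<Longrightarrow> (\<And>n. n < k \<Longrightarrow> \<sigma> n = \<sigma>' n) \<Longrightarrow> (\<And>n. n < m \<Longrightarrow> \<tau> n = \<tau>' n) \<Longrightarrow>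
    valf D \<Gamma> \<sigma> \<tau> u = valf D \<Gamma> \<sigma>' \<tau>' u"
proof (induction t and u arbitrary: \<Gamma> k \<sigma> \<sigma>' and \<Gamma> k \<sigma> \<sigma>')
  case (Fn2 c s t)
  have "val D \<Delta> \<sigma> \<tau> s = val D \<Delta> \<sigma>' \<tau>' s" "val D \<Delta> \<sigma> \<tau> t = val D \<Delta> \<sigma>' \<tau>' t" for \<Delta>
    using Fn2.prems Fn2.IH(1)[of k \<sigma> \<sigma>' \<Delta>] Fn2.IH(2)[of k \<sigma> \<sigma>' \<Delta>] by auto
  then show ?case by simp
next
  case (FnF c s u)
  have "val D \<Delta> \<sigma> \<tau> s = val D \<Delta> \<sigma>' \<tau>' s" "valf D \<Delta> \<sigma> \<tau> u = valf D \<Delta> \<sigma>' \<tau>' u" for \<Delta>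
    using FnF.prems FnF.IH(1)[of k \<sigma> \<sigma>' \<Delta>] FnF.IH(2)[of k \<sigma> \<sigma>' \<Delta>] by auto
  then show ?case by simp
next
  case (App u s)
  have "val D \<Delta> \<sigma> \<tau> s = val D \<Delta> \<sigma>' \<tau>' s" "valf D \<Delta> \<sigma> \<tau> u = valf D \<Delta> \<sigma>' \<tau>' u" for \<Delta>
    using App.prems App.IH(1)[of k \<sigma> \<sigma>' \<Delta>] App.IH(2)[of k \<sigma> \<sigma>' \<Delta>] by auto
  then show ?case by simp
next
  case (Lam t)
  have "val D \<Gamma> (scons x \<sigma>) \<tau> t = val D \<Gamma> (scons x \<sigma>') \<tau>' t" for x
    by (rule Lam.IH[of "Suc k"]) (use Lam.prems in \<open>auto simp: less_Suc_eq_0_disj\<close>)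
  then show ?case by simp
qed auto

end

text \<open>The case distinction makes the translation the identity on WKV; the second form alone
  would give only an equivalent formula.\<close>

primrec tr :: "fm \<Rightarrow> fm" where
  "tr (Eq s t) = (if wkv_trm s \<and> wkv_trm t then Eq s t
     else ExN (And (graph Df [] 1 0 s) (graph Df [] 1 0 t)))"
| "tr (And A B) = And (tr A) (tr B)"
| "tr (Or A B) = Or (tr A) (tr B)"
| "tr (Imp A B) = Imp (tr A) (tr B)"
| "tr (Neg A) = Neg (tr A)"
| "tr (AllN A) = AllN (tr A)"
| "tr (ExN A) = ExN (tr A)"
| "tr (AllF A) = AllF (tr A)"
| "tr (ExF A) = ExF (tr A)"

lemma wkv_tr: "wkv_fm (tr A)"
  by (induction A) (auto simp: wkv_graph[OF wkv_Df])

lemma tr_wkv: "wkv_fm A \<Longrightarrow> tr A = A"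
  by (induction A) auto

lemma wkv_csts: "wkv_trm t \<Longrightarrow> c \<in> csts t \<Longrightarrow> \<exists>t. defn c = Base t"
  "wkv_ftr u \<Longrightarrow> c \<in> cstsf u \<Longrightarrow> \<exists>t. defn c = Base t"
  by (induction t and u) auto

section \<open>Soundness of the translation: formulas of M^j read in either system\<close>

context system
begin

abbreviation "v \<equiv> val Df"
abbreviation "vf \<equiv> valf Df"
abbreviation "cv \<equiv> argsem Df"

lemma Lg_Df [simp]: "Lg (Df c)" "Lg (tr A)"
  by (simp_all add: wkv_T wkv_Df wkv_tr)

lemma exact_Base:
  assumes "defn c = Base t"
  shows "exact Df c"
proof -
  have "Df c = Eq (NVar 0) (ren_trm Suc id (lhs c))"
    using assms defn_Base[OF assms] by (subst Df_eq) simp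
  then show ?thesis unfolding exact_def[OF wkv_Df] by (simp add: fc_simps)
qed

text \<open>Induction on the rank, as bodies use only constants of smaller rank.\<close>

lemma total_Df: "total Df c"
proof (induction "lev c" arbitrary: c rule: less_induct)
  case less
  show ?case
  proof (cases "defn c")
    case (Base t)
    then show ?thesis using defn_Base[OF Base] by (intro exact_total[OF wkv_Df] exact_Base) (auto intro: wkv_T)
  next
    case (Expl t)
    show ?thesis
      by (rule total_Expl[OF wkv_Df]) (use less lev_defn[of _ c] Expl Df_eq[of c] in auto)
  next
    case (Rec r t\<^sub>0 t\<^sub>1)
    show ?thesis
      by (rule total_Rec[OF wkv_Df]) (use less lev_defn[of _ c] Rec Df_eq[of c] in auto)
  qed
qed

lemmas v_total = val_total[OF wkv_Df, OF ballI[OF total_Df]]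
lemmas v_graph = val_graph[OF wkv_Df]
lemmas v_locE = val_locE[OF wkv_Df]
lemmas v_sub = val_sub[OF wkv_Df, OF total_Df]

lemma v_wkv:
  assumes "wkv_trm t" "ok \<sigma> \<tau>" "T z"
  shows "v \<Gamma> \<sigma> \<tau> t z \<longleftrightarrow> eq \<Gamma> z (sub_trm \<sigma> \<tau> t)"
proof (rule val_exact(1)[OF wkv_Df])
  show "\<forall>c\<in>csts t. exact Df c" using wkv_csts(1)[OF assms(1)] exact_Base by blast
qed (use assms in \<open>simp_all add: wkv_T\<close>)

text \<open>For constants of WKV the formula is the equation with the constant itself; otherwise the
  bounds on the body apply, for a recursion also to the equations satisfied by
  \<open>\<beta>\<close>.\<close>

lemma cv_agree:
  assumes "\<And>n. n < nargs c \<Longrightarrow> \<sigma> n = \<sigma>' n" "\<And>n. n < fargs c \<Longrightarrow> \<tau> n = \<tau>' n"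
    and ok: "ok \<sigma> \<tau>" "ok \<sigma>' \<tau>'" and z: "T z"
  shows "cv \<Gamma> \<sigma> \<tau> c z \<longleftrightarrow> cv \<Gamma> \<sigma>' \<tau>' c z"
proof (cases "defn c")
  case (Base t)
  have e: "exact Df c" by (rule exact_Base[OF Base])
  have "sub_trm \<sigma> \<tau> (lhs c) = sub_trm \<sigma>' \<tau>' (lhs c)" using assms(1,2) by (cases c) auto
  then show ?thesis using exactD[OF wkv_Df e ok(1) z] exactD[OF wkv_Df e ok(2) z] by simp
next
  case (Expl t)
  have "bnd (nargs c) (fargs c) t" using bnd_defn[of c] Expl by simp
  from val_agree(1)[OF this assms(1,2), where D = Df and \<Gamma> = \<Gamma>]
  have "v \<Gamma> \<sigma> \<tau> t z = v \<Gamma> \<sigma>' \<tau>' t z" by simp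
  then show ?thesis using ok z Expl Df_eq[of c] by (simp add: v_graph)
next
  case (Rec r t\<^sub>0 t\<^sub>1)
  have b: "r < nargs c" "bnd (nargs c) (fargs c) t\<^sub>0" "bnd (Suc (nargs c)) (fargs c) t\<^sub>1"
    using bnd_defn[of c] Rec by simp_all
  have D: "Df c = graph_body Df (Rec r t\<^sub>0 t\<^sub>1)" using Df_eq[of c] Rec by simp
  have 0: "val Df \<Delta> (\<sigma>(r := a)) \<tau> t\<^sub>0 = val Df \<Delta> (\<sigma>'(r := a)) \<tau>' t\<^sub>0" for \<Delta> a
    by (rule val_agree(1)[OF b(2)]) (use assms(1,2) in auto)
  have 1: "val Df \<Delta> (scons w (\<sigma>(r := a))) \<tau> t\<^sub>1 = val Df \<Delta> (scons w (\<sigma>'(r := a))) \<tau>' t\<^sub>1" for \<Delta> a w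
    by (rule val_agree(1)[OF b(3)]) (use assms(1,2) in \<open>auto simp: less_Suc_eq_0_disj\<close>)
  show ?thesis
    using argsem_Rec[OF wkv_Df D _ _ ok(1) z] argsem_Rec[OF wkv_Df D _ _ ok(2) z] total_Df
    by (simp add: recf_def[OF wkv_Df D] 0 1 assms(1)[OF b(1)])
qed

text \<open>The value of the term \<open>lhs c\<close> goes through intermediate values of its
  arguments and the filled-up environment of \<open>graph\<close>; congruence and
  \<open>cv_agree\<close> remove both.\<close>

lemma v_lhs:
  assumes ok: "ok \<sigma> \<tau>" and z: "T z"
  shows "v \<Gamma> \<sigma> \<tau> (lhs c) z \<longleftrightarrow> cv \<Gamma> \<sigma> \<tau> c z"
proof -
  note T\<sigma> = okD(1)[OF ok] and U\<tau> = okD(2)[OF ok]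
  have US: "U (FConst Succ)" by simp
  show ?thesis
  proof (cases c)
    case (C1 k)
    have a: "cv \<Delta> \<sigma> \<tau> c z \<longleftrightarrow> cv \<Delta> (\<lambda>_. \<sigma> 0) (\<lambda>_. FConst Succ) c z" for \<Delta>
      by (rule cv_agree) (use ok z T\<sigma> C1 in auto)
    show ?thesis unfolding C1 lhs.simps val.simps valf.simps
    proof
      assume "loc \<Gamma> (\<lambda>\<Delta>. \<exists>a. T a \<and> eq \<Delta> a (\<sigma> 0) \<and> cv \<Delta> (\<lambda>_. a) (\<lambda>_. FConst Succ) (C1 k) z)"
      then show "cv \<Gamma> \<sigma> \<tau> (C1 k) z"
      proof (rule fc_locE, goal_cases)
        case (3 \<Delta>)
        then obtain a' where "T a'" "eq \<Delta> a' (\<sigma> 0)" and h: "cv \<Delta> (\<lambda>_. a') (\<lambda>_. FConst Succ) (C1 k) z" by blast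
        then show ?case unfolding a[unfolded C1]
          by (rule_tac argsem_cong[where D = Df and c = "C1 k", OF wkv_Df _ _ z z _ _ h]) (use z T\<sigma> in \<open>simp_all add: eqenv_const\<close>)
      qed (use ok z in simp_all)
    next
      assume "cv \<Gamma> \<sigma> \<tau> (C1 k) z"
      then show "loc \<Gamma> (\<lambda>\<Delta>. \<exists>a. T a \<and> eq \<Delta> a (\<sigma> 0) \<and> cv \<Delta> (\<lambda>_. a) (\<lambda>_. FConst Succ) (C1 k) z)"
        unfolding a[unfolded C1] using T\<sigma> by (intro locI exI[of _ "\<sigma> 0"]) simp
    qed
  next
    case (C2 k)
    have a: "cv \<Delta> \<sigma> \<tau> c z \<longleftrightarrow> cv \<Delta> (scons (\<sigma> 0) (\<lambda>_. \<sigma> 1)) (\<lambda>_. FConst Succ) c z" for \<Delta>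
      by (rule cv_agree) (use ok z T\<sigma> C2 in \<open>auto simp: less_2_cases_iff\<close>)
    show ?thesis unfolding C2 lhs.simps val.simps
    proof
      assume "loc \<Gamma> (\<lambda>\<Delta>. \<exists>a. T a \<and> eq \<Delta> a (\<sigma> 0) \<and> loc \<Delta> (\<lambda>\<Delta>. \<exists>b. T b \<and> eq \<Delta> b (\<sigma> 1) \<and>
        cv \<Delta> (scons a (\<lambda>_. b)) (\<lambda>_. FConst Succ) (C2 k) z))"
      then show "cv \<Gamma> \<sigma> \<tau> (C2 k) z"
      proof (rule fc_locE, goal_cases)
        case (3 \<Delta>)
        then obtain a' where a': "T a'" "eq \<Delta> a' (\<sigma> 0)"
          and l: "loc \<Delta> (\<lambda>\<Delta>. \<exists>b. T b \<and> eq \<Delta> b (\<sigma> 1) \<and> cv \<Delta> (scons a' (\<lambda>_. b)) (\<lambda>_. FConst Succ) (C2 k) z)" by blast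
        from l show ?case
        proof (rule fc_locE, goal_cases)
          case (3 E)
          then obtain b' where "T b'" "eq E b' (\<sigma> 1)"
            and h: "cv E (scons a' (\<lambda>_. b')) (\<lambda>_. FConst Succ) (C2 k) z" by blast
          then show ?case unfolding a[unfolded C2]
            by (rule_tac argsem_cong[where D = Df and c = "C2 k", OF wkv_Df _ _ z z _ _ h])
              (use z T\<sigma> a'(1) eq_mono[OF a'(2) 3(1)] in \<open>simp_all add: eqenv_scons eqenv_const\<close>)
        qed (use ok z in simp_all)
      qed (use ok z in simp_all)
    next
      assume "cv \<Gamma> \<sigma> \<tau> (C2 k) z"
      then show "loc \<Gamma> (\<lambda>\<Delta>. \<exists>a. T a \<and> eq \<Delta> a (\<sigma> 0) \<and> loc \<Delta> (\<lambda>\<Delta>. \<exists>b. T b \<and> eq \<Delta> b (\<sigma> 1) \<and>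
        cv \<Delta> (scons a (\<lambda>_. b)) (\<lambda>_. FConst Succ) (C2 k) z))"
        unfolding a[unfolded C2] using T\<sigma> by (intro locI exI[of _ "\<sigma> 0"] exI[of _ "\<sigma> 1"] conjI) simp_all
    qed
  next
    case (CF k)
    have a: "cv \<Delta> \<sigma> \<tau> c z \<longleftrightarrow> cv \<Delta> (\<lambda>_. \<sigma> 0) (\<lambda>_. \<tau> 0) c z" for \<Delta>
      by (rule cv_agree) (use ok z T\<sigma> U\<tau> CF in auto)
    show ?thesis unfolding CF lhs.simps val.simps valf.simps
    proof
      assume "loc \<Gamma> (\<lambda>\<Delta>. \<exists>a. T a \<and> eq \<Delta> a (\<sigma> 0) \<and> loc \<Delta> (\<lambda>\<Delta>. \<exists>\<gamma>. U \<gamma> \<and>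
        (\<forall>x. T x \<longrightarrow> eq \<Delta> (App \<gamma> x) (App (\<tau> 0) x)) \<and> cv \<Delta> (\<lambda>_. a) (\<lambda>_. \<gamma>) (CF k) z))"
      then show "cv \<Gamma> \<sigma> \<tau> (CF k) z"
      proof (rule fc_locE, goal_cases)
        case (3 \<Delta>)
        then obtain a' where a': "T a'" "eq \<Delta> a' (\<sigma> 0)"
          and l: "loc \<Delta> (\<lambda>\<Delta>. \<exists>\<gamma>. U \<gamma> \<and> (\<forall>x. T x \<longrightarrow> eq \<Delta> (App \<gamma> x) (App (\<tau> 0) x)) \<and> cv \<Delta> (\<lambda>_. a') (\<lambda>_. \<gamma>) (CF k) z)" by blast
        from l show ?case
        proof (rule fc_locE, goal_cases)
          case (3 E)
          then obtain \<gamma> where "U \<gamma>" "eqf E \<gamma> (\<tau> 0)"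
            and h: "cv E (\<lambda>_. a') (\<lambda>_. \<gamma>) (CF k) z" unfolding eqf_def by blast
          then show ?case unfolding a[unfolded CF]
            by (rule_tac argsem_cong[where D = Df and c = "CF k", OF wkv_Df _ _ z z _ _ h])
              (use z T\<sigma> U\<tau> a'(1) eq_mono[OF a'(2) 3(1)] in \<open>simp_all add: eqenv_const\<close>)
        qed (use ok z in simp_all)
      qed (use ok z in simp_all)
    next
      assume "cv \<Gamma> \<sigma> \<tau> (CF k) z"
      then show "loc \<Gamma> (\<lambda>\<Delta>. \<exists>a. T a \<and> eq \<Delta> a (\<sigma> 0) \<and> loc \<Delta> (\<lambda>\<Delta>. \<exists>\<gamma>. U \<gamma> \<and>
        (\<forall>x. T x \<longrightarrow> eq \<Delta> (App \<gamma> x) (App (\<tau> 0) x)) \<and> cv \<Delta> (\<lambda>_. a) (\<lambda>_. \<gamma>) (CF k) z))"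
        unfolding a[unfolded CF] using T\<sigma> U\<tau> by (intro locI exI[of _ "\<sigma> 0"] exI[of _ "\<tau> 0"] conjI) simp_all
    qed
  qed
qed

text \<open>The reading of a formula of M^j in the system at hand. In WKV it gives soundness; in M^j
  it is compared with \<open>fc\<close>.\<close>

definition tc :: "fm list \<Rightarrow> (nat \<Rightarrow> trm) \<Rightarrow> (nat \<Rightarrow> ftr) \<Rightarrow> fm \<Rightarrow> bool" where
  "tc \<Gamma> \<sigma> \<tau> A \<longleftrightarrow> fc \<Gamma> \<sigma> \<tau> (tr A)"

lemma tc_simps:
  "tc \<Gamma> \<sigma> \<tau> (And A B) \<longleftrightarrow> tc \<Gamma> \<sigma> \<tau> A \<and> tc \<Gamma> \<sigma> \<tau> B"
  "ok \<sigma> \<tau> \<Longrightarrow> tc \<Gamma> \<sigma> \<tau> (Or A B) \<longleftrightarrow> loc \<Gamma> (\<lambda>\<Delta>. tc \<Delta> \<sigma> \<tau> A \<or> tc \<Delta> \<sigma> \<tau> B)"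
  "ok \<sigma> \<tau> \<Longrightarrow> tc \<Gamma> \<sigma> \<tau> (Imp A B) \<longleftrightarrow> (\<forall>\<Delta>. \<Gamma> \<sqsubseteq> \<Delta> \<longrightarrow> tc \<Delta> \<sigma> \<tau> A \<longrightarrow> tc \<Delta> \<sigma> \<tau> B)"
  "ok \<sigma> \<tau> \<Longrightarrow> tc \<Gamma> \<sigma> \<tau> (Neg A) \<longleftrightarrow> (\<forall>\<Delta>. \<Gamma> \<sqsubseteq> \<Delta> \<longrightarrow> tc \<Delta> \<sigma> \<tau> A \<longrightarrow> (\<forall>C. Lg C \<longrightarrow> pv \<Delta> C))"
  "tc \<Gamma> \<sigma> \<tau> (AllN A) \<longleftrightarrow> (\<forall>t. T t \<longrightarrow> tc \<Gamma> (scons t \<sigma>) \<tau> A)"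
  "tc \<Gamma> \<sigma> \<tau> (AllF A) \<longleftrightarrow> (\<forall>u. U u \<longrightarrow> tc \<Gamma> \<sigma> (scons u \<tau>) A)"
  "ok \<sigma> \<tau> \<Longrightarrow> tc \<Gamma> \<sigma> \<tau> (ExN A) \<longleftrightarrow> loc \<Gamma> (\<lambda>\<Delta>. \<exists>t. T t \<and> tc \<Delta> (scons t \<sigma>) \<tau> A)"
  "ok \<sigma> \<tau> \<Longrightarrow> tc \<Gamma> \<sigma> \<tau> (ExF A) \<longleftrightarrow> loc \<Gamma> (\<lambda>\<Delta>. \<exists>u. U u \<and> tc \<Delta> \<sigma> (scons u \<tau>) A)"
  by (simp_all add: tc_def fc_simps)

lemma tc_mono: "tc \<Gamma> \<sigma> \<tau> A \<Longrightarrow> \<Gamma> \<sqsubseteq> \<Delta> \<Longrightarrow> tc \<Delta> \<sigma> \<tau> A"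
  unfolding tc_def by (rule fc_mono)

lemma tc_locE: "loc \<Gamma> P \<Longrightarrow> ok \<sigma> \<tau> \<Longrightarrow> (\<And>\<Delta>. \<Gamma> \<sqsubseteq> \<Delta> \<Longrightarrow> P \<Delta> \<Longrightarrow> tc \<Delta> \<sigma> \<tau> A) \<Longrightarrow> tc \<Gamma> \<sigma> \<tau> A"
  unfolding tc_def by (erule fc_locE) simp_all

text \<open>On WKV terms having a common value is provably the same as being equal. Hence the case
  distinction in \<open>tr\<close> is invisible from here on.\<close>

lemma tc_Eq:
  assumes ok: "ok \<sigma> \<tau>"
  shows "tc \<Gamma> \<sigma> \<tau> (Eq s t) \<longleftrightarrow> loc \<Gamma> (\<lambda>\<Delta>. \<exists>z. T z \<and> v \<Delta> \<sigma> \<tau> s z \<and> v \<Delta> \<sigma> \<tau> t z)"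
proof (cases "wkv_trm s \<and> wkv_trm t")
  case True
  let ?s = "sub_trm \<sigma> \<tau> s" and ?t = "sub_trm \<sigma> \<tau> t"
  have T: "T ?s" "T ?t" using True ok by (simp_all add: wkv_T)
  have s: "v \<Delta> \<sigma> \<tau> s z \<longleftrightarrow> eq \<Delta> z ?s" and t: "v \<Delta> \<sigma> \<tau> t z \<longleftrightarrow> eq \<Delta> z ?t" if "T z" for \<Delta> z
    using True v_wkv[OF _ ok that] by blast+
  have "eq \<Gamma> ?s ?t \<longleftrightarrow> loc \<Gamma> (\<lambda>\<Delta>. \<exists>z. T z \<and> v \<Delta> \<sigma> \<tau> s z \<and> v \<Delta> \<sigma> \<tau> t z)"
  proof
    assume "eq \<Gamma> ?s ?t"
    then show "loc \<Gamma> (\<lambda>\<Delta>. \<exists>z. T z \<and> v \<Delta> \<sigma> \<tau> s z \<and> v \<Delta> \<sigma> \<tau> t z)"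
      using T s[OF T(1)] t[OF T(1)] by (intro locI exI[of _ ?s] conjI) simp_all
  next
    assume "loc \<Gamma> (\<lambda>\<Delta>. \<exists>z. T z \<and> v \<Delta> \<sigma> \<tau> s z \<and> v \<Delta> \<sigma> \<tau> t z)"
    then show "eq \<Gamma> ?s ?t" by (rule eq_locE[OF _ T]) (use s t eq_euclid in blast)
  qed
  then show ?thesis using True by (simp add: tc_def fc_simps)
next
  case False
  then have "tr (Eq s t) = ExN (And (graph Df [] 1 0 s) (graph Df [] 1 0 t))" by simp
  then show ?thesis using ok unfolding tc_def
    by (simp add: fc_simps Lg_graph[OF wkv_Df] v_graph cong: conj_cong)
qed

text \<open>The left side has a value by totality, so carrying values from left to right is
  enough.\<close>

lemma tc_EqI:
  assumes ok: "ok \<sigma> \<tau>" and "\<And>\<Delta> z. \<Gamma> \<sqsubseteq> \<Delta> \<Longrightarrow> T z \<Longrightarrow> v \<Delta> \<sigma> \<tau> s z \<Longrightarrow> v \<Delta> \<sigma> \<tau> t z"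
  shows "tc \<Gamma> \<sigma> \<tau> (Eq s t)"
  unfolding tc_Eq[OF ok]
  using v_total(1)[OF ok, of \<Gamma> s] assms(2) unfolding uex_def by (elim conjE loc_map) blast

text \<open>Takes the place of commuting \<open>tr\<close> with substitution: the effect of
  substituting terms of M^j is that of an environment holding their values.\<close>

lemma tc_sub:
  "ok \<sigma>' \<tau>' \<Longrightarrow> ok \<sigma>'' \<tau>'' \<Longrightarrow> (\<And>n. v \<Gamma> \<sigma>' \<tau>' (\<sigma> n) (\<sigma>'' n)) \<Longrightarrow>
   (\<And>n x. T x \<Longrightarrow> vf \<Gamma> \<sigma>' \<tau>' (\<tau> n) x (App (\<tau>'' n) x)) \<Longrightarrow>
   tc \<Gamma> \<sigma>' \<tau>' (sub_fm \<sigma> \<tau> A) \<longleftrightarrow> tc \<Gamma> \<sigma>'' \<tau>'' A"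
proof (induction A arbitrary: \<Gamma> \<sigma> \<sigma>' \<sigma>'' \<tau> \<tau>' \<tau>'')
  case (Eq s t)
  have "v \<Delta> \<sigma>' \<tau>' (sub_trm \<sigma> \<tau> r) z \<longleftrightarrow> v \<Delta> \<sigma>'' \<tau>'' r z" if "\<Gamma> \<sqsubseteq> \<Delta>" "T z" for \<Delta> z r
    by (rule v_sub(1)[OF Eq.prems(1,2) that(2) val_mono(1)[OF Eq.prems(3) that(1)] val_mono(2)[OF Eq.prems(4) that(1)]])
  then show ?case unfolding sub_fm.simps tc_Eq[OF Eq.prems(1)] tc_Eq[OF Eq.prems(2)]
    by (intro loc_cong ex_cong1 conj_cong refl) blast+
next
  case (And A B)
  have "tc \<Gamma> \<sigma>' \<tau>' (sub_fm \<sigma> \<tau> A) \<longleftrightarrow> tc \<Gamma> \<sigma>'' \<tau>'' A" "tc \<Gamma> \<sigma>' \<tau>' (sub_fm \<sigma> \<tau> B) \<longleftrightarrow> tc \<Gamma> \<sigma>'' \<tau>'' B"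
    by (rule And.IH[OF And.prems(1,2,3,4)], assumption)+
  then show ?case unfolding sub_fm.simps tc_simps by simp
next
  case (Or A B)
  have "tc \<Delta> \<sigma>' \<tau>' (sub_fm \<sigma> \<tau> A) \<longleftrightarrow> tc \<Delta> \<sigma>'' \<tau>'' A" "tc \<Delta> \<sigma>' \<tau>' (sub_fm \<sigma> \<tau> B) \<longleftrightarrow> tc \<Delta> \<sigma>'' \<tau>'' B" if "\<Gamma> \<sqsubseteq> \<Delta>" for \<Delta>
    by (rule Or.IH[OF Or.prems(1,2) val_mono(1)[OF Or.prems(3) that] val_mono(2)[OF Or.prems(4) that]], assumption)+
  then show ?case unfolding sub_fm.simps tc_simps(2)[OF Or.prems(1)] tc_simps(2)[OF Or.prems(2)]
    by (intro loc_cong) blast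
next
  case (Imp A B)
  have "tc \<Delta> \<sigma>' \<tau>' (sub_fm \<sigma> \<tau> A) \<longleftrightarrow> tc \<Delta> \<sigma>'' \<tau>'' A" "tc \<Delta> \<sigma>' \<tau>' (sub_fm \<sigma> \<tau> B) \<longleftrightarrow> tc \<Delta> \<sigma>'' \<tau>'' B" if "\<Gamma> \<sqsubseteq> \<Delta>" for \<Delta>
    by (rule Imp.IH[OF Imp.prems(1,2) val_mono(1)[OF Imp.prems(3) that] val_mono(2)[OF Imp.prems(4) that]], assumption)+
  then show ?case unfolding sub_fm.simps tc_simps(3)[OF Imp.prems(1)] tc_simps(3)[OF Imp.prems(2)] by blast
next
  case (Neg A)
  have "tc \<Delta> \<sigma>' \<tau>' (sub_fm \<sigma> \<tau> A) \<longleftrightarrow> tc \<Delta> \<sigma>'' \<tau>'' A" if "\<Gamma> \<sqsubseteq> \<Delta>" for \<Delta>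
    by (rule Neg.IH[OF Neg.prems(1,2) val_mono(1)[OF Neg.prems(3) that] val_mono(2)[OF Neg.prems(4) that]], assumption)
  then show ?case unfolding sub_fm.simps tc_simps(4)[OF Neg.prems(1)] tc_simps(4)[OF Neg.prems(2)] by blast
next
  case (AllN A)
  have *: "tc \<Gamma> (scons x \<sigma>') \<tau>' (sub_fm (upN_trm \<sigma>) (upN_ftr \<tau>) A) \<longleftrightarrow> tc \<Gamma> (scons x \<sigma>'') \<tau>'' A" if x: "T x" for x
  proof (rule AllN.IH)
    show "v \<Gamma> (scons x \<sigma>') \<tau>' (upN_trm \<sigma> n) (scons x \<sigma>'' n)" for n
      using AllN.prems(3) x by (cases n) (simp_all add: val_ren)
    show "vf \<Gamma> (scons x \<sigma>') \<tau>' (upN_ftr \<tau> n) y (App (\<tau>'' n) y)" if "T y" for n y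
      using AllN.prems(4)[OF that] by (simp add: val_ren)
  qed (use AllN.prems x in simp_all)
  show ?case unfolding sub_fm.simps tc_simps using * by blast
next
  case (ExN A)
  have *: "tc \<Delta> (scons x \<sigma>') \<tau>' (sub_fm (upN_trm \<sigma>) (upN_ftr \<tau>) A) \<longleftrightarrow> tc \<Delta> (scons x \<sigma>'') \<tau>'' A"
    if x: "T x" and D: "\<Gamma> \<sqsubseteq> \<Delta>" for x \<Delta>
  proof (rule ExN.IH)
    show "v \<Delta> (scons x \<sigma>') \<tau>' (upN_trm \<sigma> n) (scons x \<sigma>'' n)" for n
      using val_mono(1)[OF ExN.prems(3) D] x by (cases n) (simp_all add: val_ren)
    show "vf \<Delta> (scons x \<sigma>') \<tau>' (upN_ftr \<tau> n) y (App (\<tau>'' n) y)" if "T y" for n y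
      using val_mono(2)[OF ExN.prems(4)[OF that] D] by (simp add: val_ren)
  qed (use ExN.prems x in simp_all)
  show ?case unfolding sub_fm.simps tc_simps(7)[OF ExN.prems(1)] tc_simps(7)[OF ExN.prems(2)]
    using * by (intro loc_cong ex_cong1 conj_cong refl) blast
next
  case (AllF A)
  have *: "tc \<Gamma> \<sigma>' (scons u \<tau>') (sub_fm (upF_trm \<sigma>) (upF_ftr \<tau>) A) \<longleftrightarrow> tc \<Gamma> \<sigma>'' (scons u \<tau>'') A" if u: "U u" for u
  proof (rule AllF.IH)
    show "v \<Gamma> \<sigma>' (scons u \<tau>') (upF_trm \<sigma> n) (\<sigma>'' n)" for n
      using AllF.prems(3) by (simp add: val_ren)
    show "vf \<Gamma> \<sigma>' (scons u \<tau>') (upF_ftr \<tau> n) y (App (scons u \<tau>'' n) y)" if "T y" for n y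
      using AllF.prems(4)[OF that] that u by (cases n) (simp_all add: val_ren)
  qed (use AllF.prems u in simp_all)
  show ?case unfolding sub_fm.simps tc_simps using * by blast
next
  case (ExF A)
  have *: "tc \<Delta> \<sigma>' (scons u \<tau>') (sub_fm (upF_trm \<sigma>) (upF_ftr \<tau>) A) \<longleftrightarrow> tc \<Delta> \<sigma>'' (scons u \<tau>'') A"
    if u: "U u" and D: "\<Gamma> \<sqsubseteq> \<Delta>" for u \<Delta>
  proof (rule ExF.IH)
    show "v \<Delta> \<sigma>' (scons u \<tau>') (upF_trm \<sigma> n) (\<sigma>'' n)" for n
      using val_mono(1)[OF ExF.prems(3) D] by (simp add: val_ren)
    show "vf \<Delta> \<sigma>' (scons u \<tau>') (upF_ftr \<tau> n) y (App (scons u \<tau>'' n) y)" if "T y" for n y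
      using val_mono(2)[OF ExF.prems(4)[OF that] D] that u by (cases n) (simp_all add: val_ren)
  qed (use ExF.prems u in simp_all)
  show ?case unfolding sub_fm.simps tc_simps(8)[OF ExF.prems(1)] tc_simps(8)[OF ExF.prems(2)]
    using * by (intro loc_cong ex_cong1 conj_cong refl) blast
qed

lemma tc_ren:
  assumes ok: "ok \<sigma> \<tau>"
  shows "tc \<Gamma> \<sigma> \<tau> (ren_fm \<rho> \<phi> A) \<longleftrightarrow> tc \<Gamma> (\<lambda>n. \<sigma> (\<rho> n)) (\<lambda>n. \<tau> (\<phi> n)) A"
  unfolding ren_fm_sub_fm using ok by (intro tc_sub) (simp_all add: ok_def)

lemma tc_liftN: "ok \<sigma> \<tau> \<Longrightarrow> T t \<Longrightarrow> tc \<Gamma> (scons t \<sigma>) \<tau> (liftN A) \<longleftrightarrow> tc \<Gamma> \<sigma> \<tau> A"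
  by (simp add: liftN_def tc_ren)

lemma tc_liftF: "ok \<sigma> \<tau> \<Longrightarrow> U u \<Longrightarrow> tc \<Gamma> \<sigma> (scons u \<tau>) (liftF A) \<longleftrightarrow> tc \<Gamma> \<sigma> \<tau> A"
  by (simp add: liftF_def tc_ren)

lemma tc_instN:
  assumes "ok \<sigma> \<tau>" "T z" "v \<Gamma> \<sigma> \<tau> t z"
  shows "tc \<Gamma> \<sigma> \<tau> (instN t A) \<longleftrightarrow> tc \<Gamma> (scons z \<sigma>) \<tau> A"
  unfolding instN_def
proof (rule tc_sub)
  show "v \<Gamma> \<sigma> \<tau> (scons t NVar n) (scons z \<sigma> n)" for n
    using assms by (cases n) (simp_all add: okD)
qed (use assms in \<open>simp_all add: okD\<close>)

lemma tc_instF: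
  assumes "ok \<sigma> \<tau>" "U \<gamma>" "\<forall>x. T x \<longrightarrow> vf \<Gamma> \<sigma> \<tau> u x (App \<gamma> x)"
  shows "tc \<Gamma> \<sigma> \<tau> (instF u A) \<longleftrightarrow> tc \<Gamma> \<sigma> (scons \<gamma> \<tau>) A"
  unfolding instF_def
proof (rule tc_sub)
  show "vf \<Gamma> \<sigma> \<tau> (scons u FVar n) x (App (scons \<gamma> \<tau> n) x)" if "T x" for n x
    using assms that by (cases n) (simp_all add: okD)
qed (use assms in \<open>simp_all add: okD\<close>)

lemma v_witness: "ok \<sigma> \<tau> \<Longrightarrow> loc \<Gamma> (\<lambda>\<Delta>. \<exists>z. T z \<and> v \<Delta> \<sigma> \<tau> t z)"
  using v_total(1) unfolding uex_def by blast

text \<open>The rules for function quantifiers mention functors of M^j; AC00! supplies one of the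
  language with the same values.\<close>

lemma vf_witness:
  assumes ok: "ok \<sigma> \<tau>"
  shows "loc \<Gamma> (\<lambda>\<Delta>. \<exists>\<gamma>. U \<gamma> \<and> (\<forall>x. T x \<longrightarrow> vf \<Delta> \<sigma> \<tau> u x (App \<gamma> x)))"
proof -
  note g = valf_graph[OF wkv_Df ok]
  have "loc \<Gamma> (\<lambda>\<Delta>. \<exists>\<gamma>. U \<gamma> \<and> (\<forall>x. T x \<longrightarrow> fc \<Delta> (scons (App \<gamma> x) (scons x \<sigma>)) \<tau> (graphf Df [] 2 0 u)))"
  proof (rule choice)
    fix x assume x: "T x"
    show "uex \<Gamma> (\<lambda>\<Delta> z. fc \<Delta> (scons z (scons x \<sigma>)) \<tau> (graphf Df [] 2 0 u))"
      using v_total(2)[OF ok x] by (subst uex_cong[OF g[OF _ x, symmetric]])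
  qed (use ok Lg_graph[OF wkv_Df] in simp_all)
  then show ?thesis by (rule loc_map) (use g in auto)
qed

end

lemma Mj_axioms: "axioms Mj = common_axioms \<union> (\<Union>c. cst_axioms c)"
  by (simp add: Mj_def defining_axioms[symmetric] Un_assoc)

lemma lang_Mj: "lang Mj = UNIV"
  by (simp add: Mj_def)

context system
begin

lemma tc_common_wkv: "A \<in> common_axioms \<Longrightarrow> wkv_fm A \<Longrightarrow> ok \<sigma> \<tau> \<Longrightarrow> tc \<Gamma> \<sigma> \<tau> A"
  by (simp add: tc_def tr_wkv fc_common wkv_T)

lemma tc_lambda:
  assumes ok: "ok \<sigma> \<tau>"
  shows "tc \<Gamma> \<sigma> \<tau> (Eq (App (Lam t) s) (sub_trm (scons s NVar) FVar t))"
proof (rule tc_EqI[OF ok])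
  fix \<Delta> z assume z: "T z" and "v \<Delta> \<sigma> \<tau> (App (Lam t) s) z"
  then have "loc \<Delta> (\<lambda>\<Delta>. \<exists>a. T a \<and> v \<Delta> \<sigma> \<tau> s a \<and> v \<Delta> (scons a \<sigma>) \<tau> t z)" by simp
  then show "v \<Delta> \<sigma> \<tau> (sub_trm (scons s NVar) FVar t) z"
  proof (rule v_locE[OF _ ok z], elim exE conjE)
    fix E a assume a: "T a" "v E \<sigma> \<tau> s a" and t: "v E (scons a \<sigma>) \<tau> t z"
    have "v E \<sigma> \<tau> (sub_trm (scons s NVar) FVar t) z \<longleftrightarrow> v E (scons a \<sigma>) \<tau> t z"
    proof (rule v_sub(1))
      show "v E \<sigma> \<tau> (scons s NVar n) (scons a \<sigma> n)" for n
        using a ok by (cases n) (simp_all add: okD)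
    qed (use ok a z in \<open>simp_all add: okD\<close>)
    with t show "v E \<sigma> \<tau> (sub_trm (scons s NVar) FVar t) z" by simp
  qed
qed

text \<open>This is induction for the WKV formula \<open>tr A\<close>; \<open>tc_sub\<close> only
  has to relate its instances at zero and at the successor.\<close>

lemma tc_induction:
  assumes ok: "ok \<sigma> \<tau>"
  shows "tc \<Gamma> \<sigma> \<tau> (Imp (And (instN Zero A)
    (AllN (Imp A (sub_fm (scons (S' (NVar 0)) (\<lambda>n. NVar (Suc n))) FVar A)))) (AllN A))"
  unfolding tc_simps(3)[OF ok]
proof (intro allI impI)
  let ?B = "sub_fm (scons (S' (NVar 0)) (\<lambda>n. NVar (Suc n))) FVar A"
  fix \<Delta> assume D: "\<Gamma> \<sqsubseteq> \<Delta>" and "tc \<Delta> \<sigma> \<tau> (And (instN Zero A) (AllN (Imp A ?B)))"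
  then have 0: "tc \<Delta> \<sigma> \<tau> (instN Zero A)" and 1: "tc \<Delta> \<sigma> \<tau> (AllN (Imp A ?B))"
    by (simp_all add: tc_simps(1))
  show "tc \<Delta> \<sigma> \<tau> (AllN A)"
    unfolding tc_simps(5)
  proof (intro allI impI)
    fix t assume t: "T t"
    show "tc \<Delta> (scons t \<sigma>) \<tau> A" unfolding tc_def
    proof (rule fc_induct[OF _ ok _ t])
      show "fc \<Delta> (scons Zero \<sigma>) \<tau> (tr A)"
        using 0 tc_instN[OF ok T_simps(2), of \<Delta> Zero A] by (simp add: tc_def)
      fix E y assume E: "\<Delta> \<sqsubseteq> E" and y: "T y" and A: "fc E (scons y \<sigma>) \<tau> (tr A)"
      have oky: "ok (scons y \<sigma>) \<tau>" using ok y by simp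
      have "tc \<Delta> (scons y \<sigma>) \<tau> (Imp A ?B)" using 1 y unfolding tc_simps(5) by blast
      then have "tc E (scons y \<sigma>) \<tau> ?B"
        unfolding tc_simps(3)[OF oky] using E A[folded tc_def] by blast
      also have "tc E (scons y \<sigma>) \<tau> ?B \<longleftrightarrow> tc E (scons (S' y) \<sigma>) \<tau> A"
      proof (rule tc_sub)
        show "v E (scons y \<sigma>) \<tau> (scons (S' (NVar 0)) (\<lambda>n. NVar (Suc n)) n) (scons (S' y) \<sigma> n)" for n
          by (cases n) (use ok y in \<open>simp_all add: okD v_wkv del: val.simps\<close>)
      qed (use ok y in \<open>simp_all add: okD\<close>)
      finally show "fc E (scons (S' y) \<sigma>) \<tau> (tr A)" unfolding tc_def .
    qed simp
  qed
qed

text \<open>Only the renaming inside the uniqueness clause stands between the two sides, and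
  \<open>tc_ren\<close> absorbs it.\<close>

lemma tc_ExUniqueN:
  assumes ok: "ok \<sigma> \<tau>"
  shows "tc \<Gamma> \<sigma> \<tau> (ExUniqueN A) \<longleftrightarrow> fc \<Gamma> \<sigma> \<tau> (ExUniqueN (tr A))"
  using ok
  by (simp add: ExUniqueN_def tc_simps fc_simps fc_ren tc_ren scons_up_ren' tc_def[symmetric]
      cong: conj_cong imp_cong) (simp add: tc_def fc_simps)

lemma tc_AC:
  assumes ok: "ok \<sigma> \<tau>"
  shows "tc \<Gamma> \<sigma> \<tau> (Imp (AllN (ExUniqueN A))
     (ExF (AllN (sub_fm (scons (App (FVar 0) (NVar 0)) NVar) (\<lambda>n. FVar (Suc n)) A))))"
  unfolding tc_simps(3)[OF ok] tc_simps(8)[OF ok] tc_simps(5)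
proof (intro allI impI)
  let ?B = "sub_fm (scons (App (FVar 0) (NVar 0)) NVar) (\<lambda>n. FVar (Suc n)) A"
  fix \<Delta> assume ex: "\<forall>t. T t \<longrightarrow> tc \<Delta> (scons t \<sigma>) \<tau> (ExUniqueN A)"
  have "loc \<Delta> (\<lambda>\<Delta>. \<exists>\<gamma>. U \<gamma> \<and> (\<forall>x. T x \<longrightarrow> fc \<Delta> (scons (App \<gamma> x) (scons x \<sigma>)) \<tau> (tr A)))"
  proof (rule fc_AC[OF _ ok])
    show "fc \<Delta> \<sigma> \<tau> (AllN (ExUniqueN (tr A)))"
      unfolding fc_simps using ex ok tc_ExUniqueN by simp
  qed simp
  then show "loc \<Delta> (\<lambda>\<Delta>. \<exists>u. U u \<and> (\<forall>t. T t \<longrightarrow> tc \<Delta> (scons t \<sigma>) (scons u \<tau>) ?B))"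
  proof (rule loc_map, elim exE conjE)
    fix E \<gamma> assume \<gamma>: "U \<gamma>" and A: "\<forall>x. T x \<longrightarrow> fc E (scons (App \<gamma> x) (scons x \<sigma>)) \<tau> (tr A)"
    have "tc E (scons x \<sigma>) (scons \<gamma> \<tau>) ?B" if x: "T x" for x
    proof -
      have "tc E (scons x \<sigma>) (scons \<gamma> \<tau>) ?B \<longleftrightarrow> tc E (scons (App \<gamma> x) (scons x \<sigma>)) \<tau> A"
      proof (rule tc_sub)
        show "v E (scons x \<sigma>) (scons \<gamma> \<tau>) (scons (App (FVar 0) (NVar 0)) NVar n) (scons (App \<gamma> x) (scons x \<sigma>) n)" for n
          using ok x \<gamma> by (cases n) (simp_all add: okD v_wkv[of _ "scons x \<sigma>" "scons \<gamma> \<tau>"] del: val.simps)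
      qed (use ok x \<gamma> in \<open>simp_all add: okD\<close>)
      then show ?thesis using A x unfolding tc_def by blast
    qed
    with \<gamma> show "\<exists>u. U u \<and> (\<forall>t. T t \<longrightarrow> tc E (scons t \<sigma>) (scons u \<tau>) ?B)" by blast
  qed
qed

lemma v_upd:
  assumes ok: "ok \<sigma> \<tau>" and a: "T a" "v \<Gamma> \<sigma> \<tau> s a" and z: "T z"
  shows "v \<Gamma> \<sigma> \<tau> (sub_trm (NVar(r := s)) FVar t) z \<longleftrightarrow> v \<Gamma> (\<sigma>(r := a)) \<tau> t z"
proof (rule v_sub(1))
  show "ok (\<sigma>(r := a)) \<tau>" using ok a by (simp add: ok_def)
qed (use assms in \<open>simp_all add: okD\<close>)

text \<open>For an explicit body \<open>Df c\<close> is the graph of the right-hand side; for a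
  recursion the two axioms are the zero and successor equations of its formula.\<close>

lemma tc_defining:
  assumes A: "A \<in> cst_axioms c" and ok: "ok \<sigma> \<tau>"
  shows "tc \<Gamma> \<sigma> \<tau> A"
proof (cases "defn c")
  case (Base t)
  with A show ?thesis by simp
next
  case (Expl t)
  have A: "A = Eq (lhs c) t" using A Expl by simp
  show ?thesis unfolding A
  proof (rule tc_EqI[OF ok])
    fix \<Delta> z assume z: "T z" and "v \<Delta> \<sigma> \<tau> (lhs c) z"
    then have "cv \<Delta> \<sigma> \<tau> c z" using v_lhs[OF ok z] by blast
    then show "v \<Delta> \<sigma> \<tau> t z" using Expl Df_eq[of c] v_graph[OF ok z] by simp
  qed
next
  case (Rec r t\<^sub>0 t\<^sub>1)
  have D: "Df c = graph_body Df (Rec r t\<^sub>0 t\<^sub>1)" using Df_eq[of c] Rec by simp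
  have tot: "\<forall>c\<in>csts t\<^sub>0. total Df c" "\<forall>c\<in>csts t\<^sub>1. total Df c" using total_Df by blast+
  have "A = Eq (sub_trm (NVar(r := Zero)) FVar (lhs c)) (sub_trm (NVar(r := Zero)) FVar t\<^sub>0)
      \<or> A = Eq (sub_trm (NVar(r := S' (NVar r))) FVar (lhs c)) (sub_trm (scons (lhs c) NVar) FVar t\<^sub>1)"
    using A Rec by simp
  then show ?thesis
  proof
    assume A: "A = Eq (sub_trm (NVar(r := Zero)) FVar (lhs c)) (sub_trm (NVar(r := Zero)) FVar t\<^sub>0)"
    show ?thesis unfolding A
    proof (rule tc_EqI[OF ok])
      fix \<Delta> z assume z: "T z" and *: "v \<Delta> \<sigma> \<tau> (sub_trm (NVar(r := Zero)) FVar (lhs c)) z"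
      have 0: "v \<Delta> \<sigma> \<tau> Zero Zero" by simp
      have ok': "ok (\<sigma>(r := Zero)) \<tau>" using ok by (simp add: ok_def)
      show "v \<Delta> \<sigma> \<tau> (sub_trm (NVar(r := Zero)) FVar t\<^sub>0) z"
        using * unfolding v_upd[OF ok T_simps(2) 0 z] v_lhs[OF ok' z] argsem_Rec_Zero[OF wkv_Df D tot ok z] .
    qed
  next
    assume A: "A = Eq (sub_trm (NVar(r := S' (NVar r))) FVar (lhs c)) (sub_trm (scons (lhs c) NVar) FVar t\<^sub>1)"
    show ?thesis unfolding A
    proof (rule tc_EqI[OF ok])
      fix \<Delta> z assume z: "T z" and *: "v \<Delta> \<sigma> \<tau> (sub_trm (NVar(r := S' (NVar r))) FVar (lhs c)) z"
      have r: "T (\<sigma> r)" "T (S' (\<sigma> r))" using ok by (simp_all add: okD)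
      have S: "v \<Delta> \<sigma> \<tau> (S' (NVar r)) (S' (\<sigma> r))"
        using ok r by (simp add: v_wkv del: val.simps)
      have ok': "ok (\<sigma>(r := S' (\<sigma> r))) \<tau>" using ok r by (simp add: ok_def)
      have "loc \<Delta> (\<lambda>\<Delta>. \<exists>w. T w \<and> cv \<Delta> \<sigma> \<tau> c w \<and> v \<Delta> (scons w \<sigma>) \<tau> t\<^sub>1 z)"
        using * argsem_Rec_Suc[OF wkv_Df D tot ok z r(1), of \<Delta>]
        unfolding v_upd[OF ok r(2) S z] v_lhs[OF ok' z] by simp
      then show "v \<Delta> \<sigma> \<tau> (sub_trm (scons (lhs c) NVar) FVar t\<^sub>1) z"
      proof (rule v_locE[OF _ ok z], elim exE conjE)
        fix E w assume w: "T w" "cv E \<sigma> \<tau> c w" "v E (scons w \<sigma>) \<tau> t\<^sub>1 z"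
        have "v E \<sigma> \<tau> (sub_trm (scons (lhs c) NVar) FVar t\<^sub>1) z \<longleftrightarrow> v E (scons w \<sigma>) \<tau> t\<^sub>1 z"
        proof (rule v_sub(1))
          show "v E \<sigma> \<tau> (scons (lhs c) NVar n) (scons w \<sigma> n)" for n
            using ok w by (cases n) (simp_all add: okD v_lhs)
        qed (use ok w z in \<open>simp_all add: okD\<close>)
        with w(3) show "v E \<sigma> \<tau> (sub_trm (scons (lhs c) NVar) FVar t\<^sub>1) z" by simp
      qed
    qed
  qed
qed

lemma tc_Mj_axiom:
  assumes "A \<in> axioms Mj" and ok: "ok \<sigma> \<tau>"
  shows "tc \<Gamma> \<sigma> \<tau> A"
proof -
  consider "A \<in> common_axioms" "wkv_fm A" | "A \<in> lambda_conversion" | "A \<in> induction_schema"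
    | "A \<in> AC00_unique" | c where "A \<in> cst_axioms c"
    using assms(1) unfolding Mj_axioms common_axioms_def
    by (auto simp: eq_axioms_def arith_axioms_def pairing_axioms_def)
  then show ?thesis
  proof cases
    case 1 then show ?thesis using ok by (simp add: tc_common_wkv)
  next
    case 2 then show ?thesis unfolding lambda_conversion_def mem_Collect_eq
      by (elim exE conjE) (simp only: tc_lambda[OF ok])
  next
    case 3 then show ?thesis unfolding induction_schema_def mem_Collect_eq
      by (elim exE conjE) (simp only: tc_induction[OF ok])
  next
    case 4 then show ?thesis unfolding AC00_unique_def mem_Collect_eq
      by (elim exE conjE) (simp only: tc_AC[OF ok])
  next
    case 5 then show ?thesis using ok by (rule tc_defining)
  qed
qed

text \<open>The environment and the interpreting context are arbitrary: the quantifier rules extend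
  the former, while discharged assumptions, disjunctions and witnesses enlarge the latter.\<close>

theorem tc_sound:
  "nd UNIV (axioms Mj) \<Theta> E \<Longrightarrow> ok \<sigma> \<tau> \<Longrightarrow> (\<And>A. A \<in> \<Theta> \<Longrightarrow> tc \<Gamma> \<sigma> \<tau> A) \<Longrightarrow> tc \<Gamma> \<sigma> \<tau> E"
proof (induction arbitrary: \<Gamma> \<sigma> \<tau> rule: nd.induct)
  case (assm A \<Theta>)
  show ?case by (rule assm.prems(2)[OF assm.hyps(1)])
next
  case (axm A \<Theta>)
  show ?case by (rule tc_Mj_axiom[OF axm.hyps(1) axm.prems(1)])
next
  case (AndI \<Theta> A B)
  show ?case unfolding tc_simps using AndI.IH(1)[OF AndI.prems] AndI.IH(2)[OF AndI.prems] by simp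
next
  case (AndE1 \<Theta> A B)
  show ?case using AndE1.IH[OF AndE1.prems] unfolding tc_simps by simp
next
  case (AndE2 \<Theta> A B)
  show ?case using AndE2.IH[OF AndE2.prems] unfolding tc_simps by simp
next
  case (OrI1 \<Theta> A B)
  show ?case unfolding tc_simps(2)[OF OrI1.prems(1)] using OrI1.IH[OF OrI1.prems] by (intro locI) simp
next
  case (OrI2 \<Theta> B A)
  show ?case unfolding tc_simps(2)[OF OrI2.prems(1)] using OrI2.IH[OF OrI2.prems] by (intro locI) simp
next
  case (OrE \<Theta> A B C)
  have "loc \<Gamma> (\<lambda>\<Delta>. tc \<Delta> \<sigma> \<tau> A \<or> tc \<Delta> \<sigma> \<tau> B)"
    using OrE.IH(1)[OF OrE.prems] unfolding tc_simps(2)[OF OrE.prems(1)] .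
  then show ?case
  proof (rule tc_locE[OF _ OrE.prems(1)])
    fix \<Delta> assume D: "\<Gamma> \<sqsubseteq> \<Delta>" and "tc \<Delta> \<sigma> \<tau> A \<or> tc \<Delta> \<sigma> \<tau> B"
    have m: "tc \<Delta> \<sigma> \<tau> B'" if "B' \<in> \<Theta>" for B' using OrE.prems(2)[OF that] D by (rule tc_mono)
    from \<open>tc \<Delta> \<sigma> \<tau> A \<or> tc \<Delta> \<sigma> \<tau> B\<close> show "tc \<Delta> \<sigma> \<tau> C"
    proof
      assume "tc \<Delta> \<sigma> \<tau> A" then show ?thesis by (rule_tac OrE.IH(2)[OF OrE.prems(1)]) (use m in auto)
    next
      assume "tc \<Delta> \<sigma> \<tau> B" then show ?thesis by (rule_tac OrE.IH(3)[OF OrE.prems(1)]) (use m in auto)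
    qed
  qed
next
  case (ImpI A \<Theta> B)
  show ?case unfolding tc_simps(3)[OF ImpI.prems(1)]
  proof (intro allI impI)
    fix \<Delta> assume D: "\<Gamma> \<sqsubseteq> \<Delta>" and A: "tc \<Delta> \<sigma> \<tau> A"
    show "tc \<Delta> \<sigma> \<tau> B"
      by (rule ImpI.IH[OF ImpI.prems(1)]) (use A tc_mono[OF ImpI.prems(2) D] in auto)
  qed
next
  case (ImpE \<Theta> A B)
  show ?case using ImpE.IH(1)[OF ImpE.prems] ImpE.IH(2)[OF ImpE.prems]
    unfolding tc_simps(3)[OF ImpE.prems(1)] by blast
next
  case (NegI A \<Theta> B)
  show ?case unfolding tc_simps(4)[OF NegI.prems(1)]
  proof (intro allI impI)
    fix \<Delta> C assume D: "\<Gamma> \<sqsubseteq> \<Delta>" and A: "tc \<Delta> \<sigma> \<tau> A" and C: "Lg C"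
    have "tc \<Delta> \<sigma> \<tau> B"
      by (rule NegI.IH(1)[OF NegI.prems(1)]) (use A tc_mono[OF NegI.prems(2) D] in auto)
    moreover have "tc \<Delta> \<sigma> \<tau> (Neg B)"
      by (rule NegI.IH(2)[OF NegI.prems(1)]) (use A tc_mono[OF NegI.prems(2) D] in auto)
    ultimately show "pv \<Delta> C" unfolding tc_simps(4)[OF NegI.prems(1)] using C by blast
  qed
next
  case (NegE \<Theta> A B)
  have L: "Lg (sub_fm \<sigma> \<tau> (tr B))" using NegE.prems(1) by simp
  have A: "tc \<Gamma> \<sigma> \<tau> A" and N: "tc \<Gamma> \<sigma> \<tau> (Neg A)" by (rule NegE.IH[OF NegE.prems], assumption)+
  have "pv \<Gamma> (sub_fm \<sigma> \<tau> (tr B))"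
    by (rule N[unfolded tc_simps(4)[OF NegE.prems(1)], rule_format, OF order_refl A L])
  then show ?case unfolding tc_def fc_def .
next
  case (AllNI \<Theta> A)
  show ?case unfolding tc_simps
  proof (intro allI impI)
    fix t assume t: "T t"
    show "tc \<Gamma> (scons t \<sigma>) \<tau> A"
      by (rule AllNI.IH) (use AllNI.prems t in \<open>auto simp: tc_liftN\<close>)
  qed
next
  case (AllNE \<Theta> A t)
  have A: "\<forall>t. T t \<longrightarrow> tc \<Gamma> (scons t \<sigma>) \<tau> A" using AllNE.IH[OF AllNE.prems] unfolding tc_simps .
  show ?case
  \<comment> \<open>\<open>t\<close> may contain constants outside the language; its value
    \<open>z\<close> does not, and the conclusion may be proved locally.\<close>
  proof (rule tc_locE[OF v_witness[OF AllNE.prems(1), of \<Gamma> t] AllNE.prems(1)], elim exE conjE)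
    fix \<Delta> z assume D: "\<Gamma> \<sqsubseteq> \<Delta>" and z: "T z" "v \<Delta> \<sigma> \<tau> t z"
    have "tc \<Delta> (scons z \<sigma>) \<tau> A" using A z(1) tc_mono[OF _ D] by blast
    then show "tc \<Delta> \<sigma> \<tau> (instN t A)" unfolding tc_instN[OF AllNE.prems(1) z] .
  qed
next
  case (ExNI \<Theta> t A)
  have A: "tc \<Gamma> \<sigma> \<tau> (instN t A)" by (rule ExNI.IH[OF ExNI.prems])
  show ?case unfolding tc_simps(7)[OF ExNI.prems(1)]
    using v_witness[OF ExNI.prems(1), of \<Gamma> t]
  proof (rule loc_map, elim exE conjE)
    fix \<Delta> z assume D: "\<Gamma> \<sqsubseteq> \<Delta>" and z: "T z" "v \<Delta> \<sigma> \<tau> t z"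
    then show "\<exists>t. T t \<and> tc \<Delta> (scons t \<sigma>) \<tau> A"
      using tc_mono[OF A D] z(1) unfolding tc_instN[OF ExNI.prems(1) z] by blast
  qed
next
  case (ExNE \<Theta> A C)
  have "loc \<Gamma> (\<lambda>\<Delta>. \<exists>t. T t \<and> tc \<Delta> (scons t \<sigma>) \<tau> A)"
    using ExNE.IH(1)[OF ExNE.prems] unfolding tc_simps(7)[OF ExNE.prems(1)] .
  then show ?case
  proof (rule tc_locE[OF _ ExNE.prems(1)], elim exE conjE)
    fix \<Delta> t assume D: "\<Gamma> \<sqsubseteq> \<Delta>" and t: "T t" "tc \<Delta> (scons t \<sigma>) \<tau> A"
    have "tc \<Delta> (scons t \<sigma>) \<tau> (liftN C)"
      by (rule ExNE.IH(2)) (use ExNE.prems(1) t tc_mono[OF ExNE.prems(2) D] in \<open>auto simp: tc_liftN\<close>)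
    then show "tc \<Delta> \<sigma> \<tau> C" using ExNE.prems(1) t by (simp add: tc_liftN)
  qed
next
  case (AllFI \<Theta> A)
  show ?case unfolding tc_simps
  proof (intro allI impI)
    fix t assume t: "U t"
    show "tc \<Gamma> \<sigma> (scons t \<tau>) A"
      by (rule AllFI.IH) (use AllFI.prems t in \<open>auto simp: tc_liftF\<close>)
  qed
next
  case (AllFE \<Theta> A u)
  have A: "\<forall>t. U t \<longrightarrow> tc \<Gamma> \<sigma> (scons t \<tau>) A" using AllFE.IH[OF AllFE.prems] unfolding tc_simps .
  show ?case
  proof (rule tc_locE[OF vf_witness[OF AllFE.prems(1), of \<Gamma> u] AllFE.prems(1)], elim exE conjE)
    fix \<Delta> z assume D: "\<Gamma> \<sqsubseteq> \<Delta>" and z: "U z" "\<forall>x. T x \<longrightarrow> vf \<Delta> \<sigma> \<tau> u x (App z x)"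
    have "tc \<Delta> \<sigma> (scons z \<tau>) A" using A z(1) tc_mono[OF _ D] by blast
    then show "tc \<Delta> \<sigma> \<tau> (instF u A)" unfolding tc_instF[OF AllFE.prems(1) z] .
  qed
next
  case (ExFI \<Theta> u A)
  have A: "tc \<Gamma> \<sigma> \<tau> (instF u A)" by (rule ExFI.IH[OF ExFI.prems])
  show ?case unfolding tc_simps(8)[OF ExFI.prems(1)]
    using vf_witness[OF ExFI.prems(1), of \<Gamma> u]
  proof (rule loc_map, elim exE conjE)
    fix \<Delta> z assume D: "\<Gamma> \<sqsubseteq> \<Delta>" and z: "U z" "\<forall>x. T x \<longrightarrow> vf \<Delta> \<sigma> \<tau> u x (App z x)"
    then show "\<exists>t. U t \<and> tc \<Delta> \<sigma> (scons t \<tau>) A"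
      using tc_mono[OF A D] z(1) unfolding tc_instF[OF ExFI.prems(1) z] by blast
  qed
next
  case (ExFE \<Theta> A C)
  have "loc \<Gamma> (\<lambda>\<Delta>. \<exists>t. U t \<and> tc \<Delta> \<sigma> (scons t \<tau>) A)"
    using ExFE.IH(1)[OF ExFE.prems] unfolding tc_simps(8)[OF ExFE.prems(1)] .
  then show ?case
  proof (rule tc_locE[OF _ ExFE.prems(1)], elim exE conjE)
    fix \<Delta> t assume D: "\<Gamma> \<sqsubseteq> \<Delta>" and t: "U t" "tc \<Delta> \<sigma> (scons t \<tau>) A"
    have "tc \<Delta> \<sigma> (scons t \<tau>) (liftF C)"
      by (rule ExFE.IH(2)) (use ExFE.prems(1) t tc_mono[OF ExFE.prems(2) D] in \<open>auto simp: tc_liftF\<close>)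
    then show "tc \<Delta> \<sigma> \<tau> C" using ExFE.prems(1) t by (simp add: tc_liftF)
  qed
qed

lemma prim_rec_derivable:
  assumes "A \<in> prim_rec_schema" "Lg A"
  shows "pv [] A"
proof -
  obtain t r where A: "A = ExF (And (Eq (App (FVar 0) Zero) (ren_trm id Suc t))
      (AllN (Eq (App (FVar 0) (S' (NVar 0)))
        (App (ren_ftr Suc Suc r) (Fn2 PairJ (NVar 0) (App (FVar 0) (NVar 0)))))))"
    using assms(1) unfolding prim_rec_schema_def by blast
  have T: "T t" "U r" using assms(2) unfolding A by simp_all
  \<comment> \<open>\<open>t\<close> and \<open>r\<close> are arbitrary in the language at hand,
    whereas \<open>primitive_recursion\<close> expects formulas of WKV; hence they are put into the
    environment.\<close>
  let ?\<sigma> = "scons t NVar" and ?\<tau> = "scons r FVar"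
  let ?A0 = "Eq (NVar 0) (NVar 1)" and ?A1 = "Eq (NVar 0) (App (FVar 0) (J (NVar 2) (NVar 1)))"
  have "loc [] (\<lambda>\<Delta>. \<exists>\<beta>. U \<beta> \<and> fc \<Delta> (scons (App \<beta> Zero) ?\<sigma>) ?\<tau> ?A0 \<and>
    (\<forall>y. T y \<longrightarrow> fc \<Delta> (scons (App \<beta> (S' y)) (scons (App \<beta> y) (scons y ?\<sigma>))) ?\<tau> ?A1))"
    by (rule primitive_recursion) (use T in \<open>simp_all add: fc_simps uex_eq\<close>)
  then have "loc [] (\<lambda>\<Delta>. \<exists>\<beta>. U \<beta> \<and> eq \<Delta> (App \<beta> Zero) t \<and>
    (\<forall>y. T y \<longrightarrow> eq \<Delta> (App \<beta> (S' y)) (App r (J y (App \<beta> y)))))"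
    by (simp add: fc_simps)
  then have "fc [] NVar FVar A"
    unfolding A using T by (simp add: fc_simps sub_ren comp_def id_def)
  then show ?thesis by (simp add: fc_def)
qed

section \<open>In the full language the graphs agree with the constants\<close>

context
  assumes full: b and defining: "\<And>c. cst_axioms c \<subseteq> Ax"
begin

lemma all_T: "T t" "U u" "Lg A" "ok \<sigma> \<tau>"
  using full unfolding ok_def T_def U_def Lg_def by simp_all

lemma fc_defining: "A \<in> cst_axioms c \<Longrightarrow> fc \<Gamma> \<sigma> \<tau> A"
  using defining by (intro fc_axiom all_T) blast

text \<open>Induction on the rank. For a recursion the defining axioms say that the constant itself,
  abstracted in its recursion argument, solves the equations; solutions are unique.\<close>

lemma exact_Df: "exact Df c"
proof (induction "lev c" arbitrary: c rule: less_induct)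
  case less
  show ?case
  proof (cases "defn c")
    case (Base t)
    then show ?thesis by (rule exact_Base)
  next
    case (Expl t)
    have ex: "\<forall>c\<in>csts t. exact Df c" using less lev_defn[of _ c] Expl by simp
    have l: "eq \<Gamma> (sub_trm \<sigma> \<tau> (lhs c)) (sub_trm \<sigma> \<tau> t)" for \<Gamma> \<sigma> \<tau>
      using fc_defining[of "Eq (lhs c) t" c \<Gamma> \<sigma> \<tau>] Expl by (simp add: fc_simps)
    show ?thesis unfolding exact_def[OF wkv_Df]
    proof (intro allI impI)
      fix \<Gamma> \<sigma> \<tau> z assume ok: "ok \<sigma> \<tau>" and z: "T z"
      have "cv \<Gamma> \<sigma> \<tau> c z \<longleftrightarrow> v \<Gamma> \<sigma> \<tau> t z" using Expl Df_eq[of c] v_graph[OF ok z] by simp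
      also have "\<dots> \<longleftrightarrow> eq \<Gamma> z (sub_trm \<sigma> \<tau> t)" by (rule val_exact(1)[OF wkv_Df ex all_T(1) ok z])
      also have "\<dots> \<longleftrightarrow> eq \<Gamma> z (sub_trm \<sigma> \<tau> (lhs c))" by (rule eq_right[OF eq_sym[OF l]])
      finally show "cv \<Gamma> \<sigma> \<tau> c z \<longleftrightarrow> eq \<Gamma> z (sub_trm \<sigma> \<tau> (lhs c))" .
    qed
  next
    case (Rec r t\<^sub>0 t\<^sub>1)
    have D: "Df c = graph_body Df (Rec r t\<^sub>0 t\<^sub>1)" using Df_eq[of c] Rec by simp
    have tot: "\<forall>c\<in>csts t\<^sub>0. total Df c" "\<forall>c\<in>csts t\<^sub>1. total Df c" using total_Df by blast+
    have ex: "\<forall>c\<in>csts t\<^sub>0. exact Df c" "\<forall>c\<in>csts t\<^sub>1. exact Df c"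
      using less lev_defn[of _ c] Rec by simp_all
    have upd: "(\<lambda>n. sub_trm \<sigma> \<tau> ((NVar(r := s)) n)) = \<sigma>(r := sub_trm \<sigma> \<tau> s)" for \<sigma> \<tau> s
      by (rule ext) simp
    have l0: "eq \<Gamma> (sub_trm (\<sigma>(r := Zero)) \<tau> (lhs c)) (sub_trm (\<sigma>(r := Zero)) \<tau> t\<^sub>0)" for \<Gamma> \<sigma> \<tau>
      using fc_defining[of "Eq (sub_trm (NVar(r := Zero)) FVar (lhs c)) (sub_trm (NVar(r := Zero)) FVar t\<^sub>0)" c \<Gamma> \<sigma> \<tau>] Rec
      by (simp add: fc_simps sub_sub upd del: fun_upd_apply)
    have l1: "eq \<Gamma> (sub_trm (\<sigma>(r := S' (\<sigma> r))) \<tau> (lhs c)) (sub_trm (scons (sub_trm \<sigma> \<tau> (lhs c)) \<sigma>) \<tau> t\<^sub>1)" for \<Gamma> \<sigma> \<tau>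
      using fc_defining[of "Eq (sub_trm (NVar(r := S' (NVar r))) FVar (lhs c)) (sub_trm (scons (lhs c) NVar) FVar t\<^sub>1)" c \<Gamma> \<sigma> \<tau>] Rec
      by (simp add: fc_simps sub_sub sub_scons upd del: fun_upd_apply)
    show ?thesis unfolding exact_def[OF wkv_Df]
    proof (intro allI impI)
      fix \<Gamma> \<sigma> \<tau> z assume ok: "ok \<sigma> \<tau>" and z: "T z"
      \<comment> \<open>The constant as a function of argument \<open>r\<close>, the other arguments
        being taken from \<open>\<sigma>\<close> and \<open>\<tau>\<close>.\<close>
      let ?t = "sub_trm (\<lambda>n. if n = r then NVar 0 else ren_trm Suc id (\<sigma> n)) (upN_ftr \<tau>) (lhs c)"
      have e: "(\<lambda>n. sub_trm (scons y NVar) FVar (if n = r then NVar 0 else ren_trm Suc id (\<sigma> n))) = \<sigma>(r := y)" for y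
        by (rule ext) simp
      have \<beta>: "eq \<Delta> (App (Lam ?t) y) (sub_trm (\<sigma>(r := y)) \<tau> (lhs c))" for \<Delta> y
        using beta'[of ?t y \<Delta>] by (simp add: all_T sub_sub e)
      have "recf Df r t\<^sub>0 t\<^sub>1 \<Gamma> \<sigma> \<tau> (Lam ?t)"
        unfolding recf_def[OF wkv_Df D tot]
      proof (intro conjI allI impI)
        show "v \<Gamma> (\<sigma>(r := Zero)) \<tau> t\<^sub>0 (App (Lam ?t) Zero)"
          unfolding val_exact(1)[OF wkv_Df ex(1) all_T(1,4,1)] using \<beta> l0 by (rule eq_trans)
        fix y
        have "eq \<Gamma> (sub_trm (\<sigma>(r := S' y)) \<tau> (lhs c)) (sub_trm (scons (sub_trm (\<sigma>(r := y)) \<tau> (lhs c)) (\<sigma>(r := y))) \<tau> t\<^sub>1)"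
          using l1[of \<Gamma> "\<sigma>(r := y)" \<tau>] by simp
        then show "v \<Gamma> (scons (App (Lam ?t) y) (\<sigma>(r := y))) \<tau> t\<^sub>1 (App (Lam ?t) (S' y))"
          unfolding val_exact(1)[OF wkv_Df ex(2) all_T(1,4,1)]
          by (rule eq_trans[OF \<beta> eq_trans[OF _ eq_sub_head[OF eq_sym[OF \<beta>] all_T(4,1)]]])
      qed
      note r = this
      have E: "eq \<Gamma> (App (Lam ?t) (\<sigma> r)) (sub_trm \<sigma> \<tau> (lhs c))" using \<beta>[of \<Gamma> "\<sigma> r"] by simp
      show "cv \<Gamma> \<sigma> \<tau> c z \<longleftrightarrow> eq \<Gamma> z (sub_trm \<sigma> \<tau> (lhs c))"
      proof
        assume "cv \<Gamma> \<sigma> \<tau> c z"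
        from argsem_RecD[OF wkv_Df D tot ok z all_T(2) r this] E
        show "eq \<Gamma> z (sub_trm \<sigma> \<tau> (lhs c))" by (rule eq_trans)
      next
        assume "eq \<Gamma> z (sub_trm \<sigma> \<tau> (lhs c))"
        then have "eq \<Gamma> (App (Lam ?t) (\<sigma> r)) z" by (rule eq_trans[OF E eq_sym])
        from argsem_cong[where D = Df and c = c, OF wkv_Df ok ok all_T(1) z eqenv_refl[OF ok] this]
          argsem_RecI[OF wkv_Df D tot ok all_T(2) r]
        show "cv \<Gamma> \<sigma> \<tau> c z" by blast
      qed
    qed
  qed
qed

lemma tc_exact_Eq: "tc \<Gamma> \<sigma> \<tau> (Eq s t) \<longleftrightarrow> fc \<Gamma> \<sigma> \<tau> (Eq s t)"
proof -
  have ex: "\<forall>c\<in>csts t. exact Df c" for t using exact_Df by blast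
  have e: "v \<Delta> \<sigma> \<tau> t z \<longleftrightarrow> eq \<Delta> z (sub_trm \<sigma> \<tau> t)" for \<Delta> z t
    by (rule val_exact(1)[OF wkv_Df ex all_T(1,4,1)])
  have "loc \<Gamma> (\<lambda>\<Delta>. \<exists>z. T z \<and> eq \<Delta> z (sub_trm \<sigma> \<tau> s) \<and> eq \<Delta> z (sub_trm \<sigma> \<tau> t)) \<longleftrightarrow>
    eq \<Gamma> (sub_trm \<sigma> \<tau> s) (sub_trm \<sigma> \<tau> t)"
  proof
    assume "loc \<Gamma> (\<lambda>\<Delta>. \<exists>z. T z \<and> eq \<Delta> z (sub_trm \<sigma> \<tau> s) \<and> eq \<Delta> z (sub_trm \<sigma> \<tau> t))"
    then show "eq \<Gamma> (sub_trm \<sigma> \<tau> s) (sub_trm \<sigma> \<tau> t)"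
      by (rule eq_locE[OF _ all_T(1,1)]) (elim exE conjE, erule (1) eq_euclid)
  next
    assume "eq \<Gamma> (sub_trm \<sigma> \<tau> s) (sub_trm \<sigma> \<tau> t)"
    then show "loc \<Gamma> (\<lambda>\<Delta>. \<exists>z. T z \<and> eq \<Delta> z (sub_trm \<sigma> \<tau> s) \<and> eq \<Delta> z (sub_trm \<sigma> \<tau> t))"
      by (intro locI exI[of _ "sub_trm \<sigma> \<tau> s"]) (simp add: all_T)
  qed
  then show ?thesis by (simp only: tc_Eq[OF all_T(4)] e fc_simps(1))
qed

lemma tc_exact: "tc \<Gamma> \<sigma> \<tau> A \<longleftrightarrow> fc \<Gamma> \<sigma> \<tau> A"
proof (induction A arbitrary: \<Gamma> \<sigma> \<tau>)
  case (Eq s t)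
  show ?case by (rule tc_exact_Eq)
next
  case (And A B)
  then show ?case by (simp only: tc_simps fc_simps)
next
  case (Or A B)
  then show ?case by (simp only: tc_simps(2)[OF all_T(4)] fc_simps(3)[OF all_T(4,3,3)])
next
  case (Imp A B)
  then show ?case by (simp only: tc_simps(3)[OF all_T(4)] fc_simps(4)[OF all_T(4,3)])
next
  case (Neg A)
  then show ?case by (simp only: tc_simps(4)[OF all_T(4)] fc_simps(5)[OF all_T(4,3)])
next
  case (AllN A)
  then show ?case by (simp only: tc_simps fc_simps)
next
  case (AllF A)
  then show ?case by (simp only: tc_simps fc_simps)
next
  case (ExN A)
  then show ?case by (simp only: tc_simps(7)[OF all_T(4)] fc_simps(8)[OF all_T(4,3)])
next
  case (ExF A)
  then show ?case by (simp only: tc_simps(8)[OF all_T(4)] fc_simps(9)[OF all_T(4,3)])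
qed

end
end

section \<open>The two systems, and the conditions on the translation other than
  effectiveness\<close>

interpretation WKV: system False "axioms WKV"
proof
  show "common_axioms \<inter> {A. calculus.Lg False A} \<subseteq> axioms WKV"
    by (auto simp: WKV_def calculus.Lg_def)
qed

interpretation Mj: system True "axioms Mj"
  by unfold_locales (auto simp: Mj_axioms)

lemma lang_WKV: "lang WKV = {A. WKV.Lg A}"
  by (simp add: WKV_def WKV.Lg_def)

lemma WKV_axiom_derivable:
  assumes "A \<in> axioms WKV"
  shows "nd UNIV (axioms Mj) \<Gamma> A"
proof -
  consider "A \<in> common_axioms" | "A \<in> prim_rec_schema" using assms by (auto simp: WKV_def)
  then show ?thesis
  proof cases
    case 1
    then show ?thesis by (intro nd.axm) (auto simp: Mj_axioms)
  next
    case 2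
    have "Mj.pv [] A" by (rule Mj.prim_rec_derivable[OF 2]) (simp add: Mj.Lg_def)
    then show ?thesis unfolding Mj.pv_def Mj.Lg_def by (auto elim: nd_weaken)
  qed
qed

text \<open>The rules remain valid in the larger language; only the recursion schema turns from an
  axiom into a theorem.\<close>

lemma WKV_Mj: "nd L (axioms WKV) \<Gamma> A \<Longrightarrow> nd UNIV (axioms Mj) \<Gamma> A"
proof (induction rule: nd.induct)
  case (axm A \<Gamma>)
  then show ?case by (intro WKV_axiom_derivable)
next
  case (NegI A \<Gamma> B)
  show ?case by (rule nd.NegI[OF NegI.IH]) simp
next
  case (OrE \<Gamma> A B C)
  show ?case by (rule nd.OrE[OF OrE.IH])
next
  case (ExNE \<Gamma> A C)
  show ?case by (rule nd.ExNE[OF ExNE.IH])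
next
  case (ExFE \<Gamma> A C)
  show ?case by (rule nd.ExFE[OF ExFE.IH])
next
  case (NegE \<Gamma> A B)
  show ?case by (rule nd.NegE[OF NegE.IH]) simp
next
  case (ImpE \<Gamma> A B)
  show ?case by (rule nd.ImpE[OF ImpE.IH])
next
  case (AndE1 \<Gamma> A B)
  show ?case by (rule nd.AndE1[OF AndE1.IH])
next
  case (AndE2 \<Gamma> A B)
  show ?case by (rule nd.AndE2[OF AndE2.IH])
next
  case (AllNE \<Gamma> A t)
  show ?case by (rule nd.AllNE[OF AllNE.IH]) simp
next
  case (AllFE \<Gamma> A t)
  show ?case by (rule nd.AllFE[OF AllFE.IH]) simp
next
  case (ExNI \<Gamma> t A)
  show ?case by (rule nd.ExNI[OF ExNI.IH]) simp
next
  case (ExFI \<Gamma> t A)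
  show ?case by (rule nd.ExFI[OF ExFI.IH]) simp
next
  case (AllNI \<Gamma> A)
  show ?case by (rule nd.AllNI[OF AllNI.IH])
next
  case (AllFI \<Gamma> A)
  show ?case by (rule nd.AllFI[OF AllFI.IH])
next
  case (ImpI A \<Gamma> B)
  show ?case by (rule nd.ImpI[OF ImpI.IH]) simp
next
  case (AndI \<Gamma> A B)
  show ?case by (rule nd.AndI[OF AndI.IH])
next
  case (OrI1 \<Gamma> A B)
  show ?case by (rule nd.OrI1[OF OrI1.IH]) simp
next
  case (OrI2 \<Gamma> A B)
  show ?case by (rule nd.OrI2[OF OrI2.IH]) simp
next
  case (assm A \<Gamma>)
  then show ?case by (intro nd.assm) simp_all
qed

lemma Mj_extension: "extension Mj WKV"
  unfolding extension_def
proof (intro conjI allI impI)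
  show "lang WKV \<subseteq> lang Mj" by (simp add: lang_Mj)
  fix \<Gamma> E assume "derivable WKV \<Gamma> E"
  then obtain \<Theta> where "finite \<Theta>" "\<Theta> \<subseteq> \<Gamma>" "nd (lang WKV) (axioms WKV) \<Theta> E"
    unfolding derivable_def by blast
  moreover from this(3) have "nd UNIV (axioms Mj) \<Theta> E" by (rule WKV_Mj)
  ultimately show "derivable Mj \<Gamma> E" unfolding derivable_def lang_Mj by blast
qed

text \<open>Soundness is applied in the context of the translated assumptions under the identity
  environment, where each of them is forced as an assumption.\<close>

lemma tr_derivable:
  assumes "derivable Mj \<Gamma> E"
  shows "derivable WKV (tr ` \<Gamma>) (tr E)"
proof -
  obtain \<Theta> where \<Theta>: "finite \<Theta>" "\<Theta> \<subseteq> \<Gamma>" "nd UNIV (axioms Mj) \<Theta> E"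
    using assms unfolding derivable_def lang_Mj by blast
  obtain As where As: "set As = \<Theta>" using finite_list[OF \<Theta>(1)] by blast
  have "WKV.tc (map tr As) NVar FVar E"
  proof (rule WKV.tc_sound[OF \<Theta>(3)])
    fix A assume "A \<in> \<Theta>"
    then show "WKV.tc (map tr As) NVar FVar A"
      using As by (simp add: WKV.tc_def WKV.fc_def WKV.pv_hyp)
  qed simp
  then have "nd (lang WKV) (axioms WKV) (tr ` \<Theta>) (tr E)"
    using As by (simp add: WKV.tc_def WKV.fc_def WKV.pv_def lang_WKV)
  then show ?thesis unfolding derivable_def using \<Theta>(1,2) by (intro exI[of _ "tr ` \<Theta>"]) auto
qed

lemma tr_equivalent: "derivable Mj {} (Iff (tr E) E)"
proof -
  have *: "Mj.tc \<Gamma> \<sigma> \<tau> E \<longleftrightarrow> Mj.fc \<Gamma> \<sigma> \<tau> E" for \<Gamma> \<sigma> \<tau>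
    by (rule Mj.tc_exact) (auto simp: Mj_axioms)
  have "Mj.fc [] NVar FVar (Iff (tr E) E)"
    using *[of _ NVar FVar]
    by (simp add: Iff_def Mj.fc_simps(2,4) Mj.Lg_def Mj.tc_def)
  then have "nd UNIV (axioms Mj) {} (Iff (tr E) E)"
    by (simp add: Mj.fc_def Mj.pv_def Mj.Lg_def)
  then show ?thesis unfolding derivable_def lang_Mj by blast
qed

lemma tr_commutes: "commutes_with_logic L tr"
  by (simp add: commutes_with_logic_def)

lemma definitional_extensionI:
  assumes "effective_on UNIV tr"
  shows "definitional_extension Mj WKV"
  unfolding definitional_extension_def lang_Mj
proof (intro conjI exI[of _ tr] Mj_extension assms tr_commutes ballI allI impI tr_equivalent tr_derivable)
  show "tr E \<in> lang WKV" for E by (simp add: lang_WKV WKV.Lg_def wkv_tr)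
  show "tr E = E" if "E \<in> lang WKV" for E using that by (simp add: lang_WKV WKV.Lg_def tr_wkv)
qed

section \<open>Effectiveness of the translation\<close>

text \<open>\<open>recursive\<close> constrains functions also on lists of the wrong length, where \<open>comp\<close> leaves them
  unspecified.\<close>

definition comp :: "nat \<Rightarrow> (nat list \<Rightarrow> nat) \<Rightarrow> bool" where
  "comp n F \<longleftrightarrow> (\<exists>g. recursive n g \<and> (\<forall>xs. length xs = n \<longrightarrow> g xs = F xs))"

lemma comp_ext: "comp n F \<Longrightarrow> (\<And>xs. length xs = n \<Longrightarrow> F xs = G xs) \<Longrightarrow> comp n G"
  unfolding comp_def by (elim exE conjE, rule exI, rule conjI, assumption) simp

lemma comp_proj: "i < n \<Longrightarrow> comp n (\<lambda>xs. xs ! i)"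
  unfolding comp_def using rec_proj by blast

lemma comp_zero: "comp n (\<lambda>_. 0)"
  unfolding comp_def using rec_zero by blast

lemma comp_comp1:
  assumes "comp 1 F" "comp n G"
  shows "comp n (\<lambda>xs. F [G xs])"
proof -
  obtain f g where f: "recursive 1 f" "\<And>xs. length xs = 1 \<Longrightarrow> f xs = F xs"
    and g: "recursive n g" "\<And>xs. length xs = n \<Longrightarrow> g xs = G xs"
    using assms unfolding comp_def by blast
  have "recursive n (\<lambda>xs. f (map (\<lambda>g. g xs) [g]))"
    by (rule rec_comp) (use f g in auto)
  then show ?thesis unfolding comp_def using f(2) g(2) by (intro exI conjI) auto
qed

lemma comp_comp2:
  assumes "comp 2 F" "comp n G" "comp n H"
  shows "comp n (\<lambda>xs. F [G xs, H xs])"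
proof -
  obtain f g h where f: "recursive 2 f" "\<And>xs. length xs = 2 \<Longrightarrow> f xs = F xs"
    and g: "recursive n g" "\<And>xs. length xs = n \<Longrightarrow> g xs = G xs"
    and h: "recursive n h" "\<And>xs. length xs = n \<Longrightarrow> h xs = H xs"
    using assms unfolding comp_def by blast
  have "recursive n (\<lambda>xs. f (map (\<lambda>g. g xs) [g, h]))"
    by (rule rec_comp) (use f g h in \<open>auto simp: numeral_2_eq_2\<close>)
  then show ?thesis unfolding comp_def using f(2) g(2) h(2) by (intro exI conjI) auto
qed

lemma comp_Suc: "comp n F \<Longrightarrow> comp n (\<lambda>xs. Suc (F xs))"
proof -
  have "comp 1 (\<lambda>xs. Suc (xs ! 0))" unfolding comp_def using rec_succ by blast
  then show "comp n F \<Longrightarrow> ?thesis" using comp_comp1[of "\<lambda>xs. Suc (xs ! 0)"] by simp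
qed

lemma comp_rec:
  assumes "comp n F" "comp (Suc (Suc n)) G"
  shows "comp (Suc n) (\<lambda>xs. rec_nat (F (tl xs)) (\<lambda>k v. G (k # v # tl xs)) (hd xs))"
proof -
  obtain f g where f: "recursive n f" "\<And>xs. length xs = n \<Longrightarrow> f xs = F xs"
    and g: "recursive (Suc (Suc n)) g" "\<And>xs. length xs = Suc (Suc n) \<Longrightarrow> g xs = G xs"
    using assms unfolding comp_def by blast
  have "rec_nat (f (tl xs)) (\<lambda>k v. g (k # v # tl xs)) k = rec_nat (F (tl xs)) (\<lambda>k v. G (k # v # tl xs)) k"
    if "length xs = Suc n" for xs k
    using that by (induction k) (simp_all add: f g)
  then show ?thesis unfolding comp_def using rec_prim[OF f(1) g(1)] by blast
qed

lemma comp_mu: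
  assumes "comp (Suc n) F" "\<And>xs. length xs = n \<Longrightarrow> \<exists>y. F (y # xs) = 0"
  shows "comp n (\<lambda>xs. LEAST y. F (y # xs) = 0)"
proof -
  obtain f where f: "recursive (Suc n) f" "\<And>xs. length xs = Suc n \<Longrightarrow> f xs = F xs"
    using assms unfolding comp_def by blast
  have "recursive n (\<lambda>xs. LEAST y. f (y # xs) = 0)"
    by (rule rec_mu[OF f(1)]) (use f(2) assms(2) in simp)
  then show ?thesis unfolding comp_def using f(2) by (intro exI conjI) auto
qed

definition cmp :: "(nat \<Rightarrow> nat) \<Rightarrow> bool" where
  "cmp f \<longleftrightarrow> comp 1 (\<lambda>xs. f (xs ! 0))"

definition cmp2 :: "(nat \<Rightarrow> nat \<Rightarrow> nat) \<Rightarrow> bool" where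
  "cmp2 f \<longleftrightarrow> comp 2 (\<lambda>xs. f (xs ! 0) (xs ! 1))"

lemma cmp_id: "cmp (\<lambda>x. x)"
  unfolding cmp_def by (rule comp_proj) simp

lemma cmp_const: "cmp (\<lambda>_. c)"
  unfolding cmp_def by (induction c) (simp_all add: comp_zero comp_Suc)

lemma cmp_comp: "cmp f \<Longrightarrow> cmp g \<Longrightarrow> cmp (\<lambda>x. f (g x))"
  unfolding cmp_def using comp_comp1[of "\<lambda>xs. f (xs ! 0)"] by simp

lemma cmp2_comp: "cmp2 f \<Longrightarrow> cmp g \<Longrightarrow> cmp h \<Longrightarrow> cmp (\<lambda>x. f (g x) (h x))"
  unfolding cmp_def cmp2_def using comp_comp2[of "\<lambda>xs. f (xs ! 0) (xs ! 1)"] by simp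

lemma cmp2_rec:
  assumes "cmp f" "comp 3 (\<lambda>xs. g (xs ! 0) (xs ! 1) (xs ! 2))"
  shows "cmp2 (\<lambda>n a. rec_nat (f a) (\<lambda>k v. g k v a) n)"
proof -
  have "comp (Suc 1) (\<lambda>xs. rec_nat (f (tl xs ! 0)) (\<lambda>k v. g ((k # v # tl xs) ! 0) ((k # v # tl xs) ! 1) ((k # v # tl xs) ! 2)) (hd xs))"
    by (rule comp_rec) (use assms in \<open>simp_all add: cmp_def numeral_3_eq_3\<close>)
  then show ?thesis unfolding cmp2_def
    by (simp add: numeral_2_eq_2) (erule comp_ext, auto simp: length_Suc_conv numeral_2_eq_2)
qed

lemma cmp2_add: "cmp2 (+)"
proof -
  have "cmp2 (\<lambda>n a. rec_nat a (\<lambda>k v. Suc v) n)"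
    by (rule cmp2_rec[where g = "\<lambda>k v a. Suc v"]) (simp_all add: cmp_id comp_Suc comp_proj)
  moreover have "rec_nat a (\<lambda>k v. Suc v) n = n + a" for n a by (induction n) auto
  ultimately show ?thesis by simp
qed

lemma cmp_pred: "cmp (\<lambda>x. x - 1)"
proof -
  have "cmp2 (\<lambda>n a. rec_nat 0 (\<lambda>k v. k) n)"
    by (rule cmp2_rec[where g = "\<lambda>k v a. k"]) (simp_all add: cmp_const comp_proj)
  moreover have "rec_nat 0 (\<lambda>k v. k) n = n - 1" for n by (cases n) auto
  ultimately show ?thesis using cmp2_comp[OF _ cmp_id cmp_id] by simp
qed

lemma cmp2_swap: "cmp2 f \<Longrightarrow> cmp2 (\<lambda>a b. f b a)"
  unfolding cmp2_def
  using comp_comp2[of "\<lambda>xs. f (xs ! 0) (xs ! 1)" 2 "\<lambda>xs. xs ! 1" "\<lambda>xs. xs ! 0"] by (simp add: comp_proj)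

lemma cmp2_minus: "cmp2 (-)"
proof -
  have "comp 3 (\<lambda>xs. xs ! 1 - 1)"
    using comp_comp1[OF cmp_pred[unfolded cmp_def], of 3 "\<lambda>xs. xs ! 1"] by (simp add: comp_proj)
  then have "cmp2 (\<lambda>n a. rec_nat a (\<lambda>k v. v - 1) n)"
    by (intro cmp2_rec[where g = "\<lambda>k v a. v - 1"]) (simp_all add: cmp_id)
  moreover have "rec_nat a (\<lambda>k v. v - 1) n = a - n" for n a by (induction n) auto
  ultimately have "cmp2 (\<lambda>n a. a - n)" by simp
  from cmp2_swap[OF this] show ?thesis .
qed

lemma cmp_add: "cmp f \<Longrightarrow> cmp g \<Longrightarrow> cmp (\<lambda>x. f x + g x)"
  by (rule cmp2_comp[OF cmp2_add])

lemma cmp_minus: "cmp f \<Longrightarrow> cmp g \<Longrightarrow> cmp (\<lambda>x. f x - g x)"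
  by (rule cmp2_comp[OF cmp2_minus])

lemma cmp_Suc: "cmp f \<Longrightarrow> cmp (\<lambda>x. Suc (f x))"
  unfolding cmp_def by (rule comp_Suc)

lemma cmp2_guard: "cmp2 (\<lambda>c a. if c = 0 then a else 0)"
proof -
  have "cmp2 (\<lambda>n a. rec_nat a (\<lambda>k v. 0) n)"
    by (rule cmp2_rec[where g = "\<lambda>k v a. 0"]) (simp_all add: cmp_id comp_zero)
  moreover have "rec_nat a (\<lambda>k v. 0) n = (if n = 0 then a else 0)" for n a :: nat by (cases n) auto
  ultimately show ?thesis by simp
qed

lemma cmp_if:
  assumes "cmp c" "cmp d" "cmp f" "cmp g"
  shows "cmp (\<lambda>x. if c x = d x then f x else g x)"
proof -
  \<comment> \<open>Truncated subtraction in both directions: the sum vanishes exactly when the two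
    numbers are equal.\<close>
  let ?e = "\<lambda>x. (c x - d x) + (d x - c x)"
  have e: "cmp ?e" by (intro cmp_add cmp_minus assms)
  have e': "cmp (\<lambda>x. 1 - ?e x)" by (rule cmp_minus[OF cmp_const e])
  have "cmp (\<lambda>x. (if ?e x = 0 then f x else 0) + (if 1 - ?e x = 0 then g x else 0))"
    by (rule cmp_add) (rule cmp2_comp[OF cmp2_guard] e e' assms)+
  moreover have "(if ?e x = 0 then f x else 0) + (if 1 - ?e x = 0 then g x else 0)
      = (if c x = d x then f x else g x)" for x by auto
  ultimately show ?thesis by simp
qed

lemma cmp_if_less:
  assumes "cmp c" "cmp d" "cmp f" "cmp g"
  shows "cmp (\<lambda>x. if c x < d x then f x else g x)"
proof -
  have "cmp (\<lambda>x. if d x - c x = 0 then g x else f x)"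
    using assms by (intro cmp_if cmp_minus cmp_const)
  moreover have "(if d x - c x = 0 then g x else f x) = (if c x < d x then f x else g x)" for x by auto
  ultimately show ?thesis by simp
qed

lemma cmp_triangle: "cmp triangle"
proof -
  have "comp 3 (\<lambda>xs. xs ! 1 + Suc (xs ! 0))"
    using comp_comp2[OF cmp2_add[unfolded cmp2_def], of 3 "\<lambda>xs. xs ! 1" "\<lambda>xs. Suc (xs ! 0)"]
    by (simp add: comp_proj comp_Suc)
  then have "cmp2 (\<lambda>n a. rec_nat 0 (\<lambda>k v. v + Suc k) n)"
    by (intro cmp2_rec[where g = "\<lambda>k v a. v + Suc k"]) (simp_all add: cmp_const)
  moreover have "rec_nat 0 (\<lambda>k v. v + Suc k) n = triangle n" for n by (induction n) auto
  ultimately show ?thesis using cmp2_comp[OF _ cmp_id cmp_id] by simp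
qed

section \<open>Decoding pairs\<close>

abbreviation pr :: "nat \<Rightarrow> nat \<Rightarrow> nat" where "pr a b \<equiv> prod_encode (a, b)"

definition p1 :: "nat \<Rightarrow> nat" where "p1 z = fst (prod_decode z)"
definition p2 :: "nat \<Rightarrow> nat" where "p2 z = snd (prod_decode z)"

lemma p_pr [simp]: "p1 (pr a b) = a" "p2 (pr a b) = b"
  by (simp_all add: p1_def p2_def)

lemma pr_p: "pr (p1 z) (p2 z) = z"
  by (simp add: p1_def p2_def)

lemma triangle_mono: "a \<le> b \<Longrightarrow> triangle a \<le> triangle b"
  by (induction rule: dec_induct) auto

text \<open>A nonzero tag makes the rest of a code smaller. Tag 0 would not do, as 0 codes the pair
  of zeros; but constructors with tag 0 have no argument to recurse on.\<close>

lemma p2_less: "p1 z \<noteq> 0 \<Longrightarrow> p2 z < z"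
proof -
  assume "p1 z \<noteq> 0"
  moreover have "n \<le> triangle n" for n by (induction n) auto
  from this[of "p1 z + p2 z"] have "p2 z + p1 z \<le> triangle (p1 z + p2 z)" by simp
  moreover have "z = triangle (p1 z + p2 z) + p1 z" using pr_p[of z] by (simp add: prod_encode_def)
  ultimately show ?thesis by linarith
qed

lemma p_le: "p1 z \<le> z" "p2 z \<le> z"
  using le_prod_encode_1[of "p1 z" "p2 z"] le_prod_encode_2[of "p2 z" "p1 z"] by (simp_all add: pr_p)

text \<open>Pairs are enumerated along diagonals, and diagonal \<open>s\<close> ends just before
  \<open>triangle (Suc s)\<close>; a search therefore finds the diagonal of \<open>z\<close>, which
  is the sum of its components.\<close>

lemma diagonal: "(LEAST s. Suc z - triangle (Suc s) = 0) = p1 z + p2 z"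
proof (rule Least_equality)
  have z: "z = triangle (p1 z + p2 z) + p1 z" using pr_p[of z] by (simp add: prod_encode_def)
  then show "Suc z - triangle (Suc (p1 z + p2 z)) = 0" by simp
  fix s assume s: "Suc z - triangle (Suc s) = 0"
  show "p1 z + p2 z \<le> s"
  proof (rule ccontr)
    assume "\<not> p1 z + p2 z \<le> s"
    then have "triangle (Suc s) \<le> triangle (p1 z + p2 z)" by (intro triangle_mono) simp
    with s z show False by linarith
  qed
qed

lemma cmp_pair: "cmp f \<Longrightarrow> cmp g \<Longrightarrow> cmp (\<lambda>x. pr (f x) (g x))"
  unfolding prod_encode_def by (simp, intro cmp_add cmp_comp[OF cmp_triangle])

lemma cmp_diagonal: "cmp (\<lambda>z. p1 z + p2 z)"
proof -
  have T: "comp 2 (\<lambda>xs. triangle (Suc (xs ! 0)))"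
    using comp_comp1[OF cmp_triangle[unfolded cmp_def], of 2 "\<lambda>xs. Suc (xs ! 0)"] by (simp add: comp_proj comp_Suc)
  have "comp (Suc 1) (\<lambda>xs. Suc (xs ! 1) - triangle (Suc (xs ! 0)))"
    using comp_comp2[OF cmp2_minus[unfolded cmp2_def], of 2 "\<lambda>xs. Suc (xs ! 1)", OF _ T]
    by (simp add: comp_proj comp_Suc numeral_2_eq_2)
  then have "comp 1 (\<lambda>xs. LEAST y. Suc ((y # xs) ! 1) - triangle (Suc ((y # xs) ! 0)) = 0)"
  proof (rule comp_mu)
    have "n \<le> triangle n" for n by (induction n) auto
    then show "\<exists>y. Suc ((y # xs) ! 1) - triangle (Suc ((y # xs) ! 0)) = 0" for xs
      by (intro exI[of _ "xs ! 0"]) (metis One_nat_def diff_is_0_eq' nth_Cons_0 nth_Cons_Suc)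
  qed
  then show ?thesis unfolding cmp_def diagonal[symmetric] by (simp add: One_nat_def)
qed

lemma cmp_p1: "cmp f \<Longrightarrow> cmp (\<lambda>x. p1 (f x))"
proof -
  have "z - triangle (p1 z + p2 z) = p1 z" for z using pr_p[of z] by (simp add: prod_encode_def)
  then have "cmp p1" using cmp_minus[OF cmp_id cmp_comp[OF cmp_triangle cmp_diagonal]] by simp
  then show "cmp f \<Longrightarrow> ?thesis" by (rule cmp_comp)
qed

lemma cmp_p2: "cmp f \<Longrightarrow> cmp (\<lambda>x. p2 (f x))"
proof -
  have "cmp (\<lambda>z. (p1 z + p2 z) - p1 z)" by (intro cmp_minus cmp_diagonal cmp_p1 cmp_id)
  then have "cmp p2" by simp
  then show "cmp f \<Longrightarrow> ?thesis" by (rule cmp_comp)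
qed

lemma cmp2_iterate: "cmp f \<Longrightarrow> cmp2 (\<lambda>n x. (f ^^ n) x)"
proof -
  assume f: "cmp f"
  have "comp 3 (\<lambda>xs. f (xs ! 1))"
    using comp_comp1[OF f[unfolded cmp_def], of 3 "\<lambda>xs. xs ! 1"] by (simp add: comp_proj)
  then have "cmp2 (\<lambda>n a. rec_nat a (\<lambda>k v. f v) n)"
    by (intro cmp2_rec[where g = "\<lambda>k v a. f v"]) (simp_all add: cmp_id)
  moreover have "rec_nat a (\<lambda>k v. f v) n = (f ^^ n) a" for n a by (induction n) auto
  ultimately show ?thesis by simp
qed

text \<open>The topmost nonzero entry is split off by a conditional. The graphs of the finitely many
  constants are handled in this way.\<close>

lemma cmp_finite_table: "(\<And>k. k \<ge> N \<Longrightarrow> f k = 0) \<Longrightarrow> cmp f"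
proof (induction N arbitrary: f)
  case 0
  then show ?case using cmp_const[of 0] by (metis (no_types, lifting) ext le0)
next
  case (Suc N)
  have "cmp (\<lambda>k. if k = N then 0 else f k)"
  proof (rule Suc.IH)
    show "(if k = N then 0 else f k) = 0" if "N \<le> k" for k using that Suc.prems[of k] by auto
  qed
  then have h: "cmp (\<lambda>k. if k = N then f N else (if k = N then 0 else f k))"
    by (rule cmp_if[OF cmp_id cmp_const cmp_const])
  have eq: "(\<lambda>k. if k = N then f N else (if k = N then 0 else f k)) = f" by auto
  show ?case using h unfolding eq .
qed

lemmas cmp_intros = cmp_id cmp_const cmp_Suc cmp_add cmp_minus cmp_pair cmp_p1 cmp_p2 cmp_if cmp_if_less

text \<open>Recursion along two calls with smaller argument is computed by a machine with a stack of tasks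
  (to evaluate the function at a point, or to combine the two topmost values) and a stack of values.\<close>

definition push :: "nat \<Rightarrow> nat \<Rightarrow> nat" where "push a s = Suc (pr a s)"
definition top :: "nat \<Rightarrow> nat" where "top s = p1 (s - 1)"
definition pop :: "nat \<Rightarrow> nat" where "pop s = p2 (s - 1)"

text \<open>The empty stack is 0, which the successor in \<open>push\<close> keeps apart from all
  others.\<close>

lemma stack [simp]: "top (push a s) = a" "pop (push a s) = s" "push a s \<noteq> 0"
  by (simp_all add: push_def top_def pop_def)

lemma cmp_push: "cmp f \<Longrightarrow> cmp g \<Longrightarrow> cmp (\<lambda>x. push (f x) (g x))"
  unfolding push_def by (intro cmp_intros)

lemma cmp_top: "cmp f \<Longrightarrow> cmp (\<lambda>x. top (f x))"
  unfolding top_def by (intro cmp_intros)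

lemma cmp_pop: "cmp f \<Longrightarrow> cmp (\<lambda>x. pop (f x))"
  unfolding pop_def by (intro cmp_intros)

text \<open>The function is first defined outright, by recursion on a bound for the depth, and the
  machine is then shown to compute it. The measure \<open>m\<close> guarantees termination; the
  machine never evaluates it.\<close>

theorem cmp_recursion:
  assumes cmp: "cmp node" "cmp l" "cmp r" "cmp c"
    and dec: "\<And>x. node x \<noteq> 0 \<Longrightarrow> m (l x) < m x \<and> m (r x) < (m x :: nat)"
  shows "\<exists>F. cmp F \<and> (\<forall>x. F x = (if node x = 0 then c (pr x 0) else c (pr x (pr (F (l x)) (F (r x))))))"
proof -
  \<comment> \<open>\<open>G k\<close> unfolds the recursion at most \<open>k\<close> times; its
    value at \<open>x\<close> is final once \<open>k\<close> reaches \<open>m x\<close>.\<close>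
  define G where "G = rec_nat (\<lambda>x. c (pr x 0))
    (\<lambda>_ G x. if node x = 0 then c (pr x 0) else c (pr x (pr (G (l x)) (G (r x)))))"
  have G0: "G 0 x = c (pr x 0)"
    and GS: "G (Suc k) x = (if node x = 0 then c (pr x 0) else c (pr x (pr (G k (l x)) (G k (r x)))))" for k x
    by (simp_all add: G_def)
  have stable: "G k x = G k' x" if "m x \<le> k" "m x \<le> k'" for k k' x
    using that
  proof (induction "m x" arbitrary: x k k' rule: less_induct)
    case less
    have leaf: "G k x = c (pr x 0)" if "node x = 0" for k using that by (cases k) (simp_all add: G0 GS)
    show ?case
    proof (cases "node x = 0")
      case True
      then show ?thesis by (simp add: leaf)
    next
      case False
      note d = dec[OF False]
      obtain j j' where j: "k = Suc j" "k' = Suc j'" using d less.prems by (cases k; cases k') auto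
      have "G j (l x) = G j' (l x)" by (rule less.hyps) (use d less.prems j in auto)
      moreover have "G j (r x) = G j' (r x)" by (rule less.hyps) (use d less.prems j in auto)
      ultimately show ?thesis by (simp add: j GS)
    qed
  qed
  define F where "F x = G (m x) x" for x
  have F: "F x = (if node x = 0 then c (pr x 0) else c (pr x (pr (F (l x)) (F (r x)))))" for x
  proof (cases "node x = 0")
    case True
    then show ?thesis by (cases "m x") (simp_all add: F_def G0 GS)
  next
    case False
    note d = dec[OF False]
    obtain j where j: "m x = Suc j" using d by (cases "m x") auto
    have "G j (l x) = F (l x)" "G j (r x) = F (r x)" unfolding F_def by (rule stable; use d j in simp)+
    then show ?thesis using False by (simp add: F_def[of x] j GS)
  qed
  \<comment> \<open>A configuration consists of the stack of tasks and the stack of values. Tag 0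
    asks for evaluation, tag 1 for combination. The left call runs first, so its value lies below
    that of the right call.\<close>
  define step where "step s = (let T = p1 s; V = p2 s; x = p2 (top T) in
     if T = 0 then s
     else if p1 (top T) = 0 then
       (if node x = 0 then pr (pop T) (push (c (pr x 0)) V)
        else pr (push (pr 0 (l x)) (push (pr 0 (r x)) (push (pr 1 x) (pop T)))) V)
     else pr (pop T) (push (c (pr x (pr (top (pop V)) (top V)))) (pop (pop V))))" for s
  have cstep: "cmp step" unfolding step_def Let_def
    by (intro cmp_intros cmp_push cmp_top cmp_pop cmp_comp[OF cmp(1)] cmp_comp[OF cmp(2)]
        cmp_comp[OF cmp(3)] cmp_comp[OF cmp(4)])
  \<comment> \<open>Evaluation leaves whatever lies below on both stacks untouched, which the
    induction needs for the second call.\<close>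
  have run: "\<exists>n. (step ^^ n) (pr (push (pr 0 x) T) V) = pr T (push (F x) V)" for x T V
  proof (induction "m x" arbitrary: x T V rule: less_induct)
    case less
    show ?case
    proof (cases "node x = 0")
      case True
      have "(step ^^ 1) (pr (push (pr 0 x) T) V) = pr T (push (F x) V)"
        using True by (simp add: step_def F[of x])
      then show ?thesis by blast
    next
      case False
      let ?T2 = "push (pr 1 x) T"
      let ?T1 = "push (pr 0 (r x)) ?T2"
      obtain n1 where n1: "(step ^^ n1) (pr (push (pr 0 (l x)) ?T1) V) = pr ?T1 (push (F (l x)) V)"
        using less.hyps[of "l x" ?T1 V] dec[OF False] by blast
      obtain n2 where n2: "(step ^^ n2) (pr ?T1 (push (F (l x)) V)) = pr ?T2 (push (F (r x)) (push (F (l x)) V))"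
        using less.hyps[of "r x" ?T2 "push (F (l x)) V"] dec[OF False] by blast
      have s: "step (pr (push (pr 0 x) T) V) = pr (push (pr 0 (l x)) ?T1) V"
        using False by (simp add: step_def)
      have e: "step (pr ?T2 (push (F (r x)) (push (F (l x)) V))) = pr T (push (F x) V)"
        using False by (simp add: step_def F[of x])
      have "(step ^^ Suc (n2 + (n1 + Suc 0))) (pr (push (pr 0 x) T) V) = pr T (push (F x) V)"
        by (simp only: funpow.simps funpow_add comp_apply id_apply s n1 n2 e)
      then show ?thesis by blast
    qed
  qed
  define init where "init x = pr (push (pr 0 x) 0) 0" for x
  \<comment> \<open>The running time is found by searching for an empty stack of tasks. Such a
    configuration is a fixed point of \<open>step\<close>, so the first one found is also the one
    reached in \<open>run\<close>.\<close>
  define steps where "steps x = (LEAST n. p1 ((step ^^ n) (init x)) = 0)" for x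
  have ex: "\<exists>n. p1 ((step ^^ n) (init x)) = 0" for x
    using run[of x 0 0] unfolding init_def by (metis p_pr(1))
  have fix0: "(step ^^ k) s = s" if "p1 s = 0" for k s
    using that by (induction k) (simp_all add: step_def)
  have result: "(step ^^ steps x) (init x) = pr 0 (push (F x) 0)" for x
  proof -
    obtain n where n: "(step ^^ n) (init x) = pr 0 (push (F x) 0)" using run[of x 0 0] unfolding init_def by blast
    have h: "p1 ((step ^^ steps x) (init x)) = 0" unfolding steps_def by (rule LeastI_ex[OF ex])
    have "steps x \<le> n" unfolding steps_def by (rule Least_le) (simp add: n)
    then obtain k where "n = k + steps x" by (metis le_add_diff_inverse2)
    then have "(step ^^ n) (init x) = (step ^^ k) ((step ^^ steps x) (init x))" by (simp add: funpow_add)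
    also have "\<dots> = (step ^^ steps x) (init x)" by (rule fix0[OF h])
    finally show ?thesis using n by simp
  qed
  have cinit: "cmp init" unfolding init_def by (intro cmp_intros cmp_push)
  have "comp (Suc 1) (\<lambda>xs. p1 ((step ^^ (xs ! 0)) (init (xs ! 1))))"
    using comp_comp1[OF cmp_p1[OF cmp_id, unfolded cmp_def] comp_comp2[OF cmp2_iterate[OF cstep, unfolded cmp2_def]
      comp_proj comp_comp1[OF cinit[unfolded cmp_def] comp_proj]], of 0 "Suc 1" 1]
    by simp
  then have "comp 1 (\<lambda>xs. LEAST y. p1 ((step ^^ ((y # xs) ! 0)) (init ((y # xs) ! 1))) = 0)"
    by (rule comp_mu) (use ex in simp)
  then have "cmp steps" unfolding cmp_def steps_def by simp
  from cmp2_comp[OF cmp2_iterate[OF cstep] this cinit]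
  have "cmp (\<lambda>x. top (p2 ((step ^^ steps x) (init x))))" by (intro cmp_top cmp_p2)
  then have "cmp F" by (simp add: result)
  then show ?thesis using F by blast
qed

text \<open>The codes of number terms and of functors are tagged 0 and 1.\<close>

lemma wkv_effective:
  "\<exists>F. cmp F \<and> (\<forall>t. F (pr 0 (code_trm t)) = (if wkv_trm t then 1 else 0))
    \<and> (\<forall>u. F (pr 1 (code_ftr u)) = (if wkv_ftr u then 1 else 0))"
proof -
  let ?k = "\<lambda>x. p1 (p2 x)" and ?a = "\<lambda>x. p2 (p2 x)"
  \<comment> \<open>\<open>?k\<close> is the tag of the constructor and \<open>?a\<close> codes its
    arguments. \<open>FnF\<close>, tag 3, is treated as a leaf with value 0, as it never belongs to
    WKV; \<open>Lam\<close> makes its only call twice.\<close>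
  define node where "node x = (if p1 x = 0 then (if ?k x = 2 then 1 else if ?k x = 4 then 1 else 0)
    else if ?k x = 2 then 1 else 0 :: nat)" for x
  define l where "l x = (if p1 x = 0 then (if ?k x = 2 then pr 0 (p1 (p2 (?a x))) else pr 1 (p1 (?a x)))
    else pr 0 (?a x))" for x
  define r where "r x = (if p1 x = 0 then (if ?k x = 2 then pr 0 (p2 (p2 (?a x))) else pr 0 (p2 (?a x)))
    else pr 0 (?a x))" for x
  define c where "c z = (let x = p1 z; va = p1 (p2 z); vb = p2 (p2 z) in
    if p1 x = 0 then
      (if ?k x = 0 then 1 else if ?k x = 1 then 1
       else if ?k x = 2 then (if p1 (?a x) < 3 then (if va = 1 then vb else 0) else 0)
       else if ?k x = 4 then (if va = 1 then vb else 0) else 0)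
    else (if ?k x = 0 then 1 else if ?k x = 1 then (if ?a x < 3 then 1 else 0) else va))" for z
  have cmp: "cmp node" "cmp l" "cmp r" "cmp c"
    unfolding node_def l_def r_def c_def Let_def by (intro cmp_intros)+
  have dec: "p2 (l x) < p2 x \<and> p2 (r x) < p2 x" if "node x \<noteq> 0" for x
  proof -
    have "?k x \<noteq> 0" using that by (auto simp: node_def split: if_splits)
    then have "?a x < p2 x" by (rule p2_less)
    moreover have "p1 (?a x) \<le> ?a x" "p2 (?a x) \<le> ?a x" "p1 (p2 (?a x)) \<le> p2 (?a x)" "p2 (p2 (?a x)) \<le> p2 (?a x)"
      by (rule p_le)+
    ultimately show ?thesis by (simp add: l_def r_def)
  qed
  obtain F where F: "cmp F"
    "\<And>x. F x = (if node x = 0 then c (pr x 0) else c (pr x (pr (F (l x)) (F (r x)))))"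
    using cmp_recursion[of node l r c p2, OF cmp dec] by blast
  \<comment> \<open>The codes of constants are arranged so that those of WKV are 0, 1 and 2.\<close>
  have c1: "code_const1 k < 3 \<longleftrightarrow> wkv_const1 k" for k by (cases k) auto
  have c2: "code_const2 k < 3 \<longleftrightarrow> wkv_const2 k" for k by (cases k) auto
  have "F (pr 0 (code_trm t)) = (if wkv_trm t then 1 else 0)" "F (pr 1 (code_ftr u)) = (if wkv_ftr u then 1 else 0)" for t u
  proof (induction t and u)
    case (Fn2 k s t)
    show ?case by (subst F(2)) (use Fn2 in \<open>simp add: node_def l_def r_def c_def c2 del: wkv_const2.simps\<close>)
  next
    case (FConst k)
    show ?case by (subst F(2)) (simp add: node_def l_def r_def c_def c1 del: wkv_const1.simps)
  qed (subst F(2), simp add: node_def l_def r_def c_def)+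
  with F(1) show ?thesis by (intro exI[of _ F] conjI allI)
qed

text \<open>The parameters of \<open>graph\<close> are coded with the length of the list \<open>e\<close>.\<close>

primrec code_list :: "nat list \<Rightarrow> nat" where
  "code_list [] = 0"
| "code_list (l # ls) = pr l (code_list ls)"

definition code_env :: "nat list \<Rightarrow> nat" where
  "code_env e = pr (length e) (code_list e)"

lemma code_list_nth: "i < length e \<Longrightarrow> p1 ((p2 ^^ i) (code_list e)) = e ! i"
proof (induction e arbitrary: i)
  case (Cons a e)
  then show ?case by (cases i) (simp_all add: funpow_swap1)
qed simp

definition idx_code :: "nat \<Rightarrow> nat \<Rightarrow> nat \<Rightarrow> nat" where
  "idx_code e d n = (if n < p1 e then d - 1 - p1 ((p2 ^^ n) (p2 e)) else n - p1 e + d)"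

lemma idx_code: "idx_code (code_env e) d n = idx e d n"
  by (simp add: idx_code_def code_env_def idx_def code_list_nth)

lemma cmp_idx: "cmp f \<Longrightarrow> cmp g \<Longrightarrow> cmp h \<Longrightarrow> cmp (\<lambda>x. idx_code (f x) (g x) (h x))"
  unfolding idx_code_def
  by (intro cmp_intros cmp2_comp[OF cmp2_iterate[OF cmp_p2[OF cmp_id]]])

text \<open>The formulas that \<open>graph\<close> inserts for constants are finitely many and are
  looked up, so substitution itself need not be computed.\<close>

definition table1 :: "nat \<Rightarrow> nat" where
  "table1 n = (if \<exists>k. code_const1 k = n
     then code_fm (sub_fm (\<lambda>n. NVar (min n 1)) (\<lambda>_. FConst Succ) (Df (C1 (THE k. code_const1 k = n)))) else 0)"

definition table2 :: "nat \<Rightarrow> nat" where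
  "table2 n = (if \<exists>k. code_const2 k = n
     then code_fm (sub_fm (\<lambda>n. NVar (2 - n)) (\<lambda>_. FConst Succ) (Df (C2 (THE k. code_const2 k = n)))) else 0)"

definition tableF :: "nat \<Rightarrow> nat" where
  "tableF n = (if \<exists>k. code_constF k = n
     then code_fm (sub_fm (\<lambda>n. NVar (1 - n)) (\<lambda>_. FVar 0) (Df (CF (THE k. code_constF k = n)))) else 0)"

lemma code_const_inj:
  "code_const1 k = code_const1 k' \<longleftrightarrow> k = k'" "code_const2 c = code_const2 c' \<longleftrightarrow> c = c'"
  "code_constF f = code_constF f' \<longleftrightarrow> f = f'"
proof -
  show "code_const1 k = code_const1 k' \<longleftrightarrow> k = k'" by (cases k; cases k'; simp)
  show "code_const2 c = code_const2 c' \<longleftrightarrow> c = c'" by (cases c; cases c'; simp)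
  show "code_constF f = code_constF f' \<longleftrightarrow> f = f'" by (cases f; cases f'; simp)
qed

lemma code_const_less: "code_const1 k < 20" "code_const2 c < 20" "code_constF f < 20"
proof -
  show "code_const1 k < 20" by (cases k; simp)
  show "code_const2 c < 20" by (cases c; simp)
  show "code_constF f < 20" by (cases f; simp)
qed

lemma table:
  "table1 (code_const1 k) = code_fm (sub_fm (\<lambda>n. NVar (min n 1)) (\<lambda>_. FConst Succ) (Df (C1 k)))"
  "table2 (code_const2 c) = code_fm (sub_fm (\<lambda>n. NVar (2 - n)) (\<lambda>_. FConst Succ) (Df (C2 c)))"
  "tableF (code_constF f) = code_fm (sub_fm (\<lambda>n. NVar (1 - n)) (\<lambda>_. FVar 0) (Df (CF f)))"
proof -
  have t: "(THE k'. code_const1 k' = code_const1 k) = k" "(THE c'. code_const2 c' = code_const2 c) = c"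
    "(THE f'. code_constF f' = code_constF f) = f"
    by (rule the_equality; simp add: code_const_inj)+
  show "table1 (code_const1 k) = code_fm (sub_fm (\<lambda>n. NVar (min n 1)) (\<lambda>_. FConst Succ) (Df (C1 k)))"
    "table2 (code_const2 c) = code_fm (sub_fm (\<lambda>n. NVar (2 - n)) (\<lambda>_. FConst Succ) (Df (C2 c)))"
    "tableF (code_constF f) = code_fm (sub_fm (\<lambda>n. NVar (1 - n)) (\<lambda>_. FVar 0) (Df (CF f)))"
    unfolding table1_def table2_def tableF_def t by auto
qed

lemma cmp_table: "cmp f \<Longrightarrow> cmp (\<lambda>x. table1 (f x))" "cmp f \<Longrightarrow> cmp (\<lambda>x. table2 (f x))"
  "cmp f \<Longrightarrow> cmp (\<lambda>x. tableF (f x))"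
proof -
  have "table1 n = 0" "table2 n = 0" "tableF n = 0" if "20 \<le> n" for n
    using that code_const_less by (auto simp: table1_def table2_def tableF_def linorder_not_less[symmetric])
  then have t: "cmp table1" "cmp table2" "cmp tableF" using cmp_finite_table[of 20] by blast+
  show "cmp f \<Longrightarrow> cmp (\<lambda>x. table1 (f x))" "cmp f \<Longrightarrow> cmp (\<lambda>x. table2 (f x))"
    "cmp f \<Longrightarrow> cmp (\<lambda>x. tableF (f x))"
    using t[THEN cmp_comp, of f] by blast+
qed

text \<open>The code being traversed stands last, so that \<open>p2 (p2 x)\<close> is a measure
  unaffected by the growing parameters.\<close>

definition task :: "nat \<Rightarrow> nat \<Rightarrow> nat \<Rightarrow> nat \<Rightarrow> nat \<Rightarrow> nat" where
  "task tag e d m n = pr tag (pr (pr e (pr d m)) n)"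

lemma cmp_task: "cmp f \<Longrightarrow> cmp g \<Longrightarrow> cmp h \<Longrightarrow> cmp i \<Longrightarrow> cmp j \<Longrightarrow> cmp (\<lambda>x. task (f x) (g x) (h x) (i x) (j x))"
  unfolding task_def by (intro cmp_pair)

lemma graph_effective:
  "\<exists>F. cmp F \<and> (\<forall>t e d m. F (task 0 (code_env e) d m (code_trm t)) = code_fm (graph Df e d m t))
    \<and> (\<forall>u e d m. F (task 1 (code_env e) d m (code_ftr u)) = code_fm (graphf Df e d m u))"
proof -
  let ?e = "\<lambda>x. p1 (p1 (p2 x))" and ?d = "\<lambda>x. p1 (p2 (p1 (p2 x)))" and ?m = "\<lambda>x. p2 (p2 (p1 (p2 x)))"
  let ?k = "\<lambda>x. p1 (p2 (p2 x))" and ?a = "\<lambda>x. p2 (p2 (p2 x))"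
  define node where "node x = (if p1 x = 0 then (if ?k x < 2 then 0 else 1)
    else if ?k x = 2 then 1 else 0 :: nat)" for x
  define l where "l x = (if p1 x = 0
    then (if ?k x < 4 then task 0 (?e x) (?d x + 1) (?m x) (p1 (p2 (?a x))) else task 0 (?e x) (?d x + 1) (?m x) (p2 (?a x)))
    else task 0 (pr (p1 (?e x) + 1) (pr (?d x - 2) (p2 (?e x)))) (?d x) (?m x) (?a x))" for x
  \<comment> \<open>\<open>Lam\<close> has a single argument: its second call only has to decrease
    the measure, and the result is discarded.\<close>
  define r where "r x = (if p1 x = 0
    then (if ?k x = 2 then task 0 (?e x) (?d x + 2) (?m x) (p2 (p2 (?a x)))
      else if ?k x = 3 then task 1 (?e x) (?d x + 3) (?m x + 1) (p2 (p2 (?a x)))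
      else task 1 (?e x) (?d x + 2) (?m x) (p1 (?a x)))
    else task 0 0 0 0 (?a x))" for x
  \<comment> \<open>In formula codes the tags 0, 1, 5, 6, 8 mean \<open>Eq\<close>,
    \<open>And\<close>, \<open>AllN\<close>, \<open>ExN\<close>, \<open>ExF\<close>; in term codes
    0, 1, 4 mean \<open>NVar\<close>, \<open>Zero\<close>, \<open>App\<close>, and in functor codes
    0 means \<open>FVar\<close>.\<close>
  define c where "c z = (let x = p1 z; va = p1 (p2 z); vb = p2 (p2 z) in
    if p1 x = 0 then
      (if ?k x = 0 then pr 0 (pr (pr 0 0) (pr 0 (idx_code (?e x) (?d x) (?a x))))
       else if ?k x = 1 then pr 0 (pr (pr 0 0) (pr 1 0))
       else if ?k x = 2 then pr 6 (pr 1 (pr va (pr 6 (pr 1 (pr vb (table2 (p1 (?a x))))))))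
       else if ?k x = 3 then pr 6 (pr 1 (pr va (pr 8 (pr 1 (pr
         (pr 5 (pr 6 (pr 1 (pr (pr 0 (pr (pr 0 0) (pr 4 (pr (pr 0 0) (pr 0 1))))) vb)))) (tableF (p1 (?a x))))))))
       else pr 6 (pr 1 (pr va (pr 6 (pr 1 (pr (pr 0 (pr (pr 0 0) (pr 0 2))) vb))))))
    else (if ?k x = 0 then pr 0 (pr (pr 0 0) (pr 4 (pr (pr 0 (?a x + ?m x)) (pr 0 1))))
       else if ?k x = 1 then table1 (?a x) else va))" for z
  have cmp: "cmp node" "cmp l" "cmp r" "cmp c"
    unfolding node_def l_def r_def c_def Let_def by (intro cmp_intros cmp_task cmp_idx cmp_table)+
  have dec: "p2 (p2 (l x)) < p2 (p2 x) \<and> p2 (p2 (r x)) < p2 (p2 x)" if "node x \<noteq> 0" for x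
  proof -
    have "?k x \<noteq> 0" using that by (auto simp: node_def split: if_splits)
    then have "?a x < p2 (p2 x)" by (rule p2_less)
    moreover have "p1 (?a x) \<le> ?a x" "p2 (?a x) \<le> ?a x" "p1 (p2 (?a x)) \<le> p2 (?a x)" "p2 (p2 (?a x)) \<le> p2 (?a x)"
      by (rule p_le)+
    ultimately show ?thesis by (simp add: l_def r_def task_def)
  qed
  obtain F where F: "cmp F"
    "\<And>x. F x = (if node x = 0 then c (pr x 0) else c (pr x (pr (F (l x)) (F (r x)))))"
    using cmp_recursion[of node l r c "\<lambda>x. p2 (p2 x)", OF cmp dec] by blast
  have e: "pr (p1 (code_env e) + 1) (pr a (p2 (code_env e))) = code_env (a # e)" for a e
    by (simp add: code_env_def)
  have "F (task 0 (code_env e) d m (code_trm t)) = code_fm (graph Df e d m t)"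
    "F (task 1 (code_env e) d m (code_ftr u)) = code_fm (graphf Df e d m u)" for t u e d m
  proof (induction t and u arbitrary: e d m and e d m)
    case (NVar n)
    show ?case by (subst F(2)) (simp add: node_def c_def task_def idx_code)
  next
    case Zero
    show ?case by (subst F(2)) (simp add: node_def c_def task_def)
  next
    case (Fn2 k s t)
    have "l (task 0 (code_env e) d m (code_trm (Fn2 k s t))) = task 0 (code_env e) (Suc d) m (code_trm s)"
      "r (task 0 (code_env e) d m (code_trm (Fn2 k s t))) = task 0 (code_env e) (Suc (Suc d)) m (code_trm t)"
      by (simp_all add: l_def r_def task_def)
    then show ?case by (subst F(2)) (simp add: Fn2, simp add: node_def c_def task_def table)
  next
    case (FnF k s u)
    have "l (task 0 (code_env e) d m (code_trm (FnF k s u))) = task 0 (code_env e) (Suc d) m (code_trm s)"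
      "r (task 0 (code_env e) d m (code_trm (FnF k s u))) = task 1 (code_env e) (Suc (Suc (Suc d))) (Suc m) (code_ftr u)"
      by (simp_all add: l_def r_def task_def)
    then show ?case by (subst F(2)) (simp add: FnF[unfolded One_nat_def], simp add: node_def c_def task_def table)
  next
    case (App u s)
    have "l (task 0 (code_env e) d m (code_trm (App u s))) = task 0 (code_env e) (Suc d) m (code_trm s)"
      "r (task 0 (code_env e) d m (code_trm (App u s))) = task 1 (code_env e) (Suc (Suc d)) m (code_ftr u)"
      by (simp_all add: l_def r_def task_def)
    then show ?case by (subst F(2)) (simp add: App[unfolded One_nat_def], simp add: node_def c_def task_def)
  next
    case (FVar n)
    show ?case by (subst F(2)) (simp add: node_def c_def task_def)
  next
    case (FConst k)
    show ?case by (subst F(2)) (simp add: node_def c_def task_def table)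
  next
    case (Lam t)
    have "l (task 1 (code_env e) d m (code_ftr (Lam t))) = task 0 (code_env ((d - 2) # e)) d m (code_trm t)"
      unfolding e[symmetric] by (simp add: l_def task_def)
    then show ?case by (subst F(2)) (simp add: Lam, simp add: node_def c_def task_def)
  qed
  with F(1) show ?thesis by (intro exI[of _ F] conjI allI)
qed

lemma tr_effective: "effective_on UNIV tr"
proof -
  from wkv_effective obtain W where W: "cmp W \<and> (\<forall>t. W (pr 0 (code_trm t)) = (if wkv_trm t then 1 else 0))
    \<and> (\<forall>u. W (pr 1 (code_ftr u)) = (if wkv_ftr u then 1 else 0))" ..
  from graph_effective obtain G where G: "cmp G
    \<and> (\<forall>t e d m. G (task 0 (code_env e) d m (code_trm t)) = code_fm (graph Df e d m t))
    \<and> (\<forall>u e d m. G (task 1 (code_env e) d m (code_ftr u)) = code_fm (graphf Df e d m u))" ..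
  define node where "node x = p1 x" for x
  \<comment> \<open>Tags 1 to 3 are the binary connectives; from 4 on there is one argument, and
    both calls go to it. Equations, tag 0, are leaves, decided by \<open>W\<close> and translated by
    \<open>G\<close>.\<close>
  define l where "l x = (if p1 x < 4 then p1 (p2 x) else p2 x)" for x
  define r where "r x = p2 (if p1 x < 4 then p2 x else pr 0 (p2 x))" for x
  define c where "c z = (let x = p1 z; va = p1 (p2 z); vb = p2 (p2 z); s = p1 (p2 x); t = p2 (p2 x) in
    if p1 x = 0 then
      (if W (pr 0 s) + W (pr 0 t) = 2 then x
       else pr 6 (pr 1 (pr (G (task 0 (code_env []) 1 0 s)) (G (task 0 (code_env []) 1 0 t)))))
    else if p1 x < 4 then pr (p1 x) (pr va vb) else pr (p1 x) va)" for z
  have cmp: "cmp node" "cmp l" "cmp r" "cmp c"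
    unfolding node_def l_def r_def c_def Let_def
    by (intro cmp_intros cmp_task cmp_comp[OF conjunct1[OF W]] cmp_comp[OF conjunct1[OF G]])+
  have dec: "l x < x \<and> r x < x" if "node x \<noteq> 0" for x
  proof -
    have "p2 x < x" using that unfolding node_def by (rule p2_less)
    moreover have "p1 (p2 x) \<le> p2 x" "p2 (p2 x) \<le> p2 x" by (rule p_le)+
    ultimately show ?thesis by (simp add: l_def r_def)
  qed
  obtain F where F: "cmp F"
    "\<And>x. F x = (if node x = 0 then c (pr x 0) else c (pr x (pr (F (l x)) (F (r x)))))"
    using cmp_recursion[of node l r c "\<lambda>x. x", OF cmp dec] by blast
  have code: "F (code_fm E) = code_fm (tr E)" for E
  proof (induction E)
    case (Eq s t)
    show ?case by (subst F(2)) (simp add: node_def c_def W G)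
  qed (subst F(2), simp add: node_def c_def l_def r_def)+
  obtain f where "recursive 1 f" "\<And>xs. length xs = 1 \<Longrightarrow> f xs = F (xs ! 0)"
    using F(1) unfolding cmp_def comp_def by blast
  then show ?thesis unfolding effective_on_def using code by (intro exI[of _ f]) simp
qed

theorem theorem7p4:
  shows "definitional_extension Mj WKV"
  by (rule definitional_extensionI[OF tr_effective])

end
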